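(* Hyperbolicity of the normalization of a complex space does not imply hyperbolicity of the space, neither for affine algebraic varieties nor for compact complex spaces. Precisely: (1) There exist an affine algebraic subvariety $E \subset \mathbf{C}^4$ and a normalization $(\tilde{E}, \pi)$ of $E$ such that $\tilde{E}$ is hyperbolic but $E$ is not hyperbolic. (2) There exist a compact complex space $E_1$ and a normalization $(\tilde{E}_1, \pi_1)$ of $E_1$ such that $\tilde{E}_1$ is hyperbolic but $E_1$ is not hyperbolic.
   Context: A complex space is a pair $(E, O)$, where $E$ is a Hausdorff topological space and $O$ is a subsheaf of the sheaf of germs of continuous (complex-valued) functions on $E$, such that every point of $E$ has an open neighborhood $U$ for which $(U, O|_U)$ can be identified with an analytic subset of an open subset $\Omega \subset \mathbf{C}^n$ together with the sheaf of germs of holomorphic functions on that analytic set. In particular, complex spaces here are reduced. An affine algebraic subvariety of $\mathbf{C}^n$ (a common zero set of polynomials, not assumed smooth) is regarded as a complex space in this way. A complex space $E$ is normal at a point $a \in E$ if the ring of germs of holomorphic functions at $a$ is integrally closed in its (total) quotient ring. $E$ is normal if it is normal at every point. A normalization of a complex space $E$ is a pair $(\tilde{E}, \pi)$ consisting of a normal complex space $\tilde{E}$ and a surjective holomorphic mapping $\pi : \tilde{E} \to E$ such that (i) $\pi$ is proper and $\pi^{-1}(a)$ is finite for every $a \in E$; (ii) if $S$ is the set of singular points of $E$, then $\tilde{E} - \pi^{-1}(S)$ is dense in $\tilde{E}$ and $\pi : \tilde{E} - \pi^{-1}(S) \to E - S$ is biholomorphic. A complex space is called hyperbolic if the Kobayashi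 pseudodistance on it is a distance, i.e. it is strictly positive for every pair of distinct points. *)

theory Defs
  imports "HOL-Analysis.Analysis" "HOL-Algebra.Ring"
begin

subsection \<open>Holomorphic functions and analytic sets in \<open>\<complex>\<^sup>n\<close>\<close>

text \<open>
  Local models of a complex space live in \<open>\<complex>\<^sup>n\<close> with \<open>n\<close> depending on the point, so \<open>\<complex>\<^sup>n\<close>
  is the set of sequences vanishing from index \<open>n\<close> on. The topology inherited from the product
  topology on \<^typ>\<open>nat \<Rightarrow> complex\<close> is the Euclidean one.
\<close>

definition Cn :: "nat \<Rightarrow> (nat \<Rightarrow> complex) set" where
  "Cn n = {z. \<forall>i\<ge>n. z i = 0}"

abbreviation open_Cn :: "nat \<Rightarrow> (nat \<Rightarrow> complex) set \<Rightarrow> bool" where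
  "open_Cn n U \<equiv> openin (top_of_set (Cn n)) U"

text \<open>
  Complex (Frechet) differentiability at every point of an open set; the norm on \<open>\<complex>\<^sup>n\<close>
  is the sum norm.
\<close>

definition holomorphic_Cn :: "nat \<Rightarrow> (nat \<Rightarrow> complex) set \<Rightarrow> ((nat \<Rightarrow> complex) \<Rightarrow> complex) \<Rightarrow> bool" where
  "holomorphic_Cn n U F \<longleftrightarrow> open_Cn n U \<and>
     (\<forall>z\<in>U. \<exists>c :: nat \<Rightarrow> complex.
        ((\<lambda>w. cmod (F w - F z - (\<Sum>i<n. c i * (w i - z i))) / (\<Sum>i<n. cmod (w i - z i)))
           \<longlongrightarrow> 0) (at z within Cn n))"

definition analytic_subset :: "nat \<Rightarrow> (nat \<Rightarrow> complex) set \<Rightarrow> (nat \<Rightarrow> complex) set \<Rightarrow> bool" where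
  "analytic_subset n \<Omega> A \<longleftrightarrow> open_Cn n \<Omega> \<and> A \<subseteq> \<Omega> \<and>
     (\<forall>a\<in>\<Omega>. \<exists>U Fs. open_Cn n U \<and> a \<in> U \<and> U \<subseteq> \<Omega> \<and>
        finite Fs \<and> (\<forall>F\<in>Fs. holomorphic_Cn n U F) \<and>
        A \<inter> U = {z\<in>U. \<forall>F\<in>Fs. F z = 0})"

inductive polynomial_Cn :: "nat \<Rightarrow> ((nat \<Rightarrow> complex) \<Rightarrow> complex) \<Rightarrow> bool" for n where
  const: "polynomial_Cn n (\<lambda>z. c)"
| coord: "i < n \<Longrightarrow> polynomial_Cn n (\<lambda>z. z i)"
| add: "polynomial_Cn n p \<Longrightarrow> polynomial_Cn n q \<Longrightarrow> polynomial_Cn n (\<lambda>z. p z + q z)"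
| mult: "polynomial_Cn n p \<Longrightarrow> polynomial_Cn n q \<Longrightarrow> polynomial_Cn n (\<lambda>z. p z * q z)"

definition affine_algebraic_subvariety :: "nat \<Rightarrow> (nat \<Rightarrow> complex) set \<Rightarrow> bool" where
  "affine_algebraic_subvariety n A \<longleftrightarrow>
     (\<exists>P. (\<forall>p\<in>P. polynomial_Cn n p) \<and> A = {z\<in>Cn n. \<forall>p\<in>P. p z = 0})"


subsection \<open>Complex spaces\<close>

text \<open>
  A topology together with, for each open set \<open>V\<close>, the set of sections over \<open>V\<close> of a sheaf of
  complex-valued functions. Sections are total functions whose values outside \<open>V\<close> are
  irrelevant; only open arguments of \<open>sections\<close> matter.
\<close>

record 'a function_space =
  topo :: "'a topology"
  sections :: "'a set \<Rightarrow> ('a \<Rightarrow> complex) set"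

abbreviation points :: "'a function_space \<Rightarrow> 'a set" where
  "points X \<equiv> topspace (topo X)"

definition subsheaf_of_continuous :: "'a function_space \<Rightarrow> bool" where
  "subsheaf_of_continuous X \<longleftrightarrow>
     (\<forall>U f. openin (topo X) U \<and> f \<in> sections X U \<longrightarrow>
        continuous_map (subtopology (topo X) U) euclidean f) \<and>
     (\<forall>U f g. openin (topo X) U \<and> f \<in> sections X U \<and> (\<forall>x\<in>U. g x = f x) \<longrightarrow>
        g \<in> sections X U) \<and>
     (\<forall>U V f. openin (topo X) U \<and> openin (topo X) V \<and> V \<subseteq> U \<and> f \<in> sections X U \<longrightarrow>
        f \<in> sections X V) \<and>
     (\<forall>U f. openin (topo X) U \<and>
        (\<forall>a\<in>U. \<exists>V. openin (topo X) V \<and> a \<in> V \<and> V \<subseteq> U \<and> f \<in> sections X V) \<longrightarrow>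
        f \<in> sections X U)"

text \<open>Meaningful for open \<open>U\<close>: the open subsets of \<open>U\<close> are then the open sets contained in \<open>U\<close>.\<close>

definition restrict_space_to :: "'a function_space \<Rightarrow> 'a set \<Rightarrow> 'a function_space" where
  "restrict_space_to X U = \<lparr>topo = subtopology (topo X) U, sections = sections X\<rparr>"

definition holomorphic_map :: "'a function_space \<Rightarrow> 'b function_space \<Rightarrow> ('a \<Rightarrow> 'b) \<Rightarrow> bool" where
  "holomorphic_map X Y f \<longleftrightarrow> continuous_map (topo X) (topo Y) f \<and>
     (\<forall>V g. openin (topo Y) V \<and> g \<in> sections Y V \<longrightarrow>
        g \<circ> f \<in> sections X {x\<in>points X. f x \<in> V})"

definition biholomorphic_map :: "'a function_space \<Rightarrow> 'b function_space \<Rightarrow> ('a \<Rightarrow> 'b) \<Rightarrow> bool" where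
  "biholomorphic_map X Y f \<longleftrightarrow> holomorphic_map X Y f \<and>
     (\<exists>g. holomorphic_map Y X g \<and>
        (\<forall>x\<in>points X. g (f x) = x) \<and> (\<forall>y\<in>points Y. f (g y) = y))"

text \<open>
  A subset of \<open>\<complex>\<^sup>n\<close> with the sheaf of functions that are locally restrictions of holomorphic
  functions on open subsets of \<open>\<complex>\<^sup>n\<close>.
\<close>

definition space_of_subset :: "nat \<Rightarrow> (nat \<Rightarrow> complex) set \<Rightarrow> (nat \<Rightarrow> complex) function_space" where
  "space_of_subset n A = \<lparr>topo = top_of_set A,
     sections = (\<lambda>V. {f. \<forall>a\<in>V. \<exists>W F. a \<in> W \<and> holomorphic_Cn n W F \<and> (\<forall>z\<in>V \<inter> W. f z = F z)})\<rparr>"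

definition complex_space :: "'a function_space \<Rightarrow> bool" where
  "complex_space X \<longleftrightarrow> Hausdorff_space (topo X) \<and> subsheaf_of_continuous X \<and>
     (\<forall>a\<in>points X. \<exists>U n \<Omega> A \<phi>. openin (topo X) U \<and> a \<in> U \<and> analytic_subset n \<Omega> A \<and>
        biholomorphic_map (restrict_space_to X U) (space_of_subset n A) \<phi>)"

definition singular_points :: "'a function_space \<Rightarrow> 'a set" where
  "singular_points X = {a\<in>points X. \<not> (\<exists>U n \<Omega> \<phi>. openin (topo X) U \<and> a \<in> U \<and> open_Cn n \<Omega> \<and>
     biholomorphic_map (restrict_space_to X U) (space_of_subset n \<Omega>) \<phi>)}"


subsection \<open>Germs, total quotient rings, normality\<close>

definition germ_rel :: "'a function_space \<Rightarrow> 'a \<Rightarrow>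
    (('a set \<times> ('a \<Rightarrow> complex)) \<times> ('a set \<times> ('a \<Rightarrow> complex))) set" where
  "germ_rel X a = {((U, f), (V, g)).
     openin (topo X) U \<and> a \<in> U \<and> f \<in> sections X U \<and>
     openin (topo X) V \<and> a \<in> V \<and> g \<in> sections X V \<and>
     (\<exists>W. openin (topo X) W \<and> a \<in> W \<and> W \<subseteq> U \<inter> V \<and> (\<forall>x\<in>W. f x = g x))}"

definition germ_ring :: "'a function_space \<Rightarrow> 'a \<Rightarrow> ('a set \<times> ('a \<Rightarrow> complex)) set ring" where
  "germ_ring X a =
     \<lparr>carrier = {(U, f). openin (topo X) U \<and> a \<in> U \<and> f \<in> sections X U} // germ_rel X a,
      mult = (\<lambda>F G. \<Union>(U, f)\<in>F. \<Union>(V, g)\<in>G. germ_rel X a `` {(U \<inter> V, \<lambda>x. f x * g x)}),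
      one = germ_rel X a `` {(points X, \<lambda>_. 1)},
      zero = germ_rel X a `` {(points X, \<lambda>_. 0)},
      add = (\<lambda>F G. \<Union>(U, f)\<in>F. \<Union>(V, g)\<in>G. germ_rel X a `` {(U \<inter> V, \<lambda>x. f x + g x)})\<rparr>"

definition non_zero_divisors :: "('r, 'm) ring_scheme \<Rightarrow> 'r set" where
  "non_zero_divisors R =
     {s\<in>carrier R. \<forall>x\<in>carrier R. s \<otimes>\<^bsub>R\<^esub> x = \<zero>\<^bsub>R\<^esub> \<longrightarrow> x = \<zero>\<^bsub>R\<^esub>}"

definition fraction_rel :: "('r, 'm) ring_scheme \<Rightarrow> (('r \<times> 'r) \<times> ('r \<times> 'r)) set" where
  "fraction_rel R = {((a, s), (b, t)).
     a \<in> carrier R \<and> s \<in> non_zero_divisors R \<and> b \<in> carrier R \<and> t \<in> non_zero_divisors R \<and>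
     a \<otimes>\<^bsub>R\<^esub> t = b \<otimes>\<^bsub>R\<^esub> s}"

definition total_quotient_ring :: "('r, 'm) ring_scheme \<Rightarrow> ('r \<times> 'r) set ring" where
  "total_quotient_ring R =
     \<lparr>carrier = (carrier R \<times> non_zero_divisors R) // fraction_rel R,
      mult = (\<lambda>P Q. \<Union>(a, s)\<in>P. \<Union>(b, t)\<in>Q. fraction_rel R `` {(a \<otimes>\<^bsub>R\<^esub> b, s \<otimes>\<^bsub>R\<^esub> t)}),
      one = fraction_rel R `` {(\<one>\<^bsub>R\<^esub>, \<one>\<^bsub>R\<^esub>)},
      zero = fraction_rel R `` {(\<zero>\<^bsub>R\<^esub>, \<one>\<^bsub>R\<^esub>)},
      add = (\<lambda>P Q. \<Union>(a, s)\<in>P. \<Union>(b, t)\<in>Q.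
               fraction_rel R `` {((a \<otimes>\<^bsub>R\<^esub> t) \<oplus>\<^bsub>R\<^esub> (b \<otimes>\<^bsub>R\<^esub> s), s \<otimes>\<^bsub>R\<^esub> t)})\<rparr>"

definition fraction_embedding :: "('r, 'm) ring_scheme \<Rightarrow> 'r \<Rightarrow> ('r \<times> 'r) set" where
  "fraction_embedding R a = fraction_rel R `` {(a, \<one>\<^bsub>R\<^esub>)}"

definition integral_over :: "'q set \<Rightarrow> ('q, 'm) ring_scheme \<Rightarrow> 'q \<Rightarrow> bool" where
  "integral_over A Q x \<longleftrightarrow> (\<exists>(n::nat) c. 0 < n \<and> (\<forall>i<n. c i \<in> A) \<and>
     x [^]\<^bsub>Q\<^esub> n \<oplus>\<^bsub>Q\<^esub> (\<Oplus>\<^bsub>Q\<^esub>i\<in>{..<n}. c i \<otimes>\<^bsub>Q\<^esub> x [^]\<^bsub>Q\<^esub> i) = \<zero>\<^bsub>Q\<^esub>)"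

definition integrally_closed_in :: "'q set \<Rightarrow> ('q, 'm) ring_scheme \<Rightarrow> bool" where
  "integrally_closed_in A Q \<longleftrightarrow> (\<forall>x\<in>carrier Q. integral_over A Q x \<longrightarrow> x \<in> A)"

definition normal_at :: "'a function_space \<Rightarrow> 'a \<Rightarrow> bool" where
  "normal_at X a \<longleftrightarrow>
     integrally_closed_in (fraction_embedding (germ_ring X a) ` carrier (germ_ring X a))
       (total_quotient_ring (germ_ring X a))"

definition normal_complex_space :: "'a function_space \<Rightarrow> bool" where
  "normal_complex_space X \<longleftrightarrow> complex_space X \<and> (\<forall>a\<in>points X. normal_at X a)"

definition is_normalization ::
    "'a function_space \<Rightarrow> 'b function_space \<Rightarrow> ('b \<Rightarrow> 'a) \<Rightarrow> bool" where
  "is_normalization E E' \<pi> \<longleftrightarrow>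
     complex_space E \<and> normal_complex_space E' \<and>
     holomorphic_map E' E \<pi> \<and> \<pi> ` points E' = points E \<and>
     proper_map (topo E') (topo E) \<pi> \<and>
     (\<forall>a\<in>points E. finite {x\<in>points E'. \<pi> x = a}) \<and>
     (let R' = {x\<in>points E'. \<pi> x \<notin> singular_points E} in
        topo E' closure_of R' = points E' \<and>
        biholomorphic_map (restrict_space_to E' R')
          (restrict_space_to E (points E - singular_points E)) \<pi>)"


subsection \<open>Kobayashi pseudodistance and hyperbolicity\<close>

definition unit_disc :: "complex function_space" where
  "unit_disc = \<lparr>topo = top_of_set (ball 0 1), sections = (\<lambda>V. {f. f holomorphic_on V})\<rparr>"

definition poincare_dist :: "complex \<Rightarrow> complex \<Rightarrow> real" where
  "poincare_dist a b = (let r = cmod ((a - b) / (1 - cnj a * b)) in ln ((1 + r) / (1 - r)))"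

text \<open>
  A chain of \<open>k\<close> holomorphic discs \<open>f i\<close> joining \<open>p\<close> to \<open>q\<close>. Points that no chain joins
  (points in different connected components) get distance \<open>\<infinity>\<close>.
\<close>

definition disc_chain :: "'a function_space \<Rightarrow> 'a \<Rightarrow> 'a \<Rightarrow> nat \<Rightarrow>
    (nat \<Rightarrow> complex \<Rightarrow> 'a) \<Rightarrow> (nat \<Rightarrow> complex) \<Rightarrow> (nat \<Rightarrow> complex) \<Rightarrow> bool" where
  "disc_chain X p q k f a b \<longleftrightarrow> 0 < k \<and>
     (\<forall>i<k. holomorphic_map unit_disc X (f i) \<and> a i \<in> ball 0 1 \<and> b i \<in> ball 0 1) \<and>
     f 0 (a 0) = p \<and> (\<forall>i. Suc i < k \<longrightarrow> f i (b i) = f (Suc i) (a (Suc i))) \<and>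
     f (k - 1) (b (k - 1)) = q"

definition kobayashi_dist :: "'a function_space \<Rightarrow> 'a \<Rightarrow> 'a \<Rightarrow> ereal" where
  "kobayashi_dist X p q =
     Inf {ereal (\<Sum>i<k. poincare_dist (a i) (b i)) | k f a b. disc_chain X p q k f a b}"

definition hyperbolic_space :: "'a function_space \<Rightarrow> bool" where
  "hyperbolic_space X \<longleftrightarrow> (\<forall>p\<in>points X. \<forall>q\<in>points X. p \<noteq> q \<longrightarrow> 0 < kobayashi_dist X p q)"

end

theory Submission
  imports Defs "HOL-Complex_Analysis.Complex_Analysis"
begin

text \<open>
  Let \<open>C\<close> be the affine curve \<open>y\<^sup>2 = x\<^sup>6 + 1\<close>, of genus 2. The map
  \<open>(x, y, w, u) \<mapsto> (x, y w, w, u)\<close> on the surface \<open>C \<times> C\<close> identifies \<open>(x, y)\<close> with \<open>(x, -y)\<close>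
  over \<open>w = 0\<close>. Its image \<open>E = {v\<^sup>2 = (x\<^sup>6 + 1) w\<^sup>2, u\<^sup>2 = w\<^sup>6 + 1}\<close> contains the line \<open>v = w = 0, u = 1\<close>,
  hence is not hyperbolic; it is singular exactly along \<open>w = 0\<close>, and off this set the map is inverted
  by \<open>y = v / w\<close>. Both surfaces are compactified by gluing four copies of them along
  \<open>(x, y) \<mapsto> (1/x, -y/x\<^sup>3)\<close> in either factor, so that \<open>C\<close> becomes a compact curve of genus 2.

  Hyperbolicity of \<open>C \<times> C\<close> and of its compactification comes from an explicit bound for the
  one-forms \<open>dx/y\<close> and \<open>x dx/y\<close> along a holomorphic disc, which makes bounded functions that
  separate points uniformly Lipschitz for the Poincare distance. Normality holds at smooth points of a
  surface: a quotient of germs that is integral is bounded, so its one-variable Cauchy means extend it.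
\<close>

section \<open>Holomorphic functions of several variables\<close>

text \<open>For curves the phenomenon does not occur through large discs: a nonconstant disc in a
  curve meets the singular points only at discrete parameters and lifts to the normalization. Hence
  the choice of a surface whose double curve is covered two-to-one by a hyperbolic curve and is not
  hyperbolic itself: C covers the x-line by the quotient under y to -y, and a large disc in that
  line does not lift. The transversal factor must be hyperbolic too; on the second copy of C the
  function w has simple zeros exactly at u = 1 and u = -1.

  Degree six is the even degree of genus 2. Even degree puts two points over x = infinity, and the
  palindromic x^6 + 1 makes the curve look there as it does near x = 0. The sign in (1/x, -y/x^3)
  makes the forms dx/y and x dx/y change places exactly. They have no common zero on the compact
  curve, so bounding both along discs replaces a metric of negative curvature or uniformization. The
  functions that separate points of the compact curve involve complex conjugates; the Lipschitz
  estimate is therefore made with real derivatives along rays.\<close>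

lemma closed_Cn: "closed (Cn n)"
proof -
  have "Cn n = (\<Inter>i\<in>{n..}. {z. z i = 0})"
    by (auto simp: Cn_def)
  moreover have "closed {z::nat \<Rightarrow> complex. z i = 0}" for i
    by (intro closed_Collect_eq continuous_intros continuous_on_product_coordinates)
  ultimately show ?thesis
    by (metis (no_types, lifting) closed_INT)
qed

lemma tendsto_fun:
  fixes f :: "'c \<Rightarrow> 'a \<Rightarrow> 'b::topological_space"
  assumes "\<And>i. ((\<lambda>x. f x i) \<longlongrightarrow> l i) F"
  shows "(f \<longlongrightarrow> l) F"
proof -
  have "limitin (product_topology (\<lambda>i. euclidean) UNIV) f l F"
    using assms by (simp add: limitin_componentwise)
  then show ?thesis
    by (simp add: euclidean_product_topology)
qed

text \<open>
  Caratheodory's form of complex differentiability: the chain and product rules become algebraic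
  identities for the slope functions \<open>q i\<close>.
\<close>

definition holo_at :: "nat \<Rightarrow> ((nat \<Rightarrow> complex) \<Rightarrow> complex) \<Rightarrow> (nat \<Rightarrow> complex) \<Rightarrow> bool" where
  "holo_at n F z \<longleftrightarrow> (\<exists>q. (\<forall>i<n. continuous (at z within Cn n) (q i)) \<and>
     (\<forall>\<^sub>F w in nhds z. w \<in> Cn n \<longrightarrow> F w = F z + (\<Sum>i<n. q i w * (w i - z i))))"

text \<open>The Frechet error is \<open>e w\<close> times the sum norm \<open>N w\<close>. It is
  distributed over the coordinates by factors \<open>\<sigma> i w\<close> of modulus at most one
  that turn \<open>w i - z i\<close> into its modulus, so the slopes
  \<open>c i + e w * \<sigma> i w\<close> reproduce \<open>F\<close> exactly. Conversely, the values
  of the slopes at \<open>z\<close> are the coefficients of the derivative.\<close>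

lemma holo_at_iff_frechet:
  assumes z: "z \<in> Cn n"
  shows "(\<exists>c :: nat \<Rightarrow> complex.
        ((\<lambda>w. cmod (F w - F z - (\<Sum>i<n. c i * (w i - z i))) / (\<Sum>i<n. cmod (w i - z i)))
           \<longlongrightarrow> 0) (at z within Cn n)) \<longleftrightarrow> holo_at n F z" (is "?L \<longleftrightarrow> ?R")
proof
  assume ?L
  then obtain c where c: "((\<lambda>w. cmod (F w - F z - (\<Sum>i<n. c i * (w i - z i))) /
      (\<Sum>i<n. cmod (w i - z i))) \<longlongrightarrow> 0) (at z within Cn n)" by blast
  define N where "N w = (\<Sum>i<n. cmod (w i - z i))" for w
  define e where "e w = (F w - F z - (\<Sum>i<n. c i * (w i - z i))) / of_real (N w)" for w
  define \<sigma> where "\<sigma> i w = (if w i = z i then 0 else of_real (cmod (w i - z i)) / (w i - z i))" for i w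
  have N0: "N w \<ge> 0" for w by (simp add: N_def sum_nonneg)
  have e: "(e \<longlongrightarrow> 0) (at z within Cn n)"
    apply (rule tendsto_norm_zero_cancel)
    using c N0 by (simp add: e_def norm_divide N_def[symmetric])
  have \<sigma>1: "cmod (\<sigma> i w) \<le> 1" for i w
    by (simp add: \<sigma>_def norm_divide)
  have cont: "continuous (at z within Cn n) (\<lambda>w. c i + e w * \<sigma> i w)" for i
  proof -
    have "((\<lambda>w. e w * \<sigma> i w) \<longlongrightarrow> 0) (at z within Cn n)"
      by (rule Lim_null_comparison[OF _ tendsto_norm_zero[OF e]])
        (use \<sigma>1 in \<open>auto simp: norm_mult intro!: always_eventually mult_left_le\<close>)
    then have "((\<lambda>w. c i + e w * \<sigma> i w) \<longlongrightarrow> c i + 0) (at z within Cn n)"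
      by (intro tendsto_intros)
    then show ?thesis by (simp add: continuous_within \<sigma>_def)
  qed
  have eq: "F w = F z + (\<Sum>i<n. (c i + e w * \<sigma> i w) * (w i - z i))" if "w \<in> Cn n" for w
  proof -
    have *: "\<sigma> i w * (w i - z i) = of_real (cmod (w i - z i))" for i
      by (simp add: \<sigma>_def)
    have "(\<Sum>i<n. (c i + e w * \<sigma> i w) * (w i - z i)) =
       (\<Sum>i<n. c i * (w i - z i)) + (\<Sum>i<n. e w * (\<sigma> i w * (w i - z i)))"
      by (simp add: distrib_right sum.distrib mult.assoc)
    also have "(\<Sum>i<n. e w * (\<sigma> i w * (w i - z i))) = e w * of_real (N w)"
      by (simp add: * N_def sum_distrib_left)
    \<comment> \<open>Division by zero gives 0, so \<open>e w\<close> is no information when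
      \<open>N w = 0\<close>; but then \<open>w = z\<close>, since both vanish from index
      \<open>n\<close> on, and both sides are 0.\<close>
    also have "e w * of_real (N w) = F w - F z - (\<Sum>i<n. c i * (w i - z i))"
    proof (cases "N w = 0")
      case True
      then have "\<forall>i<n. w i = z i"
        by (simp add: N_def sum_nonneg_eq_0_iff)
      moreover have "\<forall>i\<ge>n. w i = z i"
        using z that by (simp add: Cn_def)
      ultimately have "w = z" by (metis ext not_le)
      then show ?thesis by (simp add: N_def)
    qed (simp add: e_def)
    finally show ?thesis by simp
  qed
  show ?R
    unfolding holo_at_def
    by (rule exI[of _ "\<lambda>i w. c i + e w * \<sigma> i w"]) (use cont eq in auto)
next
  assume ?R
  then obtain q where q: "\<And>i. i < n \<Longrightarrow> continuous (at z within Cn n) (q i)"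
    and ev: "\<forall>\<^sub>F w in nhds z. w \<in> Cn n \<longrightarrow> F w = F z + (\<Sum>i<n. q i w * (w i - z i))"
    by (auto simp: holo_at_def)
  have "((\<lambda>w. \<Sum>i<n. cmod (q i w - q i z)) \<longlongrightarrow> (\<Sum>i<n. 0)) (at z within Cn n)"
  proof (intro tendsto_sum)
    fix i assume "i \<in> {..<n}"
    then have "(q i \<longlongrightarrow> q i z) (at z within Cn n)"
      using q by (simp add: continuous_within)
    then show "((\<lambda>w. cmod (q i w - q i z)) \<longlongrightarrow> 0) (at z within Cn n)"
      by (simp add: LIM_zero tendsto_norm_zero)
  qed
  then have lim: "((\<lambda>w. \<Sum>i<n. cmod (q i w - q i z)) \<longlongrightarrow> 0) (at z within Cn n)"
    by simp
  have ev': "\<forall>\<^sub>F w in at z within Cn n. F w = F z + (\<Sum>i<n. q i w * (w i - z i))"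
    using ev by (auto simp: eventually_at_filter elim: eventually_mono)
  have "((\<lambda>w. cmod (F w - F z - (\<Sum>i<n. q i z * (w i - z i))) / (\<Sum>i<n. cmod (w i - z i)))
           \<longlongrightarrow> 0) (at z within Cn n)"
  proof (rule Lim_null_comparison[OF _ lim])
    show "\<forall>\<^sub>F w in at z within Cn n. norm (cmod (F w - F z - (\<Sum>i<n. q i z * (w i - z i))) /
        (\<Sum>i<n. cmod (w i - z i))) \<le> (\<Sum>i<n. cmod (q i w - q i z))"
      using ev'
    proof eventually_elim
      case (elim w)
      have "F w - F z - (\<Sum>i<n. q i z * (w i - z i)) = (\<Sum>i<n. (q i w - q i z) * (w i - z i))"
        by (simp add: elim left_diff_distrib sum_subtractf)
      also have "cmod \<dots> \<le> (\<Sum>i<n. cmod (q i w - q i z) * cmod (w i - z i))"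
        by (rule order_trans[OF norm_sum]) (simp add: norm_mult)
      also have "\<dots> \<le> (\<Sum>i<n. cmod (q i w - q i z) * (\<Sum>i<n. cmod (w i - z i)))"
        by (intro sum_mono mult_left_mono) (auto intro: member_le_sum)
      finally have "cmod (F w - F z - (\<Sum>i<n. q i z * (w i - z i)))
          \<le> (\<Sum>i<n. cmod (q i w - q i z)) * (\<Sum>i<n. cmod (w i - z i))"
        by (simp add: sum_distrib_right)
      moreover have "0 \<le> (\<Sum>i<n. cmod (w i - z i))" "0 \<le> (\<Sum>i<n. cmod (q i w - q i z))"
        by (auto intro: sum_nonneg)
      ultimately have "cmod (F w - F z - (\<Sum>i<n. q i z * (w i - z i))) / (\<Sum>i<n. cmod (w i - z i))
          \<le> (\<Sum>i<n. cmod (q i w - q i z))"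
        by (cases "(\<Sum>i<n. cmod (w i - z i)) = 0") (auto simp: pos_divide_le_eq)
      then show ?case
        using \<open>0 \<le> (\<Sum>i<n. cmod (w i - z i))\<close> by simp
    qed
  qed
  then show ?L by (intro exI[of _ "\<lambda>i. q i z"])
qed

lemma open_Cn_subset: "open_Cn n U \<Longrightarrow> U \<subseteq> Cn n"
  by (rule openin_imp_subset)

lemma holomorphic_Cn_iff:
  "holomorphic_Cn n U F \<longleftrightarrow> open_Cn n U \<and> (\<forall>z\<in>U. holo_at n F z)"
  unfolding holomorphic_Cn_def
proof (intro conj_cong refl ball_cong)
  fix z assume "open_Cn n U" "z \<in> U"
  then have "z \<in> Cn n" using open_Cn_subset by blast
  then show "(\<exists>c :: nat \<Rightarrow> complex.
        ((\<lambda>w. cmod (F w - F z - (\<Sum>i<n. c i * (w i - z i))) / (\<Sum>i<n. cmod (w i - z i)))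
           \<longlongrightarrow> 0) (at z within Cn n)) = holo_at n F z"
    by (rule holo_at_iff_frechet)
qed

lemma holo_at_cong:
  assumes "\<forall>\<^sub>F w in nhds z. w \<in> Cn n \<longrightarrow> F w = G w" "z \<in> Cn n" "holo_at n F z"
  shows "holo_at n G z"
proof -
  have "F z = G z"
    using eventually_nhds_x_imp_x[OF assms(1)] assms(2) by blast
  obtain q where q: "\<forall>i<n. continuous (at z within Cn n) (q i)"
    and ev: "\<forall>\<^sub>F w in nhds z. w \<in> Cn n \<longrightarrow> F w = F z + (\<Sum>i<n. q i w * (w i - z i))"
    using assms(3) by (auto simp: holo_at_def)
  have "\<forall>\<^sub>F w in nhds z. w \<in> Cn n \<longrightarrow> G w = G z + (\<Sum>i<n. q i w * (w i - z i))"
    using ev assms(1) by eventually_elim (use \<open>F z = G z\<close> in auto)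
  with q show ?thesis by (auto simp: holo_at_def)
qed

lemma holo_at_continuous:
  assumes "holo_at n F z"
  shows "continuous (at z within Cn n) F"
proof -
  obtain q where q: "\<And>i. i < n \<Longrightarrow> continuous (at z within Cn n) (q i)"
    and ev: "\<forall>\<^sub>F w in nhds z. w \<in> Cn n \<longrightarrow> F w = F z + (\<Sum>i<n. q i w * (w i - z i))"
    using assms by (auto simp: holo_at_def)
  have co: "((\<lambda>w. w i) \<longlongrightarrow> z i) (at z within Cn n)" for i
    by (metis continuous_on_product_coordinates continuous_on_def UNIV_I tendsto_within_subset subset_UNIV)
  have "((\<lambda>w. F z + (\<Sum>i<n. q i w * (w i - z i))) \<longlongrightarrow> F z + (\<Sum>i<n. q i z * (z i - z i))) (at z within Cn n)"
    by (intro tendsto_intros co) (use q in \<open>simp add: continuous_within\<close>)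
  moreover have "\<forall>\<^sub>F w in at z within Cn n. F z + (\<Sum>i<n. q i w * (w i - z i)) = F w"
    using ev by (auto simp: eventually_at_filter elim: eventually_mono)
  ultimately have "(F \<longlongrightarrow> F z) (at z within Cn n)"
    using tendsto_cong by fastforce
  then show ?thesis by (simp add: continuous_within)
qed

section \<open>Arithmetic and chain rules for \<open>holo_at\<close>\<close>

lemma holo_at_const [intro, simp]: "holo_at n (\<lambda>w. c) z"
  unfolding holo_at_def by (rule exI[of _ "\<lambda>i w. 0"]) auto

lemma holo_at_coord [intro]:
  assumes "i < n"
  shows "holo_at n (\<lambda>w. w i) z"
proof -
  have "(\<Sum>j<n. (if j = i then 1 else 0) * (w j - z j)) = w i - z i" for w
    using assms by (simp add: if_distrib[of "\<lambda>x. x * _"] cong: if_cong)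
  then show ?thesis
    unfolding holo_at_def
    by (intro exI[of _ "\<lambda>j w. if j = i then 1 else 0"]) (auto simp: if_distrib)
qed

lemma holo_at_add [intro]:
  assumes "holo_at n F z" "holo_at n G z"
  shows "holo_at n (\<lambda>w. F w + G w) z"
proof -
  obtain q where q: "\<forall>i<n. continuous (at z within Cn n) (q i)"
    and eq: "\<forall>\<^sub>F w in nhds z. w \<in> Cn n \<longrightarrow> F w = F z + (\<Sum>i<n. q i w * (w i - z i))"
    using assms(1) by (auto simp: holo_at_def)
  obtain r where r: "\<forall>i<n. continuous (at z within Cn n) (r i)"
    and er: "\<forall>\<^sub>F w in nhds z. w \<in> Cn n \<longrightarrow> G w = G z + (\<Sum>i<n. r i w * (w i - z i))"
    using assms(2) by (auto simp: holo_at_def)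
  show ?thesis
    unfolding holo_at_def
  proof (intro exI[of _ "\<lambda>i w. q i w + r i w"] conjI allI impI)
    show "continuous (at z within Cn n) (\<lambda>w. q i w + r i w)" if "i < n" for i
      using q r that by (auto intro: continuous_intros)
    show "\<forall>\<^sub>F w in nhds z. w \<in> Cn n \<longrightarrow>
        F w + G w = F z + G z + (\<Sum>i<n. (q i w + r i w) * (w i - z i))"
      using eq er by eventually_elim (auto simp: distrib_right sum.distrib)
  qed
qed

lemma holo_at_mult [intro]:
  assumes "holo_at n F z" "holo_at n G z"
  shows "holo_at n (\<lambda>w. F w * G w) z"
proof -
  obtain q where q: "\<forall>i<n. continuous (at z within Cn n) (q i)"
    and eq: "\<forall>\<^sub>F w in nhds z. w \<in> Cn n \<longrightarrow> F w = F z + (\<Sum>i<n. q i w * (w i - z i))"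
    using assms(1) by (auto simp: holo_at_def)
  obtain r where r: "\<forall>i<n. continuous (at z within Cn n) (r i)"
    and er: "\<forall>\<^sub>F w in nhds z. w \<in> Cn n \<longrightarrow> G w = G z + (\<Sum>i<n. r i w * (w i - z i))"
    using assms(2) by (auto simp: holo_at_def)
  show ?thesis
    unfolding holo_at_def
  proof (intro exI[of _ "\<lambda>i w. q i w * G w + F z * r i w"] conjI allI impI)
    show "continuous (at z within Cn n) (\<lambda>w. q i w * G w + F z * r i w)" if "i < n" for i
      using q r that holo_at_continuous[OF assms(2)] by (auto intro!: continuous_intros)
    show "\<forall>\<^sub>F w in nhds z. w \<in> Cn n \<longrightarrow>
        F w * G w = F z * G z + (\<Sum>i<n. (q i w * G w + F z * r i w) * (w i - z i))"
      using eq er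
    proof eventually_elim
      case (elim w)
      have "(\<Sum>i<n. (q i w * G w + F z * r i w) * (w i - z i)) =
          (\<Sum>i<n. q i w * (w i - z i)) * G w + F z * (\<Sum>i<n. r i w * (w i - z i))"
        by (simp add: sum_distrib_left sum_distrib_right sum.distrib[symmetric]) (simp add: algebra_simps)
      then show ?case using elim by (auto simp: algebra_simps)
    qed
  qed
qed

text \<open>\<open>CARAT_DERIV\<close> supplies the slope \<open>h\<close> of \<open>g\<close>, and
  \<open>h (F w) * q i w\<close> are slopes of the composite. Applied to the reciprocal it yields
  quotients, applied to local roots the charts of the curve.\<close>

lemma holo_at_compose_1:
  assumes F: "holo_at n F z" and g: "g field_differentiable at (F z)"
  shows "holo_at n (\<lambda>w. g (F w)) z"
proof -
  obtain q where q: "\<forall>i<n. continuous (at z within Cn n) (q i)"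
    and eq: "\<forall>\<^sub>F w in nhds z. w \<in> Cn n \<longrightarrow> F w = F z + (\<Sum>i<n. q i w * (w i - z i))"
    using F by (auto simp: holo_at_def)
  obtain h where h: "\<And>t. g t - g (F z) = h t * (t - F z)" "isCont h (F z)"
    using g unfolding field_differentiable_def CARAT_DERIV by blast
  show ?thesis
    unfolding holo_at_def
  proof (intro exI[of _ "\<lambda>i w. h (F w) * q i w"] conjI allI impI)
    have "continuous (at z within Cn n) (\<lambda>w. h (F w))"
      using continuous_within_compose3[OF h(2) holo_at_continuous[OF F]] .
    then show "continuous (at z within Cn n) (\<lambda>w. h (F w) * q i w)" if "i < n" for i
      using q that by (auto intro!: continuous_intros)
    show "\<forall>\<^sub>F w in nhds z. w \<in> Cn n \<longrightarrow>
        g (F w) = g (F z) + (\<Sum>i<n. h (F w) * q i w * (w i - z i))"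
      using eq
    proof eventually_elim
      case (elim w)
      then show ?case
        using h(1)[of "F w"] by (auto simp: sum_distrib_left mult.assoc diff_eq_eq add.commute)
    qed
  qed
qed

lemma holo_at_uminus [intro]: "holo_at n F z \<Longrightarrow> holo_at n (\<lambda>w. - F w) z"
  using holo_at_mult[of n "\<lambda>w. -1" z F] by simp

lemma holo_at_diff [intro]: "holo_at n F z \<Longrightarrow> holo_at n G z \<Longrightarrow> holo_at n (\<lambda>w. F w - G w) z"
  using holo_at_add[of n F z "\<lambda>w. - G w"] holo_at_uminus by auto

lemma holo_at_power [intro]: "holo_at n F z \<Longrightarrow> holo_at n (\<lambda>w. F w ^ k) z"
  by (induction k) auto

lemma holo_at_divide [intro]:
  assumes "holo_at n F z" "holo_at n G z" "G z \<noteq> 0"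
  shows "holo_at n (\<lambda>w. F w / G w) z"
proof -
  have "(\<lambda>t. inverse t) field_differentiable at (G z)"
    using assms(3) by (intro derivative_intros) auto
  from holo_at_mult[OF assms(1) holo_at_compose_1[OF assms(2) this]]
  show ?thesis by (simp add: divide_inverse)
qed

lemma tendsto_holo_components:
  assumes "\<And>j. j < n \<Longrightarrow> ((\<lambda>w. f w j) \<longlongrightarrow> f z j) F" "\<forall>\<^sub>F w in F. f w \<in> Cn n" "f z \<in> Cn n"
  shows "(f \<longlongrightarrow> f z) F"
proof (rule tendsto_fun)
  fix i
  show "((\<lambda>w. f w i) \<longlongrightarrow> f z i) F"
  proof (cases "i < n")
    case False
    have "\<forall>\<^sub>F w in F. f w i = f z i"
      using assms(2) by eventually_elim (use False assms(3) in \<open>auto simp: Cn_def\<close>)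
    then show ?thesis by (rule tendsto_eventually)
  qed (use assms in auto)
qed

text \<open>Slopes multiply like Jacobian matrices. The values of \<open>f\<close> near
  \<open>z\<close> have to lie in \<open>Cn n\<close> because \<open>G\<close> is controlled only
  there.\<close>

lemma holo_at_compose:
  assumes f: "\<And>j. j < n \<Longrightarrow> holo_at m (\<lambda>w. f w j) z"
    and fC: "\<forall>\<^sub>F w in nhds z. w \<in> Cn m \<longrightarrow> f w \<in> Cn n" and z: "z \<in> Cn m"
    and G: "holo_at n G (f z)"
  shows "holo_at m (\<lambda>w. G (f w)) z"
proof -
  obtain q where q: "\<And>j. j < n \<Longrightarrow> continuous (at (f z) within Cn n) (q j)"
    and eq: "\<forall>\<^sub>F v in nhds (f z). v \<in> Cn n \<longrightarrow> G v = G (f z) + (\<Sum>j<n. q j v * (v j - f z j))"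
    using G by (auto simp: holo_at_def)
  have "\<forall>j\<in>{..<n}. \<exists>r. (\<forall>i<m. continuous (at z within Cn m) (r i)) \<and>
    (\<forall>\<^sub>F w in nhds z. w \<in> Cn m \<longrightarrow> f w j = f z j + (\<Sum>i<m. r i w * (w i - z i)))"
    using f unfolding holo_at_def by blast
  from bchoice[OF this] obtain r where R: "\<forall>j\<in>{..<n}. (\<forall>i<m. continuous (at z within Cn m) (r j i)) \<and>
    (\<forall>\<^sub>F w in nhds z. w \<in> Cn m \<longrightarrow> f w j = f z j + (\<Sum>i<m. r j i w * (w i - z i)))" ..
  then have r: "\<And>j i. j < n \<Longrightarrow> i < m \<Longrightarrow> continuous (at z within Cn m) (r j i)"
    and er: "\<And>j. j < n \<Longrightarrow> \<forall>\<^sub>F w in nhds z. w \<in> Cn m \<longrightarrow> f w j = f z j + (\<Sum>i<m. r j i w * (w i - z i))"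
    unfolding ball_simps Ball_def lessThan_iff by blast+
  have er': "\<forall>\<^sub>F w in nhds z. \<forall>j\<in>{..<n}. w \<in> Cn m \<longrightarrow> f w j = f z j + (\<Sum>i<m. r j i w * (w i - z i))"
    by (rule eventually_ball_finite) (use er in auto)
  have fz: "f z \<in> Cn n"
    using eventually_nhds_x_imp_x[OF fC] z by blast
  have evw: "\<forall>\<^sub>F w in at z within Cn m. f w \<in> Cn n"
    using fC by (auto simp: eventually_at_filter elim: eventually_mono)
  have lim: "(f \<longlongrightarrow> f z) (at z within Cn m)"
    by (rule tendsto_holo_components[where n=n])
      (use holo_at_continuous[OF f] evw fz in \<open>auto simp: continuous_within\<close>)
  have eqf: "\<forall>\<^sub>F w in nhds z. w \<in> Cn m \<longrightarrow> (f w \<in> Cn n \<longrightarrow> G (f w) = G (f z) + (\<Sum>j<n. q j (f w) * (f w j - f z j)))"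
  proof -
    have "\<forall>\<^sub>F w in at z within Cn m. f w \<in> Cn n \<longrightarrow> G (f w) = G (f z) + (\<Sum>j<n. q j (f w) * (f w j - f z j))"
      using eventually_compose_filterlim[OF eq lim] .
    then show ?thesis
      by (auto simp: eventually_at_filter elim: eventually_mono)
  qed
  show ?thesis
    unfolding holo_at_def
  proof (intro exI[of _ "\<lambda>i w. \<Sum>j<n. q j (f w) * r j i w"] conjI allI impI)
    fix i assume "i < m"
    have "((\<lambda>w. q j (f w)) \<longlongrightarrow> q j (f z)) (at z within Cn m)" if "j < n" for j
      by (rule continuous_within_tendsto_compose[OF q[OF that] evw lim])
    then have "continuous (at z within Cn m) (\<lambda>w. q j (f w))" if "j < n" for j
      using that by (simp add: continuous_within)
    then show "continuous (at z within Cn m) (\<lambda>w. \<Sum>j<n. q j (f w) * r j i w)"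
      using r \<open>i < m\<close> by (auto intro!: continuous_intros)
  next
    show "\<forall>\<^sub>F w in nhds z. w \<in> Cn m \<longrightarrow>
        G (f w) = G (f z) + (\<Sum>i<m. (\<Sum>j<n. q j (f w) * r j i w) * (w i - z i))"
      using eqf er' fC
    proof eventually_elim
      case (elim w)
      show ?case
      proof
        assume w: "w \<in> Cn m"
        have "(\<Sum>j<n. q j (f w) * (f w j - f z j)) = (\<Sum>j<n. q j (f w) * (\<Sum>i<m. r j i w * (w i - z i)))"
          using elim w by (intro sum.cong refl) simp
        also have "\<dots> = (\<Sum>j<n. \<Sum>i<m. q j (f w) * r j i w * (w i - z i))"
          by (simp add: sum_distrib_left mult.assoc)
        also have "\<dots> = (\<Sum>i<m. \<Sum>j<n. q j (f w) * r j i w * (w i - z i))"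
          by (rule sum.swap)
        finally show "G (f w) = G (f z) + (\<Sum>i<m. (\<Sum>j<n. q j (f w) * r j i w) * (w i - z i))"
          using elim w by (simp add: sum_distrib_right)
      qed
    qed
  qed
qed

text \<open>Bridges the two notions of holomorphy: discs and complex lines are parametrised by the
  type \<open>complex\<close>, not by \<open>Cn 1\<close>, so composites with them need a chain rule
  of their own.\<close>

lemma field_differentiable_compose_holo_at:
  assumes f: "\<And>j. j < n \<Longrightarrow> (\<lambda>w. f w j) field_differentiable at z"
    and fC: "\<forall>\<^sub>F w in nhds z. f w \<in> Cn n"
    and G: "holo_at n G (f z)"
  shows "(\<lambda>w. G (f w)) field_differentiable at z"
proof -
  obtain q where q: "\<And>j. j < n \<Longrightarrow> continuous (at (f z) within Cn n) (q j)"
    and eq: "\<forall>\<^sub>F v in nhds (f z). v \<in> Cn n \<longrightarrow> G v = G (f z) + (\<Sum>j<n. q j v * (v j - f z j))"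
    using G by (auto simp: holo_at_def)
  have "\<forall>j. \<exists>h. j < n \<longrightarrow> (\<forall>w. f w j - f z j = h w * (w - z)) \<and> isCont h z"
    using f unfolding field_differentiable_def CARAT_DERIV by metis
  then obtain h where h: "\<And>j w. j < n \<Longrightarrow> f w j - f z j = h j w * (w - z)"
    "\<And>j. j < n \<Longrightarrow> isCont (h j) z" by metis
  have fz: "f z \<in> Cn n"
    using eventually_nhds_x_imp_x[OF fC] .
  have lim: "(f \<longlongrightarrow> f z) (nhds z)"
  proof (rule tendsto_holo_components[OF _ fC fz])
    fix j assume "j < n"
    then have "isCont (\<lambda>w. f w j) z"
      using f field_differentiable_imp_continuous_at by blast
    then show "((\<lambda>w. f w j) \<longlongrightarrow> f z j) (nhds z)"
      by (metis continuous_at tendsto_at_iff_tendsto_nhds)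
  qed
  have qlim: "((\<lambda>w. q j (f w)) \<longlongrightarrow> q j (f z)) (nhds z)" if "j < n" for j
    by (rule continuous_within_tendsto_compose[OF q[OF that] fC lim])
  define k where "k w = (\<Sum>j<n. q j (f w) * h j w)" for w
  have "isCont k z"
    unfolding k_def
    unfolding continuous_at
    by (intro tendsto_sum tendsto_mult tendsto_within_subset[OF tendsto_mono[OF at_within_le_nhds qlim]]
        h(2)[unfolded continuous_at]) auto
  then have "((\<lambda>w. G (f z) + k w * (w - z)) has_field_derivative k z) (at z)"
    unfolding CARAT_DERIV by (intro exI[of _ k]) auto
  moreover have "\<forall>\<^sub>F w in nhds z. G (f z) + k w * (w - z) = G (f w)"
    using eventually_compose_filterlim[OF eq lim] fC
  proof eventually_elim
    case (elim w)
    then show ?case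
      by (simp add: k_def h(1) sum_distrib_right mult.assoc)
  qed
  ultimately have "((\<lambda>w. G (f w)) has_field_derivative k z) (at z)"
    using DERIV_cong_ev[of z z "\<lambda>w. G (f z) + k w * (w - z)" "\<lambda>w. G (f w)" "k z" "k z"] by simp
  then show ?thesis
    by (auto simp: field_differentiable_def)
qed

section \<open>Function spaces\<close>

text \<open>The sections of \<open>space_of_subset n A\<close> over \<open>V\<close> do not mention
  \<open>A\<close>. Naming them separately lets one lemma about sections serve every subset and all
  of its restrictions.\<close>

definition secs :: "nat \<Rightarrow> (nat \<Rightarrow> complex) set \<Rightarrow> ((nat \<Rightarrow> complex) \<Rightarrow> complex) set" where
  "secs n V = {f. \<forall>a\<in>V. \<exists>W F. a \<in> W \<and> holomorphic_Cn n W F \<and> (\<forall>z\<in>V \<inter> W. f z = F z)}"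

lemma space_of_subset_simps [simp]:
  "topo (space_of_subset n A) = top_of_set A"
  "sections (space_of_subset n A) = secs n"
  by (auto simp: space_of_subset_def secs_def fun_eq_iff)

lemma restrict_space_to_simps [simp]:
  "topo (restrict_space_to X U) = subtopology (topo X) U"
  "sections (restrict_space_to X U) = sections X"
  by (auto simp: restrict_space_to_def)

lemma unit_disc_simps [simp]:
  "topo unit_disc = top_of_set (ball 0 1)"
  "sections unit_disc V = {f. f holomorphic_on V}"
  by (auto simp: unit_disc_def)

lemma restrict_space_of_subset:
  assumes "U \<subseteq> A"
  shows "restrict_space_to (space_of_subset n A) U = space_of_subset n U"
  using assms by (simp add: restrict_space_to_def space_of_subset_def subtopology_subtopology Int_absorb1)

lemma restrict_space_to_restrict [simp]:
  "restrict_space_to (restrict_space_to X U) V = restrict_space_to X (U \<inter> V)"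
  by (simp add: restrict_space_to_def subtopology_subtopology)

lemma sheafD:
  assumes "subsheaf_of_continuous X"
  shows sheaf_continuous: "\<And>U f. openin (topo X) U \<Longrightarrow> f \<in> sections X U \<Longrightarrow>
        continuous_map (subtopology (topo X) U) euclidean f"
    and sheaf_cong: "\<And>U f g. openin (topo X) U \<Longrightarrow> f \<in> sections X U \<Longrightarrow> (\<And>x. x \<in> U \<Longrightarrow> g x = f x) \<Longrightarrow>
        g \<in> sections X U"
    and sheaf_mono: "\<And>U V f. openin (topo X) U \<Longrightarrow> openin (topo X) V \<Longrightarrow> V \<subseteq> U \<Longrightarrow> f \<in> sections X U \<Longrightarrow>
        f \<in> sections X V"
    and sheaf_glue: "\<And>U f. openin (topo X) U \<Longrightarrow>
        (\<And>a. a \<in> U \<Longrightarrow> \<exists>V. openin (topo X) V \<and> a \<in> V \<and> V \<subseteq> U \<and> f \<in> sections X V) \<Longrightarrow>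
        f \<in> sections X U"
proof -
  note c = assms[unfolded subsheaf_of_continuous_def]
  show "\<And>U f. openin (topo X) U \<Longrightarrow> f \<in> sections X U \<Longrightarrow>
        continuous_map (subtopology (topo X) U) euclidean f"
    using c[THEN conjunct1] by blast
  show "\<And>U f g. openin (topo X) U \<Longrightarrow> f \<in> sections X U \<Longrightarrow> (\<And>x. x \<in> U \<Longrightarrow> g x = f x) \<Longrightarrow>
        g \<in> sections X U"
    using c[THEN conjunct2, THEN conjunct1] by blast
  show "\<And>U V f. openin (topo X) U \<Longrightarrow> openin (topo X) V \<Longrightarrow> V \<subseteq> U \<Longrightarrow> f \<in> sections X U \<Longrightarrow>
        f \<in> sections X V"
    using c[THEN conjunct2, THEN conjunct2, THEN conjunct1] by blast
  show "\<And>U f. openin (topo X) U \<Longrightarrow>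
        (\<And>a. a \<in> U \<Longrightarrow> \<exists>V. openin (topo X) V \<and> a \<in> V \<and> V \<subseteq> U \<and> f \<in> sections X V) \<Longrightarrow>
        f \<in> sections X U"
    using c[THEN conjunct2, THEN conjunct2, THEN conjunct2] by blast
qed

section \<open>Sections over subsets of affine space\<close>

lemma secsE:
  assumes "f \<in> secs n V" "a \<in> V"
  obtains W F where "a \<in> W" "holomorphic_Cn n W F" "\<forall>z\<in>V \<inter> W. f z = F z"
proof -
  obtain W F where "a \<in> W" "holomorphic_Cn n W F" "\<forall>z\<in>V \<inter> W. f z = F z"
    using assms unfolding secs_def by (auto simp del: Int_iff)
  then show ?thesis by (rule that)
qed

lemma secsI':
  assumes "\<And>a. a \<in> V \<Longrightarrow> \<exists>W F. a \<in> W \<and> holomorphic_Cn n W F \<and> (\<forall>z\<in>V \<inter> W. f z = F z)"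
  shows "f \<in> secs n V"
  using assms unfolding secs_def by (simp del: Int_iff)

lemma secs_mono:
  assumes "f \<in> secs n V" "V' \<subseteq> V"
  shows "f \<in> secs n V'"
proof (rule secsI')
  fix a assume "a \<in> V'"
  then have "a \<in> V" using assms by blast
  obtain W F where "a \<in> W" "holomorphic_Cn n W F" "\<forall>z\<in>V \<inter> W. f z = F z"
    by (rule secsE[OF assms(1) \<open>a \<in> V\<close>]) (rule that)
  then show "\<exists>W F. a \<in> W \<and> holomorphic_Cn n W F \<and> (\<forall>z\<in>V' \<inter> W. f z = F z)"
    using assms(2) by (intro exI[of _ W] exI[of _ F]) auto
qed

lemma secs_cong:
  assumes "f \<in> secs n V" "\<And>z. z \<in> V \<Longrightarrow> g z = f z"
  shows "g \<in> secs n V"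
proof (rule secsI')
  fix a assume "a \<in> V"
  obtain W F where "a \<in> W" "holomorphic_Cn n W F" "\<forall>z\<in>V \<inter> W. f z = F z"
    by (rule secsE[OF assms(1) \<open>a \<in> V\<close>]) (rule that)
  then show "\<exists>W F. a \<in> W \<and> holomorphic_Cn n W F \<and> (\<forall>z\<in>V \<inter> W. g z = F z)"
    using assms(2) by (intro exI[of _ W] exI[of _ F]) auto
qed

lemma secsI_holo:
  assumes "holomorphic_Cn n W f" "V \<subseteq> W"
  shows "f \<in> secs n V"
  using assms by (intro secsI' exI[of _ W] exI[of _ f]) auto

lemma secsI:
  assumes "open T" "V \<subseteq> T" "V \<subseteq> Cn n" "\<And>z. z \<in> T \<Longrightarrow> z \<in> Cn n \<Longrightarrow> holo_at n f z"
  shows "f \<in> secs n V"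
  by (rule secsI_holo[of n "Cn n \<inter> T"]) (use assms in \<open>auto simp: holomorphic_Cn_iff openin_open_Int\<close>)

lemma secs_continuous:
  assumes V: "V \<subseteq> Cn n" and f: "f \<in> secs n V"
  shows "continuous_on V f"
  unfolding continuous_on_eq_continuous_within
proof
  fix a assume a: "a \<in> V"
  obtain W F where W: "a \<in> W" "holomorphic_Cn n W F" "\<forall>z\<in>V \<inter> W. f z = F z"
    by (rule secsE[OF f a]) (rule that)
  obtain T where T: "open T" "W = Cn n \<inter> T"
    using W(2) unfolding holomorphic_Cn_iff by (metis openin_open)
  have "holo_at n F a"
    using W by (auto simp: holomorphic_Cn_iff)
  then have "(F \<longlongrightarrow> F a) (at a within V)"
    using holo_at_continuous V by (meson continuous_within tendsto_within_subset)
  moreover have "\<forall>\<^sub>F z in at a within V. F z = f z"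
    unfolding eventually_at_topological
    using T W V by (intro exI[of _ T]) auto
  ultimately have "(f \<longlongrightarrow> F a) (at a within V)"
    by (rule Lim_transform_eventually)
  then show "continuous (at a within V) f"
    using W(1,3) a by (simp add: continuous_within)
qed

lemma secs_glue:
  assumes "V \<subseteq> Cn n" "\<And>a. a \<in> V \<Longrightarrow> \<exists>V'. openin (top_of_set V) V' \<and> a \<in> V' \<and> f \<in> secs n V'"
  shows "f \<in> secs n V"
proof (rule secsI')
  fix a assume "a \<in> V"
  then obtain V' where V': "openin (top_of_set V) V'" "a \<in> V'" "f \<in> secs n V'"
    using assms(2) by blast
  then obtain T where T: "open T" "V' = V \<inter> T" by (metis openin_open)
  obtain W F where W: "a \<in> W" "holomorphic_Cn n W F" "\<forall>z\<in>V' \<inter> W. f z = F z"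
    by (rule secsE[OF V'(3,2)]) (rule that)
  have "openin (top_of_set (Cn n)) (W \<inter> T)"
    using W(2) T(1) unfolding holomorphic_Cn_iff by (metis openin_Int_open)
  then have "holomorphic_Cn n (W \<inter> T) F"
    using W(2) by (auto simp: holomorphic_Cn_iff)
  then show "\<exists>W F. a \<in> W \<and> holomorphic_Cn n W F \<and> (\<forall>z\<in>V \<inter> W. f z = F z)"
    using W V' T by (intro exI[of _ "W \<inter> T"] exI[of _ F]) auto
qed

lemma subsheaf_space_of_subset:
  assumes "A \<subseteq> Cn n"
  shows "subsheaf_of_continuous (space_of_subset n A)"
  unfolding subsheaf_of_continuous_def space_of_subset_simps
proof (intro conjI allI impI; (elim conjE)?)
  fix U f assume U: "openin (top_of_set A) U" "f \<in> secs n U"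
  then have "U \<subseteq> A" by (meson openin_imp_subset)
  then show "continuous_map (subtopology (top_of_set A) U) euclidean f"
    using secs_continuous[of U n f] U assms by (simp add: subtopology_subtopology Int_absorb1)
next
  fix U f g assume "f \<in> secs n U" "\<forall>x\<in>U. g x = f x"
  then show "g \<in> secs n U" by (metis secs_cong)
next
  fix U V f assume "V \<subseteq> U" "f \<in> secs n U"
  then show "f \<in> secs n V" by (metis secs_mono)
next
  fix U f
  assume U: "openin (top_of_set A) U"
    and *: "\<forall>a\<in>U. \<exists>V. openin (top_of_set A) V \<and> a \<in> V \<and> V \<subseteq> U \<and> f \<in> secs n V"
  show "f \<in> secs n U"
  proof (rule secs_glue)
    show "U \<subseteq> Cn n" using U assms by (meson openin_imp_subset order_trans)
    show "\<exists>V'. openin (top_of_set U) V' \<and> a \<in> V' \<and> f \<in> secs n V'" if "a \<in> U" for a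
      using * that U by (meson openin_imp_subset openin_subset_trans)
  qed
qed

lemma subsheaf_restrict:
  assumes X: "subsheaf_of_continuous X" and U: "openin (topo X) U"
  shows "subsheaf_of_continuous (restrict_space_to X U)"
  unfolding subsheaf_of_continuous_def restrict_space_to_simps openin_open_subtopology[OF U]
proof (intro conjI allI impI; (elim conjE)?)
  show "continuous_map (subtopology (subtopology (topo X) U) V) euclidean f"
    if "openin (topo X) V" "V \<subseteq> U" "f \<in> sections X V" for V f
    using sheaf_continuous[OF X that(1,3)] that(2) by (simp add: subtopology_subtopology Int_absorb1)
  show "g \<in> sections X V" if "openin (topo X) V" "f \<in> sections X V" "\<forall>x\<in>V. g x = f x" for V f g
    using sheaf_cong[OF X that(1,2)] that(3) by blast
  show "f \<in> sections X W" if "openin (topo X) V" "openin (topo X) W" "W \<subseteq> V" "f \<in> sections X V" for V W f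
    using sheaf_mono[OF X that] .
  show "f \<in> sections X V" if V: "openin (topo X) V"
    and *: "\<forall>a\<in>V. \<exists>W. (openin (topo X) W \<and> W \<subseteq> U) \<and> a \<in> W \<and> W \<subseteq> V \<and> f \<in> sections X W" for V f
    by (rule sheaf_glue[OF X V]) (use * in blast)
qed

section \<open>Holomorphic maps and their restriction\<close>

lemma holomorphic_mapD:
  assumes "holomorphic_map X Y f"
  shows holomorphic_map_continuous: "continuous_map (topo X) (topo Y) f"
    and holomorphic_map_section: "\<And>V g. openin (topo Y) V \<Longrightarrow> g \<in> sections Y V \<Longrightarrow>
        g \<circ> f \<in> sections X {x\<in>points X. f x \<in> V}"
    and holomorphic_map_points: "\<And>x. x \<in> points X \<Longrightarrow> f x \<in> points Y"
  using assms unfolding holomorphic_map_def by (auto dest: continuous_map_image_subset_topspace)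

lemma holomorphic_map_compose:
  assumes f: "holomorphic_map X Y f" and g: "holomorphic_map Y Z g"
  shows "holomorphic_map X Z (g \<circ> f)"
  unfolding holomorphic_map_def
proof (intro conjI allI impI; (elim conjE)?)
  show "continuous_map (topo X) (topo Z) (g \<circ> f)"
    by (rule continuous_map_compose[OF holomorphic_map_continuous[OF f] holomorphic_map_continuous[OF g]])
  fix V h assume V: "openin (topo Z) V" "h \<in> sections Z V"
  have "openin (topo Y) {y \<in> points Y. g y \<in> V}"
    using V(1) holomorphic_map_continuous[OF g] openin_continuous_map_preimage by blast
  from holomorphic_map_section[OF f this holomorphic_map_section[OF g V]]
  have "(h \<circ> g) \<circ> f \<in> sections X {x \<in> points X. f x \<in> {y \<in> points Y. g y \<in> V}}" .
  moreover have "{x \<in> points X. f x \<in> {y \<in> points Y. g y \<in> V}} = {x \<in> points X. (g \<circ> f) x \<in> V}"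
    using holomorphic_map_points[OF f] by auto
  ultimately show "h \<circ> (g \<circ> f) \<in> sections X {x \<in> points X. (g \<circ> f) x \<in> V}"
    by (simp add: comp_assoc)
qed

text \<open>Sections are total functions with arbitrary values off their open set; the congruence
  rule of the sheaf makes holomorphy depend only on the values of the map at
  \<open>points X\<close>.\<close>

lemma holomorphic_map_cong:
  assumes X: "subsheaf_of_continuous X" and f: "holomorphic_map X Y f"
    and fg: "\<And>x. x \<in> points X \<Longrightarrow> f x = g x"
  shows "holomorphic_map X Y g"
  unfolding holomorphic_map_def
proof (intro conjI allI impI; (elim conjE)?)
  show "continuous_map (topo X) (topo Y) g"
    using continuous_map_eq[OF holomorphic_map_continuous[OF f] fg] .
  fix V h assume V: "openin (topo Y) V" "h \<in> sections Y V"
  have eq: "{x \<in> points X. f x \<in> V} = {x \<in> points X. g x \<in> V}" using fg by auto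
  have o: "openin (topo X) {x \<in> points X. f x \<in> V}"
    using V(1) holomorphic_map_continuous[OF f] openin_continuous_map_preimage by blast
  show "h \<circ> g \<in> sections X {x \<in> points X. g x \<in> V}"
    using sheaf_cong[OF X o holomorphic_map_section[OF f V], of "h \<circ> g"] fg eq by auto
qed

lemma holomorphic_map_restrict_domain:
  assumes X: "subsheaf_of_continuous X" and f: "holomorphic_map X Y f" and U: "openin (topo X) U"
  shows "holomorphic_map (restrict_space_to X U) Y f"
  unfolding holomorphic_map_def
proof (intro conjI allI impI; (elim conjE)?)
  show "continuous_map (topo (restrict_space_to X U)) (topo Y) f"
    using holomorphic_map_continuous[OF f] by (simp add: continuous_map_from_subtopology)
  fix V h assume V: "openin (topo Y) V" "h \<in> sections Y V"
  have o: "openin (topo X) {x \<in> points X. f x \<in> V}"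
    using V(1) holomorphic_map_continuous[OF f] openin_continuous_map_preimage by blast
  have "{x \<in> points (restrict_space_to X U). f x \<in> V} = U \<inter> {x \<in> points X. f x \<in> V}"
    using openin_subset[OF U] by auto
  then show "h \<circ> f \<in> sections (restrict_space_to X U) {x \<in> points (restrict_space_to X U). f x \<in> V}"
    using sheaf_mono[OF X o _ _ holomorphic_map_section[OF f V]] U o by (simp add: openin_Int)
qed

lemma holomorphic_map_into_restrict:
  assumes f: "holomorphic_map X Y f" and V: "openin (topo Y) V" and fV: "\<And>x. x \<in> points X \<Longrightarrow> f x \<in> V"
  shows "holomorphic_map X (restrict_space_to Y V) f"
  unfolding holomorphic_map_def
proof (intro conjI allI impI; (elim conjE)?)
  show "continuous_map (topo X) (topo (restrict_space_to Y V)) f"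
    using holomorphic_map_continuous[OF f] fV by (auto simp: continuous_map_in_subtopology)
  fix V' h assume V': "openin (topo (restrict_space_to Y V)) V'" "h \<in> sections (restrict_space_to Y V) V'"
  then show "h \<circ> f \<in> sections X {x \<in> points X. f x \<in> V'}"
    using holomorphic_map_section[OF f] V by (auto simp: openin_open_subtopology)
qed

lemma holomorphic_map_from_restrict:
  assumes f: "holomorphic_map X (restrict_space_to Y V) f" and V: "openin (topo Y) V"
    and Y: "subsheaf_of_continuous Y"
  shows "holomorphic_map X Y f"
  unfolding holomorphic_map_def
proof (intro conjI allI impI; (elim conjE)?)
  show "continuous_map (topo X) (topo Y) f"
    using holomorphic_map_continuous[OF f] by (auto simp: continuous_map_in_subtopology)
  fix W h assume W: "openin (topo Y) W" "h \<in> sections Y W"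
  have WV: "openin (topo Y) (W \<inter> V)" using W V by blast
  then have "h \<in> sections Y (W \<inter> V)" using sheaf_mono[OF Y W(1) WV _ W(2)] by blast
  then have "h \<circ> f \<in> sections X {x \<in> points X. f x \<in> W \<inter> V}"
    using holomorphic_map_section[OF f, of "W \<inter> V" h] WV V by (simp add: openin_open_subtopology)
  moreover have "{x \<in> points X. f x \<in> W \<inter> V} = {x \<in> points X. f x \<in> W}"
    using holomorphic_map_points[OF f] by auto
  ultimately show "h \<circ> f \<in> sections X {x \<in> points X. f x \<in> W}" by simp
qed

text \<open>Combines locality of continuity with the gluing axiom of the source. It is what makes
  the inverse of the glued normalization holomorphic, since that inverse has a formula only chart by
  chart.\<close>

lemma holomorphic_map_local:
  assumes X: "subsheaf_of_continuous X"
    and loc: "\<And>a. a \<in> points X \<Longrightarrow> \<exists>U. openin (topo X) U \<and> a \<in> U \<and> holomorphic_map (restrict_space_to X U) Y f"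
  shows "holomorphic_map X Y f"
proof -
  have pre: "\<exists>U. openin (topo X) U \<and> a \<in> U \<and> openin (topo X) (U \<inter> {x \<in> points X. f x \<in> V}) \<and>
     holomorphic_map (restrict_space_to X U) Y f" if V: "openin (topo Y) V" and a: "a \<in> points X" for V a
  proof -
    obtain U where U: "openin (topo X) U" "a \<in> U" "holomorphic_map (restrict_space_to X U) Y f"
      using loc a by blast
    have "openin (subtopology (topo X) U) {x \<in> topspace (subtopology (topo X) U). f x \<in> V}"
      using holomorphic_map_continuous[OF U(3)] V openin_continuous_map_preimage by fastforce
    then have "openin (topo X) {x \<in> topspace (subtopology (topo X) U). f x \<in> V}"
      using U(1) by (simp add: openin_open_subtopology)
    moreover have "{x \<in> topspace (subtopology (topo X) U). f x \<in> V} = U \<inter> {x \<in> points X. f x \<in> V}"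
      by auto
    ultimately show ?thesis using U by auto
  qed
  have op: "openin (topo X) {x \<in> points X. f x \<in> V}" if V: "openin (topo Y) V" for V
  proof (subst openin_subopen, safe)
    fix a assume a: "a \<in> points X" "f a \<in> V"
    then show "\<exists>T. openin (topo X) T \<and> a \<in> T \<and> T \<subseteq> {x \<in> points X. f x \<in> V}"
      using pre[OF V a(1)] by blast
  qed
  show ?thesis
    unfolding holomorphic_map_def
  proof (intro conjI allI impI; (elim conjE)?)
    have "f x \<in> points Y" if "x \<in> points X" for x
      using loc[OF that] holomorphic_map_points that by fastforce
    then show "continuous_map (topo X) (topo Y) f"
      using op by (auto simp: continuous_map_def)
    fix V h assume V: "openin (topo Y) V" "h \<in> sections Y V"
    show "h \<circ> f \<in> sections X {x \<in> points X. f x \<in> V}"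
    proof (rule sheaf_glue[OF X op[OF V(1)]])
      fix a assume a: "a \<in> {x \<in> points X. f x \<in> V}"
      then obtain U where U: "openin (topo X) U" "a \<in> U" "openin (topo X) (U \<inter> {x \<in> points X. f x \<in> V})"
        "holomorphic_map (restrict_space_to X U) Y f"
        using pre[OF V(1)] by blast
      have "{x \<in> points (restrict_space_to X U). f x \<in> V} = U \<inter> {x \<in> points X. f x \<in> V}"
        by auto
      then have "h \<circ> f \<in> sections X (U \<inter> {x \<in> points X. f x \<in> V})"
        using holomorphic_map_section[OF U(4) V] by simp
      then show "\<exists>T. openin (topo X) T \<and> a \<in> T \<and> T \<subseteq> {x \<in> points X. f x \<in> V} \<and> h \<circ> f \<in> sections X T"
        using U a by (intro exI[of _ "U \<inter> {x \<in> points X. f x \<in> V}"]) auto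
    qed
  qed
qed

text \<open>Carries the inverse as an argument, so that symmetry, composition and restriction keep
  track of it without choosing it anew.\<close>

definition biholo_pair :: "'a function_space \<Rightarrow> 'b function_space \<Rightarrow> ('a \<Rightarrow> 'b) \<Rightarrow> ('b \<Rightarrow> 'a) \<Rightarrow> bool" where
  "biholo_pair X Y f g \<longleftrightarrow> holomorphic_map X Y f \<and> holomorphic_map Y X g \<and>
     (\<forall>x\<in>points X. g (f x) = x) \<and> (\<forall>y\<in>points Y. f (g y) = y)"

lemma biholomorphic_map_iff_pair: "biholomorphic_map X Y f \<longleftrightarrow> (\<exists>g. biholo_pair X Y f g)"
  by (auto simp: biholomorphic_map_def biholo_pair_def)

lemma biholo_pair_sym: "biholo_pair X Y f g \<Longrightarrow> biholo_pair Y X g f"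
  by (auto simp: biholo_pair_def)

lemma biholo_pair_compose:
  "biholo_pair X Y f g \<Longrightarrow> biholo_pair Y Z f' g' \<Longrightarrow> biholo_pair X Z (f' \<circ> f) (g \<circ> g')"
  by (auto simp: biholo_pair_def holomorphic_map_compose holomorphic_map_points)

lemma biholo_pair_restrict:
  assumes fg: "biholo_pair X Y f g" and X: "subsheaf_of_continuous X" and Y: "subsheaf_of_continuous Y"
    and V: "openin (topo Y) V"
  shows "openin (topo X) {x\<in>points X. f x \<in> V}"
    and "biholo_pair (restrict_space_to X {x\<in>points X. f x \<in> V}) (restrict_space_to Y V) f g"
proof -
  have f: "holomorphic_map X Y f" and g: "holomorphic_map Y X g"
    and gf: "\<And>x. x \<in> points X \<Longrightarrow> g (f x) = x" and fg: "\<And>y. y \<in> points Y \<Longrightarrow> f (g y) = y"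
    using fg by (auto simp: biholo_pair_def)
  show U: "openin (topo X) {x\<in>points X. f x \<in> V}"
    using V holomorphic_map_continuous[OF f] openin_continuous_map_preimage by blast
  have VY: "V \<subseteq> points Y" using V by (rule openin_subset)
  show "biholo_pair (restrict_space_to X {x\<in>points X. f x \<in> V}) (restrict_space_to Y V) f g"
    unfolding biholo_pair_def
  proof (intro conjI ballI)
    show "holomorphic_map (restrict_space_to X {x\<in>points X. f x \<in> V}) (restrict_space_to Y V) f"
      by (rule holomorphic_map_into_restrict[OF holomorphic_map_restrict_domain[OF X f U] V]) auto
    show "holomorphic_map (restrict_space_to Y V) (restrict_space_to X {x\<in>points X. f x \<in> V}) g"
      by (rule holomorphic_map_into_restrict[OF holomorphic_map_restrict_domain[OF Y g V] U])
        (use VY fg holomorphic_map_points[OF g] in auto)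
  qed (use gf fg in auto)
qed

text \<open>The dimension is explicit because normality is derived from charts of dimension two,
  whereas a singular point must be shown to have no chart of any dimension.\<close>

definition chart_at :: "nat \<Rightarrow> 'a function_space \<Rightarrow> 'a \<Rightarrow> bool" where
  "chart_at n X a \<longleftrightarrow> (\<exists>U \<Omega> \<phi> \<psi>. openin (topo X) U \<and> a \<in> U \<and> open_Cn n \<Omega> \<and>
     biholo_pair (restrict_space_to X U) (space_of_subset n \<Omega>) \<phi> \<psi>)"

lemma singular_points_iff: "a \<in> singular_points X \<longleftrightarrow> a \<in> points X \<and> \<not> (\<exists>n. chart_at n X a)"
  unfolding singular_points_def chart_at_def biholomorphic_map_iff_pair by blast

text \<open>One chart serves all points of its open set. This carries singularity from general
  points of the double curve to the limit points among them.\<close>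

lemma open_regular_points: "openin (topo X) (points X - singular_points X)"
proof (subst openin_subopen, safe)
  fix a assume "a \<in> points X" "a \<notin> singular_points X"
  then obtain n U \<Omega> \<phi> \<psi> where U: "openin (topo X) U" "a \<in> U" "open_Cn n \<Omega>"
     "biholo_pair (restrict_space_to X U) (space_of_subset n \<Omega>) \<phi> \<psi>"
    by (auto simp: singular_points_iff chart_at_def)
  then have "U \<subseteq> points X - singular_points X"
    using openin_subset[OF U(1)] by (auto simp: singular_points_iff chart_at_def)
  then show "\<exists>T. openin (topo X) T \<and> a \<in> T \<and> T \<subseteq> points X - singular_points X"
    using U by blast
qed

text \<open>The chart at \<open>f a\<close> is cut down to its intersection \<open>W\<close> with
  \<open>V\<close>, and both the chart and \<open>f\<close> are restricted to the preimages of
  \<open>W\<close>; their composite is the required chart.\<close>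

lemma chart_at_transfer:
  assumes X: "subsheaf_of_continuous X" and Y: "subsheaf_of_continuous Y"
    and U: "openin (topo X) U" and V: "openin (topo Y) V"
    and fg: "biholo_pair (restrict_space_to X U) (restrict_space_to Y V) f g"
    and a: "a \<in> U" and ch: "chart_at n Y (f a)"
  shows "chart_at n X a"
proof -
  obtain V1 \<Omega> \<phi> \<psi> where V1: "openin (topo Y) V1" "f a \<in> V1" "open_Cn n \<Omega>"
     "biholo_pair (restrict_space_to Y V1) (space_of_subset n \<Omega>) \<phi> \<psi>"
    using ch by (auto simp: chart_at_def)
  have UX: "U \<subseteq> points X" and VY: "V \<subseteq> points Y" and V1Y: "V1 \<subseteq> points Y"
    using U V V1 openin_subset by auto
  have faV: "f a \<in> V"
    using fg a UX by (auto simp: biholo_pair_def dest!: holomorphic_map_points)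
  define W where "W = V \<inter> V1"
  have W: "openin (topo Y) W" using V V1 by (auto simp: W_def)
  have WV: "openin (topo (restrict_space_to Y V)) W" "openin (topo (restrict_space_to Y V1)) W"
    using W V V1 by (auto simp: openin_open_subtopology W_def)
  define U1 where "U1 = {x\<in>points (restrict_space_to X U). f x \<in> W}"
  have 1: "openin (topo (restrict_space_to X U)) U1"
    "biholo_pair (restrict_space_to (restrict_space_to X U) U1) (restrict_space_to (restrict_space_to Y V) W) f g"
    unfolding U1_def
    by (rule biholo_pair_restrict[OF fg subsheaf_restrict[OF X U] subsheaf_restrict[OF Y V] WV(1)])+
  have \<Omega>C: "\<Omega> \<subseteq> Cn n" using V1(3) by (rule open_Cn_subset)
  define \<Omega>1 where "\<Omega>1 = {x\<in>points (space_of_subset n \<Omega>). \<psi> x \<in> W}"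
  have 2: "openin (topo (space_of_subset n \<Omega>)) \<Omega>1"
    "biholo_pair (restrict_space_to (space_of_subset n \<Omega>) \<Omega>1) (restrict_space_to (restrict_space_to Y V1) W) \<psi> \<phi>"
    unfolding \<Omega>1_def
    by (rule biholo_pair_restrict[OF biholo_pair_sym[OF V1(4)] subsheaf_space_of_subset[OF \<Omega>C]
          subsheaf_restrict[OF Y V1(1)] WV(2)])+
  have \<Omega>1: "open_Cn n \<Omega>1"
    using 2(1) V1(3) by (simp add: openin_trans)
  have "\<Omega>1 \<subseteq> \<Omega>" by (auto simp: \<Omega>1_def)
  have "V \<inter> W = W" "V1 \<inter> W = W" "U \<inter> U1 = U1" using UX by (auto simp: W_def U1_def)
  then have "biholo_pair (restrict_space_to X U1) (restrict_space_to Y W) f g"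
    "biholo_pair (space_of_subset n \<Omega>1) (restrict_space_to Y W) \<psi> \<phi>"
    using 1(2) 2(2) by (simp_all add: restrict_space_of_subset[OF \<open>\<Omega>1 \<subseteq> \<Omega>\<close>])
  from biholo_pair_compose[OF this(1) biholo_pair_sym[OF this(2)]]
  have "biholo_pair (restrict_space_to X U1) (space_of_subset n \<Omega>1) (\<phi> \<circ> f) (g \<circ> \<psi>)" .
  moreover have "openin (topo X) U1" using 1(1) U by (simp add: openin_open_subtopology)
  moreover have "a \<in> U1" using a UX faV V1 by (auto simp: U1_def W_def)
  ultimately show ?thesis using \<Omega>1 unfolding chart_at_def by blast
qed

text \<open>The working criterion for maps between subsets: holomorphic components suffice. Near a
  point the components extend to an ambient map \<open>\<Phi>\<close>, a section of the target
  extends to an ambient function \<open>G\<close>, and \<open>G \<circ> \<Phi>\<close> is the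
  ambient extension of the pulled back section.\<close>

lemma holomorphic_map_subsets:
  assumes A: "A \<subseteq> Cn m" and B: "B \<subseteq> Cn n" and fAB: "\<And>z. z \<in> A \<Longrightarrow> f z \<in> B"
    and comp: "\<And>j. j < n \<Longrightarrow> (\<lambda>z. f z j) \<in> secs m A"
  shows "holomorphic_map (space_of_subset m A) (space_of_subset n B) f"
  unfolding holomorphic_map_def
proof (intro conjI allI impI; (elim conjE)?)
  have fC: "f z \<in> Cn n" if "z \<in> A" for z using fAB B that by auto
  have "continuous_on A f"
  proof (rule continuous_on_coordinatewise_then_product)
    fix i
    show "continuous_on A (\<lambda>z. f z i)"
    proof (cases "i < n")
      case True then show ?thesis using secs_continuous[OF A comp] by blast
    next
      case False
      then show ?thesis
        using fC by (subst continuous_on_cong[OF refl, of _ _ "\<lambda>z. 0"]) (auto simp: Cn_def)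
    qed
  qed
  then show "continuous_map (topo (space_of_subset m A)) (topo (space_of_subset n B)) f"
    using fAB by auto
  fix V g assume V: "openin (topo (space_of_subset n B)) V" "g \<in> sections (space_of_subset n B) V"
  then have g: "g \<in> secs n V" by simp
  have VB: "V \<subseteq> B" using V by (auto dest: openin_imp_subset)
  have "g \<circ> f \<in> secs m {z\<in>A. f z \<in> V}"
  proof (rule secsI')
    fix a assume "a \<in> {z \<in> A. f z \<in> V}"
    then have a: "a \<in> A" "f a \<in> V" by auto
    obtain W G where W: "f a \<in> W" "holomorphic_Cn n W G" "\<forall>z\<in>V \<inter> W. g z = G z"
      by (rule secsE[OF g a(2)]) (rule that)
    have "\<exists>T F. a \<in> T \<and> holomorphic_Cn m T F \<and> (\<forall>z\<in>A \<inter> T. f z j = F z)" if j: "j < n" for j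
    proof -
      obtain T F where "a \<in> T" "holomorphic_Cn m T F" "\<forall>z\<in>A \<inter> T. f z j = F z"
        by (rule secsE[OF comp[OF j] a(1)]) (rule that)
      then show ?thesis by (intro exI[of _ T] exI[of _ F]) auto
    qed
    then have "\<forall>j\<in>{..<n}. \<exists>T F. a \<in> T \<and> holomorphic_Cn m T F \<and> (\<forall>z\<in>A \<inter> T. f z j = F z)"
      by simp
    from bchoice[OF this] obtain T where
      "\<forall>j\<in>{..<n}. \<exists>F. a \<in> T j \<and> holomorphic_Cn m (T j) F \<and> (\<forall>z\<in>A \<inter> T j. f z j = F z)" ..
    from bchoice[OF this] obtain F where
      F: "\<forall>j\<in>{..<n}. a \<in> T j \<and> holomorphic_Cn m (T j) (F j) \<and> (\<forall>z\<in>A \<inter> T j. f z j = F j z)" ..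
    have TF: "\<And>j. j < n \<Longrightarrow> a \<in> T j" "\<And>j. j < n \<Longrightarrow> holomorphic_Cn m (T j) (F j)"
      "\<And>j z. j < n \<Longrightarrow> z \<in> A \<Longrightarrow> z \<in> T j \<Longrightarrow> f z j = F j z"
      using F by simp_all
    \<comment> \<open>Padding with zeros keeps \<open>\<Phi>\<close> inside \<open>Cn n\<close> on
      all of \<open>S\<close>, although it agrees with \<open>f\<close> only on
      \<open>A\<close>.\<close>
    define \<Phi> where "\<Phi> z = (\<lambda>j. if j < n then F j z else 0)" for z
    \<comment> \<open>The factor \<open>Cn m\<close> supplies an open set of \<open>Cn m\<close>
      when \<open>n = 0\<close>, where the intersection over \<open>j\<close> is the whole
      type.\<close>
    define S where "S = Cn m \<inter> (\<Inter>j\<in>{..<n}. T j)"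
    have S: "open_Cn m S"
    proof (cases "n = 0")
      case True then show ?thesis by (simp add: S_def)
    next
      case False
      then have "open_Cn m (\<Inter>j\<in>{..<n}. T j)"
        using TF(2) by (intro openin_INT2) (auto simp: holomorphic_Cn_iff)
      then show ?thesis unfolding S_def by (metis openin_Int openin_subtopology_self)
    qed
    have aS: "a \<in> S" using a A TF by (auto simp: S_def)
    have \<Phi>C: "\<Phi> z \<in> Cn n" for z by (simp add: \<Phi>_def Cn_def)
    have \<Phi>h: "holo_at m (\<lambda>z. \<Phi> z j) z" if "j < n" "z \<in> S" for j z
      using that TF(2)[of j] by (auto simp: \<Phi>_def S_def holomorphic_Cn_iff)
    have \<Phi>f: "\<Phi> z = f z" if "z \<in> A" "z \<in> S" for z
    proof
      fix j show "\<Phi> z j = f z j"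
        using that TF(3)[of j z] fC[of z] by (auto simp: \<Phi>_def S_def Cn_def)
    qed
    have cont: "continuous_on S \<Phi>"
      unfolding continuous_on_def
    proof
      fix z assume z: "z \<in> S"
      show "(\<Phi> \<longlongrightarrow> \<Phi> z) (at z within S)"
      proof (rule tendsto_holo_components[where n=n])
        fix j assume "j < n"
        then show "((\<lambda>w. \<Phi> w j) \<longlongrightarrow> \<Phi> z j) (at z within S)"
          using holo_at_continuous[OF \<Phi>h[OF _ z]] S
          by (meson continuous_within open_Cn_subset tendsto_within_subset)
      qed (auto simp: \<Phi>C)
    qed
    define W' where "W' = S \<inter> \<Phi> -` W"
    have "openin (top_of_set S) W'"
      unfolding W'_def using continuous_openin_preimage[OF cont, of "Cn n" W] \<Phi>C W(2)
      by (auto simp: holomorphic_Cn_iff)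
    then have W': "open_Cn m W'" using S openin_trans by blast
    have "holo_at m (\<lambda>z. G (\<Phi> z)) z" if z: "z \<in> W'" for z
    proof (rule holo_at_compose[where n=n and f=\<Phi> and G=G])
      show "holo_at m (\<lambda>w. \<Phi> w j) z" if "j < n" for j
        using \<Phi>h[OF that] z by (auto simp: W'_def)
      show "z \<in> Cn m" using z by (auto simp: W'_def S_def)
      show "holo_at n G (\<Phi> z)" using W z by (auto simp: W'_def holomorphic_Cn_iff)
    qed (simp add: \<Phi>C)
    then have "holomorphic_Cn m W' (G \<circ> \<Phi>)"
      using W' by (simp add: holomorphic_Cn_iff comp_def)
    moreover have "a \<in> W'" using aS W \<Phi>f a by (simp add: W'_def)
    moreover have "(g \<circ> f) z = (G \<circ> \<Phi>) z" if "z \<in> {z\<in>A. f z \<in> V} \<inter> W'" for z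
      using that W(3) \<Phi>f[of z] by (simp add: W'_def)
    ultimately show "\<exists>W F. a \<in> W \<and> holomorphic_Cn m W F \<and> (\<forall>z\<in>{z \<in> A. f z \<in> V} \<inter> W. (g \<circ> f) z = F z)"
      by blast
  qed
  then show "g \<circ> f \<in> sections (space_of_subset m A) {x \<in> points (space_of_subset m A). f x \<in> V}"
    by simp
qed

text \<open>The counterpart for discs as source; it produces the discs that run inside the double
  line.\<close>

lemma holomorphic_map_disc:
  assumes B: "B \<subseteq> Cn n" and fB: "\<And>z. z \<in> ball 0 1 \<Longrightarrow> f z \<in> B"
    and comp: "\<And>j. j < n \<Longrightarrow> (\<lambda>z. f z j) holomorphic_on ball 0 1"
  shows "holomorphic_map unit_disc (space_of_subset n B) f"
  unfolding holomorphic_map_def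
proof (intro conjI allI impI; (elim conjE)?)
  have fC: "f z \<in> Cn n" if "z \<in> ball 0 1" for z using fB B that by auto
  have cont: "continuous_on (ball 0 1) f"
  proof (rule continuous_on_coordinatewise_then_product)
    fix i
    show "continuous_on (ball 0 1) (\<lambda>z. f z i)"
    proof (cases "i < n")
      case True then show ?thesis using comp holomorphic_on_imp_continuous_on by blast
    next
      case False
      then show ?thesis
        using fC by (subst continuous_on_cong[OF refl, of _ _ "\<lambda>z. 0"]) (auto simp: Cn_def)
    qed
  qed
  then show c: "continuous_map (topo unit_disc) (topo (space_of_subset n B)) f"
    using fB by auto
  fix V g assume V: "openin (topo (space_of_subset n B)) V" "g \<in> sections (space_of_subset n B) V"
  have "openin (top_of_set (ball 0 1)) {z \<in> ball 0 1. f z \<in> V}"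
    using openin_continuous_map_preimage[OF c V(1)] by simp
  then have op: "open {z \<in> ball 0 1. f z \<in> V}"
    using open_ball openin_open_trans by blast
  have "(g \<circ> f) holomorphic_on {z \<in> ball 0 1. f z \<in> V}"
    unfolding holomorphic_on_def
  proof
    fix a :: complex assume "a \<in> {z \<in> ball 0 1. f z \<in> V}"
    then have a: "a \<in> ball 0 1" "f a \<in> V" by auto
    obtain W G where W: "f a \<in> W" "holomorphic_Cn n W G" "\<forall>z\<in>V \<inter> W. g z = G z"
      by (rule secsE[OF V(2)[unfolded space_of_subset_simps] a(2)]) (rule that)
    obtain T where T: "open T" "W = Cn n \<inter> T"
      using W(2) unfolding holomorphic_Cn_iff by (metis openin_open)
    have evb: "\<forall>\<^sub>F z in nhds a. z \<in> ball 0 1 \<and> f z \<in> V"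
      using eventually_nhds_in_open[OF op, of a] a by simp
    have "(f \<longlongrightarrow> f a) (nhds a)"
      using cont a by (metis continuous_on_eq_continuous_at isCont_def open_ball tendsto_at_iff_tendsto_nhds)
    then have evT: "\<forall>\<^sub>F z in nhds a. f z \<in> T"
      using T W topological_tendstoD by blast
    have "(\<lambda>z. G (f z)) field_differentiable at a"
    proof (rule field_differentiable_compose_holo_at[where n=n and f=f and G=G])
      show "(\<lambda>w. f w j) field_differentiable at a" if "j < n" for j
        using comp[OF that] a by (simp add: holomorphic_on_imp_differentiable_at)
      show "\<forall>\<^sub>F w in nhds a. f w \<in> Cn n"
        using evb by eventually_elim (use fC in auto)
      show "holo_at n G (f a)" using W by (auto simp: holomorphic_Cn_iff)
    qed
    moreover have "\<forall>\<^sub>F z in nhds a. G (f z) = (g \<circ> f) z"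
      using evb evT by eventually_elim (use W(3) T fC in auto)
    ultimately have "(g \<circ> f) field_differentiable at a"
      unfolding field_differentiable_def by (metis DERIV_cong_ev)
    then show "(g \<circ> f) field_differentiable at a within {z \<in> ball 0 1. f z \<in> V}"
      by (rule field_differentiable_at_within)
  qed
  then show "g \<circ> f \<in> sections unit_disc {x \<in> points unit_disc. f x \<in> V}"
    by simp
qed

lemma holomorphic_map_id_restrict:
  assumes "subsheaf_of_continuous X" "openin (topo X) U"
  shows "holomorphic_map (restrict_space_to X U) X id"
proof -
  have "holomorphic_map X X id"
    unfolding holomorphic_map_def
  proof (intro conjI allI impI; (elim conjE)?)
    fix V g assume V: "openin (topo X) V" "g \<in> sections X V"
    then have "{x \<in> points X. id x \<in> V} = V" using openin_subset[OF V(1)] by auto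
    then show "g \<circ> id \<in> sections X {x \<in> points X. id x \<in> V}" using V by simp
  qed simp
  then show ?thesis using assms holomorphic_map_restrict_domain by blast
qed

text \<open>An analytic subset is its own local model, with the identity as one chart for all
  points.\<close>

lemma complex_space_subset:
  assumes "analytic_subset n \<Omega> A"
  shows "complex_space (space_of_subset n A)"
proof -
  have A: "A \<subseteq> Cn n" using assms by (auto simp: analytic_subset_def dest: open_Cn_subset)
  have sh: "subsheaf_of_continuous (space_of_subset n A)"
    by (rule subsheaf_space_of_subset[OF A])
  have "holomorphic_map (restrict_space_to (space_of_subset n A) A) (space_of_subset n A) id"
    by (rule holomorphic_map_id_restrict[OF sh]) simp
  then have "biholo_pair (restrict_space_to (space_of_subset n A) A) (space_of_subset n A) id id"
    by (simp add: biholo_pair_def restrict_space_of_subset)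
  then have "biholomorphic_map (restrict_space_to (space_of_subset n A) A) (space_of_subset n A) id"
    by (auto simp: biholomorphic_map_iff_pair)
  moreover have "Hausdorff_space (topo (space_of_subset n A))"
    by (simp add: Hausdorff_space_subtopology)
  moreover have "openin (topo (space_of_subset n A)) A" by simp
  ultimately show ?thesis
    unfolding complex_space_def using sh assms
    by (intro conjI ballI exI[of _ A] exI[of _ n] exI[of _ \<Omega>] exI[of _ id]) auto
qed

section \<open>Total quotient rings and germs\<close>

text \<open>Operations on classes are coded as unions over representatives; such a union collapses
  once its members are seen to be equal.\<close>

lemma UN_const_class:
  assumes "x \<in> A" "\<And>y. y \<in> A \<Longrightarrow> f y = C"
  shows "(\<Union>y\<in>A. f y) = C"
  using assms by blast

section \<open>Fractions over a commutative ring\<close>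

context cring
begin

abbreviation (input) nzd where "nzd \<equiv> non_zero_divisors R"
abbreviation (input) fr where "fr a s \<equiv> fraction_rel R `` {(a, s)}"

lemma nzd_closed: "s \<in> nzd \<Longrightarrow> s \<in> carrier R"
  by (simp add: non_zero_divisors_def)

lemma nzd_one: "\<one> \<in> nzd"
  by (simp add: non_zero_divisors_def)

lemma nzd_mult:
  assumes "s \<in> nzd" "t \<in> nzd"
  shows "s \<otimes> t \<in> nzd"
proof -
  have st: "s \<in> carrier R" "t \<in> carrier R" using assms nzd_closed by auto
  have "x = \<zero>" if x: "x \<in> carrier R" "s \<otimes> t \<otimes> x = \<zero>" for x
  proof -
    have "s \<otimes> (t \<otimes> x) = \<zero>" using x st by (simp add: m_assoc)
    moreover have "t \<otimes> x \<in> carrier R" using x st by simp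
    ultimately have "t \<otimes> x = \<zero>" using assms(1) unfolding non_zero_divisors_def by blast
    then show ?thesis using assms(2) x(1) unfolding non_zero_divisors_def by blast
  qed
  then show ?thesis using st by (simp add: non_zero_divisors_def)
qed

lemma nzd_pow: "s \<in> nzd \<Longrightarrow> s [^] (n::nat) \<in> nzd"
  by (induction n) (auto simp: nzd_one nzd_mult)

lemma nzd_cancel:
  assumes "s \<in> nzd" "x \<in> carrier R" "y \<in> carrier R" "s \<otimes> x = s \<otimes> y"
  shows "x = y"
proof -
  have s: "s \<in> carrier R" using assms nzd_closed by auto
  have "s \<otimes> (x \<ominus> y) = \<zero>"
    using assms s by (simp add: minus_eq r_distr r_minus r_neg)
  moreover have "x \<ominus> y \<in> carrier R" using assms by simp
  ultimately have "x \<ominus> y = \<zero>"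
    using assms(1) unfolding non_zero_divisors_def by blast
  then have "x \<ominus> y \<oplus> y = y" using assms by simp
  then show ?thesis using assms by (simp add: minus_eq a_assoc l_neg)
qed

lemma fraction_rel_iff:
  "((a, s), (b, t)) \<in> fraction_rel R \<longleftrightarrow> a \<in> carrier R \<and> s \<in> nzd \<and> b \<in> carrier R \<and> t \<in> nzd \<and> a \<otimes> t = b \<otimes> s"
  by (simp add: fraction_rel_def)

text \<open>Transitivity is the point where denominators have to be non-zero-divisors: the middle
  denominator \<open>t\<close> is cancelled.\<close>

lemma equiv_fraction_rel: "equiv (carrier R \<times> nzd) (fraction_rel R)"
proof (rule equivI)
  show "fraction_rel R \<subseteq> (carrier R \<times> nzd) \<times> carrier R \<times> nzd"
    by (auto simp: fraction_rel_def)
  show "refl_on (carrier R \<times> nzd) (fraction_rel R)"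
    by (auto simp: refl_on_def fraction_rel_iff)
  show "sym (fraction_rel R)"
    by (auto simp: sym_def fraction_rel_iff)
  show "trans (fraction_rel R)"
  proof (rule transI, clarify)
    fix a s b t c u
    assume "((a, s), (b, t)) \<in> fraction_rel R" "((b, t), (c, u)) \<in> fraction_rel R"
    then have *: "a \<in> carrier R" "b \<in> carrier R" "c \<in> carrier R" "s \<in> nzd" "t \<in> nzd" "u \<in> nzd"
      "a \<otimes> t = b \<otimes> s" "b \<otimes> u = c \<otimes> t" by (auto simp: fraction_rel_iff)
    then have c: "s \<in> carrier R" "t \<in> carrier R" "u \<in> carrier R" using nzd_closed by auto
    have "t \<otimes> (a \<otimes> u) = (a \<otimes> t) \<otimes> u" using *(1-3) c by (simp add: m_ac)
    also have "\<dots> = (b \<otimes> s) \<otimes> u" by (simp only: *(7))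
    also have "\<dots> = (b \<otimes> u) \<otimes> s" using *(1-3) c by (simp add: m_ac)
    also have "\<dots> = (c \<otimes> t) \<otimes> s" by (simp only: *(8))
    also have "\<dots> = t \<otimes> (c \<otimes> s)" using *(1-3) c by (simp add: m_ac)
    finally have "a \<otimes> u = c \<otimes> s" using nzd_cancel[OF *(5)] * c by auto
    then show "((a, s), (c, u)) \<in> fraction_rel R" using * by (simp add: fraction_rel_iff)
  qed
qed

lemma fr_eq_iff:
  assumes "a \<in> carrier R" "s \<in> nzd" "b \<in> carrier R" "t \<in> nzd"
  shows "fr a s = fr b t \<longleftrightarrow> a \<otimes> t = b \<otimes> s"
  using eq_equiv_class_iff[OF equiv_fraction_rel, of "(a, s)" "(b, t)"] assms
  by (simp add: fraction_rel_iff)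

lemma fr_closed: "a \<in> carrier R \<Longrightarrow> s \<in> nzd \<Longrightarrow> fr a s \<in> carrier (total_quotient_ring R)"
  by (auto simp: total_quotient_ring_def intro!: quotientI)

lemma fr_cases:
  assumes "x \<in> carrier (total_quotient_ring R)"
  obtains a s where "a \<in> carrier R" "s \<in> nzd" "x = fr a s"
  using assms by (auto simp: total_quotient_ring_def elim!: quotientE)

lemma fr_UN2:
  assumes "a \<in> carrier R" "s \<in> nzd" "b \<in> carrier R" "t \<in> nzd"
    and "\<And>a' s' b' t'. a' \<in> carrier R \<Longrightarrow> s' \<in> nzd \<Longrightarrow> b' \<in> carrier R \<Longrightarrow> t' \<in> nzd \<Longrightarrow>
      a \<otimes> s' = a' \<otimes> s \<Longrightarrow> b \<otimes> t' = b' \<otimes> t \<Longrightarrow> H a' s' b' t' = C"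
  shows "(\<Union>(a', s')\<in>fr a s. \<Union>(b', t')\<in>fr b t. H a' s' b' t') = C"
proof (rule UN_const_class[of "(a, s)"])
  show "(a, s) \<in> fr a s" using assms by (simp add: fraction_rel_iff)
  fix y assume "y \<in> fr a s"
  then obtain a' s' where y: "y = (a', s')" "a' \<in> carrier R" "s' \<in> nzd" "a \<otimes> s' = a' \<otimes> s"
    by (cases y) (auto simp: fraction_rel_iff)
  have "(\<Union>(b', t')\<in>fr b t. H a' s' b' t') = C"
  proof (rule UN_const_class[of "(b, t)"])
    show "(b, t) \<in> fr b t" using assms by (simp add: fraction_rel_iff)
    fix z assume "z \<in> fr b t"
    then obtain b' t' where z: "z = (b', t')" "b' \<in> carrier R" "t' \<in> nzd" "b \<otimes> t' = b' \<otimes> t"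
      by (cases z) (auto simp: fraction_rel_iff)
    then show "(case z of (b', t') \<Rightarrow> H a' s' b' t') = C"
      using assms(5) y by simp
  qed
  then show "(case y of (a', s') \<Rightarrow> \<Union>(b', t')\<in>fr b t. H a' s' b' t') = C"
    using y by simp
qed

lemma fr_mult:
  assumes "a \<in> carrier R" "s \<in> nzd" "b \<in> carrier R" "t \<in> nzd"
  shows "fr a s \<otimes>\<^bsub>total_quotient_ring R\<^esub> fr b t = fr (a \<otimes> b) (s \<otimes> t)"
proof -
  have "(\<Union>(a', s')\<in>fr a s. \<Union>(b', t')\<in>fr b t. fr (a' \<otimes> b') (s' \<otimes> t')) = fr (a \<otimes> b) (s \<otimes> t)"
  proof (rule fr_UN2[OF assms])
    fix a' s' b' t' assume *: "a' \<in> carrier R" "s' \<in> nzd" "b' \<in> carrier R" "t' \<in> nzd"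
      "a \<otimes> s' = a' \<otimes> s" "b \<otimes> t' = b' \<otimes> t"
    note c = assms(1,3) *(1,3) nzd_closed[OF assms(2)] nzd_closed[OF assms(4)] nzd_closed[OF *(2)] nzd_closed[OF *(4)]
    have "(a' \<otimes> b') \<otimes> (s \<otimes> t) = (a' \<otimes> s) \<otimes> (b' \<otimes> t)" using c by (simp add: m_ac)
    also have "\<dots> = (a \<otimes> s') \<otimes> (b \<otimes> t')" using * by simp
    also have "\<dots> = (a \<otimes> b) \<otimes> (s' \<otimes> t')" using c by (simp add: m_ac)
    finally show "fr (a' \<otimes> b') (s' \<otimes> t') = fr (a \<otimes> b) (s \<otimes> t)"
      using * assms by (subst fr_eq_iff) (auto intro: nzd_mult)
  qed
  then show ?thesis by (simp add: total_quotient_ring_def)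
qed

lemma fr_add:
  assumes "a \<in> carrier R" "s \<in> nzd" "b \<in> carrier R" "t \<in> nzd"
  shows "fr a s \<oplus>\<^bsub>total_quotient_ring R\<^esub> fr b t = fr (a \<otimes> t \<oplus> b \<otimes> s) (s \<otimes> t)"
proof -
  have "(\<Union>(a', s')\<in>fr a s. \<Union>(b', t')\<in>fr b t. fr (a' \<otimes> t' \<oplus> b' \<otimes> s') (s' \<otimes> t')) =
      fr (a \<otimes> t \<oplus> b \<otimes> s) (s \<otimes> t)"
  proof (rule fr_UN2[OF assms])
    fix a' s' b' t' assume *: "a' \<in> carrier R" "s' \<in> nzd" "b' \<in> carrier R" "t' \<in> nzd"
      "a \<otimes> s' = a' \<otimes> s" "b \<otimes> t' = b' \<otimes> t"
    note c = assms(1,3) *(1,3) nzd_closed[OF assms(2)] nzd_closed[OF assms(4)] nzd_closed[OF *(2)] nzd_closed[OF *(4)]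
    have "(a' \<otimes> t' \<oplus> b' \<otimes> s') \<otimes> (s \<otimes> t) = (a' \<otimes> s) \<otimes> (t' \<otimes> t) \<oplus> (b' \<otimes> t) \<otimes> (s' \<otimes> s)"
      using c by (simp add: m_ac l_distr r_distr)
    also have "\<dots> = (a \<otimes> s') \<otimes> (t' \<otimes> t) \<oplus> (b \<otimes> t') \<otimes> (s' \<otimes> s)" using * by simp
    also have "\<dots> = (a \<otimes> t \<oplus> b \<otimes> s) \<otimes> (s' \<otimes> t')" using c by (simp add: m_ac l_distr r_distr)
    finally show "fr (a' \<otimes> t' \<oplus> b' \<otimes> s') (s' \<otimes> t') = fr (a \<otimes> t \<oplus> b \<otimes> s) (s \<otimes> t)"
      using * assms c by (subst fr_eq_iff) (auto intro: nzd_mult)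
  qed
  then show ?thesis by (simp add: total_quotient_ring_def)
qed

lemma fr_add_same:
  assumes "a \<in> carrier R" "s \<in> nzd" "b \<in> carrier R"
  shows "fr a s \<oplus>\<^bsub>total_quotient_ring R\<^esub> fr b s = fr (a \<oplus> b) s"
proof -
  note c = assms(1,3) nzd_closed[OF assms(2)]
  show ?thesis
    using assms c by (simp add: fr_add fr_eq_iff nzd_mult l_distr r_distr m_ac)
qed

lemma fr_zero: "s \<in> nzd \<Longrightarrow> \<zero>\<^bsub>total_quotient_ring R\<^esub> = fr \<zero> s"
  using nzd_closed by (simp add: total_quotient_ring_def fr_eq_iff nzd_one)

lemma fr_one: "\<one>\<^bsub>total_quotient_ring R\<^esub> = fr \<one> \<one>"
  by (simp add: total_quotient_ring_def)

text \<open>Makes the laws of finite sums available in the quotient ring, which the sum in an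
  integral equation calls for.\<close>

lemma abelian_monoid_total_quotient_ring: "abelian_monoid (total_quotient_ring R)"
proof (rule abelian_monoidI)
  fix x y assume "x \<in> carrier (total_quotient_ring R)" "y \<in> carrier (total_quotient_ring R)"
  then obtain a s b t where x: "a \<in> carrier R" "s \<in> nzd" "x = fr a s"
    and y: "b \<in> carrier R" "t \<in> nzd" "y = fr b t" by (metis fr_cases)
  note c = x(1) y(1) nzd_closed[OF x(2)] nzd_closed[OF y(2)]
  show "x \<oplus>\<^bsub>total_quotient_ring R\<^esub> y \<in> carrier (total_quotient_ring R)"
    using x y c by (simp add: fr_add fr_closed nzd_mult)
  show "x \<oplus>\<^bsub>total_quotient_ring R\<^esub> y = y \<oplus>\<^bsub>total_quotient_ring R\<^esub> x"
    using x y c by (simp add: fr_add fr_eq_iff nzd_mult m_ac a_ac)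
next
  fix x y z assume "x \<in> carrier (total_quotient_ring R)" "y \<in> carrier (total_quotient_ring R)"
    "z \<in> carrier (total_quotient_ring R)"
  then obtain a s b t d u where x: "a \<in> carrier R" "s \<in> nzd" "x = fr a s"
    and y: "b \<in> carrier R" "t \<in> nzd" "y = fr b t"
    and z: "d \<in> carrier R" "u \<in> nzd" "z = fr d u" by (metis fr_cases)
  note c = x(1) y(1) z(1) nzd_closed[OF x(2)] nzd_closed[OF y(2)] nzd_closed[OF z(2)]
  show "x \<oplus>\<^bsub>total_quotient_ring R\<^esub> y \<oplus>\<^bsub>total_quotient_ring R\<^esub> z =
      x \<oplus>\<^bsub>total_quotient_ring R\<^esub> (y \<oplus>\<^bsub>total_quotient_ring R\<^esub> z)"
    using x y z c by (simp add: fr_add fr_eq_iff nzd_mult m_ac a_ac l_distr r_distr)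
next
  show "\<zero>\<^bsub>total_quotient_ring R\<^esub> \<in> carrier (total_quotient_ring R)"
    using nzd_one by (simp add: fr_zero fr_closed)
  fix x assume "x \<in> carrier (total_quotient_ring R)"
  then obtain a s where x: "a \<in> carrier R" "s \<in> nzd" "x = fr a s" by (metis fr_cases)
  then show "\<zero>\<^bsub>total_quotient_ring R\<^esub> \<oplus>\<^bsub>total_quotient_ring R\<^esub> x = x"
    by (simp add: fr_zero[of s] fr_add_same)
qed

lemma fr_pow:
  assumes "a \<in> carrier R" "s \<in> nzd"
  shows "fr a s [^]\<^bsub>total_quotient_ring R\<^esub> (n::nat) = fr (a [^] n) (s [^] n)"
proof (induction n)
  case 0
  then show ?case by (simp add: fr_one nat_pow_def)
next
  case (Suc n)
  have "fr a s [^]\<^bsub>total_quotient_ring R\<^esub> Suc n =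
      fr a s [^]\<^bsub>total_quotient_ring R\<^esub> n \<otimes>\<^bsub>total_quotient_ring R\<^esub> fr a s"
    by (simp add: nat_pow_def)
  then show ?case using Suc assms by (simp add: fr_mult nzd_pow)
qed

text \<open>Clearing denominators: the monic equation for a/s, brought to the denominator s^n,
  becomes an equation homogeneous in a and s over the ring itself, because s^n may be cancelled.
  Being integral over the ring thus turns into a divisibility question about a and s.\<close>

lemma integrally_closed_total_quotient_ring:
  assumes *: "\<And>a s (n::nat) C. \<lbrakk>a \<in> carrier R; s \<in> nzd; 0 < n; \<And>i. i < n \<Longrightarrow> C i \<in> carrier R;
      a [^] n \<oplus> (\<Oplus>i\<in>{..<n}. C i \<otimes> a [^] i \<otimes> s [^] (n - i)) = \<zero>\<rbrakk>
    \<Longrightarrow> \<exists>b\<in>carrier R. a = b \<otimes> s"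
  shows "integrally_closed_in (fraction_embedding R ` carrier R) (total_quotient_ring R)"
  unfolding integrally_closed_in_def
proof (intro ballI impI)
  interpret Q: abelian_monoid "total_quotient_ring R" by (rule abelian_monoid_total_quotient_ring)
  fix x assume "x \<in> carrier (total_quotient_ring R)"
    and int: "integral_over (fraction_embedding R ` carrier R) (total_quotient_ring R) x"
  then obtain a s where x: "a \<in> carrier R" "s \<in> nzd" "x = fr a s" by (metis fr_cases)
  have s: "s \<in> carrier R" using x nzd_closed by auto
  obtain n :: nat and c where n: "0 < n" and c: "\<forall>i<n. c i \<in> fraction_embedding R ` carrier R"
    and eq: "x [^]\<^bsub>total_quotient_ring R\<^esub> n \<oplus>\<^bsub>total_quotient_ring R\<^esub>
      (\<Oplus>\<^bsub>total_quotient_ring R\<^esub>i\<in>{..<n}. c i \<otimes>\<^bsub>total_quotient_ring R\<^esub> x [^]\<^bsub>total_quotient_ring R\<^esub> i) =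
      \<zero>\<^bsub>total_quotient_ring R\<^esub>"
    using int unfolding integral_over_def by blast
  have "\<forall>i\<in>{..<n}. \<exists>d. d \<in> carrier R \<and> c i = fr d \<one>"
    using c by (auto simp: fraction_embedding_def)
  from bchoice[OF this] obtain C where C: "\<And>i. i < n \<Longrightarrow> C i \<in> carrier R" "\<And>i. i < n \<Longrightarrow> c i = fr (C i) \<one>"
    by auto
  \<comment> \<open>The i-th term has denominator s^i; expanding by s^(n-i) gives all terms the
    common denominator s^n.\<close>
  have term_eq: "c i \<otimes>\<^bsub>total_quotient_ring R\<^esub> x [^]\<^bsub>total_quotient_ring R\<^esub> i =
      fr (C i \<otimes> a [^] i \<otimes> s [^] (n - i)) (s [^] n)" if i: "i < n" for i
  proof -
    have "s [^] n = s [^] (n - i) \<otimes> s [^] i"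
      using nat_pow_mult[OF s, of "n - i" i] i by simp
    then show ?thesis
      using C[OF i] x s nzd_pow[OF x(2)] nzd_mult[OF nzd_pow[OF x(2)] nzd_pow[OF x(2)], of i "n - i"]
      by (simp add: fr_pow fr_mult nzd_one fr_eq_iff m_ac)
  qed
  have sum_eq: "(\<Oplus>\<^bsub>total_quotient_ring R\<^esub>i\<in>{..<m}. c i \<otimes>\<^bsub>total_quotient_ring R\<^esub> x [^]\<^bsub>total_quotient_ring R\<^esub> i) =
      fr (\<Oplus>i\<in>{..<m}. C i \<otimes> a [^] i \<otimes> s [^] (n - i)) (s [^] n)" if "m \<le> n" for m
    using that
  proof (induction m)
    case 0
    then show ?case using fr_zero[OF nzd_pow[OF x(2)]] by simp
  next
    case (Suc m)
    have t: "C i \<otimes> a [^] i \<otimes> s [^] (n - i) \<in> carrier R" if "i < n" for i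
      using C that x s by simp
    have "(\<Oplus>\<^bsub>total_quotient_ring R\<^esub>i\<in>{..<Suc m}. c i \<otimes>\<^bsub>total_quotient_ring R\<^esub> x [^]\<^bsub>total_quotient_ring R\<^esub> i) =
       (c m \<otimes>\<^bsub>total_quotient_ring R\<^esub> x [^]\<^bsub>total_quotient_ring R\<^esub> m) \<oplus>\<^bsub>total_quotient_ring R\<^esub>
       (\<Oplus>\<^bsub>total_quotient_ring R\<^esub>i\<in>{..<m}. c i \<otimes>\<^bsub>total_quotient_ring R\<^esub> x [^]\<^bsub>total_quotient_ring R\<^esub> i)"
      unfolding lessThan_Suc
      by (rule Q.finsum_insert) (use Suc.prems t nzd_pow[OF x(2)] in \<open>auto simp: term_eq intro!: fr_closed\<close>)
    also have "\<dots> = fr (C m \<otimes> a [^] m \<otimes> s [^] (n - m)) (s [^] n) \<oplus>\<^bsub>total_quotient_ring R\<^esub>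
        fr (\<Oplus>i\<in>{..<m}. C i \<otimes> a [^] i \<otimes> s [^] (n - i)) (s [^] n)"
      using Suc by (simp add: term_eq)
    also have "\<dots> = fr (C m \<otimes> a [^] m \<otimes> s [^] (n - m) \<oplus> (\<Oplus>i\<in>{..<m}. C i \<otimes> a [^] i \<otimes> s [^] (n - i))) (s [^] n)"
      by (rule fr_add_same) (use Suc.prems t nzd_pow[OF x(2)] in \<open>auto intro!: finsum_closed\<close>)
    also have "C m \<otimes> a [^] m \<otimes> s [^] (n - m) \<oplus> (\<Oplus>i\<in>{..<m}. C i \<otimes> a [^] i \<otimes> s [^] (n - i)) =
        (\<Oplus>i\<in>{..<Suc m}. C i \<otimes> a [^] i \<otimes> s [^] (n - i))"
      unfolding lessThan_Suc
      by (rule finsum_insert[symmetric]) (use Suc.prems t in auto)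
    finally show ?case .
  qed
  have S: "(\<Oplus>i\<in>{..<n}. C i \<otimes> a [^] i \<otimes> s [^] (n - i)) \<in> carrier R"
    using C x s by (auto intro!: finsum_closed)
  have "fr (a [^] n \<oplus> (\<Oplus>i\<in>{..<n}. C i \<otimes> a [^] i \<otimes> s [^] (n - i))) (s [^] n) = fr \<zero> (s [^] n)"
  proof -
    have "fr (a [^] n \<oplus> (\<Oplus>i\<in>{..<n}. C i \<otimes> a [^] i \<otimes> s [^] (n - i))) (s [^] n) =
        fr (a [^] n) (s [^] n) \<oplus>\<^bsub>total_quotient_ring R\<^esub>
        fr (\<Oplus>i\<in>{..<n}. C i \<otimes> a [^] i \<otimes> s [^] (n - i)) (s [^] n)"
      using x S nzd_pow[OF x(2)] by (intro fr_add_same[symmetric]) auto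
    also have "\<dots> = \<zero>\<^bsub>total_quotient_ring R\<^esub>"
      using eq by (simp only: sum_eq[OF order_refl, symmetric] fr_pow[OF x(1,2), folded x(3), symmetric])
    finally show ?thesis using fr_zero[OF nzd_pow[OF x(2)]] by simp
  qed
  then have "(a [^] n \<oplus> (\<Oplus>i\<in>{..<n}. C i \<otimes> a [^] i \<otimes> s [^] (n - i))) \<otimes> s [^] n = \<zero> \<otimes> s [^] n"
    using x S s nzd_pow[OF x(2)] by (subst (asm) fr_eq_iff) auto
  then have "s [^] n \<otimes> (a [^] n \<oplus> (\<Oplus>i\<in>{..<n}. C i \<otimes> a [^] i \<otimes> s [^] (n - i))) = s [^] n \<otimes> \<zero>"
    using x S s by (simp add: m_comm)
  then have "a [^] n \<oplus> (\<Oplus>i\<in>{..<n}. C i \<otimes> a [^] i \<otimes> s [^] (n - i)) = \<zero>"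
    using nzd_cancel[OF nzd_pow[OF x(2)]] x S by auto
  then have "\<exists>b\<in>carrier R. a = b \<otimes> s"
    using C(1) by (intro *[of a s n C] x(1,2) n) auto
  then obtain b where b: "b \<in> carrier R" "a = b \<otimes> s" by auto
  then have "x = fraction_embedding R b"
    using x s by (simp add: fraction_embedding_def fr_eq_iff nzd_one)
  then show "x \<in> fraction_embedding R ` carrier R" using b by simp
qed

end

text \<open>\<^const>\<open>subsheaf_of_continuous\<close> says nothing about the ring structure of the sections.\<close>

definition ring_sheaf :: "'a function_space \<Rightarrow> bool" where
  "ring_sheaf X \<longleftrightarrow> (\<forall>U. openin (topo X) U \<longrightarrow>
     (\<forall>c. (\<lambda>_. c) \<in> sections X U) \<and>
     (\<forall>f\<in>sections X U. \<forall>g\<in>sections X U.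
        (\<lambda>x. f x + g x) \<in> sections X U \<and> (\<lambda>x. f x * g x) \<in> sections X U))"

section \<open>Rings of germs and a criterion for normality\<close>

locale germs =
  fixes X :: "'a function_space" and a :: 'a
  assumes sheaf: "subsheaf_of_continuous X" and ring: "ring_sheaf X" and a: "a \<in> points X"
begin

definition valid :: "'a set \<Rightarrow> ('a \<Rightarrow> complex) \<Rightarrow> bool" where
  "valid U f \<longleftrightarrow> openin (topo X) U \<and> a \<in> U \<and> f \<in> sections X U"

definition cls :: "'a set \<Rightarrow> ('a \<Rightarrow> complex) \<Rightarrow> ('a set \<times> ('a \<Rightarrow> complex)) set" where
  "cls U f = germ_rel X a `` {(U, f)}"

lemma germ_rel_iff:
  "((U, f), (V, g)) \<in> germ_rel X a \<longleftrightarrow> valid U f \<and> valid V g \<and>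
     (\<exists>W. openin (topo X) W \<and> a \<in> W \<and> W \<subseteq> U \<inter> V \<and> (\<forall>x\<in>W. f x = g x))"
  by (auto simp: germ_rel_def valid_def)

lemma equiv_germ_rel: "equiv {(U, f). valid U f} (germ_rel X a)"
proof (rule equivI)
  show "germ_rel X a \<subseteq> {(U, f). valid U f} \<times> {(U, f). valid U f}"
    by (auto simp: germ_rel_iff)
  show "refl_on {(U, f). valid U f} (germ_rel X a)"
    by (auto simp: refl_on_def germ_rel_iff valid_def)
  show "sym (germ_rel X a)"
  proof (rule symI, clarify)
    fix U f V g assume "((U, f), (V, g)) \<in> germ_rel X a"
    then obtain W where "valid U f" "valid V g" "openin (topo X) W" "a \<in> W" "W \<subseteq> U \<inter> V" "\<forall>x\<in>W. f x = g x"
      by (auto simp: germ_rel_iff)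
    then show "((V, g), (U, f)) \<in> germ_rel X a"
      by (auto simp: germ_rel_iff intro!: exI[of _ W])
  qed
  show "trans (germ_rel X a)"
  proof (rule transI, clarify)
    fix U f V g T h assume *: "((U, f), (V, g)) \<in> germ_rel X a" "((V, g), (T, h)) \<in> germ_rel X a"
    obtain W where W: "openin (topo X) W" "a \<in> W" "W \<subseteq> U \<inter> V" "\<forall>x\<in>W. f x = g x"
      using * by (auto simp: germ_rel_iff)
    obtain W' where W': "openin (topo X) W'" "a \<in> W'" "W' \<subseteq> V \<inter> T" "\<forall>x\<in>W'. g x = h x"
      using * by (auto simp: germ_rel_iff)
    show "((U, f), (T, h)) \<in> germ_rel X a"
      using * W W' by (auto simp: germ_rel_iff intro!: exI[of _ "W \<inter> W'"])
  qed
qed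

lemma cls_eq_iff:
  assumes "valid U f" "valid V g"
  shows "cls U f = cls V g \<longleftrightarrow>
    (\<exists>W. openin (topo X) W \<and> a \<in> W \<and> W \<subseteq> U \<inter> V \<and> (\<forall>x\<in>W. f x = g x))"
  using eq_equiv_class_iff[OF equiv_germ_rel, of "(U, f)" "(V, g)"] assms
  by (simp add: cls_def germ_rel_iff)

lemma cls_eqI:
  assumes "valid U f" "valid V g" "\<And>x. x \<in> U \<Longrightarrow> x \<in> V \<Longrightarrow> f x = g x"
  shows "cls U f = cls V g"
  using assms by (subst cls_eq_iff) (auto simp: valid_def intro!: exI[of _ "U \<inter> V"])

lemma carrier_germ_ring: "carrier (germ_ring X a) = {cls U f | U f. valid U f}"
  by (auto simp: germ_ring_def quotient_def cls_def valid_def)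

lemma cls_closed: "valid U f \<Longrightarrow> cls U f \<in> carrier (germ_ring X a)"
  by (auto simp: carrier_germ_ring)

lemma cls_cases:
  assumes "F \<in> carrier (germ_ring X a)"
  obtains U f where "valid U f" "F = cls U f"
  using assms by (auto simp: carrier_germ_ring)

lemma valid_Int:
  assumes "valid U f" "valid V g"
  shows "openin (topo X) (U \<inter> V)" "a \<in> U \<inter> V" "f \<in> sections X (U \<inter> V)" "g \<in> sections X (U \<inter> V)"
proof -
  show o: "openin (topo X) (U \<inter> V)" "a \<in> U \<inter> V"
    using assms by (auto simp: valid_def)
  show "f \<in> sections X (U \<inter> V)" "g \<in> sections X (U \<inter> V)"
    using sheaf_mono[OF sheaf _ o(1), of U f] sheaf_mono[OF sheaf _ o(1), of V g] assms
    by (simp_all add: valid_def)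
qed

lemma valid_add: "valid U f \<Longrightarrow> valid V g \<Longrightarrow> valid (U \<inter> V) (\<lambda>x. f x + g x)"
  using valid_Int[of U f V g] ring unfolding ring_sheaf_def by (simp add: valid_def)

lemma valid_mult: "valid U f \<Longrightarrow> valid V g \<Longrightarrow> valid (U \<inter> V) (\<lambda>x. f x * g x)"
  using valid_Int[of U f V g] ring unfolding ring_sheaf_def by (simp add: valid_def)

lemma valid_const: "valid (points X) (\<lambda>_. c)"
  using ring a unfolding ring_sheaf_def by (simp add: valid_def)

lemma valid_subset: "valid U f \<Longrightarrow> openin (topo X) V \<Longrightarrow> a \<in> V \<Longrightarrow> V \<subseteq> U \<Longrightarrow> valid V f"
  using sheaf_mono[OF sheaf, of U V f] by (simp add: valid_def)

lemma cls_subset: "valid U f \<Longrightarrow> openin (topo X) V \<Longrightarrow> a \<in> V \<Longrightarrow> V \<subseteq> U \<Longrightarrow> cls U f = cls V f"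
  using valid_subset by (intro cls_eqI) auto

text \<open>With the operation \<open>p\<close> as a parameter, independence of representatives is
  settled for sums and products of germs together.\<close>

lemma cls_UN2:
  assumes f: "valid U f" and g: "valid V g"
    and op: "\<And>U f V g. valid U f \<Longrightarrow> valid V g \<Longrightarrow> valid (U \<inter> V) (\<lambda>x. p (f x) (g x))"
  shows "(\<Union>(U', f')\<in>cls U f. \<Union>(V', g')\<in>cls V g. germ_rel X a `` {(U' \<inter> V', \<lambda>x. p (f' x) (g' x))}) =
    cls (U \<inter> V) (\<lambda>x. p (f x) (g x))"
proof -
  have *: "germ_rel X a `` {(U' \<inter> V', \<lambda>x. p (f' x) (g' x))} = cls (U \<inter> V) (\<lambda>x. p (f x) (g x))"
    if m: "(U', f') \<in> cls U f" "(V', g') \<in> cls V g" for U' f' V' g'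
  proof -
    obtain W where W: "openin (topo X) W" "a \<in> W" "W \<subseteq> U \<inter> U'" "\<forall>x\<in>W. f x = f' x" "valid U' f'"
      using m(1) unfolding cls_def Image_singleton_iff germ_rel_iff by blast
    obtain W' where W': "openin (topo X) W'" "a \<in> W'" "W' \<subseteq> V \<inter> V'" "\<forall>x\<in>W'. g x = g' x" "valid V' g'"
      using m(2) unfolding cls_def Image_singleton_iff germ_rel_iff by blast
    show ?thesis
      unfolding cls_def[symmetric]
      using W W' op[OF W(5) W'(5)] op[OF f g]
      by (subst cls_eq_iff) (auto intro!: exI[of _ "W \<inter> W'"])
  qed
  have mem: "(U, f) \<in> cls U f" "(V, g) \<in> cls V g"
    using f g by (auto simp: cls_def germ_rel_iff valid_def)
  show ?thesis
  proof (rule UN_const_class[OF mem(1)])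
    fix y assume y: "y \<in> cls U f"
    have "(\<Union>(V', g')\<in>cls V g. germ_rel X a `` {(fst y \<inter> V', \<lambda>x. p (snd y x) (g' x))}) =
        cls (U \<inter> V) (\<lambda>x. p (f x) (g x))"
      by (rule UN_const_class[OF mem(2)]) (use *[of "fst y" "snd y"] y in auto)
    then show "(case y of (U', f') \<Rightarrow> \<Union>(V', g')\<in>cls V g. germ_rel X a `` {(U' \<inter> V', \<lambda>x. p (f' x) (g' x))}) =
        cls (U \<inter> V) (\<lambda>x. p (f x) (g x))"
      by (simp add: case_prod_beta)
  qed
qed

lemma cls_mult:
  "valid U f \<Longrightarrow> valid V g \<Longrightarrow>
    cls U f \<otimes>\<^bsub>germ_ring X a\<^esub> cls V g = cls (U \<inter> V) (\<lambda>x. f x * g x)"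
  using cls_UN2[of U f V g "(*)"] valid_mult by (simp add: germ_ring_def)

lemma cls_add:
  "valid U f \<Longrightarrow> valid V g \<Longrightarrow>
    cls U f \<oplus>\<^bsub>germ_ring X a\<^esub> cls V g = cls (U \<inter> V) (\<lambda>x. f x + g x)"
  using cls_UN2[of U f V g "(+)"] valid_add by (simp add: germ_ring_def)

lemma cls_one: "\<one>\<^bsub>germ_ring X a\<^esub> = cls (points X) (\<lambda>_. 1)"
  and cls_zero: "\<zero>\<^bsub>germ_ring X a\<^esub> = cls (points X) (\<lambda>_. 0)"
  by (simp_all add: germ_ring_def cls_def)

lemma cring_germ_ring: "cring (germ_ring X a)"
proof (rule cringI)
  show "abelian_group (germ_ring X a)"
  proof (rule abelian_groupI)
    fix F G assume "F \<in> carrier (germ_ring X a)" "G \<in> carrier (germ_ring X a)"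
    then obtain U f V g where F: "valid U f" "F = cls U f" and G: "valid V g" "G = cls V g"
      by (metis cls_cases)
    show "F \<oplus>\<^bsub>germ_ring X a\<^esub> G \<in> carrier (germ_ring X a)"
      using F G valid_add by (simp add: cls_add cls_closed)
    show "F \<oplus>\<^bsub>germ_ring X a\<^esub> G = G \<oplus>\<^bsub>germ_ring X a\<^esub> F"
      using F G valid_add by (simp add: cls_add Int_commute add.commute)
  next
    fix F G H assume "F \<in> carrier (germ_ring X a)" "G \<in> carrier (germ_ring X a)" "H \<in> carrier (germ_ring X a)"
    then obtain U f V g W h where F: "valid U f" "F = cls U f" and G: "valid V g" "G = cls V g"
      and H: "valid W h" "H = cls W h"
      by (metis cls_cases)
    show "F \<oplus>\<^bsub>germ_ring X a\<^esub> G \<oplus>\<^bsub>germ_ring X a\<^esub> H = F \<oplus>\<^bsub>germ_ring X a\<^esub> (G \<oplus>\<^bsub>germ_ring X a\<^esub> H)"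
      using F G H valid_add by (simp add: cls_add Int_assoc add.assoc)
  next
    show "\<zero>\<^bsub>germ_ring X a\<^esub> \<in> carrier (germ_ring X a)"
      by (simp add: cls_zero cls_closed valid_const)
  next
    fix F assume "F \<in> carrier (germ_ring X a)"
    then obtain U f where F: "valid U f" "F = cls U f" by (metis cls_cases)
    \<comment> \<open>\<open>ring_sheaf\<close> grants constants, sums and products, so the additive
      inverse is obtained as a product with the constant -1.\<close>
    have m: "valid U (\<lambda>x. (-1) * f x)"
      using valid_subset[OF valid_mult[OF valid_const[of "-1"] F(1)], of U] F(1) openin_subset[of "topo X" U]
      by (auto simp: valid_def)
    show "\<zero>\<^bsub>germ_ring X a\<^esub> \<oplus>\<^bsub>germ_ring X a\<^esub> F = F"
      using F by (simp add: cls_zero cls_add valid_const)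
        (intro cls_eqI, use valid_add[OF valid_const[of 0] F(1)] in auto)
    show "\<exists>G\<in>carrier (germ_ring X a). G \<oplus>\<^bsub>germ_ring X a\<^esub> F = \<zero>\<^bsub>germ_ring X a\<^esub>"
    proof (rule bexI[OF _ cls_closed[OF m]])
      show "cls U (\<lambda>x. (-1) * f x) \<oplus>\<^bsub>germ_ring X a\<^esub> F = \<zero>\<^bsub>germ_ring X a\<^esub>"
        using cls_add[OF m F(1)] F(2) cls_eqI[OF valid_add[OF m F(1)] valid_const[of 0]]
        by (simp add: cls_zero)
    qed
  qed
  show "Group.comm_monoid (germ_ring X a)"
  proof (rule comm_monoidI)
    fix F G assume "F \<in> carrier (germ_ring X a)" "G \<in> carrier (germ_ring X a)"
    then obtain U f V g where F: "valid U f" "F = cls U f" and G: "valid V g" "G = cls V g"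
      by (metis cls_cases)
    show "F \<otimes>\<^bsub>germ_ring X a\<^esub> G \<in> carrier (germ_ring X a)"
      using F G valid_mult by (simp add: cls_mult cls_closed)
    show "F \<otimes>\<^bsub>germ_ring X a\<^esub> G = G \<otimes>\<^bsub>germ_ring X a\<^esub> F"
      using F G valid_mult by (simp add: cls_mult Int_commute mult.commute)
  next
    fix F G H assume "F \<in> carrier (germ_ring X a)" "G \<in> carrier (germ_ring X a)" "H \<in> carrier (germ_ring X a)"
    then obtain U f V g W h where F: "valid U f" "F = cls U f" and G: "valid V g" "G = cls V g"
      and H: "valid W h" "H = cls W h"
      by (metis cls_cases)
    show "F \<otimes>\<^bsub>germ_ring X a\<^esub> G \<otimes>\<^bsub>germ_ring X a\<^esub> H = F \<otimes>\<^bsub>germ_ring X a\<^esub> (G \<otimes>\<^bsub>germ_ring X a\<^esub> H)"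
      using F G H valid_mult by (simp add: cls_mult Int_assoc mult.assoc)
  next
    show "\<one>\<^bsub>germ_ring X a\<^esub> \<in> carrier (germ_ring X a)"
      by (simp add: cls_one cls_closed valid_const)
  next
    fix F assume "F \<in> carrier (germ_ring X a)"
    then obtain U f where F: "valid U f" "F = cls U f" by (metis cls_cases)
    show "\<one>\<^bsub>germ_ring X a\<^esub> \<otimes>\<^bsub>germ_ring X a\<^esub> F = F"
      using F by (simp add: cls_one cls_mult valid_const)
        (intro cls_eqI, use valid_mult[OF valid_const[of 1] F(1)] in auto)
  qed
  fix F G H assume "F \<in> carrier (germ_ring X a)" "G \<in> carrier (germ_ring X a)" "H \<in> carrier (germ_ring X a)"
  then obtain U f V g W h where F: "valid U f" "F = cls U f" and G: "valid V g" "G = cls V g"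
    and H: "valid W h" "H = cls W h"
    by (metis cls_cases)
  show "(F \<oplus>\<^bsub>germ_ring X a\<^esub> G) \<otimes>\<^bsub>germ_ring X a\<^esub> H =
      F \<otimes>\<^bsub>germ_ring X a\<^esub> H \<oplus>\<^bsub>germ_ring X a\<^esub> G \<otimes>\<^bsub>germ_ring X a\<^esub> H"
    unfolding F(2) G(2) H(2) cls_mult[OF F(1) H(1)] cls_mult[OF G(1) H(1)] cls_add[OF F(1) G(1)]
      cls_mult[OF valid_add[OF F(1) G(1)] H(1)] cls_add[OF valid_mult[OF F(1) H(1)] valid_mult[OF G(1) H(1)]]
    by (rule cls_eqI[OF valid_mult[OF valid_add[OF F(1) G(1)] H(1)]
          valid_add[OF valid_mult[OF F(1) H(1)] valid_mult[OF G(1) H(1)]]]) (simp add: distrib_right)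
qed

lemma cls_pow:
  assumes "valid U f"
  shows "valid U (\<lambda>x. f x ^ n)" and "cls U f [^]\<^bsub>germ_ring X a\<^esub> n = cls U (\<lambda>x. f x ^ n)"
proof -
  interpret R: cring "germ_ring X a" by (rule cring_germ_ring)
  have U: "openin (topo X) U" "a \<in> U" "U \<subseteq> points X"
    using assms openin_subset by (auto simp: valid_def)
  have "valid U (\<lambda>x. f x ^ n) \<and> cls U f [^]\<^bsub>germ_ring X a\<^esub> n = cls U (\<lambda>x. f x ^ n)"
  proof (induction n)
    case 0
    have "valid U (\<lambda>_. 1)" using valid_subset[OF valid_const U] .
    then show ?case
      using cls_subset[OF valid_const U, of 1] by (simp add: cls_one)
  next
    case (Suc n)
    then have "valid (U \<inter> U) (\<lambda>x. f x ^ n * f x)" using assms valid_mult by blast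
    then show ?case using Suc assms by (simp add: cls_mult mult.commute)
  qed
  then show "valid U (\<lambda>x. f x ^ n)" "cls U f [^]\<^bsub>germ_ring X a\<^esub> n = cls U (\<lambda>x. f x ^ n)" by auto
qed

text \<open>Translates normality into a statement about functions on one neighbourhood. Only
  finitely many germs occur in an integral equation, so they have representatives on a common open
  set, on which after shrinking the equation holds pointwise.\<close>

lemma normal_atI:
  assumes *: "\<And>U f s n c. \<lbrakk>valid U f; valid U s; 0 < n; \<And>i. i < n \<Longrightarrow> valid U (c i);
      \<And>W. openin (topo X) W \<Longrightarrow> a \<in> W \<Longrightarrow> W \<subseteq> U \<Longrightarrow> \<exists>x\<in>W. s x \<noteq> 0;
      \<And>x. x \<in> U \<Longrightarrow> f x ^ n + (\<Sum>i<n. c i x * f x ^ i * s x ^ (n - i)) = 0\<rbrakk>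
    \<Longrightarrow> \<exists>V b. valid V b \<and> V \<subseteq> U \<and> (\<forall>x\<in>V. f x = b x * s x)"
  shows "normal_at X a"
proof -
  interpret R: cring "germ_ring X a" by (rule cring_germ_ring)
  show ?thesis
    unfolding normal_at_def
  proof (rule R.integrally_closed_total_quotient_ring)
    fix F S n C
    assume F: "F \<in> carrier (germ_ring X a)" and S: "S \<in> non_zero_divisors (germ_ring X a)" and n: "0 < (n::nat)"
      and C: "\<And>i. i < n \<Longrightarrow> C i \<in> carrier (germ_ring X a)"
      and eq: "F [^]\<^bsub>germ_ring X a\<^esub> n \<oplus>\<^bsub>germ_ring X a\<^esub>
         (\<Oplus>\<^bsub>germ_ring X a\<^esub>i\<in>{..<n}. C i \<otimes>\<^bsub>germ_ring X a\<^esub> F [^]\<^bsub>germ_ring X a\<^esub> i \<otimes>\<^bsub>germ_ring X a\<^esub>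
            S [^]\<^bsub>germ_ring X a\<^esub> (n - i)) = \<zero>\<^bsub>germ_ring X a\<^esub>"
    obtain U1 f where f: "valid U1 f" "F = cls U1 f" using F by (metis cls_cases)
    obtain U2 s where s: "valid U2 s" "S = cls U2 s" using S R.nzd_closed by (metis cls_cases)
    have "\<forall>i\<in>{..<n}. \<exists>p. valid (fst p) (snd p) \<and> C i = cls (fst p) (snd p)"
    proof
      fix i assume "i \<in> {..<n}"
      then have "C i \<in> carrier (germ_ring X a)" using C by simp
      then obtain V g where "valid V g" "C i = cls V g" by (rule cls_cases)
      then show "\<exists>p. valid (fst p) (snd p) \<and> C i = cls (fst p) (snd p)"
        by (intro exI[of _ "(V, g)"]) simp
    qed
    from bchoice[OF this] obtain p where p: "\<And>i. i < n \<Longrightarrow> valid (fst (p i)) (snd (p i))"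
      "\<And>i. i < n \<Longrightarrow> C i = cls (fst (p i)) (snd (p i))" by auto
    define c where "c i = snd (p i)" for i
    \<comment> \<open>An intersection over a finite nonempty index set, hence open; nonemptiness is
      the positive degree of the equation.\<close>
    define U where "U = U1 \<inter> U2 \<inter> (\<Inter>i\<in>{..<n}. fst (p i))"
    have U: "openin (topo X) U" "a \<in> U"
    proof -
      have "openin (topo X) (\<Inter>i\<in>{..<n}. fst (p i))"
        using n p(1) by (intro openin_INT2) (auto simp: valid_def)
      then show "openin (topo X) U" using f s by (auto simp: U_def valid_def)
      show "a \<in> U" using f s p by (auto simp: U_def valid_def)
    qed
    have sub: "U \<subseteq> U1" "U \<subseteq> U2" "\<And>i. i < n \<Longrightarrow> U \<subseteq> fst (p i)" by (auto simp: U_def)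
    have vf: "valid U f" "F = cls U f" using valid_subset[OF f(1) U sub(1)] cls_subset[OF f(1) U sub(1)] f(2) by auto
    have vs: "valid U s" "S = cls U s" using valid_subset[OF s(1) U sub(2)] cls_subset[OF s(1) U sub(2)] s(2) by auto
    have vc: "valid U (c i)" "C i = cls U (c i)" if "i < n" for i
      using valid_subset[OF p(1)[OF that] U sub(3)[OF that]] cls_subset[OF p(1)[OF that] U sub(3)[OF that]]
        p(2)[OF that] by (auto simp: c_def)
    define t where "t i x = c i x * f x ^ i * s x ^ (n - i)" for i x
    have t: "valid U (t i)" "C i \<otimes>\<^bsub>germ_ring X a\<^esub> F [^]\<^bsub>germ_ring X a\<^esub> i \<otimes>\<^bsub>germ_ring X a\<^esub>
            S [^]\<^bsub>germ_ring X a\<^esub> (n - i) = cls U (t i)" if i: "i < n" for i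
    proof -
      have v: "valid U (\<lambda>x. c i x * f x ^ i)"
        using valid_mult[OF vc(1)[OF i] cls_pow(1)[OF vf(1), of i]] by simp
      show "valid U (t i)"
        using valid_mult[OF v cls_pow(1)[OF vs(1), of "n - i"]] by (simp add: t_def[abs_def])
      show "C i \<otimes>\<^bsub>germ_ring X a\<^esub> F [^]\<^bsub>germ_ring X a\<^esub> i \<otimes>\<^bsub>germ_ring X a\<^esub>
            S [^]\<^bsub>germ_ring X a\<^esub> (n - i) = cls U (t i)"
        using cls_mult[OF vc(1)[OF i] cls_pow(1)[OF vf(1), of i]] cls_mult[OF v cls_pow(1)[OF vs(1), of "n - i"]]
        by (simp add: vc(2)[OF i] vf(2) vs(2) cls_pow(2)[OF vf(1)] cls_pow(2)[OF vs(1)] t_def[abs_def])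
    qed
    have sum: "valid U (\<lambda>x. \<Sum>i<m. t i x) \<and>
       (\<Oplus>\<^bsub>germ_ring X a\<^esub>i\<in>{..<m}. C i \<otimes>\<^bsub>germ_ring X a\<^esub> F [^]\<^bsub>germ_ring X a\<^esub> i \<otimes>\<^bsub>germ_ring X a\<^esub>
            S [^]\<^bsub>germ_ring X a\<^esub> (n - i)) = cls U (\<lambda>x. \<Sum>i<m. t i x)" if "m \<le> n" for m
      using that
    proof (induction m)
      case 0
      have "U \<subseteq> points X" using U openin_subset by blast
      then show ?case
        using valid_subset[OF valid_const U, of 0] cls_subset[OF valid_const U, of 0] by (simp add: cls_zero)
    next
      case (Suc m)
      have "(\<Oplus>\<^bsub>germ_ring X a\<^esub>i\<in>{..<Suc m}. C i \<otimes>\<^bsub>germ_ring X a\<^esub> F [^]\<^bsub>germ_ring X a\<^esub> i \<otimes>\<^bsub>germ_ring X a\<^esub>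
            S [^]\<^bsub>germ_ring X a\<^esub> (n - i)) = C m \<otimes>\<^bsub>germ_ring X a\<^esub> F [^]\<^bsub>germ_ring X a\<^esub> m \<otimes>\<^bsub>germ_ring X a\<^esub>
            S [^]\<^bsub>germ_ring X a\<^esub> (n - m) \<oplus>\<^bsub>germ_ring X a\<^esub>
           (\<Oplus>\<^bsub>germ_ring X a\<^esub>i\<in>{..<m}. C i \<otimes>\<^bsub>germ_ring X a\<^esub> F [^]\<^bsub>germ_ring X a\<^esub> i \<otimes>\<^bsub>germ_ring X a\<^esub>
            S [^]\<^bsub>germ_ring X a\<^esub> (n - i))"
        unfolding lessThan_Suc
        by (rule R.finsum_insert) (use Suc.prems t cls_closed in auto)
      also have "\<dots> = cls (U \<inter> U) (\<lambda>x. t m x + (\<Sum>i<m. t i x))"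
        using Suc t[of m] by (simp add: cls_add)
      finally show ?case
        using valid_add[OF t(1)[of m], of U "\<lambda>x. \<Sum>i<m. t i x"] Suc by (simp add: add.commute)
    qed
    have e: "valid U (\<lambda>x. f x ^ n + (\<Sum>i<n. t i x))"
      using valid_add[OF cls_pow(1)[OF vf(1), of n], of U "\<lambda>x. \<Sum>i<n. t i x"] sum[of n] by simp
    have "cls U (\<lambda>x. f x ^ n + (\<Sum>i<n. t i x)) = cls (points X) (\<lambda>_. 0)"
      using eq cls_add[OF cls_pow(1)[OF vf(1), of n], of U "\<lambda>x. \<Sum>i<n. t i x"] sum[of n]
      by (simp add: vf(2) cls_pow(2)[OF vf(1)] cls_zero)
    then obtain V where V: "openin (topo X) V" "a \<in> V" "V \<subseteq> U" "\<forall>x\<in>V. f x ^ n + (\<Sum>i<n. t i x) = 0"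
      using e valid_const by (subst (asm) cls_eq_iff) auto
    \<comment> \<open>If \<open>s\<close> vanished near \<open>a\<close>, its germ would be zero and
      would annihilate 1. A non-zero-divisor then forces 1 = 0 in the germ ring, which is false at
      the point \<open>a\<close>.\<close>
    have "\<exists>x\<in>W. s x \<noteq> 0" if W: "openin (topo X) W" "a \<in> W" "W \<subseteq> V" for W
    proof (rule ccontr)
      assume "\<not> (\<exists>x\<in>W. s x \<noteq> 0)"
      then have "S = \<zero>\<^bsub>germ_ring X a\<^esub>"
        unfolding vs(2) cls_zero using vs(1) valid_const W V(3) openin_subset[OF W(1)]
        by (subst cls_eq_iff) (auto intro!: exI[of _ W])
      then have "S \<otimes>\<^bsub>germ_ring X a\<^esub> \<one>\<^bsub>germ_ring X a\<^esub> = \<zero>\<^bsub>germ_ring X a\<^esub>" by simp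
      then have "\<one>\<^bsub>germ_ring X a\<^esub> = \<zero>\<^bsub>germ_ring X a\<^esub>"
        using S unfolding non_zero_divisors_def by blast
      then show False
        unfolding cls_one cls_zero using valid_const by (subst (asm) cls_eq_iff) auto
    qed
    then have "\<exists>V' b. valid V' b \<and> V' \<subseteq> V \<and> (\<forall>x\<in>V'. f x = b x * s x)"
    proof (intro *[of V f s n c])
      show "valid V f" "valid V s" "\<And>i. i < n \<Longrightarrow> valid V (c i)"
        using valid_subset[OF vf(1) V(1-3)] valid_subset[OF vs(1) V(1-3)] valid_subset[OF vc(1) V(1-3)] by auto
      show "f x ^ n + (\<Sum>i<n. c i x * f x ^ i * s x ^ (n - i)) = 0" if "x \<in> V" for x
        using V(4) that by (simp add: t_def)
    qed (use n in auto)
    then obtain V' b where b: "valid V' b" "V' \<subseteq> V" "\<forall>x\<in>V'. f x = b x * s x" by blast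
    have "F = cls V' b \<otimes>\<^bsub>germ_ring X a\<^esub> S"
      unfolding vf(2) vs(2) cls_mult[OF b(1) vs(1)]
      by (rule cls_eqI[OF vf(1) valid_mult[OF b(1) vs(1)]]) (use b in auto)
    then show "\<exists>b\<in>carrier (germ_ring X a). F = b \<otimes>\<^bsub>germ_ring X a\<^esub> S"
      using cls_closed[OF b(1)] by blast
  qed
qed

end

section \<open>Two complex variables\<close>

text \<open>Identifies the product type, where norms, balls and compactness are at hand, with
  \<open>Cn 2\<close>.\<close>

definition pt :: "complex \<times> complex \<Rightarrow> nat \<Rightarrow> complex" where
  "pt p = (\<lambda>i. if i = 0 then fst p else if i = 1 then snd p else 0)"

lemma pt_simps [simp]: "pt p 0 = fst p" "pt p (Suc 0) = snd p" "pt p 1 = snd p" "i \<ge> 2 \<Longrightarrow> pt p i = 0"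
  by (auto simp: pt_def)

lemma pt_in_Cn [simp]: "pt p \<in> Cn 2"
  by (simp add: Cn_def)

lemma pt_collapse: "z \<in> Cn 2 \<Longrightarrow> pt (z 0, z 1) = z"
proof
  fix i assume z: "z \<in> Cn 2"
  show "pt (z 0, z 1) i = z i"
  proof (cases "i \<ge> 2")
    case False
    then have "i = 0 \<or> i = 1" by auto
    then show ?thesis by (auto simp: pt_def)
  qed (use z in \<open>simp add: Cn_def\<close>)
qed

lemma continuous_on_pt: "continuous_on UNIV pt"
proof (rule continuous_on_coordinatewise_then_product)
  fix i :: nat
  consider "i = 0" | "i = 1" | "i \<ge> 2" by linarith
  then show "continuous_on UNIV (\<lambda>p. pt p i)"
    by cases (auto intro!: continuous_intros)
qed

lemma open_vimage_pt:
  assumes "open_Cn 2 W"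
  shows "open (pt -` W)"
proof -
  obtain T where T: "open T" "W = Cn 2 \<inter> T" using assms by (metis openin_open)
  then have "pt -` W = pt -` T" by auto
  then show ?thesis using T(1) open_vimage[OF _ continuous_on_pt] by simp
qed

text \<open>Cauchy's formula written as an integral over the unit interval, so that it can be read
  as a parameter integral; at the centre it is the mean value property.\<close>

lemma Cauchy_mean:
  assumes "continuous_on (cball a r) f" "f holomorphic_on ball a r" "norm (w - a) < r"
  shows "((\<lambda>s. f (a + r * exp (2 * of_real pi * \<i> * of_real s)) * (r * exp (2 * of_real pi * \<i> * of_real s)) /
      (a + r * exp (2 * of_real pi * \<i> * of_real s) - w)) has_integral f w) {0..1::real}"
proof -
  let ?\<gamma> = "\<lambda>s::real. a + r * exp (2 * of_real pi * \<i> * of_real s)"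
  have "((\<lambda>s. f (?\<gamma> s) / (?\<gamma> s - w) * (2 * pi * \<i> * r * exp (2 * of_real pi * \<i> * s))) has_integral
      (2 * of_real pi * \<i> * f w)) {0..1::real}"
    using Cauchy_integral_circlepath[OF assms]
    unfolding has_contour_integral_def
    by (rule has_integral_eq[rotated]) (simp add: vector_derivative_circlepath01; simp add: circlepath)
  from has_integral_mult_right[OF this, of "1 / (2 * of_real pi * \<i>)"]
  show ?thesis
    by (simp add: mult_ac)
qed

text \<open>Subtracting the mean value at \<open>a\<close> from Cauchy's formula at \<open>w\<close>
  leaves the kernel (\<gamma> - a)/(\<gamma> - w) - 1 = (w - a)/(\<gamma> - w). The factor w - a
  comes out and the remaining integral is an explicit slope.\<close>

lemma circle_slope:
  assumes "continuous_on (cball a r) f" "f holomorphic_on ball a r" "norm (w - a) < r"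
  shows "f w = f a + (w - a) * integral {0..1::real} (\<lambda>s. f (a + r * exp (2 * of_real pi * \<i> * of_real s)) /
      (a + r * exp (2 * of_real pi * \<i> * of_real s) - w))"
proof -
  let ?\<gamma> = "\<lambda>s::real. a + r * exp (2 * of_real pi * \<i> * of_real s)"
  have r: "r > 0" using assms(3) norm_ge_zero[of "w - a"] by linarith
  have ne: "?\<gamma> s - w \<noteq> 0" for s
  proof
    assume "?\<gamma> s - w = 0"
    then have "w - a = r * exp (2 * of_real pi * \<i> * of_real s)" by (simp add: algebra_simps)
    then have "norm (w - a) = r" using r by (simp add: norm_mult norm_exp_eq_Re)
    then show False using assms(3) by simp
  qed
  have "continuous_on {0..1} (\<lambda>s. f (?\<gamma> s) / (?\<gamma> s - w))"
    by (intro continuous_intros continuous_on_compose2[OF assms(1)])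
      (use ne r in \<open>auto simp: dist_norm norm_mult norm_exp_eq_Re\<close>)
  then have int: "(\<lambda>s. f (?\<gamma> s) / (?\<gamma> s - w)) integrable_on {0..1}"
    by (rule integrable_continuous_interval)
  have "((\<lambda>s. f (?\<gamma> s) * (r * exp (2 * of_real pi * \<i> * of_real s)) / (?\<gamma> s - a)) has_integral f a) {0..1}"
    using Cauchy_mean[OF assms(1,2), of a] r by simp
  then have "((\<lambda>s. f (?\<gamma> s)) has_integral f a) {0..1}"
    using r by simp
  from has_integral_diff[OF Cauchy_mean[OF assms] this]
  have "((\<lambda>s. (w - a) * (f (?\<gamma> s) / (?\<gamma> s - w))) has_integral f w - f a) {0..1}"
    by (rule has_integral_eq[rotated]) (use ne in \<open>simp add: field_simps\<close>)
  then have "integral {0..1} (\<lambda>s. (w - a) * (f (?\<gamma> s) / (?\<gamma> s - w))) = f w - f a"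
    by (rule integral_unique)
  moreover have "integral {0..1} (\<lambda>s. (w - a) * (f (?\<gamma> s) / (?\<gamma> s - w))) =
      (w - a) * integral {0..1} (\<lambda>s. f (?\<gamma> s) / (?\<gamma> s - w))"
    by (rule integral_mult_right)
  ultimately have "f w - f a = (w - a) * integral {0..1} (\<lambda>s. f (?\<gamma> s) / (?\<gamma> s - w))"
    by simp
  then show ?thesis by (metis add.commute diff_add_cancel)
qed

lemma integral_continuous_on_param01:
  fixes f :: "'a::topological_space \<Rightarrow> real \<Rightarrow> complex"
  assumes "continuous_on (U \<times> {0..1}) (\<lambda>(x, t). f x t)"
  shows "continuous_on U (\<lambda>x. integral {0..1} (f x))"
  using integral_continuous_on_param[of U 0 1 f, unfolded cbox_interval, OF assms] .

text \<open>
  A parameter integral of separately holomorphic functions is holomorphic: by \<open>circle_slope\<close> the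
  difference quotients in each variable are themselves parameter integrals, hence continuous.
\<close>

lemma holo_at_integral:
  fixes H :: "complex \<Rightarrow> complex \<Rightarrow> real \<Rightarrow> complex"
  assumes \<rho>: "\<rho> > 0"
    and cont: "continuous_on (cball a0 \<rho> \<times> cball a1 \<rho> \<times> {0..1}) (\<lambda>(x, y, t). H x y t)"
    and h0: "\<And>y t. y \<in> cball a1 \<rho> \<Longrightarrow> t \<in> {0..1} \<Longrightarrow> (\<lambda>x. H x y t) holomorphic_on ball a0 \<rho>"
    and h1: "\<And>x t. x \<in> cball a0 \<rho> \<Longrightarrow> t \<in> {0..1} \<Longrightarrow> (\<lambda>y. H x y t) holomorphic_on ball a1 \<rho>"
  shows "holo_at 2 (\<lambda>z. integral {0..1} (H (z 0) (z 1))) (pt (a0, a1))"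
proof -
  let ?\<gamma>0 = "\<lambda>s::real. a0 + \<rho> * exp (2 * of_real pi * \<i> * of_real s)"
  let ?\<gamma>1 = "\<lambda>s::real. a1 + \<rho> * exp (2 * of_real pi * \<i> * of_real s)"
  have \<gamma>: "?\<gamma>0 s \<in> cball a0 \<rho>" "?\<gamma>1 s \<in> cball a1 \<rho>" "dist a0 (?\<gamma>0 s) = \<rho>" "dist a1 (?\<gamma>1 s) = \<rho>" for s
    using \<rho> by (simp_all add: dist_norm norm_mult norm_exp_eq_Re)
  have cont': "continuous_on (cball a0 \<rho> \<times> cball a1 \<rho> \<times> {0..1}) (\<lambda>p. H (fst p) (fst (snd p)) (snd (snd p)))"
    using cont by (simp add: case_prod_unfold)
  have contH: "continuous_on S (\<lambda>q. H (u q) (v q) (t q))"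
    if "continuous_on S u" "continuous_on S v" "continuous_on S t"
      "\<And>q. q \<in> S \<Longrightarrow> u q \<in> cball a0 \<rho>" "\<And>q. q \<in> S \<Longrightarrow> v q \<in> cball a1 \<rho>" "\<And>q. q \<in> S \<Longrightarrow> t q \<in> {0..1}"
    for S :: "'b::topological_space set" and u v t
  proof -
    have "continuous_on S (\<lambda>q. (\<lambda>p. H (fst p) (fst (snd p)) (snd (snd p))) (u q, v q, t q))"
      by (rule continuous_on_compose2[OF cont']) (use that in \<open>auto intro!: continuous_intros\<close>)
    then show ?thesis by simp
  qed
  let ?B = "ball a0 \<rho> \<times> ball a1 \<rho>"
  \<comment> \<open>Slopes along the staircase from (a0, a1) through (a0, y) to (x, y):
    \<open>Q0\<close> moves the first variable with the second held at y, \<open>Q1\<close> moves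
    the second with the first frozen at a0.\<close>
  define Q0 where "Q0 p t = integral {0..1} (\<lambda>s. H (?\<gamma>0 s) (snd p) t / (?\<gamma>0 s - fst p))" for p t
  define Q1 where "Q1 p t = integral {0..1} (\<lambda>s. H a0 (?\<gamma>1 s) t / (?\<gamma>1 s - snd p))" for p :: "complex \<times> complex" and t
  have ne0: "?\<gamma>0 s - fst p \<noteq> 0" if "p \<in> ?B" for s p
    using \<gamma>(3)[of s] that by (cases p) auto
  have ne1: "?\<gamma>1 s - snd p \<noteq> 0" if "p \<in> ?B" for s p
    using \<gamma>(4)[of s] that by (cases p) auto
  have cQ0: "continuous_on (?B \<times> {0..1}) (\<lambda>(p, t). Q0 p t)"
    unfolding Q0_def case_prod_unfold
    by (rule integral_continuous_on_param01, unfold case_prod_unfold)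
      (intro continuous_intros contH; use \<gamma> ne0 in \<open>force simp: mem_Times_iff\<close>)
  have cQ1: "continuous_on (?B \<times> {0..1}) (\<lambda>(p, t). Q1 p t)"
    unfolding Q1_def case_prod_unfold
    by (rule integral_continuous_on_param01, unfold case_prod_unfold)
      (intro continuous_intros contH; use \<gamma> ne1 \<rho> in \<open>force simp: mem_Times_iff\<close>)
  define q where "q i z = (if i = (0::nat) then integral {0..1} (Q0 (z 0, z 1)) else integral {0..1} (Q1 (z 0, z 1)))"
    for i and z :: "nat \<Rightarrow> complex"
  have oB: "open ?B" by (intro open_Times open_ball)
  have aB: "(a0, a1) \<in> ?B" using \<rho> by simp
  have coord: "isCont (\<lambda>z::nat \<Rightarrow> complex. (z 0, z 1)) z" for z
  proof -
    have "isCont (\<lambda>z::nat \<Rightarrow> complex. z i) z" for i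
    proof -
      have "continuous_on UNIV (\<lambda>z::nat \<Rightarrow> complex. z i)" by simp
      with continuous_on_eq_continuous_at[OF open_UNIV, of "\<lambda>z::nat \<Rightarrow> complex. z i"]
      show ?thesis by blast
    qed
    then show ?thesis by (intro continuous_intros)
  qed
  have cq: "isCont (q i) (pt (a0, a1))" for i
  proof -
    have "isCont (\<lambda>p. integral {0..1} (Q0 p)) (a0, a1)" "isCont (\<lambda>p. integral {0..1} (Q1 p)) (a0, a1)"
      using integral_continuous_on_param01[OF cQ0] integral_continuous_on_param01[OF cQ1] oB aB
      by (auto simp: continuous_on_eq_continuous_at)
    then show ?thesis
      using isCont_o2[OF coord, of "pt (a0, a1)" "\<lambda>p. integral {0..1} (Q0 p)"]
        isCont_o2[OF coord, of "pt (a0, a1)" "\<lambda>p. integral {0..1} (Q1 p)"]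
      by (cases "i = 0") (simp_all add: q_def[abs_def])
  qed
  have inB: "\<forall>\<^sub>F z in nhds (pt (a0, a1)). (z 0, z 1) \<in> ?B"
    using topological_tendstoD[OF iffD1[OF tendsto_at_iff_tendsto_nhds coord[of "pt (a0, a1)", unfolded isCont_def]] oB] aB
    by simp
  have c01: "continuous_on {0..1} (H x y)" if "x \<in> cball a0 \<rho>" "y \<in> cball a1 \<rho>" for x y
    by (rule contH) (use that in \<open>auto intro!: continuous_intros\<close>)
  have main: "integral {0..1} (H x y) = integral {0..1} (H a0 a1) + (x - a0) * integral {0..1} (Q0 (x, y)) +
      (y - a1) * integral {0..1} (Q1 (x, y))" if xy: "(x, y) \<in> ?B" for x y
  proof -
    have eq: "H x y t = H a0 a1 t + (x - a0) * Q0 (x, y) t + (y - a1) * Q1 (x, y) t" if t: "t \<in> {0..1}" for t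
    proof -
      have "H x y t = H a0 y t + (x - a0) * Q0 (x, y) t"
        unfolding Q0_def fst_conv snd_conv
        by (rule circle_slope[where f="\<lambda>x. H x y t"])
          (use xy t h0 in \<open>auto simp: dist_norm norm_minus_commute intro!: contH continuous_intros\<close>)
      moreover have "H a0 y t = H a0 a1 t + (y - a1) * Q1 (x, y) t"
        unfolding Q1_def fst_conv snd_conv
        by (rule circle_slope[where f="\<lambda>y. H a0 y t"])
          (use xy t h1 \<rho> in \<open>auto simp: dist_norm norm_minus_commute intro!: contH continuous_intros\<close>)
      ultimately show ?thesis by simp
    qed
    have ic: "continuous_on {0..1} (Q0 (x, y))" "continuous_on {0..1} (Q1 (x, y))"
    proof -
      have c: "continuous_on {0..1::real} (\<lambda>t. ((x, y), t))" by (intro continuous_intros)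
      have i: "(\<lambda>t. ((x, y), t)) ` {0..1} \<subseteq> ?B \<times> {0..1}" using xy by auto
      show "continuous_on {0..1} (Q0 (x, y))" "continuous_on {0..1} (Q1 (x, y))"
        using continuous_on_compose2[OF cQ0 c i] continuous_on_compose2[OF cQ1 c i] by simp_all
    qed
    have "integral {0..1} (H x y) =
        integral {0..1} (\<lambda>t. (H a0 a1 t + (x - a0) * Q0 (x, y) t) + (y - a1) * Q1 (x, y) t)"
      using eq by (intro integral_cong) auto
    also have "\<dots> = integral {0..1} (\<lambda>t. H a0 a1 t + (x - a0) * Q0 (x, y) t) +
        integral {0..1} (\<lambda>t. (y - a1) * Q1 (x, y) t)"
      by (intro integral_add integrable_continuous_interval continuous_intros ic c01) (use \<rho> in auto)
    also have "integral {0..1} (\<lambda>t. H a0 a1 t + (x - a0) * Q0 (x, y) t) =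
        integral {0..1} (H a0 a1) + integral {0..1} (\<lambda>t. (x - a0) * Q0 (x, y) t)"
      by (intro integral_add integrable_continuous_interval continuous_intros ic c01) (use \<rho> in auto)
    finally show ?thesis by simp
  qed
  show ?thesis
    unfolding holo_at_def
  proof (intro exI[of _ q] conjI allI impI)
    show "continuous (at (pt (a0, a1)) within Cn 2) (q i)" for i
      using cq continuous_at_imp_continuous_at_within by blast
    show "\<forall>\<^sub>F w in nhds (pt (a0, a1)). w \<in> Cn 2 \<longrightarrow> integral {0..1} (H (w 0) (w 1)) =
        integral {0..1} (H (pt (a0, a1) 0) (pt (a0, a1) 1)) + (\<Sum>i<2. q i w * (w i - pt (a0, a1) i))"
      using inB
    proof eventually_elim
      case (elim w)
      then show ?case using main[of "w 0" "w 1"]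
        by (simp add: q_def eval_nat_numeral mult.commute)
    qed
  qed
qed

text \<open>Since \<open>g\<close> is not identically zero on a connected set, its zeros are
  isolated; the quotient is bounded near each of them, so Riemann's theorem extends it. The
  extension is written down directly by taking the limit at the zeros.\<close>

lemma holomorphic_divide_of_bounded:
  fixes f g :: "complex \<Rightarrow> complex"
  assumes f: "f holomorphic_on S" and g: "g holomorphic_on S" and S: "open S" "connected S"
    and bd: "\<And>z. z \<in> S \<Longrightarrow> norm (f z) \<le> M * norm (g z)" and ex: "\<beta> \<in> S" "g \<beta> \<noteq> 0"
  shows "\<exists>k. k holomorphic_on S \<and> (\<forall>z\<in>S. f z = k z * g z)"
proof -
  define k where "k z = (if g z = 0 then Lim (at z) (\<lambda>w. f w / g w) else f z / g z)" for z
  have "k field_differentiable at z" if z: "z \<in> S" for z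
  proof (cases "g z = 0")
    case False
    have "continuous_on S g" using g holomorphic_on_imp_continuous_on by blast
    then have op: "open {w \<in> S. g w \<noteq> 0}"
    proof -
      have "{w \<in> S. g w \<noteq> 0} = S \<inter> g -` (-{0})" by auto
      then show ?thesis using \<open>continuous_on S g\<close> S(1) by (simp add: continuous_open_preimage open_Compl)
    qed
    have "(\<lambda>w. f w / g w) field_differentiable at z"
      using f g z S False by (intro derivative_intros) (auto simp: holomorphic_on_imp_differentiable_at)
    moreover have "\<forall>\<^sub>F w in nhds z. f w / g w = k w"
      using eventually_nhds_in_open[OF op, of z] z False by (auto simp: k_def elim!: eventually_mono)
    ultimately show ?thesis
      unfolding field_differentiable_def by (metis DERIV_cong_ev)
  next
    case True
    obtain r where r: "0 < r" "ball z r \<subseteq> S" "\<And>w. w \<in> ball z r - {z} \<Longrightarrow> g w \<noteq> 0"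
      using isolated_zeros[OF g S z True ex] by metis
    have hol: "(\<lambda>w. f w / g w) holomorphic_on (ball z r - {z})"
      using r(2,3) by (intro holomorphic_intros) (auto intro: holomorphic_on_subset[OF f] holomorphic_on_subset[OF g])
    have "\<forall>\<^sub>F w in at z. w \<in> ball z r - {z}"
      using eventually_at_in_open[of "ball z r" z] r(1) by simp
    then have "\<forall>\<^sub>F w in at z. norm (f w / g w) \<le> M"
    proof eventually_elim
      case (elim w)
      then show ?case using bd[of w] r(2) r(3)[of w] by (auto simp: norm_divide divide_le_eq)
    qed
    then obtain h where h: "h holomorphic_on ball z r" "\<And>w. w \<in> ball z r - {z} \<Longrightarrow> h w = f w / g w"
      using holomorphic_on_extend_bounded[OF hol] r(1) by auto
    have "isCont h z"
      using h(1) r(1) by (meson centre_in_ball continuous_on_eq_continuous_at holomorphic_on_imp_continuous_on open_ball)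
    then have "(h \<longlongrightarrow> h z) (at z)" by (simp add: isCont_def)
    then have "((\<lambda>w. f w / g w) \<longlongrightarrow> h z) (at z)"
    proof (rule Lim_transform_eventually)
      show "\<forall>\<^sub>F w in at z. h w = f w / g w"
        using eventually_at_in_open[of "ball z r" z] r(1) h(2) by (auto elim!: eventually_mono)
    qed
    then have "Lim (at z) (\<lambda>w. f w / g w) = h z"
      by (intro tendsto_Lim) auto
    then have kh: "k w = h w" if "w \<in> ball z r" for w
      using True h(2)[of w] r(3)[of w] that by (cases "w = z") (auto simp: k_def)
    have "h field_differentiable at z"
      using h(1) r(1) by (simp add: holomorphic_on_imp_differentiable_at)
    moreover have "\<forall>\<^sub>F w in nhds z. h w = k w"
      using eventually_nhds_in_open[of "ball z r" z] r(1) kh by (auto elim!: eventually_mono)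
    ultimately show ?thesis
      unfolding field_differentiable_def by (metis DERIV_cong_ev)
  qed
  then have "k holomorphic_on S"
    using field_differentiable_at_within unfolding holomorphic_on_def by blast
  \<comment> \<open>At a zero of \<open>g\<close> the bound gives \<open>f z = 0\<close> as
    well.\<close>
  moreover have "f z = k z * g z" if "z \<in> S" for z
    using bd[OF that] by (cases "g z = 0") (auto simp: k_def)
  ultimately show ?thesis by blast
qed

lemma field_differentiable_pt_line:
  assumes "holo_at 2 F (pt (p + (\<zeta> * v0, \<zeta> * v1)))"
  shows "(\<lambda>\<zeta>. F (pt (p + (\<zeta> * v0, \<zeta> * v1)))) field_differentiable at \<zeta>"
proof (rule field_differentiable_compose_holo_at[where n=2 and G=F and f="\<lambda>\<zeta>. pt (p + (\<zeta> * v0, \<zeta> * v1))"])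
  show "(\<lambda>w. pt (p + (w * v0, w * v1)) j) field_differentiable at \<zeta>" if "j < 2" for j
  proof -
    have "j = 0 \<or> j = 1" using that by auto
    then show ?thesis by (auto intro!: derivative_intros)
  qed
qed (use assms in auto)

text \<open>Pick a complex line through the point on which \<open>g\<close> does not vanish
  identically, and on it a small circle free of zeros of \<open>g\<close>. The parallel circles
  around nearby centres are free of zeros too. On each of their discs f/g extends, with centre value
  the mean over the circle; that mean is a parameter integral of functions holomorphic in the
  centre, hence holomorphic.\<close>

lemma exists_holomorphic_quotient:
  assumes f: "holomorphic_Cn 2 W f" and g: "holomorphic_Cn 2 W g" and a: "a \<in> W"
    and bd: "\<And>z. z \<in> W \<Longrightarrow> norm (f z) \<le> M * norm (g z)"
    and nz: "\<And>T. open_Cn 2 T \<Longrightarrow> a \<in> T \<Longrightarrow> T \<subseteq> W \<Longrightarrow> \<exists>z\<in>T. g z \<noteq> 0"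
  shows "\<exists>W' b. a \<in> W' \<and> W' \<subseteq> W \<and> holomorphic_Cn 2 W' b \<and> (\<forall>z\<in>W'. f z = b z * g z)"
proof -
  have W: "open_Cn 2 W" using f by (simp add: holomorphic_Cn_iff)
  have WC: "W \<subseteq> Cn 2" using W by (rule open_Cn_subset)
  define p where "p = (a 0, a 1)"
  have ap: "pt p = a" unfolding p_def using a WC pt_collapse by blast
  obtain \<epsilon> where \<epsilon>: "\<epsilon> > 0" "ball p \<epsilon> \<subseteq> pt -` W"
    using open_vimage_pt[OF W] a ap by (metis open_contains_ball vimageI2)
  have opC: "open_Cn 2 (pt ` ball p d)" if "d > 0" for d
  proof -
    have "pt ` ball p d = Cn 2 \<inter> (\<lambda>z. (z 0, z 1)) -` ball p d"
    proof (rule subset_antisym; rule subsetI)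
      fix z assume z: "z \<in> Cn 2 \<inter> (\<lambda>z. (z 0, z 1)) -` ball p d"
      show "z \<in> pt ` ball p d"
        by (rule image_eqI[of _ _ "(z 0, z 1)"]) (use z pt_collapse[of z] in auto)
    next
      fix z assume "z \<in> pt ` ball p d"
      then obtain x where "x \<in> ball p d" "z = pt x" by blast
      then show "z \<in> Cn 2 \<inter> (\<lambda>z. (z 0, z 1)) -` ball p d" by simp
    qed
    moreover have "open ((\<lambda>z::nat \<Rightarrow> complex. (z 0, z 1)) -` ball p d)"
      by (intro open_vimage open_ball continuous_intros continuous_on_product_coordinates)
    ultimately show ?thesis by (simp add: openin_open_Int)
  qed
  have "\<exists>z\<in>pt ` ball p (\<epsilon> / 2). g z \<noteq> 0"
  proof (rule nz[OF opC])
    have "ball p (\<epsilon> / 2) \<subseteq> ball p \<epsilon>" using \<epsilon>(1) by (intro subset_ball) simp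
    then show "pt ` ball p (\<epsilon> / 2) \<subseteq> W" using \<epsilon>(2) by blast
  qed (use \<epsilon> ap in auto)
  \<comment> \<open>\<open>P\<close> only provides the direction of the line: \<open>g\<close> does
    not vanish at \<open>P\<close>, so not identically on the line from \<open>p\<close> to
    \<open>P\<close>.\<close>
  then obtain P where P: "dist p P < \<epsilon> / 2" "g (pt P) \<noteq> 0" by auto
  define v where "v = P - p"
  have nv: "norm v < \<epsilon> / 2" using P by (simp add: v_def dist_norm norm_minus_commute)
  define L where "L x \<zeta> = x + (\<zeta> * fst v, \<zeta> * snd v)" for x and \<zeta> :: complex
  have normL: "dist x (L x \<zeta>) = norm \<zeta> * norm v" for x \<zeta>
  proof -
    have "norm (\<zeta> * fst v, \<zeta> * snd v) = norm \<zeta> * norm v"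
      by (simp add: norm_prod_def norm_mult power_mult_distrib real_sqrt_mult distrib_left[symmetric])
    moreover have "x - L x \<zeta> = - (\<zeta> * fst v, \<zeta> * snd v)" by (simp add: L_def)
    ultimately show ?thesis by (simp only: dist_norm norm_minus_cancel)
  qed
  have Lin: "L x \<zeta> \<in> ball p \<epsilon>" if "x \<in> ball p (\<epsilon> / 2)" "norm \<zeta> \<le> 1" for x \<zeta>
  proof -
    have "norm \<zeta> * norm v \<le> norm v" using that(2) by (simp add: mult_left_le_one_le)
    then show ?thesis
      using that(1) nv normL[of x \<zeta>] dist_triangle[of p "L x \<zeta>" x] by (simp)
  qed
  have diffL: "(\<lambda>\<zeta>. F (pt (L x \<zeta>))) field_differentiable at \<zeta>"
    if "holomorphic_Cn 2 W F" "L x \<zeta> \<in> ball p \<epsilon>" for F x \<zeta>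
    using that \<epsilon> field_differentiable_pt_line[of F x \<zeta> "fst v" "snd v"]
    by (auto simp: L_def holomorphic_Cn_iff)
  have holL: "(\<lambda>\<zeta>. F (pt (L x \<zeta>))) holomorphic_on ball 0 1"
    if "holomorphic_Cn 2 W F" "x \<in> ball p (\<epsilon> / 2)" for F x
    unfolding holomorphic_on_def
  proof (rule ballI, rule field_differentiable_at_within)
    fix \<zeta> :: complex assume "\<zeta> \<in> ball 0 1"
    then show "(\<lambda>\<zeta>. F (pt (L x \<zeta>))) field_differentiable at \<zeta>"
      by (intro diffL[OF that(1)] Lin[OF that(2)]) simp
  qed
  \<comment> \<open>Radius 2 puts both \<zeta> = 0 and the point \<open>P\<close> at \<zeta> = 1
    into the domain, so that the zeros of \<open>g\<close> on the line are isolated. This is why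
    \<open>P\<close> was taken at distance less than \<epsilon>/2.\<close>
  have holL2: "(\<lambda>\<zeta>. g (pt (L p \<zeta>))) holomorphic_on ball 0 2"
    unfolding holomorphic_on_def
  proof (rule ballI, rule field_differentiable_at_within, rule diffL[OF g])
    fix \<zeta> :: complex assume "\<zeta> \<in> ball 0 2"
    then have "norm \<zeta> * norm v \<le> 2 * norm v" by (intro mult_right_mono) auto
    then show "L p \<zeta> \<in> ball p \<epsilon>" using nv normL[of p \<zeta>] by simp
  qed
  have L1: "L p 1 = P" by (simp add: L_def v_def prod_eq_iff)
  obtain r where r: "0 < r" "r < 1" "\<And>\<zeta>. norm \<zeta> = r \<Longrightarrow> g (pt (L p \<zeta>)) \<noteq> 0"
  proof (cases "g (pt (L p 0)) = 0")
    case True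
    obtain r where r: "0 < r" "\<And>z. z \<in> ball 0 r - {0} \<Longrightarrow> g (pt (L p z)) \<noteq> 0"
    proof -
      have "(0::complex) \<in> ball 0 2" "(1::complex) \<in> ball 0 2" "g (pt (L p 1)) \<noteq> 0"
        using P(2) L1 by auto
      from isolated_zeros[OF holL2 open_ball connected_ball this(1) True this(2,3)]
      show ?thesis using that by metis
    qed
    show ?thesis
    proof (rule that[of "min r 1 / 2"])
      fix \<zeta> :: complex assume \<zeta>: "cmod \<zeta> = min r 1 / 2"
      then have "cmod \<zeta> < r" "cmod \<zeta> > 0" using r(1) by (auto simp: min_def split: if_splits)
      then show "g (pt (L p \<zeta>)) \<noteq> 0" using r(2)[of \<zeta>] by auto
    qed (use r(1) in auto)
  next
    case False
    have "isCont (\<lambda>\<zeta>. g (pt (L p \<zeta>))) 0"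
      by (rule field_differentiable_imp_continuous_at[OF diffL[OF g]]) (use \<epsilon> normL[of p 0] in simp)
    then obtain r where r: "0 < r" "\<And>z. dist 0 z < r \<Longrightarrow> g (pt (L p z)) \<noteq> 0"
      using continuous_at_avoid[of 0 "\<lambda>\<zeta>. g (pt (L p \<zeta>))" 0] False by metis
    show ?thesis
      by (rule that[of "min r 1 / 2"]) (use r in auto)
  qed
  have contp: "continuous_on (ball p \<epsilon>) (\<lambda>x. F (pt x))" if F: "holomorphic_Cn 2 W F" for F
  proof -
    have "continuous_on W F"
      by (rule secs_continuous[OF WC secsI_holo[OF F order_refl]])
    then show ?thesis
      using \<epsilon>(2) by (auto intro!: continuous_on_compose2[OF _ continuous_on_subset[OF continuous_on_pt]])
  qed
  \<comment> \<open>The circle is compact and misses the zeros of \<open>g\<close>, so a whole tube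
    around it does. Translating the centre by less than the width of the tube keeps the circle
    inside it.\<close>
  define K where "K = L p ` sphere 0 r"
  have "compact K"
    unfolding K_def L_def by (intro compact_continuous_image continuous_intros) simp
  moreover have "open {x \<in> ball p \<epsilon>. g (pt x) \<noteq> 0}"
  proof -
    have "{x \<in> ball p \<epsilon>. g (pt x) \<noteq> 0} = ball p \<epsilon> \<inter> (\<lambda>x. g (pt x)) -` (-{0})" by auto
    then show ?thesis using continuous_open_preimage[OF contp[OF g] open_ball] by (simp add: open_Compl)
  qed
  moreover have "K \<subseteq> {x \<in> ball p \<epsilon>. g (pt x) \<noteq> 0}"
    using r Lin[of p] \<epsilon>(1) by (auto simp: K_def)
  ultimately obtain \<delta>0 where \<delta>0: "\<delta>0 > 0" "(\<Union>x\<in>K. ball x \<delta>0) \<subseteq> {x \<in> ball p \<epsilon>. g (pt x) \<noteq> 0}"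
    by (rule compact_subset_open_imp_ball_epsilon_subset)
  define \<delta> where "\<delta> = min \<delta>0 (\<epsilon> / 2)"
  have \<delta>: "\<delta> > 0" using \<delta>0 \<epsilon> by (simp add: \<delta>_def)
  have gnz: "g (pt (L x \<zeta>)) \<noteq> 0" if "x \<in> ball p \<delta>" "norm \<zeta> = r" for x \<zeta>
  proof -
    have "L x \<zeta> \<in> ball (L p \<zeta>) \<delta>0"
      using that by (simp add: L_def \<delta>_def dist_norm)
    moreover have "L p \<zeta> \<in> K" using that by (simp add: K_def)
    ultimately show ?thesis using \<delta>0(2) by blast
  qed
  have Lin\<delta>: "L x \<zeta> \<in> ball p \<epsilon>" if "x \<in> ball p \<delta>" "norm \<zeta> \<le> 1" for x \<zeta>
    by (rule Lin) (use that in \<open>auto simp: \<delta>_def\<close>)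
  define c where "c t = of_real r * exp (2 * of_real pi * \<i> * of_real t)" for t :: real
  have nc: "norm (c t) = r" for t using r by (simp add: c_def norm_mult norm_exp_eq_Re)
  define H where "H x y t = f (pt (L (x, y) (c t))) / g (pt (L (x, y) (c t)))" for x y t
  define b where "b z = integral {0..1} (H (z 0) (z 1))" for z :: "nat \<Rightarrow> complex"
  \<comment> \<open>On the line through \<open>x\<close> the extended quotient \<open>k\<close> is
    holomorphic up to the centre, so its mean over the circle, which is \<open>b\<close>, equals
    \<open>k 0\<close>.\<close>
  have fb: "f (pt x) = b (pt x) * g (pt x)" if x: "x \<in> ball p \<delta>" for x
  proof -
    have x': "x \<in> ball p (\<epsilon> / 2)" using x by (simp add: \<delta>_def)
    have "\<exists>k. k holomorphic_on ball 0 1 \<and> (\<forall>z\<in>ball 0 1. f (pt (L x z)) = k z * g (pt (L x z)))"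
    proof (rule holomorphic_divide_of_bounded[OF holL[OF f x'] holL[OF g x'] open_ball connected_ball])
      show "cmod (f (pt (L x z))) \<le> M * cmod (g (pt (L x z)))" if "z \<in> ball 0 1" for z
        using \<epsilon>(2) Lin[OF x', of z] that by (intro bd) auto
      show "of_real r \<in> ball (0::complex) 1" using r by simp
      show "g (pt (L x (of_real r))) \<noteq> 0" using r by (intro gnz x) simp
    qed
    then obtain k where k: "k holomorphic_on ball 0 1" "\<And>z. z \<in> ball 0 1 \<Longrightarrow> f (pt (L x z)) = k z * g (pt (L x z))"
      by blast
    have sub: "cball 0 r \<subseteq> ball (0::complex) 1" using r by auto
    have "((\<lambda>s. k (c s)) has_integral k 0) {0..1}"
    proof -
      have "k holomorphic_on ball 0 r" by (rule holomorphic_on_subset[OF k(1)]) (use r in auto)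
      then show ?thesis
        using Cauchy_mean[of 0 r k 0] r(1) continuous_on_subset[OF holomorphic_on_imp_continuous_on[OF k(1)] sub]
        by (simp add: c_def)
    qed
    moreover have "k (c s) = H (fst x) (snd x) s" for s
      using k(2)[of "c s"] gnz[OF x nc] nc[of s] r by (simp add: H_def)
    ultimately have "b (pt x) = k 0"
      by (simp add: b_def has_integral_iff)
    moreover have "L x 0 = x" by (simp add: L_def zero_prod_def[symmetric])
    ultimately show ?thesis using k(2)[of 0] by simp
  qed
  have hb: "holo_at 2 b (pt x)" if x: "x \<in> ball p \<delta>" for x
  proof -
    obtain x0 x1 where x01: "x = (x0, x1)" by (cases x)
    obtain d where d: "d > 0" "ball x d \<subseteq> ball p \<delta>" using x open_contains_ball_eq[OF open_ball] by blast
    \<comment> \<open>A third of the radius: points of the closed bidisc are at distance at most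
      2d/3, hence inside the ball.\<close>
    define \<rho> where "\<rho> = d / 3"
    have in\<delta>: "(y0, y1) \<in> ball p \<delta>" if "y0 \<in> cball x0 \<rho>" "y1 \<in> cball x1 \<rho>" for y0 y1
    proof -
      have "dist x (y0, y1) \<le> dist x0 y0 + dist x1 y1"
        unfolding x01 dist_Pair_Pair by (rule sqrt_sum_squares_le_sum) auto
      also have "\<dots> < d" using that d(1) by (simp add: \<rho>_def)
      finally show ?thesis using d(2) by auto
    qed
    have cL: "continuous_on S (\<lambda>q. F (pt (L (u q, v' q) (c (t q)))))"
      if "holomorphic_Cn 2 W F" "continuous_on S u" "continuous_on S v'" "continuous_on S t"
        "\<And>q. q \<in> S \<Longrightarrow> u q \<in> cball x0 \<rho>" "\<And>q. q \<in> S \<Longrightarrow> v' q \<in> cball x1 \<rho>"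
      for F S and u v' :: "complex \<times> complex \<times> real \<Rightarrow> complex" and t
    proof (rule continuous_on_compose2[OF contp[OF that(1)]])
      show "continuous_on S (\<lambda>q. L (u q, v' q) (c (t q)))"
        unfolding L_def c_def using that by (intro continuous_intros)
      show "(\<lambda>q. L (u q, v' q) (c (t q))) ` S \<subseteq> ball p \<epsilon>"
        using Lin\<delta>[OF in\<delta>[OF that(5,6)]] nc r by auto
    qed
    have "holo_at 2 (\<lambda>z. integral {0..1} (H (z 0) (z 1))) (pt (x0, x1))"
    proof (rule holo_at_integral[where \<rho>=\<rho>])
      show "\<rho> > 0" using d by (simp add: \<rho>_def)
      show "continuous_on (cball x0 \<rho> \<times> cball x1 \<rho> \<times> {0..1}) (\<lambda>(x, y, t). H x y t)"
        unfolding H_def case_prod_unfold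
        by (intro continuous_intros cL f g)
          (use gnz[OF in\<delta> nc] in \<open>auto simp: mem_Times_iff\<close>)
      have d0: "(\<lambda>y0. F (pt (L (y0, y1) \<zeta>))) field_differentiable at y0"
        if "holomorphic_Cn 2 W F" "(y0, y1) \<in> ball p \<delta>" "norm \<zeta> = r" for F y0 y1 \<zeta>
      proof -
        have e: "L (y0, y1) \<zeta> = (\<zeta> * fst v, y1 + \<zeta> * snd v) + (y0 * 1, y0 * 0)" for y0
          by (simp add: L_def)
        have "L (y0, y1) \<zeta> \<in> ball p \<epsilon>" using that r by (intro Lin\<delta>) auto
        then have "holo_at 2 F (pt (L (y0, y1) \<zeta>))"
          using that(1) \<epsilon>(2) by (auto simp: holomorphic_Cn_iff)
        then show ?thesis unfolding e by (rule field_differentiable_pt_line)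
      qed
      have d1: "(\<lambda>y1. F (pt (L (y0, y1) \<zeta>))) field_differentiable at y1"
        if "holomorphic_Cn 2 W F" "(y0, y1) \<in> ball p \<delta>" "norm \<zeta> = r" for F y0 y1 \<zeta>
      proof -
        have e: "L (y0, y1) \<zeta> = (y0 + \<zeta> * fst v, \<zeta> * snd v) + (y1 * 0, y1 * 1)" for y1
          by (simp add: L_def)
        have "L (y0, y1) \<zeta> \<in> ball p \<epsilon>" using that r by (intro Lin\<delta>) auto
        then have "holo_at 2 F (pt (L (y0, y1) \<zeta>))"
          using that(1) \<epsilon>(2) by (auto simp: holomorphic_Cn_iff)
        then show ?thesis unfolding e by (rule field_differentiable_pt_line)
      qed
      show "(\<lambda>x. H x y t) holomorphic_on ball x0 \<rho>" if "y \<in> cball x1 \<rho>" "t \<in> {0..1}" for y t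
        unfolding H_def holomorphic_on_def
      proof (rule ballI, rule field_differentiable_at_within, rule field_differentiable_divide)
        fix z assume "z \<in> ball x0 \<rho>"
        then have "(z, y) \<in> ball p \<delta>" using that by (intro in\<delta>) auto
        then show "(\<lambda>x. f (pt (L (x, y) (c t)))) field_differentiable at z"
          "(\<lambda>x. g (pt (L (x, y) (c t)))) field_differentiable at z" "g (pt (L (z, y) (c t))) \<noteq> 0"
          using d0[OF f _ nc] d0[OF g _ nc] gnz[OF _ nc] by auto
      qed
      show "(\<lambda>y. H x y t) holomorphic_on ball x1 \<rho>" if "x \<in> cball x0 \<rho>" "t \<in> {0..1}" for x t
        unfolding H_def holomorphic_on_def
      proof (rule ballI, rule field_differentiable_at_within, rule field_differentiable_divide)
        fix z assume "z \<in> ball x1 \<rho>"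
        then have "(x, z) \<in> ball p \<delta>" using that by (intro in\<delta>) auto
        then show "(\<lambda>y. f (pt (L (x, y) (c t)))) field_differentiable at z"
          "(\<lambda>y. g (pt (L (x, y) (c t)))) field_differentiable at z" "g (pt (L (x, z) (c t))) \<noteq> 0"
          using d1[OF f _ nc] d1[OF g _ nc] gnz[OF _ nc] by auto
      qed
    qed
    then show ?thesis by (simp add: b_def[abs_def] x01)
  qed
  have "ball p \<delta> \<subseteq> ball p \<epsilon>" using \<epsilon>(1) by (intro subset_ball) (simp add: \<delta>_def)
  then have sub: "pt ` ball p \<delta> \<subseteq> W" using \<epsilon>(2) by blast
  have "holomorphic_Cn 2 (pt ` ball p \<delta>) b"
    using opC[OF \<delta>] hb by (auto simp: holomorphic_Cn_iff)
  moreover have "a \<in> pt ` ball p \<delta>" using ap \<delta> by auto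
  ultimately show ?thesis using sub fb by blast
qed

section \<open>Normality at smooth points of a surface\<close>

lemma secs_open:
  assumes "open_Cn n V" "f \<in> secs n V"
  shows "holomorphic_Cn n V f"
  unfolding holomorphic_Cn_iff
proof (intro conjI ballI assms(1))
  fix z assume z: "z \<in> V"
  obtain W F where W: "z \<in> W" "holomorphic_Cn n W F" "\<forall>z\<in>V \<inter> W. f z = F z"
    by (rule secsE[OF assms(2) z]) (rule that)
  have "open_Cn n (V \<inter> W)" using assms(1) W(2) by (auto simp: holomorphic_Cn_iff)
  then obtain T where T: "open T" "V \<inter> W = Cn n \<inter> T" by (metis openin_open)
  have zT: "z \<in> T" "z \<in> Cn n" using T(2) W(1) z by auto
  have "\<forall>\<^sub>F w in nhds z. w \<in> Cn n \<longrightarrow> F w = f w"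
    using eventually_nhds_in_open[OF T(1) zT(1)] by eventually_elim (use T(2) W(3) in auto)
  then show "holo_at n f z"
    by (rule holo_at_cong[OF _ zT(2)]) (use W in \<open>auto simp: holomorphic_Cn_iff\<close>)
qed

text \<open>The classical bound for roots of a monic polynomial, made homogeneous so that
  \<open>s\<close> may vanish. The summand 1 in the constant yields |s| \<le> |f| in the contrary
  case, which is what allows powers of \<open>s\<close> to be replaced by powers of
  \<open>f\<close>.\<close>

lemma norm_root_le:
  fixes f s :: complex and c :: "nat \<Rightarrow> complex"
  assumes eq: "f ^ n + (\<Sum>i<n. c i * f ^ i * s ^ (n - i)) = 0" and n: "0 < n"
    and B: "\<And>i. i < n \<Longrightarrow> norm (c i) \<le> B"
  shows "norm f \<le> (1 + n * B) * norm s"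
proof (rule ccontr)
  assume "\<not> norm f \<le> (1 + n * B) * norm s"
  then have gt: "(1 + n * B) * norm s < norm f" by simp
  have B0: "B \<ge> 0" using B[OF n] norm_ge_zero order_trans by blast
  have sf: "norm s \<le> norm f"
  proof -
    have "0 \<le> (n * B) * norm s" using B0 by simp
    then show ?thesis using gt by (simp add: distrib_right)
  qed
  have f0: "norm f > 0" using gt B0 by (smt (verit, best) mult_nonneg_nonneg norm_ge_zero of_nat_0_le_iff)
  have "norm f ^ n = norm (\<Sum>i<n. c i * f ^ i * s ^ (n - i))"
    using eq by (metis add_eq_0_iff norm_minus_cancel norm_power)
  also have "\<dots> \<le> (\<Sum>i<n. norm (c i * f ^ i * s ^ (n - i)))" by (rule norm_sum)
  also have "\<dots> \<le> (\<Sum>i<n. B * (norm f ^ (n - 1) * norm s))"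
  proof (rule sum_mono)
    fix i assume "i \<in> {..<n}"
    then have i: "i < n" by simp
    \<comment> \<open>Every term has at least one factor \<open>s\<close>. That one is kept and the
      others are estimated by \<open>f\<close>.\<close>
    then have n': "n - i = Suc (n - 1 - i)" "n - 1 = i + (n - 1 - i)" by auto
    have "norm f ^ i * norm s ^ (n - i) = norm f ^ i * (norm s ^ (n - 1 - i) * norm s)"
      unfolding n'(1) by (simp add: mult.commute)
    also have "\<dots> \<le> norm f ^ i * (norm f ^ (n - 1 - i) * norm s)"
      by (intro mult_left_mono mult_right_mono power_mono sf) auto
    also have "\<dots> = norm f ^ (n - 1) * norm s"
      by (subst n'(2)) (simp only: power_add mult.assoc)
    finally show "norm (c i * f ^ i * s ^ (n - i)) \<le> B * (norm f ^ (n - 1) * norm s)"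
      using B[OF i] B0 by (simp add: norm_mult norm_power mult.assoc) (rule mult_mono; simp)
  qed
  also have "\<dots> = norm f ^ (n - 1) * (n * B * norm s)" by simp
  finally have "norm f ^ (n - 1) * norm f \<le> norm f ^ (n - 1) * (n * B * norm s)"
    using n by (metis Suc_pred' power_Suc2 One_nat_def)
  then have "norm f \<le> n * B * norm s"
    using f0 by simp
  moreover have "(1 + n * B) * norm s = norm s + n * B * norm s" by (simp add: distrib_right)
  ultimately show False using gt norm_ge_zero[of s] by linarith
qed

text \<open>In the chart the coefficients of an integral equation are locally bounded, so
  \<open>norm_root_le\<close> bounds the numerator by a multiple of the denominator, and
  \<open>exists_holomorphic_quotient\<close> divides. A denominator that is nonzero somewhere in
  every neighbourhood stays so in the chart.\<close>

lemma (in germs) normal_at_chart: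
  assumes "chart_at 2 X a"
  shows "normal_at X a"
proof (rule normal_atI)
  fix U f s n and c :: "nat \<Rightarrow> _"
  assume f: "valid U f" and s: "valid U s" and n: "0 < n" and c: "\<And>i. i < n \<Longrightarrow> valid U (c i)"
    and nz: "\<And>W. openin (topo X) W \<Longrightarrow> a \<in> W \<Longrightarrow> W \<subseteq> U \<Longrightarrow> \<exists>x\<in>W. s x \<noteq> 0"
    and eq: "\<And>x. x \<in> U \<Longrightarrow> f x ^ n + (\<Sum>i<n. c i x * f x ^ i * s x ^ (n - i)) = 0"
  obtain U0 \<Omega> \<phi> \<psi> where U0: "openin (topo X) U0" "a \<in> U0" "open_Cn 2 \<Omega>"
    and pair: "biholo_pair (restrict_space_to X U0) (space_of_subset 2 \<Omega>) \<phi> \<psi>"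
    using assms by (auto simp: chart_at_def)
  have \<Omega>C: "\<Omega> \<subseteq> Cn 2" using U0(3) by (rule open_Cn_subset)
  have U0X: "U0 \<subseteq> points X" using U0(1) by (rule openin_subset)
  have \<phi>: "holomorphic_map (restrict_space_to X U0) (space_of_subset 2 \<Omega>) \<phi>"
    and \<psi>: "holomorphic_map (space_of_subset 2 \<Omega>) (restrict_space_to X U0) \<psi>"
    and \<psi>\<phi>: "\<And>x. x \<in> U0 \<Longrightarrow> \<psi> (\<phi> x) = x" and \<phi>\<psi>: "\<And>z. z \<in> \<Omega> \<Longrightarrow> \<phi> (\<psi> z) = z"
    using pair U0X by (auto simp: biholo_pair_def)
  have \<phi>\<Omega>: "\<phi> x \<in> \<Omega>" if "x \<in> U0" for x using holomorphic_map_points[OF \<phi>, of x] that U0X by auto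
  have \<psi>U: "\<psi> z \<in> U0" if "z \<in> \<Omega>" for z using holomorphic_map_points[OF \<psi>, of z] that by auto
  define U1 where "U1 = U \<inter> U0"
  have U1: "openin (topo X) U1" "a \<in> U1" "openin (topo (restrict_space_to X U0)) U1"
    using f U0 by (auto simp: U1_def valid_def openin_open_subtopology)
  define \<Omega>1 where "\<Omega>1 = {z \<in> \<Omega>. \<psi> z \<in> U1}"
  have \<Omega>1: "open_Cn 2 \<Omega>1"
  proof -
    have "openin (top_of_set \<Omega>) \<Omega>1"
      using openin_continuous_map_preimage[OF holomorphic_map_continuous[OF \<psi>] U1(3)]
      unfolding \<Omega>1_def by simp
    then show ?thesis using U0(3) by (rule openin_trans)
  qed
  have hol: "holomorphic_Cn 2 \<Omega>1 (h \<circ> \<psi>)" if "valid U h" for h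
  proof (rule secs_open[OF \<Omega>1])
    have "valid U1 h" using valid_subset[OF that U1(1,2)] by (simp add: U1_def)
    then have "h \<in> sections (restrict_space_to X U0) U1" by (simp add: valid_def)
    from holomorphic_map_section[OF \<psi> U1(3) this]
    show "h \<circ> \<psi> \<in> secs 2 \<Omega>1" by (simp add: \<Omega>1_def)
  qed
  define z0 where "z0 = \<phi> a"
  have z0: "z0 \<in> \<Omega>1" using \<phi>\<Omega> \<psi>\<phi> U0 U1 by (simp add: z0_def \<Omega>1_def)
  \<comment> \<open>Adding up the bounds of the single coefficients dominates each of them; the
    extra 1 leaves room to shrink the neighbourhood \<open>\<Omega>2\<close>.\<close>
  define B where "B = (\<Sum>i<n. norm (c i a) + 1)"
  define \<Omega>2 where "\<Omega>2 = \<Omega>1 \<inter> (\<Inter>i\<in>{..<n}. {z \<in> \<Omega>1. norm ((c i \<circ> \<psi>) z) < norm (c i a) + 1})"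
  have "openin (top_of_set \<Omega>1) \<Omega>2"
  proof -
    have "openin (top_of_set \<Omega>1) {z \<in> \<Omega>1. norm ((c i \<circ> \<psi>) z) < norm (c i a) + 1}" if "i < n" for i
    proof -
      have "continuous_on \<Omega>1 (c i \<circ> \<psi>)"
        using secs_continuous[OF _ secsI_holo[OF hol[OF c[OF that]] order_refl]] \<Omega>1 open_Cn_subset by blast
      then have "openin (top_of_set \<Omega>1) (\<Omega>1 \<inter> (\<lambda>z. norm ((c i \<circ> \<psi>) z)) -` {..<norm (c i a) + 1})"
        by (intro continuous_openin_preimage_gen continuous_intros) auto
      then show ?thesis by (simp add: vimage_def Int_def)
    qed
    then show ?thesis
      unfolding \<Omega>2_def using n by (intro openin_Int openin_INT2) auto
  qed
  then have \<Omega>2: "open_Cn 2 \<Omega>2" using \<Omega>1 openin_trans by blast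
  have z0': "z0 \<in> \<Omega>2" using z0 \<psi>\<phi> U0 by (auto simp: \<Omega>2_def z0_def)
  have cB: "norm (c i (\<psi> z)) \<le> B" if "i < n" "z \<in> \<Omega>2" for i z
  proof -
    have "norm (c i (\<psi> z)) \<le> norm (c i a) + 1" using that by (auto simp: \<Omega>2_def less_imp_le)
    also have "\<dots> \<le> B" unfolding B_def using that by (intro member_le_sum) auto
    finally show ?thesis .
  qed
  have sub: "\<Omega>2 \<subseteq> \<Omega>1" "\<Omega>1 \<subseteq> \<Omega>" by (auto simp: \<Omega>2_def \<Omega>1_def)
  have "\<exists>W' b. z0 \<in> W' \<and> W' \<subseteq> \<Omega>2 \<and> holomorphic_Cn 2 W' b \<and> (\<forall>z\<in>W'. (f \<circ> \<psi>) z = b z * (s \<circ> \<psi>) z)"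
  proof (rule exists_holomorphic_quotient)
    show "holomorphic_Cn 2 \<Omega>2 (f \<circ> \<psi>)" "holomorphic_Cn 2 \<Omega>2 (s \<circ> \<psi>)"
      using hol[OF f] hol[OF s] \<Omega>2 sub by (auto simp: holomorphic_Cn_iff)
    show "z0 \<in> \<Omega>2" by (rule z0')
    show "norm ((f \<circ> \<psi>) z) \<le> (1 + n * B) * norm ((s \<circ> \<psi>) z)" if "z \<in> \<Omega>2" for z
      unfolding comp_def
      by (rule norm_root_le[OF eq n cB]) (use that sub in \<open>auto simp: \<Omega>1_def U1_def\<close>)
    show "\<exists>z\<in>T. (s \<circ> \<psi>) z \<noteq> 0" if T: "open_Cn 2 T" "z0 \<in> T" "T \<subseteq> \<Omega>2" for T
    proof -
      have "openin (top_of_set \<Omega>) T"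
        using T(1,3) sub \<Omega>C by (metis openin_subset_trans order_trans)
      then have "openin (subtopology (topo X) U0) {x \<in> points (restrict_space_to X U0). \<phi> x \<in> T}"
        using openin_continuous_map_preimage[OF holomorphic_map_continuous[OF \<phi>], of T] by simp
      then have o: "openin (topo X) {x \<in> points (restrict_space_to X U0). \<phi> x \<in> T}"
        using U0(1) by (simp add: openin_open_subtopology)
      have "\<exists>x\<in>{x \<in> points (restrict_space_to X U0). \<phi> x \<in> T}. s x \<noteq> 0"
      proof (rule nz[OF o])
        show "a \<in> {x \<in> points (restrict_space_to X U0). \<phi> x \<in> T}" using U0 U0X T(2) by (auto simp: z0_def)
        show "{x \<in> points (restrict_space_to X U0). \<phi> x \<in> T} \<subseteq> U"
          using T(3) sub \<psi>\<phi> by (force simp: \<Omega>1_def U1_def)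
      qed
      then show ?thesis using \<psi>\<phi> by force
    qed
  qed
  then obtain W b where W: "z0 \<in> W" "W \<subseteq> \<Omega>2" "holomorphic_Cn 2 W b" "\<And>z. z \<in> W \<Longrightarrow> f (\<psi> z) = b z * s (\<psi> z)"
    by auto
  define V where "V = {x \<in> points (restrict_space_to X U0). \<phi> x \<in> W}"
  have W': "openin (topo (space_of_subset 2 \<Omega>)) W"
    using W(2,3) sub \<Omega>C unfolding holomorphic_Cn_iff space_of_subset_simps
    by (metis openin_subset_trans order_trans)
  have "openin (topo (restrict_space_to X U0)) V"
    unfolding V_def by (rule openin_continuous_map_preimage[OF holomorphic_map_continuous[OF \<phi>] W'])
  then have V: "openin (topo X) V" using U0(1) by (simp add: openin_open_subtopology)
  have "b \<circ> \<phi> \<in> sections X V"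
    using holomorphic_map_section[OF \<phi> W', of b] secsI_holo[OF W(3)] by (simp add: V_def)
  moreover have "a \<in> V" using U0 U0X W(1) by (auto simp: V_def z0_def)
  moreover have "V \<subseteq> U" using W(2) sub \<psi>\<phi> by (force simp: V_def \<Omega>1_def U1_def)
  moreover have "\<forall>x\<in>V. f x = (b \<circ> \<phi>) x * s x"
    using W(4) \<psi>\<phi> by (force simp: V_def)
  ultimately show "\<exists>V b. valid V b \<and> V \<subseteq> U \<and> (\<forall>x\<in>V. f x = b x * s x)"
    using V by (intro exI[of _ V] exI[of _ "b \<circ> \<phi>"]) (simp add: valid_def)
qed

section \<open>Holomorphic discs and the Kobayashi distance\<close>

lemma Moebius_holomorphic_map:
  assumes "norm w < 1"
  shows "holomorphic_map unit_disc unit_disc (Moebius_function 0 w)"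
  unfolding holomorphic_map_def
proof (intro conjI allI impI; (elim conjE)?)
  have hol: "Moebius_function 0 w holomorphic_on ball 0 1"
    by (rule Moebius_function_holomorphic[OF assms])
  have maps: "Moebius_function 0 w z \<in> ball 0 1" if "z \<in> ball 0 1" for z
    using Moebius_function_norm_lt_1[OF assms, of z] that by simp
  show "continuous_map (topo unit_disc) (topo unit_disc) (Moebius_function 0 w)"
    using holomorphic_on_imp_continuous_on[OF hol] maps by auto
  fix V g assume "g \<in> sections unit_disc V"
  then have g: "g holomorphic_on V" by simp
  have "g \<circ> Moebius_function 0 w holomorphic_on {x \<in> ball 0 1. Moebius_function 0 w x \<in> V}"
    by (rule holomorphic_on_compose_gen[OF holomorphic_on_subset[OF hol] g]) auto
  then show "g \<circ> Moebius_function 0 w \<in> sections unit_disc {x \<in> points unit_disc. Moebius_function 0 w x \<in> V}"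
    by simp
qed

text \<open>A Moebius map moves any point of a disc to the centre, and -ln (1 - r) is at most the
  Poincare distance ln ((1 + r)/(1 - r)). Each \<open>u\<close> then varies along a chain by at most
  \<open>K\<close> times its length, so |u p - u q|/K bounds the distance from below. The functions
  are arbitrary on purpose: those used later contain complex conjugates.\<close>

lemma hyperbolic_if_separated:
  fixes \<U> :: "('a \<Rightarrow> complex) set"
  assumes K: "K > 0"
    and lip: "\<And>f u z. holomorphic_map unit_disc X f \<Longrightarrow> u \<in> \<U> \<Longrightarrow> z \<in> ball 0 1 \<Longrightarrow>
      norm (u (f z) - u (f 0)) \<le> K * (- ln (1 - norm z))"
    and sep: "\<And>p q. p \<in> points X \<Longrightarrow> q \<in> points X \<Longrightarrow> p \<noteq> q \<Longrightarrow> \<exists>u\<in>\<U>. u p \<noteq> u q"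
  shows "hyperbolic_space X"
  unfolding hyperbolic_space_def
proof (intro ballI impI)
  have disc: "norm (u (f a) - u (f b)) \<le> K * poincare_dist a b"
    if f: "holomorphic_map unit_disc X f" and u: "u \<in> \<U>" and a: "a \<in> ball 0 1" and b: "b \<in> ball 0 1"
    for f u a b
  proof -
    have na: "norm (-a) < 1" using a by simp
    \<comment> \<open>The position of \<open>b\<close> after \<open>a\<close> has been moved to the
      centre; its modulus is the r in the Poincare distance.\<close>
    define \<beta> where "\<beta> = (b - a) / (1 - cnj a * b)"
    have \<beta>: "\<beta> = Moebius_function 0 a b" by (simp add: \<beta>_def Moebius_function_simple)
    have n\<beta>: "norm \<beta> < 1" unfolding \<beta> using a b by (intro Moebius_function_norm_lt_1) auto
    have "Moebius_function 0 (-a) (Moebius_function 0 a b) = b"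
      by (rule Moebius_function_compose) (use a b in auto)
    moreover have "Moebius_function 0 (-a) 0 = a" by (simp add: Moebius_function_simple)
    ultimately have "norm (u (f b) - u (f a)) \<le> K * (- ln (1 - norm \<beta>))"
      using lip[OF holomorphic_map_compose[OF Moebius_holomorphic_map[OF na] f] u, of \<beta>] n\<beta> \<beta> by simp
    also have "\<dots> \<le> K * ln ((1 + norm \<beta>) / (1 - norm \<beta>))"
    proof -
      have "ln ((1 + norm \<beta>) / (1 - norm \<beta>)) = ln (1 + norm \<beta>) - ln (1 - norm \<beta>)"
      proof -
        have "0 < 1 + norm \<beta>" "0 < 1 - norm \<beta>" using n\<beta> norm_ge_zero[of \<beta>] by linarith+
        then show ?thesis by (simp add: ln_div)
      qed
      moreover have "ln (1 + norm \<beta>) \<ge> 0" by simp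
      ultimately show ?thesis using K by (intro mult_left_mono) linarith+
    qed
    also have "ln ((1 + norm \<beta>) / (1 - norm \<beta>)) = poincare_dist a b"
      by (simp add: poincare_dist_def Let_def \<beta>_def norm_divide norm_minus_commute)
    finally show ?thesis by (simp add: norm_minus_commute)
  qed
  fix p q assume "p \<in> points X" "q \<in> points X" "p \<noteq> q"
  then obtain u where u: "u \<in> \<U>" "u p \<noteq> u q" using sep by blast
  have chain: "norm (u p - u q) \<le> K * (\<Sum>i<k. poincare_dist (a i) (b i))"
    if c: "disc_chain X p q k f a b" for k f a b
  proof -
    have *: "norm (u (f 0 (a 0)) - u (f m (b m))) \<le> K * (\<Sum>i<Suc m. poincare_dist (a i) (b i))"
      if "m < k" for m using that
    proof (induction m)
      case 0
      then show ?case using disc[OF _ u(1), of "f 0" "a 0" "b 0"] c by (simp add: disc_chain_def)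
    next
      case (Suc m)
      have "norm (u (f 0 (a 0)) - u (f (Suc m) (b (Suc m)))) \<le>
          norm (u (f 0 (a 0)) - u (f m (b m))) + norm (u (f m (b m)) - u (f (Suc m) (b (Suc m))))"
        using dist_triangle[of "u (f 0 (a 0))" "u (f (Suc m) (b (Suc m)))" "u (f m (b m))"]
        by (simp add: dist_norm)
      also have "\<dots> \<le> K * (\<Sum>i<Suc m. poincare_dist (a i) (b i)) + K * poincare_dist (a (Suc m)) (b (Suc m))"
      proof (rule add_mono)
        show "norm (u (f 0 (a 0)) - u (f m (b m))) \<le> K * (\<Sum>i<Suc m. poincare_dist (a i) (b i))"
          using Suc by simp
        have "f m (b m) = f (Suc m) (a (Suc m))" using c Suc.prems by (simp add: disc_chain_def)
        then show "norm (u (f m (b m)) - u (f (Suc m) (b (Suc m)))) \<le> K * poincare_dist (a (Suc m)) (b (Suc m))"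
          using disc[OF _ u(1), of "f (Suc m)" "a (Suc m)" "b (Suc m)"] c Suc.prems by (simp add: disc_chain_def)
      qed
      finally show ?case by (simp add: distrib_left)
    qed
    show ?thesis
      using *[of "k - 1"] c by (simp add: disc_chain_def)
  qed
  have "ereal (norm (u p - u q) / K) \<le> kobayashi_dist X p q"
    unfolding kobayashi_dist_def
  proof (rule Inf_greatest, clarify)
    fix k f a b assume "disc_chain X p q k f a b"
    from chain[OF this] show "ereal (norm (u p - u q) / K) \<le> ereal (\<Sum>i<k. poincare_dist (a i) (b i))"
      using K by (simp add: divide_le_eq mult.commute)
  qed
  moreover have "0 < norm (u p - u q) / K" using u K by simp
  ultimately show "0 < kobayashi_dist X p q"
    by (metis ereal_less(2) less_le_trans)
qed

text \<open>Chains of discs are mapped to chains of the same length, so holomorphic maps do not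
  increase the distance. Applied to charts, it passes hyperbolicity from a compactification to its
  affine part.\<close>

lemma hyperbolic_space_injective:
  assumes Y: "hyperbolic_space Y" and g: "holomorphic_map X Y g" and inj: "inj_on g (points X)"
  shows "hyperbolic_space X"
  unfolding hyperbolic_space_def
proof (intro ballI impI)
  fix p q assume pq: "p \<in> points X" "q \<in> points X" "p \<noteq> q"
  have "kobayashi_dist Y (g p) (g q) \<le> kobayashi_dist X p q"
    unfolding kobayashi_dist_def
  proof (rule Inf_superset_mono, clarify)
    fix k f a b assume "disc_chain X p q k f a b"
    then have "disc_chain Y (g p) (g q) k (\<lambda>i. g \<circ> f i) a b"
      by (auto simp: disc_chain_def intro: holomorphic_map_compose[OF _ g])
    then show "\<exists>k' f' a' b'. ereal (\<Sum>i<k. poincare_dist (a i) (b i)) = ereal (\<Sum>i<k'. poincare_dist (a' i) (b' i)) \<and>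
        disc_chain Y (g p) (g q) k' f' a' b'" by blast
  qed
  moreover have "0 < kobayashi_dist Y (g p) (g q)"
    using Y pq inj holomorphic_map_points[OF g] unfolding hyperbolic_space_def inj_on_def by blast
  ultimately show "0 < kobayashi_dist X p q" by (rule less_le_trans[rotated])
qed

text \<open>A single disc already joins the two points, at Poincare distance ln ((1 + t)/(1 - t))
  with t = 1/R, and this tends to 0 with t.\<close>

lemma not_hyperbolic_if_large_discs:
  assumes pq: "p \<in> points X" "q \<in> points X" "p \<noteq> q"
    and F: "\<And>R. R > 1 \<Longrightarrow> holomorphic_map unit_disc X (F R) \<and> F R 0 = p \<and> F R (of_real (1 / R)) = q"
  shows "\<not> hyperbolic_space X"
proof
  assume "hyperbolic_space X"
  then have pos: "0 < kobayashi_dist X p q" using pq by (simp add: hyperbolic_space_def)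
  have le: "kobayashi_dist X p q \<le> ereal (ln ((1 + t) / (1 - t)))" if t: "0 < t" "t < 1" for t
  proof -
    have "disc_chain X p q 1 (\<lambda>_. F (1 / t)) (\<lambda>_. 0) (\<lambda>_. of_real t)"
      using F[of "1 / t"] t by (simp add: disc_chain_def)
    then have "ereal (\<Sum>i<(1::nat). poincare_dist 0 (of_real t)) \<in>
        {ereal (\<Sum>i<k. poincare_dist (a i) (b i)) | k f a b. disc_chain X p q k f a b}"
      by (intro CollectI exI[of _ "1::nat"] exI[of _ "\<lambda>_. F (1 / t)"] exI[of _ "\<lambda>_. 0"]
          exI[of _ "\<lambda>_. of_real t"] conjI refl)
    then have "kobayashi_dist X p q \<le> ereal (\<Sum>i<(1::nat). poincare_dist 0 (of_real t))"
      unfolding kobayashi_dist_def by (rule Inf_lower)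
    then show ?thesis using t by (simp add: poincare_dist_def Let_def)
  qed
  have "((\<lambda>t::real. ln ((1 + t) / (1 - t))) \<longlongrightarrow> ln ((1 + 0) / (1 - 0))) (at_right 0)"
    by (intro tendsto_intros) auto
  then have lim: "((\<lambda>t::real. ereal (ln ((1 + t) / (1 - t)))) \<longlongrightarrow> 0) (at_right 0)"
    by (simp add: zero_ereal_def)
  have "\<forall>\<^sub>F t in at_right (0::real). kobayashi_dist X p q \<le> ereal (ln ((1 + t) / (1 - t)))"
    unfolding eventually_at_right_field using le by (intro exI[of _ 1]) auto
  from tendsto_lowerbound[OF lim this] have "kobayashi_dist X p q \<le> 0" by simp
  then show False using pos by simp
qed

lemma has_field_derivative_eventually_eq:
  assumes "(f has_field_derivative D) (at z)" "\<forall>\<^sub>F w in nhds z. f w = g w"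
  shows "(g has_field_derivative D) (at z)"
  using DERIV_cong_ev[OF refl assms(2) refl] assms(1) by blast

section \<open>Discs in the curve \<open>y\<^sup>2 = x\<^sup>6 + 1\<close>\<close>

text \<open>
  For a disc \<open>(x, y)\<close> in the curve, \<open>h1\<close> and \<open>h2\<close> are the pullbacks of the holomorphic
  one-forms \<open>dx/y\<close> and \<open>x dx/y\<close>. Where they are large on a large disc, Cauchy's estimates
  make their ratio \<open>x\<close> nearly constant to second order, which forces both \<open>y\<close> and \<open>x\<^sup>5\<close> to be
  small; this is impossible on the curve.
\<close>

lemma curve_disc_local_bound:
  assumes h: "h1 holomorphic_on T" "h2 holomorphic_on T" and T: "open T" "cball z0 d \<subseteq> T" and d: "d > 0"
    and N: "norm (h1 z0) = N" "N > 0"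
    and bd: "\<And>z. z \<in> cball z0 d \<Longrightarrow> norm (h1 z) \<le> 2 * N" "\<And>z. z \<in> cball z0 d \<Longrightarrow> norm (h2 z) \<le> 2 * N"
    and S: "open S" "z0 \<in> S" and x: "x holomorphic_on S" and y: "y holomorphic_on S"
    and x1: "norm (x z0) \<le> 1" and curve: "y z0 ^ 2 = x z0 ^ 6 + 1"
    and dx: "\<And>z. z \<in> S \<Longrightarrow> deriv x z = y z * h1 z"
    and dy: "\<And>z. z \<in> S \<Longrightarrow> deriv y z = 3 * x z ^ 5 * h1 z"
    and h2: "\<And>z. z \<in> S \<Longrightarrow> h2 z = x z * h1 z"
  shows "d * N < 8"
proof (rule ccontr)
  assume L8: "\<not> d * N < 8"
  \<comment> \<open>The size of the forms relative to the disc, unchanged under rescaling; the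
    Cauchy estimates combine to bounds in powers of \<open>L\<close>.\<close>
  define L where "L = d * N"
  have L: "L \<ge> 8" using L8 by (simp add: L_def)
  have Cauchy: "norm ((deriv ^^ n) k z0) \<le> fact n * (2 * N) / d ^ n"
    if "k holomorphic_on T" "\<And>z. z \<in> cball z0 d \<Longrightarrow> norm (k z) \<le> 2 * N" for k n
  proof (rule Cauchy_inequality)
    show "k holomorphic_on ball z0 d" using that(1) T(2) ball_subset_cball by (meson holomorphic_on_subset order_trans)
    show "continuous_on (cball z0 d) k"
      using that(1) T(2) by (meson continuous_on_subset holomorphic_on_imp_continuous_on)
    show "norm (k z) \<le> 2 * N" if "norm (z0 - z) = d" for z
      using \<open>\<And>z. z \<in> cball z0 d \<Longrightarrow> norm (k z) \<le> 2 * N\<close>[of z] that by (simp add: dist_norm)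
  qed (use d in auto)
  have z0T: "z0 \<in> T" using T d by auto
  define S' where "S' = S \<inter> T"
  have S': "open S'" "z0 \<in> S'" using S T z0T by (auto simp: S'_def)
  have D: "(k has_field_derivative deriv k z) (at z)" if "k holomorphic_on S \<or> k holomorphic_on T" "z \<in> S'" for k z
    using that holomorphic_derivI[OF _ S(1)] holomorphic_derivI[OF _ T(1)] by (auto simp: S'_def)
  have hd: "deriv h1 holomorphic_on T" "deriv h2 holomorphic_on T"
    using h T(1) by (auto intro: holomorphic_deriv)
  have e1: "deriv h2 z = y z * h1 z ^ 2 + x z * deriv h1 z" if z: "z \<in> S'" for z
  proof -
    have "((\<lambda>z. x z * h1 z) has_field_derivative deriv x z * h1 z + deriv h1 z * x z) (at z)"
      using D[OF _ z] x h by (intro DERIV_mult) auto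
    moreover have "\<forall>\<^sub>F w in nhds z. x w * h1 w = h2 w"
      using eventually_nhds_in_open[OF S'(1) z] by eventually_elim (simp add: S'_def h2)
    ultimately have "(h2 has_field_derivative deriv x z * h1 z + deriv h1 z * x z) (at z)"
      by (rule has_field_derivative_eventually_eq)
    then have "deriv h2 z = deriv x z * h1 z + deriv h1 z * x z" by (rule DERIV_imp_deriv)
    then show ?thesis using dx[of z] z by (simp add: S'_def power2_eq_square)
  qed
  \<comment> \<open>Differentiating y h1^2 + x h1' once more: y h1 h1' arises twice from h1^2 and
    once from x' = y h1, which gives the coefficient 3, and y' = 3 x^5 h1 brings in x^5.\<close>
  have e2: "deriv (deriv h2) z0 = 3 * x z0 ^ 5 * h1 z0 ^ 3 + 3 * y z0 * h1 z0 * deriv h1 z0 + x z0 * deriv (deriv h1) z0"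
  proof -
    have "((\<lambda>z. y z * h1 z ^ 2 + x z * deriv h1 z) has_field_derivative
       deriv y z0 * h1 z0 ^ 2 + (2 * h1 z0 * deriv h1 z0) * y z0 + (deriv x z0 * deriv h1 z0 + deriv (deriv h1) z0 * x z0)) (at z0)"
      using D[OF _ S'(2)] x y h hd
      by (intro DERIV_add DERIV_mult) (auto intro!: derivative_eq_intros)
    moreover have "\<forall>\<^sub>F w in nhds z0. y w * h1 w ^ 2 + x w * deriv h1 w = deriv h2 w"
      using eventually_nhds_in_open[OF S'] by eventually_elim (simp add: e1)
    ultimately have "(deriv h2 has_field_derivative
       deriv y z0 * h1 z0 ^ 2 + (2 * h1 z0 * deriv h1 z0) * y z0 + (deriv x z0 * deriv h1 z0 + deriv (deriv h1) z0 * x z0)) (at z0)"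
      by (rule has_field_derivative_eventually_eq)
    then have "deriv (deriv h2) z0 =
       deriv y z0 * h1 z0 ^ 2 + (2 * h1 z0 * deriv h1 z0) * y z0 + (deriv x z0 * deriv h1 z0 + deriv (deriv h1) z0 * x z0)"
      by (rule DERIV_imp_deriv)
    then show ?thesis using dx[OF S(2)] dy[OF S(2)] by (simp add: power2_eq_square power3_eq_cube algebra_simps)
  qed
  have b1: "norm (deriv h1 z0) \<le> 2 * N / d" "norm (deriv h2 z0) \<le> 2 * N / d"
    using Cauchy[OF h(1) bd(1), of 1] Cauchy[OF h(2) bd(2), of 1] by simp_all
  have b2: "norm (deriv (deriv h1) z0) \<le> 4 * N / d ^ 2" "norm (deriv (deriv h2) z0) \<le> 4 * N / d ^ 2"
    using Cauchy[OF h(1) bd(1), of 2] Cauchy[OF h(2) bd(2), of 2] by (simp_all add: eval_nat_numeral)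
  have xle: "norm (x z0 * w) \<le> norm w" for w
    using x1 by (simp add: norm_mult mult_left_le_one_le)
  have "norm (y z0) * N ^ 2 = norm (deriv h2 z0 - x z0 * deriv h1 z0)"
    using e1[OF S'(2)] N(1) by (simp add: norm_mult norm_power)
  also have "\<dots> \<le> 2 * N / d + 2 * N / d"
    using norm_triangle_ineq4[of "deriv h2 z0" "x z0 * deriv h1 z0"] b1 xle[of "deriv h1 z0"] by linarith
  finally have yb: "norm (y z0) * L \<le> 4"
    using N(2) d by (simp add: L_def field_simps power2_eq_square)
  have "3 * norm (x z0) ^ 5 * N ^ 3 =
      norm (deriv (deriv h2) z0 - x z0 * deriv (deriv h1) z0 - 3 * y z0 * h1 z0 * deriv h1 z0)"
    using e2 N(1) by (simp add: norm_mult norm_power)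
  also have "\<dots> \<le> norm (deriv (deriv h2) z0) + norm (x z0 * deriv (deriv h1) z0) + norm (3 * y z0 * h1 z0 * deriv h1 z0)"
    by (meson norm_triangle_ineq4 order_trans add_right_mono)
  also have "\<dots> \<le> 4 * N / d ^ 2 + 4 * N / d ^ 2 + 3 * norm (y z0) * N * (2 * N / d)"
  proof (intro add_mono)
    show "norm (x z0 * deriv (deriv h1) z0) \<le> 4 * N / d ^ 2" using xle b2(1) by (rule order_trans)
    have "norm (3 * y z0 * h1 z0 * deriv h1 z0) = 3 * norm (y z0) * N * norm (deriv h1 z0)"
      using N(1) by (simp add: norm_mult)
    also have "\<dots> \<le> 3 * norm (y z0) * N * (2 * N / d)"
      using N(2) b1(1) by (intro mult_left_mono) auto
    finally show "norm (3 * y z0 * h1 z0 * deriv h1 z0) \<le> 3 * norm (y z0) * N * (2 * N / d)" .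
  qed (rule b2(2))
  finally have "3 * norm (x z0) ^ 5 * N ^ 3 * (d ^ 2 / N) \<le>
      (4 * N / d ^ 2 + 4 * N / d ^ 2 + 3 * norm (y z0) * N * (2 * N / d)) * (d ^ 2 / N)"
    using N(2) by (intro mult_right_mono) auto
  also have "(4 * N / d ^ 2 + 4 * N / d ^ 2 + 3 * norm (y z0) * N * (2 * N / d)) * (d ^ 2 / N) = 8 + 6 * (norm (y z0) * L)"
    using N(2) d by (simp add: L_def field_simps power2_eq_square)
  also have "3 * norm (x z0) ^ 5 * N ^ 3 * (d ^ 2 / N) = 3 * norm (x z0) ^ 5 * L ^ 2"
    using N(2) by (simp add: L_def field_simps power2_eq_square power3_eq_cube)
  finally have xb: "3 * norm (x z0) ^ 5 * L ^ 2 \<le> 32" using yb by linarith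
  \<comment> \<open>The bounds |y| L \<le> 4 and 3 |x|^5 L^2 \<le> 32 with L at least 8 give |y|
    \<le> 1/2 and |x|^5 \<le> 1/6. Then |y^2 - x^6| is at most 1/4 + 1/6, whereas the curve requires
    the value 1; this is where the threshold 8 comes from.\<close>
  have y2: "norm (y z0) \<le> 1 / 2"
  proof -
    have "norm (y z0) * 8 \<le> norm (y z0) * L" using L by (intro mult_left_mono) auto
    then show ?thesis using yb by linarith
  qed
  have x5: "norm (x z0) ^ 5 \<le> 1 / 6"
  proof -
    have "64 \<le> L ^ 2" using L power_mono[of 8 L 2] by simp
    then have "3 * norm (x z0) ^ 5 * 64 \<le> 3 * norm (x z0) ^ 5 * L ^ 2" by (intro mult_left_mono) auto
    then show ?thesis using xb by linarith
  qed
  have "norm (x z0) ^ 6 = norm (x z0) * norm (x z0) ^ 5" by (simp add: eval_nat_numeral)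
  also have "\<dots> \<le> 1 * (1 / 6)" using x1 x5 by (intro mult_mono) auto
  finally have x6: "norm (x z0 ^ 6) \<le> 1 / 6" by (simp add: norm_power)
  have "norm (y z0 ^ 2) \<le> (1 / 2) ^ 2" unfolding norm_power using y2 by (intro power_mono) auto
  then have "norm (y z0 ^ 2 - x z0 ^ 6) \<le> 1 / 4 + 1 / 6"
    using norm_triangle_ineq4[of "y z0 ^ 2" "x z0 ^ 6"] x6 by (simp add: power2_eq_square)
  then show False using curve by simp
qed

text \<open>The selection argument behind Brody's reparametrisation: where (r - |z|) N z is maximal,
  \<open>N\<close> at most doubles on the disc of half the remaining radius, which is the situation
  of \<open>curve_disc_local_bound\<close>. Halving the radius turns its 8 into 16. In the chart
  with coordinate of modulus at most one the two forms play the roles \<open>k\<close> and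
  \<open>l\<close>, possibly exchanged.\<close>

lemma curve_disc_bound:
  assumes h: "h1 holomorphic_on ball 0 1" "h2 holomorphic_on ball 0 1"
    and loc: "\<And>z. z \<in> ball 0 1 \<Longrightarrow> \<exists>S x y k l. open S \<and> z \<in> S \<and> x holomorphic_on S \<and> y holomorphic_on S \<and>
      norm (x z) \<le> 1 \<and> y z ^ 2 = x z ^ 6 + 1 \<and> (k = h1 \<and> l = h2 \<or> k = h2 \<and> l = h1) \<and>
      (\<forall>w\<in>S. deriv x w = y w * k w \<and> deriv y w = 3 * x w ^ 5 * k w \<and> l w = x w * k w)"
    and z: "z \<in> ball 0 1"
  shows "max (norm (h1 z)) (norm (h2 z)) * (1 - norm z) \<le> 16"
proof (rule ccontr)
  define N where "N z = max (norm (h1 z)) (norm (h2 z))" for z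
  assume "\<not> max (norm (h1 z)) (norm (h2 z)) * (1 - norm z) \<le> 16"
  then have gt: "N z * (1 - norm z) > 16" by (simp add: N_def)
  have z1: "norm z < 1" using z by simp
  have Npos: "N z > 0" using gt z1 by (smt (verit) mult_nonpos_nonneg)
  \<comment> \<open>The midpoint between |z| + 16 / N z and 1: the product at \<open>z\<close> still
    exceeds 16, and the closed disc of radius r lies inside the unit disc.\<close>
  define r where "r = (1 + norm z + 16 / N z) / 2"
  have "16 / N z < 1 - norm z" using gt Npos by (simp add: divide_less_eq mult.commute)
  then have r: "norm z + 16 / N z < r" "r < 1" by (simp_all add: r_def)
  have rz: "norm z < r" using r(1) Npos by (smt (verit) divide_pos_pos)
  have "continuous_on (ball 0 1) N"
    unfolding N_def[abs_def] using h
    by (intro continuous_on_max continuous_on_norm holomorphic_on_imp_continuous_on)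
  then have cont: "continuous_on (cball 0 r) (\<lambda>z. (r - norm z) * N z)"
    using r(2) by (intro continuous_intros) (auto elim!: continuous_on_subset)
  have "cball (0::complex) r \<noteq> {}" using rz norm_ge_zero[of z] by (simp add: not_less del: norm_ge_zero)
  then obtain z0 where z0: "z0 \<in> cball 0 r" "\<And>w. w \<in> cball 0 r \<Longrightarrow> (r - norm w) * N w \<le> (r - norm z0) * N z0"
    using continuous_attains_sup[OF compact_cball _ cont] by blast
  have "16 < (r - norm z) * N z"
    using r(1) Npos by (simp add: field_simps)
  also have "\<dots> \<le> (r - norm z0) * N z0" using z0(2)[of z] rz by simp
  finally have big: "16 < (r - norm z0) * N z0" .
  define d where "d = (r - norm z0) / 2"
  have N0: "N z0 \<ge> 0" by (simp add: N_def le_max_iff_disj)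
  have d: "d > 0" using big N0 z0(1) by (smt (verit) d_def mem_cball_0 mult_eq_0_iff half_gt_zero)
  have Nz0: "N z0 > 0" using big N0 by (smt (verit) mult_eq_0_iff)
  have nw: "norm w \<le> norm z0 + d" if "w \<in> cball z0 d" for w
    using that norm_triangle_sub[of w z0] by (simp add: dist_norm norm_minus_commute)
  have sub: "cball z0 d \<subseteq> ball 0 1"
  proof
    fix w assume "w \<in> cball z0 d"
    from nw[OF this] show "w \<in> ball 0 1" using r(2) d by (simp add: d_def field_simps)
  qed
  have bd: "N w \<le> 2 * N z0" if w: "w \<in> cball z0 d" for w
  proof -
    have rw: "r - norm w \<ge> d" using nw[OF w] by (simp add: d_def field_simps)
    have "d * N w \<le> (r - norm w) * N w" using rw by (intro mult_right_mono) (auto simp: N_def le_max_iff_disj)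
    also have "\<dots> \<le> (r - norm z0) * N z0" using rw d by (intro z0(2)) simp
    also have "\<dots> = d * (2 * N z0)" by (simp add: d_def)
    finally show ?thesis using d by simp
  qed
  have z0b: "z0 \<in> ball 0 1" using z0(1) r(2) by simp
  obtain S x y k l where S: "open S" "z0 \<in> S" "x holomorphic_on S" "y holomorphic_on S" "norm (x z0) \<le> 1"
    "y z0 ^ 2 = x z0 ^ 6 + 1" and kl: "k = h1 \<and> l = h2 \<or> k = h2 \<and> l = h1" and
    eqs: "\<forall>w\<in>S. deriv x w = y w * k w \<and> deriv y w = 3 * x w ^ 5 * k w \<and> l w = x w * k w"
    using loc[OF z0b] by (elim exE conjE)
  \<comment> \<open>As l = x k with |x| \<le> 1, the form \<open>k\<close> is the larger one at z0,
    so its modulus is the maximum \<open>N z0\<close>.\<close>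
  have "norm (l z0) = norm (x z0) * norm (k z0)" using eqs S(2) by (simp add: norm_mult)
  also have "\<dots> \<le> norm (k z0)" using S(5) by (simp add: mult_left_le_one_le)
  finally have Nk: "norm (k z0) = N z0" using kl by (auto simp: N_def)
  have "d * N z0 < 8"
  proof (rule curve_disc_local_bound[where ?h1.0=k and ?h2.0=l and T="ball 0 1" and S=S and x=x and y=y])
    show "k holomorphic_on ball 0 1" "l holomorphic_on ball 0 1" using h kl by auto
    show "norm (k w) \<le> 2 * N z0" "norm (l w) \<le> 2 * N z0" if "w \<in> cball z0 d" for w
      using bd[OF that] kl by (auto simp: N_def)
  qed (use eqs sub d Nk Nz0 S in auto)
  then show False using big by (simp add: d_def field_simps)
qed

text \<open>The quotient dx/y is undefined at y = 0. On the curve y dy = 3 x^5 dx, hence y dx - x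
  dy/3 = (y^2 - x^6) dx/y = dx/y, and the left side is holomorphic everywhere. This expression
  defines the form in each chart.\<close>

lemma curve_disc_forms:
  assumes S: "open S1" "open S2" "S1 \<union> S2 = ball 0 1"
    and hol: "x holomorphic_on S1" "y holomorphic_on S1" "x' holomorphic_on S2" "y' holomorphic_on S2"
    and eq: "\<And>z. z \<in> S1 \<Longrightarrow> y z ^ 2 = x z ^ 6 + 1" "\<And>z. z \<in> S2 \<Longrightarrow> y' z ^ 2 = x' z ^ 6 + 1"
    and tr: "\<And>z. z \<in> S1 \<inter> S2 \<Longrightarrow> x z \<noteq> 0 \<and> x' z = 1 / x z \<and> y' z = - (y z / x z ^ 3)"
  obtains h1 h2 where "h1 holomorphic_on ball 0 1" "h2 holomorphic_on ball 0 1"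
    "\<And>z. z \<in> S1 \<Longrightarrow> deriv x z = y z * h1 z \<and> deriv y z = 3 * x z ^ 5 * h1 z \<and> h2 z = x z * h1 z"
    "\<And>z. z \<in> S2 \<Longrightarrow> deriv x' z = y' z * h2 z \<and> deriv y' z = 3 * x' z ^ 5 * h2 z \<and> h1 z = x' z * h2 z"
proof -
  have key: "deriv u z = v z * (v z * deriv u z - u z * deriv v z / 3) \<and>
      deriv v z = 3 * u z ^ 5 * (v z * deriv u z - u z * deriv v z / 3)"
    if u: "u holomorphic_on S" and v: "v holomorphic_on S" and S: "open S" "z \<in> S"
      and e: "\<And>z. z \<in> S \<Longrightarrow> v z ^ 2 = u z ^ 6 + 1" for u v :: "complex \<Rightarrow> complex" and S z
  proof -
    have Du: "(u has_field_derivative deriv u z) (at z)" and Dv: "(v has_field_derivative deriv v z) (at z)"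
      using u v S holomorphic_derivI by blast+
    have "((\<lambda>z. v z ^ 2) has_field_derivative 2 * v z * deriv v z) (at z)"
      using Dv by (auto intro!: derivative_eq_intros)
    moreover have "((\<lambda>z. u z ^ 6 + 1) has_field_derivative 6 * u z ^ 5 * deriv u z) (at z)"
      using Du by (auto intro!: derivative_eq_intros)
    moreover have "\<forall>\<^sub>F w in nhds z. v w ^ 2 = u w ^ 6 + 1"
      using eventually_nhds_in_open[OF S] by eventually_elim (rule e)
    ultimately have "((\<lambda>z. v z ^ 2) has_field_derivative 2 * v z * deriv v z) (at z)"
      "((\<lambda>z. v z ^ 2) has_field_derivative 6 * u z ^ 5 * deriv u z) (at z)"
      by (auto simp: DERIV_cong_ev)
    then have "2 * v z * deriv v z = 6 * u z ^ 5 * deriv u z" by (rule DERIV_unique)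
    then have vv: "v z * deriv v z = 3 * u z ^ 5 * deriv u z" by simp
    have ez: "v z * v z = u z ^ 6 + 1" using e[OF S(2)] by (simp add: power2_eq_square)
    have "v z * (v z * deriv u z - u z * deriv v z / 3) = (v z * v z) * deriv u z - u z * (v z * deriv v z) / 3"
      by (simp add: algebra_simps)
    also have "\<dots> = (u z ^ 6 + 1) * deriv u z - u z * (3 * u z ^ 5 * deriv u z) / 3" by (simp only: ez vv)
    also have "\<dots> = deriv u z" by (simp add: algebra_simps eval_nat_numeral)
    finally have 1: "deriv u z = v z * (v z * deriv u z - u z * deriv v z / 3)" by simp
    have "3 * u z ^ 5 * (v z * deriv u z - u z * deriv v z / 3) = v z * (3 * u z ^ 5 * deriv u z) - u z ^ 6 * deriv v z"
      by (simp add: algebra_simps eval_nat_numeral)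
    also have "\<dots> = v z * (v z * deriv v z) - u z ^ 6 * deriv v z" by (simp only: vv)
    also have "\<dots> = (v z * v z) * deriv v z - u z ^ 6 * deriv v z" by (simp only: mult.assoc)
    also have "\<dots> = deriv v z" unfolding ez by (simp add: algebra_simps)
    finally show ?thesis using 1 by simp
  qed
  define k where "k z = y z * deriv x z - x z * deriv y z / 3" for z
  define k' where "k' z = y' z * deriv x' z - x' z * deriv y' z / 3" for z
  have K: "deriv x z = y z * k z" "deriv y z = 3 * x z ^ 5 * k z" if "z \<in> S1" for z
    using key[OF hol(1,2) S(1) that eq(1)] by (simp_all add: k_def)
  have K': "deriv x' z = y' z * k' z" "deriv y' z = 3 * x' z ^ 5 * k' z" if "z \<in> S2" for z
    using key[OF hol(3,4) S(2) that eq(2)] by (simp_all add: k'_def)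
  \<comment> \<open>With x' = 1/x and y' = -y/x^3, the signs of dx' and y' cancel in dx'/y' and
    leave x dx/y.\<close>
  have agree: "k' z = x z * k z" if z: "z \<in> S1 \<inter> S2" for z
  proof -
    have Dx: "(x has_field_derivative y z * k z) (at z)" and Dy: "(y has_field_derivative 3 * x z ^ 5 * k z) (at z)"
      using holomorphic_derivI[OF hol(1) S(1)] holomorphic_derivI[OF hol(2) S(1)] K z by auto
    have x0: "x z \<noteq> 0" using tr[OF z] by simp
    have op: "open (S1 \<inter> S2)" using S by auto
    have "((\<lambda>z. 1 / x z) has_field_derivative - (y z * k z) / (x z)\<^sup>2) (at z)"
      using Dx x0 by (auto intro!: derivative_eq_intros simp: power2_eq_square)
    moreover have "\<forall>\<^sub>F w in nhds z. 1 / x w = x' w"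
      using eventually_nhds_in_open[OF op z] by eventually_elim (simp add: tr)
    ultimately have "(x' has_field_derivative - (y z * k z) / (x z)\<^sup>2) (at z)"
      by (rule has_field_derivative_eventually_eq)
    then have dx': "deriv x' z = - (y z * k z) / (x z)\<^sup>2" by (rule DERIV_imp_deriv)
    have "((\<lambda>z. - (y z / x z ^ 3)) has_field_derivative
        - ((3 * x z ^ 5 * k z * x z ^ 3 - y z * (3 * x z ^ 2 * (y z * k z))) / (x z ^ 3 * x z ^ 3))) (at z)"
      using Dx Dy x0 by (auto intro!: derivative_eq_intros)
    moreover have "\<forall>\<^sub>F w in nhds z. - (y w / x w ^ 3) = y' w"
      using eventually_nhds_in_open[OF op z] by eventually_elim (simp add: tr)
    ultimately have "(y' has_field_derivative
        - ((3 * x z ^ 5 * k z * x z ^ 3 - y z * (3 * x z ^ 2 * (y z * k z))) / (x z ^ 3 * x z ^ 3))) (at z)"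
      by (rule has_field_derivative_eventually_eq)
    then have dy': "deriv y' z =
        - ((3 * x z ^ 5 * k z * x z ^ 3 - y z * (3 * x z ^ 2 * (y z * k z))) / (x z ^ 3 * x z ^ 3))"
      by (rule DERIV_imp_deriv)
    have t: "x' z = 1 / x z" "y' z = - (y z / x z ^ 3)" using tr[OF z] by auto
    show ?thesis
      unfolding k'_def dx' dy' t using x0
      by (simp add: field_simps eval_nat_numeral)
  qed
  \<comment> \<open>In the second chart dx/y is x' dx'/y', the mirror image of x dx/y in the first;
    \<open>agree\<close> makes the definitions fit on the overlap.\<close>
  define h1 where "h1 z = (if z \<in> S1 then k z else x' z * k' z)" for z
  define h2 where "h2 z = (if z \<in> S2 then k' z else x z * k z)" for z
  have h1: "h1 z = k z" if "z \<in> S1" for z using that by (simp add: h1_def)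
  have h1': "h1 z = x' z * k' z" if "z \<in> S2" for z
    using that agree[of z] tr[of z] by (cases "z \<in> S1") (auto simp: h1_def)
  have h2: "h2 z = k' z" if "z \<in> S2" for z using that by (simp add: h2_def)
  have h2': "h2 z = x z * k z" if "z \<in> S1" for z
    using that agree[of z] by (cases "z \<in> S2") (auto simp: h2_def)
  have holk: "k holomorphic_on S1" "k' holomorphic_on S2"
    unfolding k_def k'_def using hol S by (auto intro!: holomorphic_intros holomorphic_deriv)
  have 1: "h1 holomorphic_on S1 \<union> S2"
  proof (rule holomorphic_on_Un)
    show "h1 holomorphic_on S1" using holk(1) by (rule holomorphic_transform) (simp add: h1)
    have "(\<lambda>z. x' z * k' z) holomorphic_on S2" using hol holk by (intro holomorphic_intros)
    then show "h1 holomorphic_on S2" by (rule holomorphic_transform) (simp add: h1')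
  qed (use S in auto)
  have 2: "h2 holomorphic_on S1 \<union> S2"
  proof (rule holomorphic_on_Un)
    have "(\<lambda>z. x z * k z) holomorphic_on S1" using hol holk by (intro holomorphic_intros)
    then show "h2 holomorphic_on S1" by (rule holomorphic_transform) (simp add: h2')
    show "h2 holomorphic_on S2" using holk(2) by (rule holomorphic_transform) (simp add: h2)
  qed (use S in auto)
  show ?thesis
    by (rule that[of h1 h2]) (use 1 2 S K K' h1 h1' h2 h2' in auto)
qed

text \<open>A bound on value and first derivative of a function of one real variable. Real
  derivatives are used because the functions contain conjugates and are not complex
  differentiable.\<close>

definition bounded_slope :: "(real \<Rightarrow> complex) \<Rightarrow> real \<Rightarrow> real \<Rightarrow> real \<Rightarrow> bool" where
  "bounded_slope f t v d \<longleftrightarrow> norm (f t) \<le> v \<and> (\<exists>D. (f has_vector_derivative D) (at t) \<and> norm D \<le> d)"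

lemma bounded_slope_mult:
  assumes "bounded_slope f t v d" "bounded_slope g t v' d'"
  shows "bounded_slope (\<lambda>s. f s * g s) t (v * v') (v * d' + d * v')"
proof -
  obtain D D' where D: "(f has_vector_derivative D) (at t)" "norm D \<le> d" "norm (f t) \<le> v"
    and D': "(g has_vector_derivative D') (at t)" "norm D' \<le> d'" "norm (g t) \<le> v'"
    using assms by (auto simp: bounded_slope_def)
  have "norm (f t * D' + D * g t) \<le> norm (f t) * norm D' + norm D * norm (g t)"
    by (metis norm_mult norm_triangle_ineq)
  also have "\<dots> \<le> v * d' + d * v'"
    using D D' by (intro add_mono mult_mono) (auto intro: order_trans[OF norm_ge_zero])
  finally have "norm (f t * D' + D * g t) \<le> v * d' + d * v'" .
  moreover have "norm (f t * g t) \<le> v * v'"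
    unfolding norm_mult using D D' by (intro mult_mono) (auto intro: order_trans[OF norm_ge_zero])
  ultimately show ?thesis
    unfolding bounded_slope_def using has_vector_derivative_mult[OF D(1) D'(1)] by blast
qed

lemma bounded_slope_cnj: "bounded_slope f t v d \<Longrightarrow> bounded_slope (\<lambda>s. cnj (f s)) t v d"
  unfolding bounded_slope_def using has_vector_derivative_cnj by (metis complex_mod_cnj)

lemma bounded_slope_minus: "bounded_slope f t v d \<Longrightarrow> bounded_slope (\<lambda>s. - f s) t v d"
  unfolding bounded_slope_def using has_vector_derivative_minus by (metis norm_minus_cancel)

lemma bounded_slope_one_minus:
  assumes "bounded_slope f t v d" shows "bounded_slope (\<lambda>s. 1 - f s) t (1 + v) d"
proof -
  obtain D where D: "(f has_vector_derivative D) (at t)" "norm D \<le> d" "norm (f t) \<le> v"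
    using assms by (auto simp: bounded_slope_def)
  have "((\<lambda>s. 1 - f s) has_vector_derivative 0 - D) (at t)"
    by (intro has_vector_derivative_diff has_vector_derivative_const D)
  moreover have "norm (1 - f t) \<le> 1 + v" using norm_triangle_ineq4[of 1 "f t"] D(3) by simp
  ultimately show ?thesis unfolding bounded_slope_def using D(2) by (intro conjI exI[of _ "0 - D"]) auto
qed

lemma bounded_slope_mono: "bounded_slope f t v d \<Longrightarrow> v \<le> v' \<Longrightarrow> d \<le> d' \<Longrightarrow> bounded_slope f t v' d'"
  unfolding bounded_slope_def by (meson order_trans)

text \<open>The denominator 1 + |x|^2 is at least 1, so taking the reciprocal does not enlarge the
  slope, which is 2d for |x|^2 with |x| \<le> 1.\<close>

lemma bounded_slope_weight:
  assumes "bounded_slope x t 1 d"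
  shows "bounded_slope (\<lambda>s. 1 / (1 + x s * cnj (x s))) t 1 (2 * d)"
proof -
  have "bounded_slope (\<lambda>s. x s * cnj (x s)) t (1 * 1) (1 * d + d * 1)"
    by (intro bounded_slope_mult bounded_slope_cnj assms)
  then obtain D where D: "((\<lambda>s. x s * cnj (x s)) has_vector_derivative D) (at t)" "norm D \<le> 2 * d"
    by (auto simp: bounded_slope_def)
  define w where "w s = 1 + x s * cnj (x s)" for s
  have Dw: "(w has_vector_derivative D) (at t)"
    unfolding w_def[abs_def] using has_vector_derivative_add[OF has_vector_derivative_const[of 1] D(1)] by simp
  have "w t = of_real (1 + (norm (x t))\<^sup>2)" by (simp only: w_def complex_norm_square of_real_add of_real_1)
  then have nw: "norm (w t) = 1 + (norm (x t))\<^sup>2" by (simp only: norm_of_real) simp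
  then have w1: "norm (w t) \<ge> 1" by simp
  then have w0: "w t \<noteq> 0" by auto
  have "((\<lambda>z. 1 / z) has_field_derivative - 1 / (w t)\<^sup>2) (at (w t))"
    using w0 by (auto intro!: derivative_eq_intros simp: power2_eq_square)
  from field_vector_diff_chain_at[OF Dw this]
  have "((\<lambda>s. 1 / w s) has_vector_derivative D * (- 1 / (w t)\<^sup>2)) (at t)" by (simp add: comp_def)
  moreover have "norm (D * (- 1 / (w t)\<^sup>2)) \<le> 2 * d"
  proof -
    have "1 \<le> (norm (w t))\<^sup>2" using w1 by simp
    then have "norm D / (norm (w t))\<^sup>2 \<le> norm D" by (simp add: divide_le_eq mult_left_le field_simps)
        (metis mult_left_mono mult.right_neutral norm_ge_zero)
    then show ?thesis using D(2) by (simp add: norm_mult norm_divide norm_power)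
  qed
  moreover have "norm (1 / w t) \<le> 1" using w1 by (simp add: norm_divide divide_le_eq)
  ultimately show ?thesis unfolding bounded_slope_def w_def by blast
qed

text \<open>The product rule gives values at most 2 and slopes at most 39 m; 10, 100 and 100 m are
  round numbers above them.\<close>

lemma bounded_slope_embedding:
  assumes x: "bounded_slope x t 1 (2 * m)" and y: "bounded_slope y t 2 (3 * m)" and m: "m \<ge> 0"
  shows "bounded_slope (\<lambda>s. x s / (1 + x s * cnj (x s))) t 100 (100 * m)"
    and "bounded_slope (\<lambda>s. 1 / (1 + x s * cnj (x s))) t 10 (100 * m)"
    and "bounded_slope (\<lambda>s. y s / (1 + x s * cnj (x s)) ^ 3) t 100 (100 * m)"
    and "bounded_slope (\<lambda>s. y s * cnj (x s) ^ 3 / (1 + x s * cnj (x s)) ^ 3) t 100 (100 * m)"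
proof -
  note w = bounded_slope_weight[OF x]
  note w3 = bounded_slope_mult[OF w bounded_slope_mult[OF w w]]
  note cx = bounded_slope_cnj[OF x]
  note cx3 = bounded_slope_mult[OF cx bounded_slope_mult[OF cx cx]]
  show "bounded_slope (\<lambda>s. x s / (1 + x s * cnj (x s))) t 100 (100 * m)"
    using bounded_slope_mono[OF bounded_slope_mult[OF x w], of 100 "100 * m"] m by simp
  show "bounded_slope (\<lambda>s. 1 / (1 + x s * cnj (x s))) t 10 (100 * m)"
    using bounded_slope_mono[OF w, of 10 "100 * m"] m by simp
  show "bounded_slope (\<lambda>s. y s / (1 + x s * cnj (x s)) ^ 3) t 100 (100 * m)"
    using bounded_slope_mono[OF bounded_slope_mult[OF y w3], of 100 "100 * m"] m by (simp add: power3_eq_cube mult.assoc)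
  show "bounded_slope (\<lambda>s. y s * cnj (x s) ^ 3 / (1 + x s * cnj (x s)) ^ 3) t 100 (100 * m)"
    using bounded_slope_mono[OF bounded_slope_mult[OF bounded_slope_mult[OF y cx3] w3], of 100 "100 * m"] m
    by (simp add: power3_eq_cube mult.assoc)
qed

text \<open>Along the ray from 0 to \<open>z\<close> the slope at parameter t is at most C|z|/(1 -
  t|z|), and the integral of this over the unit interval is -C ln (1 - |z|).\<close>

lemma lipschitz_of_bounded_slope:
  fixes u :: "complex \<Rightarrow> complex"
  assumes u: "\<And>z. z \<in> ball 0 1 \<Longrightarrow> \<forall>w. bounded_slope (\<lambda>s. u (z + of_real s * w)) 0 V (C * norm w / (1 - norm z))"
    and z: "z \<in> ball 0 1"
  shows "norm (u z - u 0) \<le> C * (- ln (1 - norm z))"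
proof -
  define g where "g t = u (of_real t * z)" for t :: real
  have zt: "of_real t * z \<in> ball 0 1" "norm (of_real t * z) = t * norm z" "t * norm z < 1" if "0 \<le> t" "t \<le> 1" for t
  proof -
    show n: "norm (of_real t * z) = t * norm z" using that by (simp add: norm_mult)
    have "t * norm z \<le> 1 * norm z" using that by (intro mult_right_mono) auto
    then show "t * norm z < 1" using z by simp
    then show "of_real t * z \<in> ball 0 1" using n by simp
  qed
  have deriv: "\<exists>D. (g has_vector_derivative D) (at t) \<and> norm D \<le> C * norm z / (1 - t * norm z)"
    if t: "0 \<le> t" "t \<le> 1" for t
  proof -
    obtain D where D: "((\<lambda>s. u (of_real t * z + of_real s * z)) has_vector_derivative D) (at 0)"
      "norm D \<le> C * norm z / (1 - t * norm z)"
      using u[OF zt(1)[OF t], rule_format, of z] zt(2)[OF t] by (auto simp: bounded_slope_def)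
    have "((\<lambda>s. s - t) has_vector_derivative 1) (at t)"
      by (auto intro!: derivative_eq_intros simp: has_vector_derivative_def)
    then have "((\<lambda>s. u (of_real t * z + of_real s * z)) \<circ> (\<lambda>s. s - t) has_vector_derivative 1 *\<^sub>R D) (at t)"
      by (rule vector_diff_chain_at) (use D(1) in simp)
    moreover have "(\<lambda>s. u (of_real t * z + of_real s * z)) \<circ> (\<lambda>s. s - t) = g"
      by (auto simp: g_def fun_eq_iff algebra_simps)
    ultimately show ?thesis using D(2) by auto
  qed
  then obtain D where D: "\<And>t. 0 \<le> t \<Longrightarrow> t \<le> 1 \<Longrightarrow> (g has_vector_derivative D t) (at t)"
    "\<And>t. 0 \<le> t \<Longrightarrow> t \<le> 1 \<Longrightarrow> norm (D t) \<le> C * norm z / (1 - t * norm z)" by metis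
  have "norm (g 1 - g 0) \<le> (- C * ln (1 - 1 * norm z)) - (- C * ln (1 - 0 * norm z))"
  proof (rule differentiable_bound_general[where f'=D and \<phi>'="\<lambda>t. C * norm z / (1 - t * norm z)"])
    show "continuous_on {0..1} g"
      using D(1) by (intro continuous_at_imp_continuous_on ballI has_vector_derivative_continuous) auto
    show "continuous_on {0..1} (\<lambda>t. - C * ln (1 - t * norm z))"
      by (intro continuous_intros) (use zt(3) in fastforce)
    show "((\<lambda>t. - C * ln (1 - t * norm z)) has_vector_derivative C * norm z / (1 - t * norm z)) (at t)"
      if "0 < t" "t < 1" for t
      unfolding has_real_derivative_iff_has_vector_derivative[symmetric]
      using zt(3)[of t] that by (auto intro!: derivative_eq_intros)
  qed (use D in auto)
  then show ?thesis by (simp add: g_def)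
qed

text \<open>\<open>u0\<close> to \<open>u3\<close> are coordinates of an embedding of the compact
  curve. At every parameter one of the two charts has coordinate of modulus at most one, where the
  forms bound the slopes; passing to the other chart changes the coordinates only by conjugation,
  sign and t to 1 - t. The constant is 16 from the forms times 100 from the embedding.\<close>

lemma curve_disc_lipschitz:
  assumes S: "open S1" "open S2" "S1 \<union> S2 = ball 0 1"
    and hol: "x holomorphic_on S1" "y holomorphic_on S1" "x' holomorphic_on S2" "y' holomorphic_on S2"
    and eq: "\<And>z. z \<in> S1 \<Longrightarrow> y z ^ 2 = x z ^ 6 + 1" "\<And>z. z \<in> S2 \<Longrightarrow> y' z ^ 2 = x' z ^ 6 + 1"
    and tr: "\<And>z. z \<in> S1 \<inter> S2 \<Longrightarrow> x z \<noteq> 0 \<and> x' z = 1 / x z \<and> y' z = - (y z / x z ^ 3)"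
    and small: "\<And>z. z \<in> ball 0 1 \<Longrightarrow> z \<in> S1 \<and> norm (x z) \<le> 1 \<or> z \<in> S2 \<and> norm (x' z) \<le> 1"
    and u1: "\<And>z. z \<in> S1 \<Longrightarrow> u0 z = x z / (1 + x z * cnj (x z)) \<and> u1 z = 1 / (1 + x z * cnj (x z)) \<and>
      u2 z = y z / (1 + x z * cnj (x z)) ^ 3 \<and> u3 z = y z * cnj (x z) ^ 3 / (1 + x z * cnj (x z)) ^ 3"
    and u2: "\<And>z. z \<in> S2 \<Longrightarrow> u0 z = cnj (x' z / (1 + x' z * cnj (x' z))) \<and> u1 z = 1 - 1 / (1 + x' z * cnj (x' z)) \<and>
      u2 z = - (y' z * cnj (x' z) ^ 3 / (1 + x' z * cnj (x' z)) ^ 3) \<and> u3 z = - (y' z / (1 + x' z * cnj (x' z)) ^ 3)"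
    and u: "u \<in> {u0, u1, u2, u3}" and z: "z \<in> ball 0 1"
  shows "norm (u z - u 0) \<le> 1600 * (- ln (1 - norm z))"
proof -
  obtain h1 h2 where h: "h1 holomorphic_on ball 0 1" "h2 holomorphic_on ball 0 1"
    and f1: "\<And>z. z \<in> S1 \<Longrightarrow> deriv x z = y z * h1 z \<and> deriv y z = 3 * x z ^ 5 * h1 z \<and> h2 z = x z * h1 z"
    and f2: "\<And>z. z \<in> S2 \<Longrightarrow> deriv x' z = y' z * h2 z \<and> deriv y' z = 3 * x' z ^ 5 * h2 z \<and> h1 z = x' z * h2 z"
    using curve_disc_forms[OF S hol eq tr] by metis
  have bound: "max (norm (h1 z)) (norm (h2 z)) * (1 - norm z) \<le> 16" if z: "z \<in> ball 0 1" for z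
  proof (rule curve_disc_bound[OF h _ z])
    fix z :: complex assume z: "z \<in> ball 0 1"
    show "\<exists>S x y k l. open S \<and> z \<in> S \<and> x holomorphic_on S \<and> y holomorphic_on S \<and>
      norm (x z) \<le> 1 \<and> y z ^ 2 = x z ^ 6 + 1 \<and> (k = h1 \<and> l = h2 \<or> k = h2 \<and> l = h1) \<and>
      (\<forall>w\<in>S. deriv x w = y w * k w \<and> deriv y w = 3 * x w ^ 5 * k w \<and> l w = x w * k w)"
      using small[OF z]
    proof
      assume "z \<in> S1 \<and> norm (x z) \<le> 1"
      then show ?thesis using S hol eq f1
        by (intro exI[of _ S1] exI[of _ x] exI[of _ y] exI[of _ h1] exI[of _ h2]) auto
    next
      assume "z \<in> S2 \<and> norm (x' z) \<le> 1"
      then show ?thesis using S hol eq f2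
        by (intro exI[of _ S2] exI[of _ x'] exI[of _ y'] exI[of _ h2] exI[of _ h1]) auto
    qed
  qed
  \<comment> \<open>Here da = b k w and db = 3 a^5 k w in direction \<open>w\<close>; with |a| \<le>
    1 the curve gives |b|^2 \<le> 2, so |b| \<le> 2, whence the factors 2 and 3.\<close>
  have curve_bs: "bounded_slope (\<lambda>s. a (z + of_real s * w)) 0 1 (2 * m) \<and> bounded_slope (\<lambda>s. b (z + of_real s * w)) 0 2 (3 * m)"
    if S: "open S" "z \<in> S" and ab: "a holomorphic_on S" "b holomorphic_on S" and a1: "norm (a z) \<le> 1"
      and e: "b z ^ 2 = a z ^ 6 + 1" and d: "deriv a z = b z * k" "deriv b z = 3 * a z ^ 5 * k"
      and k: "norm k * norm w \<le> m" for S z w and a b :: "complex \<Rightarrow> complex" and k m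
  proof -
    have path: "((\<lambda>s::real. z + of_real s * w) has_vector_derivative w) (at 0)"
      unfolding has_vector_derivative_def by (auto intro!: derivative_eq_intros simp: scaleR_conv_of_real)
    have ch: "((\<lambda>s. c (z + of_real s * w)) has_vector_derivative w * deriv c z) (at 0)" if "c holomorphic_on S" for c
      using field_vector_diff_chain_at[OF path, of c "deriv c z"] holomorphic_derivI[OF that S(1,2)]
      by (simp add: comp_def)
    have an: "norm (a z) ^ n \<le> 1" for n using a1 by (simp add: power_le_one)
    have "norm (b z) ^ 2 \<le> norm (a z ^ 6) + 1"
      using norm_triangle_ineq[of "a z ^ 6" 1] e by (metis norm_power norm_one)
    also have "\<dots> \<le> 2 ^ 2" using an[of 6] by (simp add: norm_power)
    finally have b2: "norm (b z) \<le> 2" by (rule power2_le_imp_le) simp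
    have "norm (w * deriv a z) = norm (b z) * (norm k * norm w)" by (simp add: d norm_mult mult_ac)
    also have "\<dots> \<le> 2 * m" using b2 k by (intro mult_mono) auto
    finally have 1: "norm (w * deriv a z) \<le> 2 * m" .
    have "norm (w * deriv b z) = 3 * (norm (a z) ^ 5 * (norm k * norm w))" by (simp add: d norm_mult norm_power mult_ac)
    also have "\<dots> \<le> 3 * (1 * m)" using an[of 5] k by (intro mult_mono) auto
    finally have 2: "norm (w * deriv b z) \<le> 3 * m" by simp
    show ?thesis using ch[OF ab(1)] ch[OF ab(2)] 1 2 a1 b2 unfolding bounded_slope_def by auto
  qed
  have slope_cong: "bounded_slope f 0 v d \<Longrightarrow> (\<forall>\<^sub>F s in nhds 0. f s = g s) \<Longrightarrow> bounded_slope g 0 v d" for f g v d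
  proof -
    assume f: "bounded_slope f 0 v d" and ev: "\<forall>\<^sub>F s in nhds 0. f s = g s"
    have "f 0 = g 0" using eventually_nhds_x_imp_x[OF ev] .
    have "(f has_vector_derivative D) (at 0) \<Longrightarrow> (g has_vector_derivative D) (at 0)" for D
      using has_vector_derivative_cong_ev[where x=0 and S=UNIV and f=f and g=g and f'=D] ev \<open>f 0 = g 0\<close>
      by simp
    then show "bounded_slope g 0 v d" using f \<open>f 0 = g 0\<close> unfolding bounded_slope_def by auto
  qed
  have ev: "\<forall>\<^sub>F s::real in nhds 0. z + of_real s * w \<in> S" if "open S" "z \<in> S" for S and z w :: complex
  proof -
    have "isCont (\<lambda>s::real. z + of_real s * w) 0" by (intro continuous_intros)
    then have "((\<lambda>s::real. z + of_real s * w) \<longlongrightarrow> z) (nhds 0)"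
      using tendsto_at_iff_tendsto_nhds[of "\<lambda>s::real. z + of_real s * w" 0] by (simp add: isCont_def)
    then show ?thesis using that topological_tendstoD by blast
  qed
  show ?thesis
  proof (rule lipschitz_of_bounded_slope[where V = 101, OF _ z], rule allI)
    fix z w :: complex assume z: "z \<in> ball 0 1"
    \<comment> \<open>The bound of \<open>curve_disc_bound\<close> at \<open>z\<close>, evaluated on
      the tangent vector \<open>w\<close>.\<close>
    define m where "m = 16 / (1 - norm z) * norm w"
    have z1: "1 - norm z > 0" using z by simp
    have m: "m \<ge> 0" unfolding m_def using z1 by (intro mult_nonneg_nonneg divide_nonneg_pos) auto
    have hm: "norm (h1 z) * norm w \<le> m" "norm (h2 z) * norm w \<le> m"
    proof -
      have "norm (h1 z) \<le> 16 / (1 - norm z)" "norm (h2 z) \<le> 16 / (1 - norm z)"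
        using bound[OF z] z1 by (auto simp: pos_le_divide_eq max_mult_distrib_right)
      then show "norm (h1 z) * norm w \<le> m" "norm (h2 z) * norm w \<le> m"
        unfolding m_def by (intro mult_right_mono; simp)+
    qed
    have c: "1600 * norm w / (1 - norm z) = 100 * m" by (simp add: m_def)
    have "bounded_slope (\<lambda>s. u (z + of_real s * w)) 0 101 (100 * m)"
      using small[OF z]
    proof
      assume z1: "z \<in> S1 \<and> norm (x z) \<le> 1"
      note bs = curve_bs[OF S(1) conjunct1[OF z1] hol(1,2) conjunct2[OF z1] eq(1)[OF conjunct1[OF z1]]
          conjunct1[OF f1[OF conjunct1[OF z1]]] conjunct1[OF conjunct2[OF f1[OF conjunct1[OF z1]]]] hm(1)]
      note E = bounded_slope_embedding[OF conjunct1[OF bs] conjunct2[OF bs] m]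
      note evS = ev[OF S(1) conjunct1[OF z1], of w]
      have "bounded_slope (\<lambda>s. u0 (z + of_real s * w)) 0 101 (100 * m)"
        by (rule slope_cong[OF bounded_slope_mono[OF E(1)]]) (use evS in \<open>auto elim!: eventually_mono simp: u1\<close>)
      moreover have "bounded_slope (\<lambda>s. u1 (z + of_real s * w)) 0 101 (100 * m)"
        by (rule slope_cong[OF bounded_slope_mono[OF E(2)]]) (use evS in \<open>auto elim!: eventually_mono simp: u1\<close>)
      moreover have "bounded_slope (\<lambda>s. u2 (z + of_real s * w)) 0 101 (100 * m)"
        by (rule slope_cong[OF bounded_slope_mono[OF E(3)]]) (use evS in \<open>auto elim!: eventually_mono simp: u1\<close>)
      moreover have "bounded_slope (\<lambda>s. u3 (z + of_real s * w)) 0 101 (100 * m)"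
        by (rule slope_cong[OF bounded_slope_mono[OF E(4)]]) (use evS in \<open>auto elim!: eventually_mono simp: u1\<close>)
      ultimately show ?thesis using u by auto
    next
      assume z2: "z \<in> S2 \<and> norm (x' z) \<le> 1"
      note bs = curve_bs[OF S(2) conjunct1[OF z2] hol(3,4) conjunct2[OF z2] eq(2)[OF conjunct1[OF z2]]
          conjunct1[OF f2[OF conjunct1[OF z2]]] conjunct1[OF conjunct2[OF f2[OF conjunct1[OF z2]]]] hm(2)]
      note E = bounded_slope_embedding[OF conjunct1[OF bs] conjunct2[OF bs] m]
      note evS = ev[OF S(2) conjunct1[OF z2], of w]
      have "bounded_slope (\<lambda>s. u0 (z + of_real s * w)) 0 101 (100 * m)"
        by (rule slope_cong[OF bounded_slope_mono[OF bounded_slope_cnj[OF E(1)]]])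
          (use evS in \<open>auto elim!: eventually_mono simp: u2\<close>)
      moreover have "bounded_slope (\<lambda>s. u1 (z + of_real s * w)) 0 101 (100 * m)"
        by (rule slope_cong[OF bounded_slope_mono[OF bounded_slope_one_minus[OF E(2)]]])
          (use evS in \<open>auto elim!: eventually_mono simp: u2\<close>)
      moreover have "bounded_slope (\<lambda>s. u2 (z + of_real s * w)) 0 101 (100 * m)"
        by (rule slope_cong[OF bounded_slope_mono[OF bounded_slope_minus[OF E(4)]]])
          (use evS in \<open>auto elim!: eventually_mono simp: u2\<close>)
      moreover have "bounded_slope (\<lambda>s. u3 (z + of_real s * w)) 0 101 (100 * m)"
        by (rule slope_cong[OF bounded_slope_mono[OF bounded_slope_minus[OF E(3)]]])
          (use evS in \<open>auto elim!: eventually_mono simp: u2\<close>)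
      ultimately show ?thesis using u by auto
    qed
    then show "bounded_slope (\<lambda>s. u (z + of_real s * w)) 0 101 (1600 * norm w / (1 - norm z))"
      unfolding c .
  qed
qed

section \<open>The affine varieties\<close>

lemma secs_const: "V \<subseteq> Cn n \<Longrightarrow> (\<lambda>_. c) \<in> secs n V"
  by (rule secsI[of UNIV]) auto

lemma secs_combine:
  assumes V: "V \<subseteq> Cn n" and f: "f \<in> secs n V" and g: "g \<in> secs n V"
    and op: "\<And>F G z. holo_at n F z \<Longrightarrow> holo_at n G z \<Longrightarrow> holo_at n (\<lambda>w. p (F w) (G w)) z"
  shows "(\<lambda>z. p (f z) (g z)) \<in> secs n V"
proof (rule secsI')
  fix a assume a: "a \<in> V"
  obtain W F where W: "a \<in> W" "holomorphic_Cn n W F" "\<forall>z\<in>V \<inter> W. f z = F z"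
    by (rule secsE[OF f a]) (rule that)
  obtain W' G where W': "a \<in> W'" "holomorphic_Cn n W' G" "\<forall>z\<in>V \<inter> W'. g z = G z"
    by (rule secsE[OF g a]) (rule that)
  have "holomorphic_Cn n (W \<inter> W') (\<lambda>z. p (F z) (G z))"
    using W(2) W'(2) op by (auto simp: holomorphic_Cn_iff)
  then show "\<exists>W F. a \<in> W \<and> holomorphic_Cn n W F \<and> (\<forall>z\<in>V \<inter> W. p (f z) (g z) = F z)"
    using W W' by (intro exI[of _ "W \<inter> W'"] exI[of _ "\<lambda>z. p (F z) (G z)"]) auto
qed

lemma ring_sheaf_space_of_subset:
  assumes "A \<subseteq> Cn n"
  shows "ring_sheaf (space_of_subset n A)"
  unfolding ring_sheaf_def
proof (intro allI impI conjI ballI)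
  fix U assume "openin (topo (space_of_subset n A)) U"
  then have U: "U \<subseteq> Cn n" using assms by (auto dest: openin_imp_subset)
  show "(\<lambda>_. c) \<in> sections (space_of_subset n A) U" for c
    using secs_const[OF U] by simp
  fix f g assume fg: "f \<in> sections (space_of_subset n A) U" "g \<in> sections (space_of_subset n A) U"
  show "(\<lambda>x. f x + g x) \<in> sections (space_of_subset n A) U"
    unfolding space_of_subset_simps
    by (rule secs_combine[where p="(+)", OF U fg[unfolded space_of_subset_simps] holo_at_add])
  show "(\<lambda>x. f x * g x) \<in> sections (space_of_subset n A) U"
    unfolding space_of_subset_simps
    by (rule secs_combine[where p="(*)", OF U fg[unfolded space_of_subset_simps] holo_at_mult])
qed

lemma holo_at_comp_fun:
  assumes "g holomorphic_on S" "open S" "F z \<in> S" "holo_at n F z"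
  shows "holo_at n (\<lambda>w. g (F w)) z"
  by (rule holo_at_compose_1[OF assms(4)]) (rule holomorphic_on_imp_differentiable_at[OF assms(1-3)])

lemmas holo_intros = holo_at_const holo_at_add holo_at_mult holo_at_diff holo_at_uminus holo_at_power
  holo_at_divide holo_at_coord

lemma open_coord: "open S \<Longrightarrow> open {z :: nat \<Rightarrow> complex. z i \<in> S}"
  using open_vimage[of S "\<lambda>z::nat \<Rightarrow> complex. z i"] by (simp add: vimage_def)

lemma continuous_on_coord: "continuous_on S (\<lambda>z :: nat \<Rightarrow> complex. z i)"
  by (rule continuous_on_subset[OF continuous_on_product_coordinates]) simp

lemma polynomial_Cn_power:
  assumes "polynomial_Cn n p"
  shows "polynomial_Cn n (\<lambda>z. p z ^ k)"
proof (induction k)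
  case 0
  then show ?case using polynomial_Cn.const[of n 1] by simp
next
  case (Suc k)
  then show ?case using polynomial_Cn.mult[OF assms] by simp
qed

lemma holo_at_polynomial: "polynomial_Cn n p \<Longrightarrow> holo_at n p z"
  by (induction rule: polynomial_Cn.induct) (auto intro: holo_intros)

lemma analytic_subset_polynomials:
  assumes "finite P" "\<And>p. p \<in> P \<Longrightarrow> polynomial_Cn n p" "A = {z \<in> Cn n. \<forall>p\<in>P. p z = 0}"
  shows "analytic_subset n (Cn n) A"
  unfolding analytic_subset_def
  using assms holo_at_polynomial
  by (intro conjI ballI exI[of _ "Cn n"] exI[of _ P]) (auto simp: holomorphic_Cn_iff)

definition vec4 :: "complex \<Rightarrow> complex \<Rightarrow> complex \<Rightarrow> complex \<Rightarrow> nat \<Rightarrow> complex" where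
  "vec4 a b c d = (\<lambda>i. if i = 0 then a else if i = 1 then b else if i = 2 then c else if i = 3 then d else 0)"

lemma vec4_simps [simp]:
  "vec4 a b c d 0 = a" "vec4 a b c d (Suc 0) = b" "vec4 a b c d 1 = b" "vec4 a b c d 2 = c"
  "vec4 a b c d 3 = d" "vec4 a b c d \<in> Cn 4"
  by (auto simp: vec4_def Cn_def)

lemma less_4_cases:
  assumes "(j::nat) < 4"
  obtains "j = 0" | "j = 1" | "j = 2" | "j = 3"
  using assms by linarith

lemma Cn4_eqI:
  assumes "z \<in> Cn 4" "w \<in> Cn 4" "z 0 = w 0" "z 1 = w 1" "z 2 = w 2" "z 3 = w 3"
  shows "z = w"
proof
  fix i
  show "z i = w i"
  proof (cases "i < 4")
    case True
    then show ?thesis by (cases rule: less_4_cases) (use assms in auto)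
  qed (use assms in \<open>auto simp: Cn_def\<close>)
qed

lemma continuous_on_vec4:
  assumes "continuous_on S a" "continuous_on S b" "continuous_on S c" "continuous_on S d"
  shows "continuous_on S (\<lambda>x. vec4 (a x) (b x) (c x) (d x))"
proof (rule continuous_on_coordinatewise_then_product)
  fix i
  show "continuous_on S (\<lambda>x. vec4 (a x) (b x) (c x) (d x) i)"
  proof (cases "i < 4")
    case True
    then show ?thesis by (cases rule: less_4_cases) (use assms in auto)
  qed (simp add: vec4_def)
qed

text \<open>Entries 0 to 3 are x, y, w, u. In \<open>pinched_square\<close> entry 1 is v, which is y
  w on the image of \<open>pinch\<close>.\<close>

definition curve_square :: "(nat \<Rightarrow> complex) set" where
  "curve_square = {z \<in> Cn 4. z 1 ^ 2 = z 0 ^ 6 + 1 \<and> z 3 ^ 2 = z 2 ^ 6 + 1}"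

definition pinched_square :: "(nat \<Rightarrow> complex) set" where
  "pinched_square = {z \<in> Cn 4. z 1 ^ 2 = (z 0 ^ 6 + 1) * z 2 ^ 2 \<and> z 3 ^ 2 = z 2 ^ 6 + 1}"

definition pinch :: "(nat \<Rightarrow> complex) \<Rightarrow> nat \<Rightarrow> complex" where
  "pinch z = vec4 (z 0) (z 1 * z 2) (z 2) (z 3)"

definition unpinch :: "(nat \<Rightarrow> complex) \<Rightarrow> nat \<Rightarrow> complex" where
  "unpinch z = vec4 (z 0) (z 1 / z 2) (z 2) (z 3)"

lemma curve_square_subset: "curve_square \<subseteq> Cn 4"
  and pinched_square_subset: "pinched_square \<subseteq> Cn 4"
  by (auto simp: curve_square_def pinched_square_def)

lemma pinch_in: "z \<in> curve_square \<Longrightarrow> pinch z \<in> pinched_square"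
  by (simp add: curve_square_def pinched_square_def pinch_def power_mult_distrib)

lemma unpinch_in: "z \<in> pinched_square \<Longrightarrow> z 2 \<noteq> 0 \<Longrightarrow> unpinch z \<in> curve_square"
  by (simp add: curve_square_def pinched_square_def unpinch_def power_divide)

lemma unpinch_pinch: "z \<in> Cn 4 \<Longrightarrow> z 2 \<noteq> 0 \<Longrightarrow> unpinch (pinch z) = z"
  by (rule Cn4_eqI) (auto simp: unpinch_def pinch_def)

lemma pinch_unpinch: "z \<in> Cn 4 \<Longrightarrow> z 2 \<noteq> 0 \<Longrightarrow> pinch (unpinch z) = z"
  by (rule Cn4_eqI) (auto simp: unpinch_def pinch_def)

lemma pinched_square_polynomials:
  "\<exists>P. finite P \<and> (\<forall>p\<in>P. polynomial_Cn 4 p) \<and> pinched_square = {z \<in> Cn 4. \<forall>p\<in>P. p z = 0}"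
proof -
  define p1 where "p1 z = z 1 ^ 2 + (-1) * ((z 0 ^ 6 + 1) * z 2 ^ 2)" for z :: "nat \<Rightarrow> complex"
  define p2 where "p2 z = z 3 ^ 2 + (-1) * (z 2 ^ 6 + 1)" for z :: "nat \<Rightarrow> complex"
  have "polynomial_Cn 4 p1" "polynomial_Cn 4 p2"
    unfolding p1_def p2_def
    by (intro polynomial_Cn.add polynomial_Cn.mult polynomial_Cn_power polynomial_Cn.const
        polynomial_Cn.coord; simp)+
  moreover have "p1 z = 0 \<longleftrightarrow> z 1 ^ 2 = (z 0 ^ 6 + 1) * z 2 ^ 2" "p2 z = 0 \<longleftrightarrow> z 3 ^ 2 = z 2 ^ 6 + 1" for z
    by (simp_all only: p1_def p2_def mult_minus1 add_uminus_conv_diff right_minus_eq)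
  ultimately show ?thesis
    by (intro exI[of _ "{p1, p2}"]) (auto simp: pinched_square_def)
qed

lemma curve_square_polynomials:
  "\<exists>P. finite P \<and> (\<forall>p\<in>P. polynomial_Cn 4 p) \<and> curve_square = {z \<in> Cn 4. \<forall>p\<in>P. p z = 0}"
proof -
  define p1 where "p1 z = z 1 ^ 2 + (-1) * (z 0 ^ 6 + 1)" for z :: "nat \<Rightarrow> complex"
  define p2 where "p2 z = z 3 ^ 2 + (-1) * (z 2 ^ 6 + 1)" for z :: "nat \<Rightarrow> complex"
  have "polynomial_Cn 4 p1" "polynomial_Cn 4 p2"
    unfolding p1_def p2_def
    by (intro polynomial_Cn.add polynomial_Cn.mult polynomial_Cn_power polynomial_Cn.const
        polynomial_Cn.coord; simp)+
  moreover have "p1 z = 0 \<longleftrightarrow> z 1 ^ 2 = z 0 ^ 6 + 1" "p2 z = 0 \<longleftrightarrow> z 3 ^ 2 = z 2 ^ 6 + 1" for z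
    by (simp_all only: p1_def p2_def mult_minus1 add_uminus_conv_diff right_minus_eq)
  ultimately show ?thesis
    by (intro exI[of _ "{p1, p2}"]) (auto simp: curve_square_def)
qed

lemma affine_pinched_square: "affine_algebraic_subvariety 4 pinched_square"
  using pinched_square_polynomials unfolding affine_algebraic_subvariety_def by blast

lemma analytic_pinched_square: "analytic_subset 4 (Cn 4) pinched_square"
proof -
  obtain P where "finite P \<and> (\<forall>p\<in>P. polynomial_Cn 4 p) \<and> pinched_square = {z \<in> Cn 4. \<forall>p\<in>P. p z = 0}"
    using pinched_square_polynomials ..
  then show ?thesis by (intro analytic_subset_polynomials[of P]) auto
qed

lemma analytic_curve_square: "analytic_subset 4 (Cn 4) curve_square"
proof -
  obtain P where "finite P \<and> (\<forall>p\<in>P. polynomial_Cn 4 p) \<and> curve_square = {z \<in> Cn 4. \<forall>p\<in>P. p z = 0}"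
    using curve_square_polynomials ..
  then show ?thesis by (intro analytic_subset_polynomials[of P]) auto
qed

text \<open>A local branch of the k-th root: the derivative k z0^(k-1) does not vanish, so the power
  map is injective near z0 with holomorphic inverse.\<close>

lemma power_local_inverse:
  fixes z0 :: complex
  assumes "z0 \<noteq> 0" "0 < k"
  obtains r g where "0 < r" "open ((\<lambda>z. z ^ k) ` ball z0 r)" "g holomorphic_on (\<lambda>z. z ^ k) ` ball z0 r"
    "\<And>z. z \<in> ball z0 r \<Longrightarrow> g (z ^ k) = z"
proof -
  have D: "((\<lambda>z. z ^ k) has_field_derivative of_nat k * z0 ^ (k - 1)) (at z0)"
    by (auto intro!: derivative_eq_intros)
  have hol: "(\<lambda>z. z ^ k) holomorphic_on (UNIV :: complex set)" by (intro holomorphic_intros)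
  have "deriv (\<lambda>z. z ^ k) z0 \<noteq> 0" using DERIV_imp_deriv[OF D] assms by simp
  then obtain r where r: "r > 0" "open ((\<lambda>z. z ^ k) ` ball z0 r)" "inj_on (\<lambda>z. z ^ k) (ball z0 r)"
    using has_complex_derivative_locally_invertible[OF hol, of z0] by auto
  obtain g where "g holomorphic_on (\<lambda>z. z ^ k) ` ball z0 r" "\<And>z. z \<in> ball z0 r \<Longrightarrow> g (z ^ k) = z"
    using holomorphic_has_inverse[OF holomorphic_on_subset[OF hol subset_UNIV] open_ball r(3)] by metis
  then show ?thesis using r(1,2) by (intro that)
qed

text \<open>Where y0 is nonzero, x is a local coordinate and y a square root of x^6 + 1; where y0 =
  0, y is a coordinate and x a sixth root of y^2 - 1. The linear form \<alpha> x + \<beta> y stands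
  for the coordinate in either case, with (\<alpha>, \<beta>) = (1, 0) or (0, 1), so that later uses
  need no case distinction.\<close>

lemma curve_chart:
  assumes xy: "y0 ^ 2 = x0 ^ 6 + (1::complex)"
  obtains \<alpha> \<beta> X Y \<Omega> O1 O2 where "open \<Omega>" "open O1" "open O2" "x0 \<in> O1" "y0 \<in> O2"
    "X holomorphic_on \<Omega>" "Y holomorphic_on \<Omega>"
    "\<forall>t\<in>\<Omega>. Y t ^ 2 = X t ^ 6 + 1 \<and> X t \<in> O1 \<and> Y t \<in> O2 \<and> \<alpha> * X t + \<beta> * Y t = t"
    "\<forall>x\<in>O1. \<forall>y\<in>O2. y ^ 2 = x ^ 6 + 1 \<longrightarrow>
      \<alpha> * x + \<beta> * y \<in> \<Omega> \<and> X (\<alpha> * x + \<beta> * y) = x \<and> Y (\<alpha> * x + \<beta> * y) = y"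
proof (cases "y0 = 0")
  case False
  obtain r g where r: "0 < r" "open ((\<lambda>z. z ^ 2) ` ball y0 r)" "g holomorphic_on (\<lambda>z. z ^ 2) ` ball y0 r"
    "\<And>z. z \<in> ball y0 r \<Longrightarrow> g (z ^ 2) = z"
    by (rule power_local_inverse[OF False, of 2]) (use that in auto)
  define T where "T = (\<lambda>z. z ^ 2) ` ball y0 r"
  define \<Omega> where "\<Omega> = {x. x ^ 6 + 1 \<in> T}"
  have \<Omega>: "open \<Omega>"
    using open_vimage[of T "\<lambda>x::complex. x ^ 6 + 1"] r(2)
    by (simp add: \<Omega>_def T_def vimage_def continuous_intros)
  have g2: "g t ^ 2 = t \<and> g t \<in> ball y0 r" if "t \<in> T" for t
    using that r(4) by (auto simp: T_def)
  have "(g \<circ> (\<lambda>x. x ^ 6 + 1)) holomorphic_on \<Omega>"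
    by (rule holomorphic_on_compose_gen[OF _ r(3)]) (auto simp: \<Omega>_def T_def intro!: holomorphic_intros)
  then have hol: "(\<lambda>x. g (x ^ 6 + 1)) holomorphic_on \<Omega>" by (simp add: comp_def)
  show ?thesis
  proof (rule that[of \<Omega> UNIV "ball y0 r" "\<lambda>x. x" "\<lambda>x. g (x ^ 6 + 1)" 1 0])
    show "\<forall>x\<in>UNIV. \<forall>y\<in>ball y0 r. y ^ 2 = x ^ 6 + 1 \<longrightarrow>
      1 * x + 0 * y \<in> \<Omega> \<and> 1 * x + 0 * y = x \<and> g ((1 * x + 0 * y) ^ 6 + 1) = y"
    proof (intro ballI impI)
      fix x y assume that: "y \<in> ball y0 r" "y ^ 2 = x ^ 6 + 1"
      have "y ^ 2 \<in> T" using that(1) unfolding T_def by (rule imageI)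
      moreover have "g (y ^ 2) = y" using r(4) that(1) by simp
      ultimately show "1 * x + 0 * y \<in> \<Omega> \<and> 1 * x + 0 * y = x \<and> g ((1 * x + 0 * y) ^ 6 + 1) = y"
        using that(2) by (simp add: \<Omega>_def)
    qed
  qed (use \<Omega> r(1) hol g2 in \<open>auto simp: \<Omega>_def\<close>)
next
  case True
  then have x0: "x0 \<noteq> 0" using xy by auto
  obtain r g where r: "0 < r" "open ((\<lambda>z. z ^ 6) ` ball x0 r)" "g holomorphic_on (\<lambda>z. z ^ 6) ` ball x0 r"
    "\<And>z. z \<in> ball x0 r \<Longrightarrow> g (z ^ 6) = z"
    by (rule power_local_inverse[OF x0, of 6]) (use that in auto)
  define T where "T = (\<lambda>z. z ^ 6) ` ball x0 r"
  define \<Omega> where "\<Omega> = {y. y ^ 2 - 1 \<in> T}"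
  have \<Omega>: "open \<Omega>"
    using open_vimage[of T "\<lambda>y::complex. y ^ 2 - 1"] r(2)
    by (simp add: \<Omega>_def T_def vimage_def continuous_intros)
  have g6: "g t ^ 6 = t \<and> g t \<in> ball x0 r" if "t \<in> T" for t
    using that r(4) by (auto simp: T_def)
  have "(g \<circ> (\<lambda>y. y ^ 2 - 1)) holomorphic_on \<Omega>"
    by (rule holomorphic_on_compose_gen[OF _ r(3)]) (auto simp: \<Omega>_def T_def intro!: holomorphic_intros)
  then have hol: "(\<lambda>y. g (y ^ 2 - 1)) holomorphic_on \<Omega>" by (simp add: comp_def)
  show ?thesis
  proof (rule that[of \<Omega> "ball x0 r" UNIV "\<lambda>y. g (y ^ 2 - 1)" "\<lambda>y. y" 0 1])
    show "\<forall>x\<in>ball x0 r. \<forall>y\<in>UNIV. y ^ 2 = x ^ 6 + 1 \<longrightarrow>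
      0 * x + 1 * y \<in> \<Omega> \<and> g ((0 * x + 1 * y) ^ 2 - 1) = x \<and> 0 * x + 1 * y = y"
    proof (intro ballI impI)
      fix x y assume that: "x \<in> ball x0 r" "y ^ 2 = x ^ 6 + 1"
      have "x ^ 6 \<in> T" using that(1) unfolding T_def by (rule imageI)
      moreover have "g (x ^ 6) = x" using r(4) that(1) by simp
      ultimately show "0 * x + 1 * y \<in> \<Omega> \<and> g ((0 * x + 1 * y) ^ 2 - 1) = x \<and> 0 * x + 1 * y = y"
        using that(2) by (simp add: \<Omega>_def)
    qed
  qed (use \<Omega> r(1) hol g6 in \<open>auto simp: \<Omega>_def\<close>)
qed

lemma chart_at_curve_square:
  assumes z: "z \<in> curve_square"
  shows "chart_at 2 (space_of_subset 4 curve_square) z"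
proof -
  have z1: "z 1 ^ 2 = z 0 ^ 6 + 1" "z 3 ^ 2 = z 2 ^ 6 + 1" using z by (auto simp: curve_square_def)
  obtain \<alpha> \<beta> X Y \<Omega>1 O1 O2 where c1: "open \<Omega>1" "open O1" "open O2" "z 0 \<in> O1" "z 1 \<in> O2"
    "X holomorphic_on \<Omega>1" "Y holomorphic_on \<Omega>1"
    "\<forall>t\<in>\<Omega>1. Y t ^ 2 = X t ^ 6 + 1 \<and> X t \<in> O1 \<and> Y t \<in> O2 \<and> \<alpha> * X t + \<beta> * Y t = t"
    "\<forall>x\<in>O1. \<forall>y\<in>O2. y ^ 2 = x ^ 6 + 1 \<longrightarrow>
      \<alpha> * x + \<beta> * y \<in> \<Omega>1 \<and> X (\<alpha> * x + \<beta> * y) = x \<and> Y (\<alpha> * x + \<beta> * y) = y"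
    by (rule curve_chart[OF z1(1)]) (rule that)
  obtain \<gamma> \<delta> X' Y' \<Omega>2 O3 O4 where c2: "open \<Omega>2" "open O3" "open O4" "z 2 \<in> O3" "z 3 \<in> O4"
    "X' holomorphic_on \<Omega>2" "Y' holomorphic_on \<Omega>2"
    "\<forall>t\<in>\<Omega>2. Y' t ^ 2 = X' t ^ 6 + 1 \<and> X' t \<in> O3 \<and> Y' t \<in> O4 \<and> \<gamma> * X' t + \<delta> * Y' t = t"
    "\<forall>x\<in>O3. \<forall>y\<in>O4. y ^ 2 = x ^ 6 + 1 \<longrightarrow>
      \<gamma> * x + \<delta> * y \<in> \<Omega>2 \<and> X' (\<gamma> * x + \<delta> * y) = x \<and> Y' (\<gamma> * x + \<delta> * y) = y"
    by (rule curve_chart[OF z1(2)]) (rule that)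
  define U where "U = {w \<in> curve_square. w 0 \<in> O1 \<and> w 1 \<in> O2 \<and> w 2 \<in> O3 \<and> w 3 \<in> O4}"
  define \<Omega> where "\<Omega> = {v \<in> Cn 2. v 0 \<in> \<Omega>1 \<and> v 1 \<in> \<Omega>2}"
  define \<phi> where "\<phi> w = pt (\<alpha> * w 0 + \<beta> * w 1, \<gamma> * w 2 + \<delta> * w 3)" for w :: "nat \<Rightarrow> complex"
  define \<psi> where "\<psi> v = vec4 (X (v 0)) (Y (v 0)) (X' (v 1)) (Y' (v 1))" for v :: "nat \<Rightarrow> complex"
  have "U = curve_square \<inter> ({w. w 0 \<in> O1} \<inter> {w. w 1 \<in> O2} \<inter> {w. w 2 \<in> O3} \<inter> {w. w 3 \<in> O4})"
    by (auto simp: U_def)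
  then have U: "openin (top_of_set curve_square) U"
    using c1 c2 by (auto intro!: openin_open_Int open_Int open_coord)
  have \<Omega>T: "\<Omega> = Cn 2 \<inter> ({v. v 0 \<in> \<Omega>1} \<inter> {v. v 1 \<in> \<Omega>2})" by (auto simp: \<Omega>_def)
  have o: "open ({v :: nat \<Rightarrow> complex. v 0 \<in> \<Omega>1} \<inter> {v. v 1 \<in> \<Omega>2})"
    using c1 c2 by (intro open_Int open_coord)
  have \<Omega>: "open_Cn 2 \<Omega>" unfolding \<Omega>T by (rule openin_open_Int[OF o])
  have UC: "U \<subseteq> Cn 4" using curve_square_subset by (auto simp: U_def)
  have \<Omega>C: "\<Omega> \<subseteq> Cn 2" by (auto simp: \<Omega>_def)
  have \<phi>U: "\<phi> w \<in> \<Omega>" if "w \<in> U" for w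
    using that c1(9) c2(9) by (auto simp: U_def curve_square_def \<phi>_def \<Omega>_def)
  have \<psi>\<Omega>: "\<psi> v \<in> U" if "v \<in> \<Omega>" for v
    using that c1(8) c2(8) by (auto simp: U_def curve_square_def \<psi>_def \<Omega>_def)
  have "biholo_pair (space_of_subset 4 U) (space_of_subset 2 \<Omega>) \<phi> \<psi>"
    unfolding biholo_pair_def
  proof (intro conjI ballI)
    show "holomorphic_map (space_of_subset 4 U) (space_of_subset 2 \<Omega>) \<phi>"
    proof (rule holomorphic_map_subsets[OF UC \<Omega>C \<phi>U])
      fix j :: nat assume "j < 2"
      then consider "j = 0" | "j = 1" by linarith
      then show "(\<lambda>w. \<phi> w j) \<in> secs 4 U"
        by cases (auto simp: \<phi>_def intro!: secsI[of UNIV, OF _ _ UC] holo_intros)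
    qed
    show "holomorphic_map (space_of_subset 2 \<Omega>) (space_of_subset 4 U) \<psi>"
    proof (rule holomorphic_map_subsets[OF \<Omega>C UC \<psi>\<Omega>])
      fix j :: nat assume "j < 4"
      have h: "(\<lambda>v. k (v i)) \<in> secs 2 \<Omega>" if "k holomorphic_on S" "open S" "i < 2" "\<And>v. v \<in> \<Omega> \<Longrightarrow> v i \<in> S" for k S i
      proof (rule secsI[OF open_coord[OF that(2), of i] _ \<Omega>C])
        show "\<Omega> \<subseteq> {v. v i \<in> S}" using that(4) by blast
        show "holo_at 2 (\<lambda>v. k (v i)) v" if "v \<in> {v. v i \<in> S}" for v
          by (rule holo_at_comp_fun[OF \<open>k holomorphic_on S\<close> \<open>open S\<close> _ holo_at_coord[OF \<open>i < 2\<close>]]) (use that in simp)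
      qed
      have "(\<lambda>v. X (v 0)) \<in> secs 2 \<Omega>" "(\<lambda>v. Y (v 0)) \<in> secs 2 \<Omega>"
        "(\<lambda>v. X' (v 1)) \<in> secs 2 \<Omega>" "(\<lambda>v. Y' (v 1)) \<in> secs 2 \<Omega>"
        using h[OF c1(6,1), of 0] h[OF c1(7,1), of 0] h[OF c2(6,1), of 1] h[OF c2(7,1), of 1]
        by (auto simp: \<Omega>_def)
      with \<open>j < 4\<close> show "(\<lambda>v. \<psi> v j) \<in> secs 2 \<Omega>"
        by (cases rule: less_4_cases) (simp_all add: \<psi>_def)
    qed
    show "\<psi> (\<phi> w) = w" if "w \<in> points (space_of_subset 4 U)" for w
      by (rule Cn4_eqI) (use that UC c1(9) c2(9) in \<open>auto simp: U_def curve_square_def \<phi>_def \<psi>_def\<close>)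
    show "\<phi> (\<psi> v) = v" if "v \<in> points (space_of_subset 2 \<Omega>)" for v
      using that c1(8) c2(8) pt_collapse[of v] by (auto simp: \<Omega>_def \<phi>_def \<psi>_def)
  qed
  moreover have "z \<in> U" using z c1 c2 by (simp add: U_def)
  moreover have "U \<subseteq> curve_square" by (auto simp: U_def)
  ultimately show ?thesis
    unfolding chart_at_def using U \<Omega>
    by (intro exI[of _ U] exI[of _ \<Omega>] exI[of _ \<phi>] exI[of _ \<psi>]) (simp add: restrict_space_of_subset)
qed

lemma biholo_pinch:
  "biholo_pair (space_of_subset 4 {z \<in> curve_square. z 2 \<noteq> 0}) (space_of_subset 4 {z \<in> pinched_square. z 2 \<noteq> 0})
     pinch unpinch"
  unfolding biholo_pair_def
proof (intro conjI ballI)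
  have o: "open {z :: nat \<Rightarrow> complex. z 2 \<noteq> 0}"
    using open_coord[of "-{0}" 2] by (simp add: open_Compl)
  have C: "{z \<in> curve_square. z 2 \<noteq> 0} \<subseteq> Cn 4" "{z \<in> pinched_square. z 2 \<noteq> 0} \<subseteq> Cn 4"
    using curve_square_subset pinched_square_subset by auto
  show "holomorphic_map (space_of_subset 4 {z \<in> curve_square. z 2 \<noteq> 0}) (space_of_subset 4 {z \<in> pinched_square. z 2 \<noteq> 0}) pinch"
  proof (rule holomorphic_map_subsets[OF C])
    fix j :: nat assume "j < 4"
    then show "(\<lambda>z. pinch z j) \<in> secs 4 {z \<in> curve_square. z 2 \<noteq> 0}"
      by (cases rule: less_4_cases) (auto simp: pinch_def intro!: secsI[of UNIV, OF _ _ C(1)] holo_intros)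
  qed (use pinch_in in \<open>auto simp: pinch_def\<close>)
  show "holomorphic_map (space_of_subset 4 {z \<in> pinched_square. z 2 \<noteq> 0}) (space_of_subset 4 {z \<in> curve_square. z 2 \<noteq> 0}) unpinch"
  proof (rule holomorphic_map_subsets[OF C(2,1)])
    fix j :: nat assume "j < 4"
    then show "(\<lambda>z. unpinch z j) \<in> secs 4 {z \<in> pinched_square. z 2 \<noteq> 0}"
      by (cases rule: less_4_cases) (auto simp: unpinch_def intro!: secsI[OF o _ C(2)] holo_intros)
  qed (use unpinch_in in \<open>auto simp: unpinch_def\<close>)
  show "unpinch (pinch z) = z" if "z \<in> points (space_of_subset 4 {z \<in> curve_square. z 2 \<noteq> 0})" for z
    using that C(1) by (auto intro!: unpinch_pinch)
  show "pinch (unpinch z) = z" if "z \<in> points (space_of_subset 4 {z \<in> pinched_square. z 2 \<noteq> 0})" for z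
    using that C(2) by (auto intro!: pinch_unpinch)
qed

lemma holomorphic_pinch:
  "holomorphic_map (space_of_subset 4 curve_square) (space_of_subset 4 pinched_square) pinch"
proof (rule holomorphic_map_subsets[OF curve_square_subset pinched_square_subset pinch_in])
  fix j :: nat assume "j < 4"
  then show "(\<lambda>z. pinch z j) \<in> secs 4 curve_square"
    by (cases rule: less_4_cases)
      (auto simp: pinch_def intro!: secsI[of UNIV, OF _ _ curve_square_subset] holo_intros)
qed

section \<open>The singular locus of the pinched surface\<close>

lemma openin_coord_neq: "openin (top_of_set A) {z :: nat \<Rightarrow> complex. z \<in> A \<and> z i \<noteq> 0}"
proof -
  have "{z. z \<in> A \<and> z i \<noteq> 0} = A \<inter> {z. z i \<in> -{0}}" by auto
  then show ?thesis using openin_open_Int[OF open_coord[of "-{0}" i], of A] by (simp add: open_Compl)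
qed

lemma regular_pinched_square:
  assumes "z \<in> pinched_square" "z 2 \<noteq> 0"
  shows "chart_at 2 (space_of_subset 4 pinched_square) z"
proof (rule chart_at_transfer[where U="{z \<in> pinched_square. z 2 \<noteq> 0}" and V="{z \<in> curve_square. z 2 \<noteq> 0}"
      and Y="space_of_subset 4 curve_square" and f=unpinch and g=pinch])
  show "biholo_pair (restrict_space_to (space_of_subset 4 pinched_square) {z \<in> pinched_square. z 2 \<noteq> 0})
     (restrict_space_to (space_of_subset 4 curve_square) {z \<in> curve_square. z 2 \<noteq> 0}) unpinch pinch"
    using biholo_pair_sym[OF biholo_pinch] by (simp add: restrict_space_of_subset)
  show "chart_at 2 (space_of_subset 4 curve_square) (unpinch z)"
    using assms by (intro chart_at_curve_square unpinch_in)
qed (use assms openin_coord_neq subsheaf_space_of_subset curve_square_subset pinched_square_subset in auto)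

lemma open_Cn_polydisc:
  assumes W: "open_Cn n W" and c: "c \<in> W"
  obtains \<epsilon> where "\<epsilon> > 0" "\<And>w. w \<in> Cn n \<Longrightarrow> (\<And>i. i < n \<Longrightarrow> norm (w i - c i) < \<epsilon>) \<Longrightarrow> w \<in> W"
proof -
  obtain T where T: "open T" "W = Cn n \<inter> T" using W by (metis openin_open)
  have "openin (product_topology (\<lambda>i. euclidean) UNIV) T"
    using T(1) by (simp add: euclidean_product_topology)
  then obtain U where U: "c \<in> Pi\<^sub>E UNIV U" "\<And>i. open (U i)" "Pi\<^sub>E UNIV U \<subseteq> T"
    using product_topology_open_contains_basis[of "\<lambda>i. euclidean" UNIV T c] c T(2) by auto
  have "\<forall>i. \<exists>e>0. ball (c i) e \<subseteq> U i"
    using U by (metis PiE_mem UNIV_I openE)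
  then obtain e where e: "\<And>i. e i > 0" "\<And>i. ball (c i) (e i) \<subseteq> U i" by metis
  \<comment> \<open>The element 1 keeps the minimum defined and positive when
    \<open>n = 0\<close>.\<close>
  define \<epsilon> where "\<epsilon> = Min (insert 1 (e ` {..<n}))"
  have "\<epsilon> > 0" using e(1) by (simp add: \<epsilon>_def)
  moreover have "w \<in> W" if w: "w \<in> Cn n" "\<And>i. i < n \<Longrightarrow> norm (w i - c i) < \<epsilon>" for w
  proof -
    have "w i \<in> U i" for i
    proof (cases "i < n")
      case True
      have "\<epsilon> \<le> e i" using True by (simp add: \<epsilon>_def)
      then show ?thesis using w(2)[OF True] e(2)[of i] by (auto simp: dist_norm norm_minus_commute)
    next
      case False
      then have "w i = c i" using w(1) c T(2) by (auto simp: Cn_def)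
      then show ?thesis using e[of i] by auto
    qed
    then show ?thesis using U(3) T(2) w(1) by auto
  qed
  ultimately show ?thesis by (rule that)
qed

text \<open>The local ring at a smooth point is an integral domain. On a polydisc, join a point
  where \<open>F\<close> is nonzero to one where \<open>G\<close> is nonzero by a complex line; it
  meets the polydisc in a convex set, on which \<open>G\<close> vanishes near the first point and
  hence, by the identity theorem, everywhere.\<close>

lemma holomorphic_Cn_product_zero:
  assumes F: "holomorphic_Cn n W F" and G: "holomorphic_Cn n W G" and c: "c \<in> W"
    and FG: "\<And>z. z \<in> W \<Longrightarrow> F z * G z = 0"
  obtains D where "open_Cn n D" "c \<in> D" "D \<subseteq> W" "(\<forall>z\<in>D. F z = 0) \<or> (\<forall>z\<in>D. G z = 0)"
proof -
  have W: "open_Cn n W" using F by (simp add: holomorphic_Cn_iff)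
  have cC: "c \<in> Cn n" using c W open_Cn_subset by blast
  obtain \<epsilon> where \<epsilon>: "\<epsilon> > 0" "\<And>w. w \<in> Cn n \<Longrightarrow> (\<And>i. i < n \<Longrightarrow> norm (w i - c i) < \<epsilon>) \<Longrightarrow> w \<in> W"
    by (rule open_Cn_polydisc[OF W c]) (use that in blast)
  define D where "D = {w \<in> Cn n. \<forall>i<n. w i \<in> ball (c i) \<epsilon>}"
  have DW: "D \<subseteq> W" using \<epsilon>(2) by (auto simp: D_def dist_norm norm_minus_commute)
  have "D = Cn n \<inter> (\<Inter>i\<in>{..<n}. {w. w i \<in> ball (c i) \<epsilon>})" by (auto simp: D_def)
  moreover have "open (\<Inter>i\<in>{..<n}. {w :: nat \<Rightarrow> complex. w i \<in> ball (c i) \<epsilon>})"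
    by (intro open_INT ballI open_coord) auto
  ultimately have D: "open_Cn n D" by (simp add: openin_open_Int)
  have "(\<forall>z\<in>D. F z = 0) \<or> (\<forall>z\<in>D. G z = 0)"
  proof (rule ccontr)
    assume "\<not> ?thesis"
    then obtain p q where p: "p \<in> D" "F p \<noteq> 0" and q: "q \<in> D" "G q \<noteq> 0" by auto
    define L where "L \<zeta> = (\<lambda>i. p i + \<zeta> * (q i - p i))" for \<zeta> :: complex
    define S where "S = (\<Inter>i\<in>{..<n}. {\<zeta>. p i + \<zeta> * (q i - p i) \<in> ball (c i) \<epsilon>})"
    have LC: "L \<zeta> \<in> Cn n" for \<zeta> using p q by (auto simp: D_def L_def Cn_def)
    have LD: "\<zeta> \<in> S \<longleftrightarrow> L \<zeta> \<in> D" for \<zeta> using LC by (auto simp: S_def D_def L_def)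
    have "open {\<zeta>. p i + \<zeta> * (q i - p i) \<in> ball (c i) \<epsilon>}" for i
      using open_vimage[of "ball (c i) \<epsilon>" "\<lambda>\<zeta>. p i + \<zeta> * (q i - p i)"]
      by (simp add: vimage_def continuous_intros)
    then have So: "open S" unfolding S_def by (intro open_INT) auto
    have "convex S" unfolding S_def
    proof (intro convex_INT ballI)
      fix i
      have "{\<zeta>. p i + \<zeta> * (q i - p i) \<in> ball (c i) \<epsilon>} = (\<lambda>\<zeta>. \<zeta> * (q i - p i)) -` ((\<lambda>x. x - p i) ` ball (c i) \<epsilon>)"
        by (force simp: image_iff algebra_simps)
      moreover have "convex \<dots>"
        by (intro convex_linear_vimage convex_translation_subtract convex_ball bounded_linear.linear bounded_linear_mult_left)
      ultimately show "convex {\<zeta>. p i + \<zeta> * (q i - p i) \<in> ball (c i) \<epsilon>}" by simp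
    qed
    then have Sc: "connected S" by (rule convex_connected)
    have L01: "L 0 = p" "L 1 = q" by (auto simp: L_def)
    have S01: "0 \<in> S" "1 \<in> S" using LD L01 p q by auto
    have hol: "(\<lambda>\<zeta>. H (L \<zeta>)) holomorphic_on S" if "holomorphic_Cn n W H" for H
      unfolding holomorphic_on_def
    proof (rule ballI, rule field_differentiable_at_within)
      fix \<zeta> assume "\<zeta> \<in> S"
      then have "L \<zeta> \<in> W" using LD DW by blast
      then show "(\<lambda>\<zeta>. H (L \<zeta>)) field_differentiable at \<zeta>"
        using that LC
        by (intro field_differentiable_compose_holo_at[where n=n and G=H and f=L])
          (auto simp: holomorphic_Cn_iff L_def intro!: derivative_intros)
    qed
    have "continuous_on S (\<lambda>\<zeta>. F (L \<zeta>))" using hol[OF F] by (rule holomorphic_on_imp_continuous_on)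
    then have o1: "open (S \<inter> (\<lambda>\<zeta>. F (L \<zeta>)) -` (-{0}))"
      by (rule continuous_open_preimage[OF _ So]) (simp add: open_Compl)
    have o2: "0 \<in> S \<inter> (\<lambda>\<zeta>. F (L \<zeta>)) -` (-{0})" using S01 L01 p by simp
    have "G (L 1) = 0"
    proof (rule analytic_continuation_open[where f="\<lambda>\<zeta>. G (L \<zeta>)" and g="\<lambda>_. 0" and s'=S and z=1
          and s="S \<inter> (\<lambda>\<zeta>. F (L \<zeta>)) -` (-{0})"])
      show "G (L \<zeta>) = 0" if "\<zeta> \<in> S \<inter> (\<lambda>\<zeta>. F (L \<zeta>)) -` (-{0})" for \<zeta>
        using that FG[of "L \<zeta>"] LD DW by auto
    qed (use o1 o2 So Sc S01 hol[OF G] in auto)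
    then show False using L01 q by simp
  qed
  moreover have "c \<in> D" using cC \<epsilon>(1) by (simp add: D_def)
  ultimately show ?thesis using that D DW by blast
qed

text \<open>At w = 0 the radicand is 1, away from the cut of the principal root. Multiplied by a
  value 1 or -1 it parametrises u near either point over w = 0.\<close>

lemma isCont_csqrt_branch: "isCont (\<lambda>w. csqrt (w ^ 6 + 1)) 0"
  by (rule isCont_o2[OF _ continuous_at_csqrt]) (auto simp: complex_nonpos_Reals_iff intro!: continuous_intros)

text \<open>Used with explicit curves \<open>p\<close> in the surfaces, to find in any neighbourhood
  points off w = 0 or points away from a pinch point.\<close>

lemma eventually_nearby_point:
  assumes V: "openin (top_of_set A) V" and cont: "isCont p 0" and p0: "p 0 \<in> V"
    and pA: "\<And>w. p w \<in> A"
  obtains w :: complex where "w \<noteq> 0" "p w \<in> V"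
proof -
  obtain T where T: "open T" "V = A \<inter> T" using V by (metis openin_open)
  have "\<forall>\<^sub>F w in at 0. p w \<in> T"
    using topological_tendstoD[OF cont[unfolded isCont_def] T(1)] p0 T(2) by auto
  then have "\<forall>\<^sub>F w in at 0. p w \<in> T \<and> w \<noteq> 0"
    by (simp add: eventually_at_filter)
  then obtain w where "p w \<in> T" "w \<noteq> 0"
    using eventually_happens'[OF at_neq_bot] by blast
  then show ?thesis using that T(2) pA by blast
qed

lemma isCont_vec4:
  assumes "isCont a x" "isCont b x" "isCont c x" "isCont d x"
  shows "isCont (\<lambda>x. vec4 (a x) (b x) (c x) (d x)) x"
  unfolding isCont_def
proof (rule tendsto_fun)
  fix i
  show "((\<lambda>x. vec4 (a x) (b x) (c x) (d x) i) \<longlongrightarrow> vec4 (a x) (b x) (c x) (d x) i) (at x)"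
  proof (cases "i < 4")
    case True
    then show ?thesis by (cases rule: less_4_cases) (use assms in \<open>auto simp: isCont_def\<close>)
  qed (simp add: vec4_def)
qed

text \<open>
  Two sheets \<open>v = \<plusminus>y w\<close> meet along \<open>w = 0\<close>, so the local ring there has zero divisors as long as
  \<open>x\<^sup>6 + 1 \<noteq> 0\<close>; the pinch points \<open>x\<^sup>6 + 1 = 0\<close> are limits of such points.
\<close>

lemma singular_pinched_square:
  assumes a: "a \<in> pinched_square" "a 2 = 0"
  shows "a \<in> singular_points (space_of_subset 4 pinched_square)"
proof -
  let ?X = "space_of_subset 4 pinched_square"
  note sh = subsheaf_space_of_subset[OF pinched_square_subset]
  have no_chart: "\<not> chart_at n ?X a" if a: "a \<in> pinched_square" "a 2 = 0" "a 0 ^ 6 + 1 \<noteq> 0" for a n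
  proof
    assume "chart_at n ?X a"
    then obtain U \<Omega> \<phi> \<psi> where U: "openin (top_of_set pinched_square) U" "a \<in> U" "open_Cn n \<Omega>"
      and pair: "biholo_pair (restrict_space_to ?X U) (space_of_subset n \<Omega>) \<phi> \<psi>"
      by (auto simp: chart_at_def)
    have UA: "U \<subseteq> pinched_square" using U(1) by (rule openin_imp_subset)
    have \<phi>: "holomorphic_map (space_of_subset 4 U) (space_of_subset n \<Omega>) \<phi>"
      and \<psi>: "holomorphic_map (space_of_subset n \<Omega>) (space_of_subset 4 U) \<psi>"
      and \<psi>\<phi>: "\<And>x. x \<in> U \<Longrightarrow> \<psi> (\<phi> x) = x"
      using pair UA by (auto simp: biholo_pair_def restrict_space_of_subset)
    have a1: "a 1 = 0" and a3: "a 3 ^ 2 = 1" using a by (auto simp: pinched_square_def)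
    obtain c where c: "c ^ 2 = a 0 ^ 6 + 1" using power2_csqrt by blast
    have c0: "c \<noteq> 0" using c a(3) by auto
    obtain r g where r: "0 < r" "open ((\<lambda>z. z ^ 2) ` ball c r)" "g holomorphic_on (\<lambda>z. z ^ 2) ` ball c r"
      "\<And>z. z \<in> ball c r \<Longrightarrow> g (z ^ 2) = z"
      by (rule power_local_inverse[OF c0, of 2]) (use that in auto)
    define T where "T = (\<lambda>z. z ^ 2) ` ball c r"
    have g2: "g t ^ 2 = t" if "t \<in> T" for t using that r(4) by (auto simp: T_def)
    have aT: "a 0 ^ 6 + 1 \<in> T" unfolding T_def c[symmetric] using r(1) by (intro imageI) simp
    have gc: "g (a 0 ^ 6 + 1) = c" unfolding c[symmetric] using r(1,4) by simp
    define O' where "O' = {z :: nat \<Rightarrow> complex. z 0 \<in> {x. x ^ 6 + 1 \<in> T}}"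
    have O': "open O'"
      unfolding O'_def using open_vimage[of T "\<lambda>x::complex. x ^ 6 + 1"] r(2)
      by (intro open_coord) (simp add: T_def vimage_def continuous_intros)
    define V where "V = U \<inter> O'"
    have V: "openin (top_of_set U) V" unfolding V_def by (rule openin_open_Int[OF O'])
    have VC: "V \<subseteq> Cn 4" using UA pinched_square_subset by (auto simp: V_def)
    \<comment> \<open>Here g (x^6 + 1) is a holomorphic choice of y near \<open>a\<close>, so
      \<open>F 1\<close> and \<open>F (-1)\<close> are v + y w and v - y w, the equations of the two
      sheets.\<close>
    define F where "F e z = z 1 + e * (g (z 0 ^ 6 + 1) * z 2)" for e :: complex and z :: "nat \<Rightarrow> complex"
    have Fs: "F e \<in> secs 4 V" for e
      unfolding F_def
      by (rule secsI[OF O' _ VC])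
        (auto simp: V_def O'_def T_def intro!: holo_intros holo_at_comp_fun[OF r(3,2)])
    have prod0: "F 1 z * F (-1) z = 0" if "z \<in> V" for z
    proof -
      have "F 1 z * F (-1) z = z 1 ^ 2 - g (z 0 ^ 6 + 1) ^ 2 * z 2 ^ 2"
        by (simp add: F_def algebra_simps power2_eq_square)
      also have "\<dots> = 0" using that UA g2 by (auto simp: V_def O'_def pinched_square_def)
      finally show ?thesis .
    qed
    define \<Omega>1 where "\<Omega>1 = {v \<in> \<Omega>. \<psi> v \<in> V}"
    have "openin (top_of_set \<Omega>) \<Omega>1"
      using openin_continuous_map_preimage[OF holomorphic_map_continuous[OF \<psi>], of V] V by (simp add: \<Omega>1_def)
    then have \<Omega>1: "open_Cn n \<Omega>1" using U(3) by (rule openin_trans)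
    have hol: "holomorphic_Cn n \<Omega>1 (F e \<circ> \<psi>)" for e
      using holomorphic_map_section[OF \<psi>, of V "F e"] V Fs by (intro secs_open[OF \<Omega>1]) (simp add: \<Omega>1_def)
    have \<phi>\<Omega>: "\<phi> x \<in> \<Omega>" if "x \<in> U" for x using holomorphic_map_points[OF \<phi>, of x] that by simp
    have aV: "a \<in> V" using U(2) aT by (simp add: V_def O'_def)
    have "\<phi> a \<in> \<Omega>1" using aV \<phi>\<Omega> \<psi>\<phi> U(2) by (simp add: \<Omega>1_def)
    obtain D where D: "open_Cn n D" "\<phi> a \<in> D" "D \<subseteq> \<Omega>1"
      "(\<forall>z\<in>D. (F 1 \<circ> \<psi>) z = 0) \<or> (\<forall>z\<in>D. (F (-1) \<circ> \<psi>) z = 0)"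
    proof (rule holomorphic_Cn_product_zero[OF hol[of 1] hol[of "-1"] \<open>\<phi> a \<in> \<Omega>1\<close>])
      show "(F 1 \<circ> \<psi>) z * (F (-1) \<circ> \<psi>) z = 0" if "z \<in> \<Omega>1" for z
        using prod0[of "\<psi> z"] that by (simp add: \<Omega>1_def)
    qed (rule that)
    define V' where "V' = {x \<in> U. \<phi> x \<in> D}"
    have "openin (top_of_set \<Omega>) D" using D(1,3) U(3) \<Omega>1_def
      by (metis (no_types, lifting) mem_Collect_eq open_Cn_subset openin_subset_trans subset_iff)
    then have "openin (top_of_set U) V'"
      using openin_continuous_map_preimage[OF holomorphic_map_continuous[OF \<phi>], of D] by (simp add: V'_def)
    then have V': "openin (top_of_set pinched_square) V'" using U(1) by (rule openin_trans)
    have F0: "(\<forall>z\<in>V'. F 1 z = 0) \<or> (\<forall>z\<in>V'. F (-1) z = 0)"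
      using D(4) \<psi>\<phi> by (auto simp: V'_def)
    \<comment> \<open>On the sheet v = e y w with x fixed, \<open>F e\<close> has the value 2 e c w.
      Points with w \<noteq> 0 on both sheets, arbitrarily near \<open>a\<close>, show that neither
      factor vanishes identically.\<close>
    have branch: "\<exists>w. w \<noteq> 0 \<and> vec4 (a 0) (e * (c * w)) w (a 3 * csqrt (w ^ 6 + 1)) \<in> V'" if e: "e ^ 2 = 1" for e
    proof -
      obtain w where "w \<noteq> 0" "vec4 (a 0) (e * (c * w)) w (a 3 * csqrt (w ^ 6 + 1)) \<in> V'"
      proof (rule eventually_nearby_point[OF V', of "\<lambda>w. vec4 (a 0) (e * (c * w)) w (a 3 * csqrt (w ^ 6 + 1))"])
        show "isCont (\<lambda>w. vec4 (a 0) (e * (c * w)) w (a 3 * csqrt (w ^ 6 + 1))) 0"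
          using isCont_csqrt_branch by (intro isCont_vec4 continuous_intros) auto
        have "vec4 (a 0) (e * (c * 0)) 0 (a 3 * csqrt (0 ^ 6 + 1)) = a"
          by (rule Cn4_eqI) (use a a1 in \<open>auto simp: pinched_square_def\<close>)
        then show "vec4 (a 0) (e * (c * 0)) 0 (a 3 * csqrt (0 ^ 6 + 1)) \<in> V'"
          using U(2) D(2) by (simp add: V'_def)
        show "vec4 (a 0) (e * (c * w)) w (a 3 * csqrt (w ^ 6 + 1)) \<in> pinched_square" for w
          using e c a3 by (simp add: pinched_square_def power_mult_distrib)
      qed
      then show ?thesis by blast
    qed
    obtain w1 where w1: "w1 \<noteq> 0" "vec4 (a 0) (1 * (c * w1)) w1 (a 3 * csqrt (w1 ^ 6 + 1)) \<in> V'"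
      using branch[of 1] by auto
    obtain w2 where w2: "w2 \<noteq> 0" "vec4 (a 0) (-1 * (c * w2)) w2 (a 3 * csqrt (w2 ^ 6 + 1)) \<in> V'"
      using branch[of "-1"] by auto
    have "F 1 (vec4 (a 0) (1 * (c * w1)) w1 (a 3 * csqrt (w1 ^ 6 + 1))) = 2 * (c * w1)"
      "F (-1) (vec4 (a 0) (-1 * (c * w2)) w2 (a 3 * csqrt (w2 ^ 6 + 1))) = - 2 * (c * w2)"
      by (simp_all add: F_def gc)
    then show False using F0 w1 w2 c0 by (metis mult_eq_0_iff neg_equal_0_iff_equal zero_neq_numeral)
  qed
  show ?thesis
  proof (rule ccontr)
    assume "a \<notin> singular_points ?X"
    then have aR: "a \<in> points ?X - singular_points ?X" using a by simp
    have op: "openin (top_of_set pinched_square) (points ?X - singular_points ?X)"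
      using open_regular_points[of ?X] by simp
    have a': "a 1 = 0" "a 3 ^ 2 = 1" using a by (auto simp: pinched_square_def)
    \<comment> \<open>The parameter only stretches x by 1 + |w|; the third entry stays 0. If x^6 =
      -1 at \<open>a\<close>, the stretched sixth power is -(1 + |w|)^6, which is not -1 for w
      \<noteq> 0.\<close>
    define p where p: "p = (\<lambda>w :: complex. vec4 (a 0 * (1 + of_real (norm w))) 0 0 (a 3))"
    obtain w where w: "w \<noteq> 0" "p w \<in> points ?X - singular_points ?X"
    proof (rule eventually_nearby_point[OF op, of p])
      show "isCont p 0" unfolding p by (intro isCont_vec4 continuous_intros)
      have "p 0 = a" unfolding p by (rule Cn4_eqI) (use a a' in \<open>auto simp: pinched_square_def\<close>)
      then show "p 0 \<in> points ?X - singular_points ?X" using aR by simp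
      show "p w \<in> pinched_square" for w using a' by (simp add: p pinched_square_def)
    qed
    then obtain n where n: "chart_at n ?X (p w)" by (auto simp: singular_points_iff)
    have "(p w) 0 ^ 6 + 1 \<noteq> 0"
    proof (cases "a 0 ^ 6 + 1 = 0")
      case False
      show ?thesis
      proof
        assume "(p w) 0 ^ 6 + 1 = 0"
        show False using no_chart[of a] aR False a by (auto simp: singular_points_iff)
      qed
    next
      case True
      then have "(p w) 0 ^ 6 = - of_real ((1 + norm w) ^ 6)"
        by (simp add: p power_mult_distrib eq_neg_iff_add_eq_0[symmetric])
      moreover have "(1 + norm w) ^ 6 > 1" using w(1) by (intro one_less_power) auto
      then have "of_real ((1 + norm w) ^ 6) \<noteq> (1::complex)"
        by (metis less_irrefl of_real_eq_1_iff)
      ultimately show ?thesis by (metis add.commute eq_neg_iff_add_eq_0 neg_equal_iff_equal minus_minus)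
    qed
    then show False using no_chart[of "p w" n] n w(2) by (simp add: p)
  qed
qed

lemma singular_points_pinched_square:
  "singular_points (space_of_subset 4 pinched_square) = {z \<in> pinched_square. z 2 = 0}"
proof (intro subset_antisym subsetI)
  fix z assume "z \<in> singular_points (space_of_subset 4 pinched_square)"
  then show "z \<in> {z \<in> pinched_square. z 2 = 0}"
    using regular_pinched_square[of z] by (auto simp: singular_points_iff)
qed (use singular_pinched_square in auto)

section \<open>The affine normalization\<close>

lemma normal_curve_square: "normal_complex_space (space_of_subset 4 curve_square)"
  unfolding normal_complex_space_def
proof (intro conjI ballI)
  show "complex_space (space_of_subset 4 curve_square)"
    by (rule complex_space_subset[OF analytic_curve_square])
  fix a assume a: "a \<in> points (space_of_subset 4 curve_square)"
  interpret germs "space_of_subset 4 curve_square" a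
    using a subsheaf_space_of_subset[OF curve_square_subset] ring_sheaf_space_of_subset[OF curve_square_subset]
    by unfold_locales
  show "normal_at (space_of_subset 4 curve_square) a"
    using a by (intro normal_at_chart chart_at_curve_square) simp
qed

text \<open>Only the second factor is moved: w runs near 0 and u follows the branch of the root
  through its given value.\<close>

lemma dense_curve_square:
  assumes "z \<in> curve_square" "openin (top_of_set curve_square) V" "z \<in> V"
  shows "\<exists>w\<in>V. w 2 \<noteq> 0"
proof (cases "z 2 = 0")
  case True
  have z: "z 1 ^ 2 = z 0 ^ 6 + 1" "z 3 ^ 2 = 1" "z \<in> Cn 4" using assms(1) True by (auto simp: curve_square_def)
  obtain w where w: "w \<noteq> 0" "vec4 (z 0) (z 1) w (z 3 * csqrt (w ^ 6 + 1)) \<in> V"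
  proof (rule eventually_nearby_point[OF assms(2), of "\<lambda>w. vec4 (z 0) (z 1) w (z 3 * csqrt (w ^ 6 + 1))"])
    show "isCont (\<lambda>w. vec4 (z 0) (z 1) w (z 3 * csqrt (w ^ 6 + 1))) 0"
      using isCont_csqrt_branch by (intro isCont_vec4 continuous_intros) auto
    have "vec4 (z 0) (z 1) 0 (z 3 * csqrt (0 ^ 6 + 1)) = z"
      by (rule Cn4_eqI) (use z True in auto)
    then show "vec4 (z 0) (z 1) 0 (z 3 * csqrt (0 ^ 6 + 1)) \<in> V" using assms(3) by simp
    show "vec4 (z 0) (z 1) w (z 3 * csqrt (w ^ 6 + 1)) \<in> curve_square" for w
      using z by (simp add: curve_square_def power_mult_distrib)
  qed
  then show ?thesis by (intro bexI[OF _ w(2)]) simp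
qed (use assms in auto)

text \<open>Over w = 0 the value of v says nothing about y, but y^2 = x^6 + 1 leaves at most two
  candidates, and either of them is a preimage there.\<close>

lemma pinch_fibre:
  assumes "z \<in> pinched_square"
  shows "finite {x \<in> curve_square. pinch x = z}" and "\<exists>x\<in>curve_square. pinch x = z"
proof -
  have sub: "{x \<in> curve_square. pinch x = z} \<subseteq>
    (\<lambda>y. vec4 (z 0) y (z 2) (z 3)) ` {csqrt (z 0 ^ 6 + 1), - csqrt (z 0 ^ 6 + 1)}"
  proof
    fix x assume "x \<in> {x \<in> curve_square. pinch x = z}"
    then have x: "x \<in> Cn 4" "x 1 ^ 2 = x 0 ^ 6 + 1" "z = pinch x" by (auto simp: curve_square_def)
    have "x 1 ^ 2 = csqrt (z 0 ^ 6 + 1) ^ 2" using x by (simp add: pinch_def)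
    then have "x 1 = csqrt (z 0 ^ 6 + 1) \<or> x 1 = - csqrt (z 0 ^ 6 + 1)" by (simp only: power2_eq_iff)
    moreover have "x = vec4 (z 0) (x 1) (z 2) (z 3)" by (rule Cn4_eqI) (use x in \<open>auto simp: pinch_def\<close>)
    ultimately show "x \<in> (\<lambda>y. vec4 (z 0) y (z 2) (z 3)) ` {csqrt (z 0 ^ 6 + 1), - csqrt (z 0 ^ 6 + 1)}"
      by blast
  qed
  then show "finite {x \<in> curve_square. pinch x = z}" by (rule finite_subset) simp
  show "\<exists>x\<in>curve_square. pinch x = z"
  proof (cases "z 2 = 0")
    case False
    then show ?thesis using assms unpinch_in pinch_unpinch pinched_square_subset by blast
  next
    case True
    then have "z 1 = 0" using assms by (auto simp: pinched_square_def)
    then show ?thesis using assms True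
      by (intro bexI[of _ "vec4 (z 0) (csqrt (z 0 ^ 6 + 1)) (z 2) (z 3)"] Cn4_eqI)
        (auto simp: pinch_def curve_square_def pinched_square_def)
  qed
qed

lemma compact_box4: "compact {z \<in> Cn 4. \<forall>i<4. norm (z i) \<le> R}"
proof -
  let ?K = "cball 0 R \<times> cball 0 R \<times> cball 0 R \<times> cball (0::complex) R"
  have "{z \<in> Cn 4. \<forall>i<4. norm (z i) \<le> R} = (\<lambda>(a, b, c, d). vec4 a b c d) ` ?K"
  proof (intro subset_antisym subsetI)
    fix z assume z: "z \<in> {z \<in> Cn 4. \<forall>i<4. norm (z i) \<le> R}"
    have "z = vec4 (z 0) (z 1) (z 2) (z 3)" by (rule Cn4_eqI) (use z in auto)
    then show "z \<in> (\<lambda>(a, b, c, d). vec4 a b c d) ` ?K"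
      using z by (intro image_eqI[of _ _ "(z 0, z 1, z 2, z 3)"]) auto
  next
    fix z assume "z \<in> (\<lambda>(a, b, c, d). vec4 a b c d) ` ?K"
    then show "z \<in> {z \<in> Cn 4. \<forall>i<4. norm (z i) \<le> R}"
      by (auto simp: vec4_def Cn_def)
  qed
  moreover have "compact ((\<lambda>(a, b, c, d). vec4 a b c d) ` ?K)"
    unfolding case_prod_unfold
    by (intro compact_continuous_image compact_Times compact_cball continuous_on_vec4 continuous_intros)
  ultimately show ?thesis by simp
qed

lemma closed_curve_square: "closed curve_square"
proof -
  have "curve_square = Cn 4 \<inter> {z. z 1 ^ 2 = z 0 ^ 6 + 1} \<inter> {z. z 3 ^ 2 = z 2 ^ 6 + 1}"
    by (auto simp: curve_square_def)
  moreover have "closed \<dots>"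
    by (intro closed_Int closed_Cn closed_Collect_eq continuous_intros continuous_on_coord)
  ultimately show ?thesis by simp
qed

lemma closed_pinched_square: "closed pinched_square"
proof -
  have "pinched_square = Cn 4 \<inter> {z. z 1 ^ 2 = (z 0 ^ 6 + 1) * z 2 ^ 2} \<inter> {z. z 3 ^ 2 = z 2 ^ 6 + 1}"
    by (auto simp: pinched_square_def)
  moreover have "closed \<dots>"
    by (intro closed_Int closed_Cn closed_Collect_eq continuous_intros continuous_on_coord)
  ultimately show ?thesis by simp
qed

text \<open>Bounds on v = y w do not bound y as w tends to 0; y is controlled by x through the
  equation of the curve. Preimages of compact sets are therefore bounded and closed.\<close>

lemma proper_pinch: "proper_map (top_of_set curve_square) (top_of_set pinched_square) pinch"
proof (rule compact_imp_proper_map)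
  show "k_space (top_of_set pinched_square)"
    by (intro metrizable_imp_k_space metrizable_space_subtopology metrizable_space_euclidean)
  show "kc_space (top_of_set pinched_square)"
    by (intro Hausdorff_imp_kc_space Hausdorff_space_subtopology) simp
  show "pinch \<in> topspace (top_of_set curve_square) \<rightarrow> topspace (top_of_set pinched_square)"
    using pinch_in by auto
  have cont: "continuous_on UNIV pinch"
    unfolding pinch_def[abs_def] by (intro continuous_on_vec4 continuous_intros continuous_on_coord)
  show "continuous_map (top_of_set curve_square) (top_of_set pinched_square) pinch \<or> kc_space (top_of_set curve_square)"
    using continuous_on_subset[OF cont] pinch_in by auto
  fix K assume "compactin (top_of_set pinched_square) K"
  then have K: "compact K" "K \<subseteq> pinched_square" by (auto simp: compactin_subtopology)
  have "\<exists>R. \<forall>z\<in>K. norm (z i) \<le> R" for i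
  proof -
    have "continuous_on K (\<lambda>z. z i)"
      by (rule continuous_on_subset[OF continuous_on_product_coordinates]) simp
    then have "bounded ((\<lambda>z. z i) ` K)"
      using K(1) by (intro compact_imp_bounded compact_continuous_image)
    then show ?thesis by (auto simp: bounded_iff)
  qed
  then obtain R where R: "\<And>i z. z \<in> K \<Longrightarrow> norm (z i) \<le> R i" by metis
  \<comment> \<open>R 0 ^ 6 + 1 bounds |y|^2, and the entry 1 ensures M \<le> M^2, so that M bounds
    |y|.\<close>
  define M where "M = Max {1, R 0, R 2, R 3, R 0 ^ 6 + 1}"
  have M: "1 \<le> M" "R 0 \<le> M" "R 2 \<le> M" "R 3 \<le> M" "R 0 ^ 6 + 1 \<le> M" by (auto simp: M_def)
  have "{x \<in> curve_square. pinch x \<in> K} = {z \<in> Cn 4. \<forall>i<4. norm (z i) \<le> M} \<inter> (curve_square \<inter> pinch -` K)"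
  proof (intro subset_antisym subsetI)
    fix x assume "x \<in> {x \<in> curve_square. pinch x \<in> K}"
    then have x: "x \<in> curve_square" "pinch x \<in> K" by auto
    have n: "norm (x 0) \<le> R 0" "norm (x 2) \<le> R 2" "norm (x 3) \<le> R 3"
      using R[OF x(2), of 0] R[OF x(2), of 2] R[OF x(2), of 3] by (auto simp: pinch_def)
    have "x 1 ^ 2 = x 0 ^ 6 + 1" using x(1) by (simp add: curve_square_def)
    then have "norm (x 1) ^ 2 = norm (x 0 ^ 6 + 1)" by (simp only: norm_power[symmetric])
    also have "\<dots> \<le> norm (x 0) ^ 6 + 1" by (metis norm_triangle_ineq norm_power norm_one)
    also have "\<dots> \<le> R 0 ^ 6 + 1" using n(1) by (simp add: power_mono)
    also have "\<dots> \<le> M" by (rule M)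
    also have "\<dots> \<le> M ^ 2" using M(1) by (simp add: power2_eq_square)
    finally have n1: "norm (x 1) \<le> M" by (rule power2_le_imp_le) (use M in auto)
    have "norm (x i) \<le> M" if "i < 4" for i
      using that by (cases rule: less_4_cases) (use n n1 M in auto)
    then show "x \<in> {z \<in> Cn 4. \<forall>i<4. norm (z i) \<le> M} \<inter> (curve_square \<inter> pinch -` K)"
      using x curve_square_subset by auto
  qed auto
  moreover have cl: "closed (curve_square \<inter> pinch -` K)"
    using closed_vimage[OF compact_imp_closed[OF K(1)] cont] closed_curve_square by (intro closed_Int)
  ultimately have "compact {x \<in> curve_square. pinch x \<in> K}"
    using compact_Int_closed[OF compact_box4 cl] by simp
  then show "compactin (top_of_set curve_square) {x \<in> topspace (top_of_set curve_square). pinch x \<in> K}"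
    by (simp add: compactin_subtopology)
qed

lemma normalization_pinched_square:
  "is_normalization (space_of_subset 4 pinched_square) (space_of_subset 4 curve_square) pinch"
  unfolding is_normalization_def Let_def
proof (intro conjI ballI)
  show "complex_space (space_of_subset 4 pinched_square)"
    by (rule complex_space_subset[OF analytic_pinched_square])
  show "pinch ` points (space_of_subset 4 curve_square) = points (space_of_subset 4 pinched_square)"
    using pinch_in pinch_fibre(2) by force
  show "finite {x \<in> points (space_of_subset 4 curve_square). pinch x = a}"
    if "a \<in> points (space_of_subset 4 pinched_square)" for a
    using pinch_fibre(1) that by simp
  let ?R = "{x \<in> points (space_of_subset 4 curve_square). pinch x \<notin> singular_points (space_of_subset 4 pinched_square)}"
  have R: "?R = {z \<in> curve_square. z 2 \<noteq> 0}"
    using pinch_in by (auto simp: singular_points_pinched_square) (auto simp: pinch_def)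
  have R2: "points (space_of_subset 4 pinched_square) - singular_points (space_of_subset 4 pinched_square) =
      {z \<in> pinched_square. z 2 \<noteq> 0}"
    by (auto simp: singular_points_pinched_square)
  show "topo (space_of_subset 4 curve_square) closure_of ?R = points (space_of_subset 4 curve_square)"
    unfolding R
  proof (intro subset_antisym subsetI)
    fix z assume z: "z \<in> points (space_of_subset 4 curve_square)"
    show "z \<in> topo (space_of_subset 4 curve_square) closure_of {z \<in> curve_square. z 2 \<noteq> 0}"
      unfolding in_closure_of
    proof (intro conjI z allI impI)
      fix T assume T: "z \<in> T \<and> openin (topo (space_of_subset 4 curve_square)) T"
      then obtain w where "w \<in> T" "w 2 \<noteq> 0" using dense_curve_square[of z T] z by auto
      moreover have "T \<subseteq> curve_square" using T by (auto dest: openin_imp_subset)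
      ultimately show "\<exists>y. y \<in> {z \<in> curve_square. z 2 \<noteq> 0} \<and> y \<in> T" by blast
    qed
  qed (auto simp: in_closure_of)
  show "biholomorphic_map (restrict_space_to (space_of_subset 4 curve_square) ?R)
     (restrict_space_to (space_of_subset 4 pinched_square)
        (points (space_of_subset 4 pinched_square) - singular_points (space_of_subset 4 pinched_square))) pinch"
    unfolding R R2 using biholo_pinch by (auto simp: restrict_space_of_subset biholomorphic_map_iff_pair)
qed (use normal_curve_square holomorphic_pinch proper_pinch in auto)

section \<open>Gluing copies of an affine variety\<close>

text \<open>Copies of \<open>A\<close> sit in an ambient space by maps \<open>c j\<close> that are
  merely homeomorphisms onto open subsets of \<open>P\<close>. The ambient topology makes the glued
  space Hausdorff at no cost; the complex structure comes from the charts alone, so only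
  \<open>transition\<close> asks for holomorphy.\<close>

locale atlas =
  fixes n :: nat and A P :: "(nat \<Rightarrow> complex) set" and J :: "'j set"
    and c r :: "'j \<Rightarrow> (nat \<Rightarrow> complex) \<Rightarrow> nat \<Rightarrow> complex"
  assumes analytic: "\<exists>\<Omega>. analytic_subset n \<Omega> A"
    and c_cont: "j \<in> J \<Longrightarrow> continuous_on A (c j)"
    and c_in: "j \<in> J \<Longrightarrow> a \<in> A \<Longrightarrow> c j a \<in> P"
    and c_open: "j \<in> J \<Longrightarrow> openin (top_of_set P) (c j ` A)"
    and r_cont: "j \<in> J \<Longrightarrow> continuous_on (c j ` A) (r j)"
    and r_c: "j \<in> J \<Longrightarrow> a \<in> A \<Longrightarrow> r j (c j a) = a"
    and cover: "p \<in> P \<Longrightarrow> \<exists>j\<in>J. p \<in> c j ` A"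
    and transition: "j \<in> J \<Longrightarrow> k \<in> J \<Longrightarrow>
      holomorphic_map (space_of_subset n {a \<in> A. c j a \<in> c k ` A}) (space_of_subset n A) (\<lambda>a. r k (c j a))"
begin

definition glue :: "(nat \<Rightarrow> complex) function_space" where
  "glue = \<lparr>topo = top_of_set P, sections = (\<lambda>V. {f. \<forall>j\<in>J. f \<circ> c j \<in> secs n {a \<in> A. c j a \<in> V}})\<rparr>"

lemma glue_simps [simp]:
  "topo glue = top_of_set P"
  "f \<in> sections glue V \<longleftrightarrow> (\<forall>j\<in>J. f \<circ> c j \<in> secs n {a \<in> A. c j a \<in> V})"
  by (auto simp: glue_def)

lemma A_subset: "A \<subseteq> Cn n"
  using analytic by (auto simp: analytic_subset_def dest!: open_Cn_subset)

lemma open_preimage: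
  assumes "j \<in> J" "openin (top_of_set P) V"
  shows "openin (top_of_set A) {a \<in> A. c j a \<in> V}"
proof -
  have "c j \<in> A \<rightarrow> P" using c_in assms(1) by auto
  then have "openin (top_of_set A) (A \<inter> c j -` V)"
    using continuous_openin_preimage[OF c_cont[OF assms(1)] _ assms(2)] by simp
  then show ?thesis by (simp add: vimage_def Int_def)
qed

lemma subsheaf_glue: "subsheaf_of_continuous glue"
  unfolding subsheaf_of_continuous_def glue_simps
proof (intro conjI allI impI; (elim conjE)?)
  fix V f assume V: "openin (top_of_set P) V" and f: "\<forall>j\<in>J. f \<circ> c j \<in> secs n {a \<in> A. c j a \<in> V}"
  have VP: "V \<subseteq> P" using V by (rule openin_imp_subset)
  show "continuous_map (subtopology (top_of_set P) V) euclidean f"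
  proof (rule pasting_lemma[where I=J and T="\<lambda>j. c j ` A \<inter> V" and f="\<lambda>_. f"])
    fix j assume j: "j \<in> J"
    show "openin (subtopology (top_of_set P) V) (c j ` A \<inter> V)"
      using openin_subtopology_Int[OF c_open[OF j]] .
    have "continuous_on {a \<in> A. c j a \<in> V} (f \<circ> c j)"
      by (rule secs_continuous) (use A_subset f j in auto)
    moreover have "continuous_on (c j ` A \<inter> V) (r j)"
      using r_cont[OF j] by (rule continuous_on_subset) auto
    ultimately have "continuous_on (c j ` A \<inter> V) (\<lambda>p. (f \<circ> c j) (r j p))"
      by (rule continuous_on_compose2) (use r_c[OF j] in auto)
    then have "continuous_on (c j ` A \<inter> V) f"
      by (rule continuous_on_eq) (use r_c[OF j] in auto)
    moreover have "P \<inter> V \<inter> (c j ` A \<inter> V) = c j ` A \<inter> V" using VP by auto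
    ultimately show "continuous_map (subtopology (subtopology (top_of_set P) V) (c j ` A \<inter> V)) euclidean f"
      by (simp add: subtopology_subtopology)
  next
    fix x assume "x \<in> topspace (subtopology (top_of_set P) V)"
    then show "\<exists>j. j \<in> J \<and> x \<in> c j ` A \<inter> V \<and> f x = f x" using cover[of x] by auto
  qed simp
next
  fix U f g assume "\<forall>j\<in>J. f \<circ> c j \<in> secs n {a \<in> A. c j a \<in> U}" "\<forall>x\<in>U. g x = f x"
  then show "\<forall>j\<in>J. g \<circ> c j \<in> secs n {a \<in> A. c j a \<in> U}"
    by (auto intro: secs_cong)
next
  fix U V f assume "V \<subseteq> U" "\<forall>j\<in>J. f \<circ> c j \<in> secs n {a \<in> A. c j a \<in> U}"
  then show "\<forall>j\<in>J. f \<circ> c j \<in> secs n {a \<in> A. c j a \<in> V}"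
    by (auto elim!: secs_mono)
next
  fix U f
  assume U: "openin (top_of_set P) U"
    and loc: "\<forall>a\<in>U. \<exists>V. openin (top_of_set P) V \<and> a \<in> V \<and> V \<subseteq> U \<and>
      (\<forall>j\<in>J. f \<circ> c j \<in> secs n {a \<in> A. c j a \<in> V})"
  show "\<forall>j\<in>J. f \<circ> c j \<in> secs n {a \<in> A. c j a \<in> U}"
  proof
    fix j assume j: "j \<in> J"
    show "f \<circ> c j \<in> secs n {a \<in> A. c j a \<in> U}"
    proof (rule secs_glue)
      show "{a \<in> A. c j a \<in> U} \<subseteq> Cn n" using A_subset by auto
      fix a assume a: "a \<in> {a \<in> A. c j a \<in> U}"
      then obtain V where V: "openin (top_of_set P) V" "c j a \<in> V" "V \<subseteq> U"
        "f \<circ> c j \<in> secs n {a \<in> A. c j a \<in> V}"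
        using loc j by blast
      have "openin (top_of_set {a \<in> A. c j a \<in> U}) {a \<in> A. c j a \<in> V}"
        using openin_subset_trans[OF open_preimage[OF j V(1)], of "{a \<in> A. c j a \<in> U}"] V(3) by auto
      then show "\<exists>V'. openin (top_of_set {a \<in> A. c j a \<in> U}) V' \<and> a \<in> V' \<and> f \<circ> c j \<in> secs n V'"
        using V a by (intro exI[of _ "{a \<in> A. c j a \<in> V}"]) auto
    qed
  qed
qed

lemma ring_sheaf_glue: "ring_sheaf glue"
  unfolding ring_sheaf_def
proof (intro allI impI conjI ballI)
  fix U :: "(nat \<Rightarrow> complex) set"
  have C: "{a \<in> A. c j a \<in> U} \<subseteq> Cn n" for j using A_subset by auto
  show "(\<lambda>_. k) \<in> sections glue U" for k
    using secs_const[OF C] by (simp add: comp_def)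
  fix f g assume fg: "f \<in> sections glue U" "g \<in> sections glue U"
  show "(\<lambda>x. f x + g x) \<in> sections glue U"
    unfolding glue_simps
  proof
    fix j assume "j \<in> J"
    then have "f \<circ> c j \<in> secs n {a \<in> A. c j a \<in> U}" "g \<circ> c j \<in> secs n {a \<in> A. c j a \<in> U}" using fg by auto
    then have "(\<lambda>z. (f \<circ> c j) z + (g \<circ> c j) z) \<in> secs n {a \<in> A. c j a \<in> U}"
      by (intro secs_combine[where p="(+)", OF C[of j]] holo_at_add)
    then show "(\<lambda>x. f x + g x) \<circ> c j \<in> secs n {a \<in> A. c j a \<in> U}"
      unfolding comp_def .
  qed
  show "(\<lambda>x. f x * g x) \<in> sections glue U"
    unfolding glue_simps
  proof
    fix j assume "j \<in> J"
    then have "f \<circ> c j \<in> secs n {a \<in> A. c j a \<in> U}" "g \<circ> c j \<in> secs n {a \<in> A. c j a \<in> U}" using fg by auto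
    then have "(\<lambda>z. (f \<circ> c j) z * (g \<circ> c j) z) \<in> secs n {a \<in> A. c j a \<in> U}"
      by (intro secs_combine[where p="(*)", OF C[of j]] holo_at_mult)
    then show "(\<lambda>x. f x * g x) \<circ> c j \<in> secs n {a \<in> A. c j a \<in> U}"
      unfolding comp_def .
  qed
qed

text \<open>\<open>c j\<close> is holomorphic by the definition of the sections; for
  \<open>r j\<close>, a function pulled back to the chart \<open>k\<close> passes through the
  transition map from \<open>k\<close> to \<open>j\<close>.\<close>

lemma chart_biholo:
  assumes j: "j \<in> J"
  shows "biholo_pair (restrict_space_to glue (c j ` A)) (space_of_subset n A) (r j) (c j)"
proof -
  have sub: "c j ` A \<subseteq> P" using c_in j by auto
  have pts: "points (restrict_space_to glue (c j ` A)) = c j ` A" using sub by auto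
  show ?thesis
    unfolding biholo_pair_def
  proof (intro conjI ballI)
    show "holomorphic_map (restrict_space_to glue (c j ` A)) (space_of_subset n A) (r j)"
      unfolding holomorphic_map_def
    proof (intro conjI allI impI; (elim conjE)?)
      show "continuous_map (topo (restrict_space_to glue (c j ` A))) (topo (space_of_subset n A)) (r j)"
        using r_cont[OF j] r_c[OF j] sub by (auto simp: subtopology_subtopology Int_absorb1)
      fix V g assume V: "openin (topo (space_of_subset n A)) V" "g \<in> sections (space_of_subset n A) V"
      have *: "(g \<circ> r j) \<circ> c k \<in> secs n {a \<in> A. c k a \<in> {x \<in> c j ` A. r j x \<in> V}}" if k: "k \<in> J" for k
      proof -
        have "g \<circ> (\<lambda>a. r j (c k a)) \<in> secs n {a \<in> {a \<in> A. c k a \<in> c j ` A}. r j (c k a) \<in> V}"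
          using holomorphic_map_section[OF transition[OF k j] V] by simp
        moreover have "{a \<in> {a \<in> A. c k a \<in> c j ` A}. r j (c k a) \<in> V} = {a \<in> A. c k a \<in> {x \<in> c j ` A. r j x \<in> V}}"
          by blast
        ultimately show ?thesis by (simp only: comp_def)
      qed
      show "g \<circ> r j \<in> sections (restrict_space_to glue (c j ` A))
          {x \<in> points (restrict_space_to glue (c j ` A)). r j x \<in> V}"
        unfolding pts unfolding restrict_space_to_simps glue_simps by (rule ballI) (rule *)
    qed
    show "holomorphic_map (space_of_subset n A) (restrict_space_to glue (c j ` A)) (c j)"
      unfolding holomorphic_map_def
    proof (intro conjI allI impI; (elim conjE)?)
      show "continuous_map (topo (space_of_subset n A)) (topo (restrict_space_to glue (c j ` A))) (c j)"
        using c_cont[OF j] sub by (auto simp: subtopology_subtopology Int_absorb1)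
      fix V g assume "g \<in> sections (restrict_space_to glue (c j ` A)) V"
      then show "g \<circ> c j \<in> sections (space_of_subset n A) {x \<in> points (space_of_subset n A). c j x \<in> V}"
        using j by simp
    qed
    show "c j (r j x) = x" if "x \<in> points (restrict_space_to glue (c j ` A))" for x
      using that r_c[OF j] by auto
  qed (use r_c[OF j] in auto)
qed

lemma chart_holomorphic:
  assumes j: "j \<in> J"
  shows "holomorphic_map (space_of_subset n A) glue (c j)"
proof (rule holomorphic_map_from_restrict[OF _ _ subsheaf_glue])
  show "holomorphic_map (space_of_subset n A) (restrict_space_to glue (c j ` A)) (c j)"
    using chart_biholo[OF j] by (simp add: biholo_pair_def)
  show "openin (topo glue) (c j ` A)" using c_open[OF j] by simp
qed

lemma complex_space_glue: "complex_space glue"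
  unfolding complex_space_def
proof (intro conjI ballI subsheaf_glue)
  show "Hausdorff_space (topo glue)" by (simp add: Hausdorff_space_subtopology)
  fix p assume "p \<in> points glue"
  then obtain j where j: "j \<in> J" "p \<in> c j ` A" using cover[of p] by auto
  obtain \<Omega> where "analytic_subset n \<Omega> A" using analytic by blast
  then show "\<exists>U n \<Omega> A \<phi>. openin (topo glue) U \<and> p \<in> U \<and> analytic_subset n \<Omega> A \<and>
      biholomorphic_map (restrict_space_to glue U) (space_of_subset n A) \<phi>"
    using j c_open[OF j(1)] chart_biholo[OF j(1)]
    by (intro exI[of _ "c j ` A"] exI[of _ n] exI[of _ \<Omega>] exI[of _ A] exI[of _ "r j"])
      (auto simp: biholomorphic_map_iff_pair)
qed

lemma chart_at_glue_iff:
  assumes j: "j \<in> J" and a: "a \<in> A"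
  shows "chart_at m glue (c j a) \<longleftrightarrow> chart_at m (space_of_subset n A) a"
proof
  have o: "openin (topo glue) (c j ` A)" using c_open[OF j] by simp
  have o': "openin (topo (space_of_subset n A)) A" by simp
  have pair: "biholo_pair (restrict_space_to glue (c j ` A)) (restrict_space_to (space_of_subset n A) A) (r j) (c j)"
    using chart_biholo[OF j] by (simp add: restrict_space_of_subset)
  note sh = subsheaf_space_of_subset[OF A_subset]
  show "chart_at m glue (c j a)" if "chart_at m (space_of_subset n A) a"
    by (rule chart_at_transfer[OF subsheaf_glue sh o o' pair]) (use that a r_c[OF j a] in auto)
  show "chart_at m (space_of_subset n A) a" if "chart_at m glue (c j a)"
    by (rule chart_at_transfer[where f="c j", OF sh subsheaf_glue o' o biholo_pair_sym[OF pair] a that])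
qed

lemma singular_glue_iff:
  "j \<in> J \<Longrightarrow> a \<in> A \<Longrightarrow> c j a \<in> singular_points glue \<longleftrightarrow> a \<in> singular_points (space_of_subset n A)"
  using c_in chart_at_glue_iff by (simp add: singular_points_iff)

lemma normal_glue:
  assumes "\<And>a. a \<in> A \<Longrightarrow> chart_at 2 (space_of_subset n A) a"
  shows "normal_complex_space glue"
  unfolding normal_complex_space_def
proof (intro conjI ballI complex_space_glue)
  fix p assume p: "p \<in> points glue"
  interpret germs glue p
    using p subsheaf_glue ring_sheaf_glue by unfold_locales
  obtain j a where "j \<in> J" "a \<in> A" "p = c j a" using cover[of p] p by auto
  then show "normal_at glue p" using assms chart_at_glue_iff by (intro normal_at_chart) auto
qed

end

text \<open>By \<open>comm\<close> the map is \<open>pinch\<close> in each pair of charts, and by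
  \<open>pre\<close> the preimage of a chart is the chart with the same index, so fibres, singular
  points and density are read off from the affine case. Properness comes from compactness of the
  source and the Hausdorff target.\<close>

lemma normalization_glue:
  fixes J :: "'j set"
  assumes E: "atlas 4 pinched_square P J c r" and E': "atlas 4 curve_square P' J c' r'"
    and cpt: "compact P'" and cont: "continuous_on P' \<pi>"
    and comm: "\<And>j a. j \<in> J \<Longrightarrow> a \<in> curve_square \<Longrightarrow> \<pi> (c' j a) = c j (pinch a)"
    and pre: "\<And>j x. j \<in> J \<Longrightarrow> x \<in> P' \<Longrightarrow> \<pi> x \<in> c j ` pinched_square \<Longrightarrow> x \<in> c' j ` curve_square"
  shows "is_normalization (atlas.glue 4 pinched_square P J c) (atlas.glue 4 curve_square P' J c') \<pi>"
proof -
  interpret E: atlas 4 pinched_square P J c r by (rule E)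
  interpret E': atlas 4 curve_square P' J c' r' by (rule E')
  have \<pi>P: "\<pi> x \<in> P" if "x \<in> P'" for x
    using E'.cover[OF that] comm pinch_in E.c_in by auto
  have cm: "continuous_map (topo E'.glue) (topo E.glue) \<pi>"
    using cont \<pi>P by auto
  have hol: "holomorphic_map E'.glue E.glue \<pi>"
    unfolding holomorphic_map_def
  proof (intro conjI allI impI cm; (elim conjE)?)
    fix V g assume V: "openin (topo E.glue) V" "g \<in> sections E.glue V"
    show "g \<circ> \<pi> \<in> sections E'.glue {x \<in> points E'.glue. \<pi> x \<in> V}"
      unfolding E'.glue_simps
    proof
      fix j assume j: "j \<in> J"
      have o: "openin (topo (space_of_subset 4 pinched_square)) {b \<in> pinched_square. c j b \<in> V}"
        using E.open_preimage[OF j, of V] V(1) by simp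
      have "(g \<circ> c j) \<circ> pinch \<in> secs 4 {a \<in> curve_square. pinch a \<in> {b \<in> pinched_square. c j b \<in> V}}"
        using holomorphic_map_section[OF holomorphic_pinch o, of "g \<circ> c j"] V(2) j by simp
      moreover have "{a \<in> curve_square. pinch a \<in> {b \<in> pinched_square. c j b \<in> V}} =
          {a \<in> curve_square. c' j a \<in> {x \<in> topspace (top_of_set P'). \<pi> x \<in> V}}"
        using comm[OF j] pinch_in E'.c_in[OF j] by auto
      ultimately have "(g \<circ> c j) \<circ> pinch \<in> secs 4 {a \<in> curve_square. c' j a \<in> {x \<in> topspace (top_of_set P'). \<pi> x \<in> V}}"
        by simp
      then show "g \<circ> \<pi> \<circ> c' j \<in> secs 4 {a \<in> curve_square. c' j a \<in> {x \<in> topspace (top_of_set P'). \<pi> x \<in> V}}"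
        by (rule secs_cong) (use comm[OF j] in auto)
    qed
  qed
  have sing: "c j a \<in> singular_points E.glue \<longleftrightarrow> a 2 = 0" if "j \<in> J" "a \<in> pinched_square" for j a
    using E.singular_glue_iff[OF that] that by (simp add: singular_points_pinched_square)
  define R where "R = points E.glue - singular_points E.glue"
  define R' where "R' = {x \<in> points E'.glue. \<pi> x \<notin> singular_points E.glue}"
  have R'_iff: "c' j a \<in> R' \<longleftrightarrow> a 2 \<noteq> 0" if "j \<in> J" "a \<in> curve_square" for j a
    using sing[OF that(1) pinch_in[OF that(2)]] comm[OF that] E'.c_in[OF that]
    by (simp add: R'_def) (simp add: pinch_def)
  have R_iff: "c j a \<in> R \<longleftrightarrow> a 2 \<noteq> 0" if "j \<in> J" "a \<in> pinched_square" for j a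
    using sing[OF that] E.c_in[OF that] by (simp add: R_def)
  have oR: "openin (topo E.glue) R" unfolding R_def by (rule open_regular_points)
  have R'_alt: "R' = {x \<in> points E'.glue. \<pi> x \<in> R}" using \<pi>P by (auto simp: R_def R'_def)
  have oR': "openin (topo E'.glue) R'"
    unfolding R'_alt by (rule openin_continuous_map_preimage[OF cm oR])
  have R'P: "R' \<subseteq> P'" and RP: "R \<subseteq> P" by (auto simp: R_def R'_def)
  have fibre: "\<exists>a\<in>curve_square. x = c' j a \<and> pinch a = b" if h: "j \<in> J" "x \<in> P'" "b \<in> pinched_square" "\<pi> x = c j b" for j x b
  proof -
    obtain a where a: "a \<in> curve_square" "x = c' j a" using pre[OF h(1,2)] h(3,4) by auto
    then have "c j (pinch a) = c j b" using comm h by simp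
    then have "pinch a = b" using E.r_c[OF h(1)] pinch_in[OF a(1)] h(3) by metis
    then show ?thesis using a by blast
  qed
  have surj: "\<exists>x\<in>P'. \<pi> x = p" if p: "p \<in> P" for p
  proof -
    obtain j b where j: "j \<in> J" "b \<in> pinched_square" "p = c j b" using E.cover[OF p] by auto
    obtain a where "a \<in> curve_square" "pinch a = b" using pinch_fibre(2)[OF j(2)] by auto
    then show ?thesis using comm[OF j(1)] j E'.c_in[OF j(1)] by blast
  qed
  \<comment> \<open>Inverting \<open>\<pi>\<close> globally on the regular part spares the patching
    of local inverses; in the chart \<open>j\<close> it is
    \<open>c' j \<circ> unpinch \<circ> r j\<close>.\<close>
  define \<iota> where "\<iota> = inv_into R' \<pi>"
  have inj: "inj_on \<pi> R'"
  proof (rule inj_onI)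
    fix x y assume xy: "x \<in> R'" "y \<in> R'" "\<pi> x = \<pi> y"
    then have xyP: "x \<in> P'" "y \<in> P'" using R'P by auto
    obtain j a where j: "j \<in> J" "a \<in> curve_square" "x = c' j a" using E'.cover[OF xyP(1)] by auto
    have "\<pi> y = c j (pinch a)" using xy comm j by simp
    then obtain b where b: "b \<in> curve_square" "y = c' j b" "pinch b = pinch a"
      using fibre[OF j(1) xyP(2) pinch_in[OF j(2)]] by auto
    have "a 2 \<noteq> 0" "b 2 \<noteq> 0" using R'_iff j b xy by auto
    then have "a = b" using b(3) unpinch_pinch j(2) b(1) curve_square_subset by (metis subsetD)
    then show "x = y" using j b by simp
  qed
  have \<iota>: "\<iota> (c j b) = c' j (unpinch b)" if "j \<in> J" "b \<in> pinched_square" "b 2 \<noteq> 0" for j b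
  proof -
    have u: "unpinch b \<in> curve_square" "unpinch b 2 = b 2" using unpinch_in that by (auto simp: unpinch_def)
    have bC: "b \<in> Cn 4" using that pinched_square_subset by auto
    have "\<pi> (c' j (unpinch b)) = c j b"
      using comm[OF that(1) u(1)] pinch_unpinch[OF bC that(3)] by simp
    moreover have "c' j (unpinch b) \<in> R'" using R'_iff[OF that(1) u(1)] u that by simp
    ultimately show ?thesis unfolding \<iota>_def using inv_into_f_f[OF inj] by metis
  qed
  have sections_mono: "subsheaf_of_continuous (space_of_subset 4 pinched_square)"
    "subsheaf_of_continuous (space_of_subset 4 curve_square)"
    by (rule subsheaf_space_of_subset[OF pinched_square_subset], rule subsheaf_space_of_subset[OF curve_square_subset])
  have hol\<iota>: "holomorphic_map (restrict_space_to E.glue R) E'.glue \<iota>"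
  proof (rule holomorphic_map_local)
    show shR: "subsheaf_of_continuous (restrict_space_to E.glue R)"
      by (rule subsheaf_restrict[OF E.subsheaf_glue oR])
    fix p assume "p \<in> points (restrict_space_to E.glue R)"
    then have p: "p \<in> R" "p \<in> P" using RP by auto
    obtain j b where j: "j \<in> J" "b \<in> pinched_square" "p = c j b" using E.cover[OF p(2)] by auto
    define W where "W = c j ` pinched_square \<inter> R"
    let ?A0 = "{z \<in> pinched_square. z 2 \<noteq> 0}" and ?B0 = "{z \<in> curve_square. z 2 \<noteq> 0}"
    have oW: "openin (topo E.glue) W" unfolding W_def using E.c_open[OF j(1)] oR by auto
    have WR: "R \<inter> W = W" "openin (topo (restrict_space_to E.glue R)) W"
      using oW oR by (auto simp: W_def openin_open_subtopology)
    have oA: "openin (topo (space_of_subset 4 pinched_square)) ?A0" using openin_coord_neq by simp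
    have oB: "openin (topo (space_of_subset 4 curve_square)) ?B0" using openin_coord_neq by simp
    have Wr: "{x \<in> points (restrict_space_to E.glue (c j ` pinched_square)). r j x \<in> ?A0} = W"
      using E.r_c[OF j(1)] R_iff[OF j(1)] E.c_in[OF j(1)] by (auto simp: W_def)
    have "biholo_pair (restrict_space_to (restrict_space_to E.glue (c j ` pinched_square)) W)
        (restrict_space_to (space_of_subset 4 pinched_square) ?A0) (r j) (c j)"
      using biholo_pair_restrict(2)[OF E.chart_biholo[OF j(1)] subsheaf_restrict[OF E.subsheaf_glue] sections_mono(1) oA]
        E.c_open[OF j(1)] Wr by simp
    moreover have "c j ` pinched_square \<inter> W = W" by (auto simp: W_def)
    ultimately have "holomorphic_map (restrict_space_to E.glue W) (space_of_subset 4 ?A0) (r j)"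
      by (simp add: biholo_pair_def restrict_space_of_subset)
    moreover have "holomorphic_map (space_of_subset 4 ?A0) (space_of_subset 4 ?B0) unpinch"
      using biholo_pinch by (simp add: biholo_pair_def)
    moreover have "holomorphic_map (space_of_subset 4 ?B0) E'.glue (c' j)"
      using holomorphic_map_restrict_domain[OF sections_mono(2) E'.chart_holomorphic[OF j(1)] oB]
      by (simp add: restrict_space_of_subset)
    ultimately have "holomorphic_map (restrict_space_to E.glue W) E'.glue (c' j \<circ> (unpinch \<circ> r j))"
      by (intro holomorphic_map_compose)
    then have "holomorphic_map (restrict_space_to E.glue W) E'.glue \<iota>"
    proof (rule holomorphic_map_cong[OF subsheaf_restrict[OF E.subsheaf_glue oW]])
      fix x assume "x \<in> points (restrict_space_to E.glue W)"
      then obtain a where "a \<in> pinched_square" "x = c j a" "a 2 \<noteq> 0"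
        using R_iff[OF j(1)] by (auto simp: W_def)
      then show "(c' j \<circ> (unpinch \<circ> r j)) x = \<iota> x" using \<iota>[OF j(1)] E.r_c[OF j(1)] by simp
    qed
    then have "holomorphic_map (restrict_space_to (restrict_space_to E.glue R) W) E'.glue \<iota>"
      using WR(1) by simp
    then show "\<exists>U. openin (topo (restrict_space_to E.glue R)) U \<and> p \<in> U \<and>
        holomorphic_map (restrict_space_to (restrict_space_to E.glue R) U) E'.glue \<iota>"
      using WR(2) j p by (intro exI[of _ W]) (auto simp: W_def)
  qed
  have \<pi>\<iota>: "\<iota> p \<in> R' \<and> \<pi> (\<iota> p) = p" if pR: "p \<in> R" for p
  proof -
    obtain x where "x \<in> P'" "\<pi> x = p" using surj[of p] pR RP by blast
    then have "p \<in> \<pi> ` R'" using pR by (auto simp: R'_alt)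
    then show ?thesis unfolding \<iota>_def by (auto simp: f_inv_into_f inv_into_into)
  qed
  show ?thesis
    unfolding is_normalization_def Let_def R_def[symmetric] R'_def[symmetric]
  proof (intro conjI ballI)
    show "complex_space E.glue" by (rule E.complex_space_glue)
    show "normal_complex_space E'.glue" by (rule E'.normal_glue[OF chart_at_curve_square])
    show "holomorphic_map E'.glue E.glue \<pi>" by (rule hol)
    show "\<pi> ` points E'.glue = points E.glue"
      using \<pi>P surj by force
    show "proper_map (topo E'.glue) (topo E.glue) \<pi>"
      by (rule continuous_imp_proper_map[OF _ _ cm])
        (use cpt in \<open>auto simp: compact_space_subtopology intro!: Hausdorff_imp_kc_space Hausdorff_space_subtopology\<close>)
    show "finite {x \<in> points E'.glue. \<pi> x = p}" if p: "p \<in> points E.glue" for p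
    proof -
      obtain j b where j: "j \<in> J" "b \<in> pinched_square" "p = c j b" using E.cover[of p] p by auto
      have "{x \<in> points E'.glue. \<pi> x = p} \<subseteq> c' j ` {a \<in> curve_square. pinch a = b}"
        using fibre[OF j(1) _ j(2)] j(3) by auto
      then show ?thesis using pinch_fibre(1)[OF j(2)] finite_surj by blast
    qed
    show "topo E'.glue closure_of R' = points E'.glue"
    proof (intro subset_antisym subsetI)
      fix x assume x: "x \<in> points E'.glue"
      then obtain j a where j: "j \<in> J" "a \<in> curve_square" "x = c' j a" using E'.cover[of x] by auto
      show "x \<in> topo E'.glue closure_of R'"
        unfolding in_closure_of
      proof (intro conjI x allI impI)
        fix T assume T: "x \<in> T \<and> openin (topo E'.glue) T"
        then have "openin (top_of_set curve_square) {a \<in> curve_square. c' j a \<in> T}"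
          using E'.open_preimage[OF j(1)] by simp
        from dense_curve_square[OF j(2) this] obtain w where "w \<in> curve_square" "c' j w \<in> T" "w 2 \<noteq> 0"
          using T j by auto
        then show "\<exists>y. y \<in> R' \<and> y \<in> T" using R'_iff[OF j(1)] by auto
      qed
    qed (simp add: in_closure_of)
    have "biholo_pair (restrict_space_to E'.glue R') (restrict_space_to E.glue R) \<pi> \<iota>"
      unfolding biholo_pair_def
    proof (intro conjI ballI)
      show "holomorphic_map (restrict_space_to E'.glue R') (restrict_space_to E.glue R) \<pi>"
        by (rule holomorphic_map_into_restrict[OF holomorphic_map_restrict_domain[OF E'.subsheaf_glue hol oR'] oR])
          (auto simp: R'_alt)
      show "holomorphic_map (restrict_space_to E.glue R) (restrict_space_to E'.glue R') \<iota>"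
        by (rule holomorphic_map_into_restrict[OF hol\<iota> oR']) (use \<pi>\<iota> in auto)
      show "\<iota> (\<pi> x) = x" if "x \<in> points (restrict_space_to E'.glue R')" for x
        using that inj by (simp add: \<iota>_def inv_into_f_f)
      show "\<pi> (\<iota> p) = p" if "p \<in> points (restrict_space_to E.glue R)" for p
        using that \<pi>\<iota> by simp
    qed
    then show "biholomorphic_map (restrict_space_to E'.glue R') (restrict_space_to E.glue R) \<pi>"
      by (auto simp: biholomorphic_map_iff_pair)
  qed
qed

text \<open>Four charts are obtained from one embedding \<open>emb\<close> by applying the group
  generated by two commuting involutions \<open>\<kappa>1\<close>, \<open>\<kappa>2\<close> of the
  ambient set \<open>E\<close>, one for each factor. \<open>\<tau>1\<close>, \<open>\<tau>2\<close>
  are the transition maps they induce. Entries 1 and 3 of a point vanish exactly when x or w is at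
  infinity, which makes the chart images open.\<close>

locale gluing =
  fixes A E :: "(nat \<Rightarrow> complex) set" and emb ret \<kappa>1 \<kappa>2 \<tau>1 \<tau>2 :: "(nat \<Rightarrow> complex) \<Rightarrow> nat \<Rightarrow> complex"
  assumes A_analytic: "\<exists>\<Omega>. analytic_subset 4 \<Omega> A"
    and emb_cont: "continuous_on A emb" and ret_emb: "\<And>z. z \<in> A \<Longrightarrow> ret (emb z) = z"
    and ret_cont: "continuous_on {e. e 1 \<noteq> 0 \<and> e 3 \<noteq> 0} ret"
    and emb_E: "\<And>z. z \<in> A \<Longrightarrow> emb z \<in> E"
    and \<kappa>_cont: "continuous_on UNIV \<kappa>1" "continuous_on UNIV \<kappa>2"
    and \<kappa>_E: "\<And>e. e \<in> E \<Longrightarrow> \<kappa>1 e \<in> E \<and> \<kappa>2 e \<in> E"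
    and \<kappa>_inv: "\<And>e. e \<in> E \<Longrightarrow> \<kappa>1 (\<kappa>1 e) = e \<and> \<kappa>2 (\<kappa>2 e) = e \<and> \<kappa>1 (\<kappa>2 e) = \<kappa>2 (\<kappa>1 e)"
    and emb_coords: "\<And>z. z \<in> A \<Longrightarrow> emb z 1 = 1 / (1 + z 0 * cnj (z 0)) \<and> emb z 3 = 1 / (1 + z 2 * cnj (z 2))"
    and \<kappa>_coords: "\<And>e. \<kappa>1 e 1 = 1 - e 1 \<and> \<kappa>1 e 3 = e 3 \<and> \<kappa>2 e 1 = e 1 \<and> \<kappa>2 e 3 = 1 - e 3"
    and \<tau>1: "\<And>z. z \<in> A \<Longrightarrow> z 0 \<noteq> 0 \<Longrightarrow> \<tau>1 z \<in> A \<and> \<kappa>1 (emb z) = emb (\<tau>1 z)"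
    and \<tau>2: "\<And>z. z \<in> A \<Longrightarrow> z 2 \<noteq> 0 \<Longrightarrow> \<tau>2 z \<in> A \<and> \<kappa>2 (emb z) = emb (\<tau>2 z)"
    and \<tau>_coords: "\<And>z. \<tau>1 z 0 = 1 / z 0 \<and> \<tau>1 z 2 = z 2 \<and> \<tau>2 z 0 = z 0 \<and> \<tau>2 z 2 = 1 / z 2"
    and \<tau>1_hol: "holomorphic_map (space_of_subset 4 {z \<in> A. z 0 \<noteq> 0}) (space_of_subset 4 A) \<tau>1"
    and \<tau>2_hol: "holomorphic_map (space_of_subset 4 {z \<in> A. z 2 \<noteq> 0}) (space_of_subset 4 A) \<tau>2"
    and cpt: "compact {z \<in> A. norm (z 0) \<le> 1 \<and> norm (z 2) \<le> 1}"
begin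

definition g :: "bool \<times> bool \<Rightarrow> (nat \<Rightarrow> complex) \<Rightarrow> nat \<Rightarrow> complex" where
  "g j e = (if fst j then \<kappa>1 else id) ((if snd j then \<kappa>2 else id) e)"

definition \<tau> :: "bool \<times> bool \<Rightarrow> (nat \<Rightarrow> complex) \<Rightarrow> nat \<Rightarrow> complex" where
  "\<tau> j z = (if fst j then \<tau>1 else id) ((if snd j then \<tau>2 else id) z)"

definition c :: "bool \<times> bool \<Rightarrow> (nat \<Rightarrow> complex) \<Rightarrow> nat \<Rightarrow> complex" where "c j z = g j (emb z)"
definition r :: "bool \<times> bool \<Rightarrow> (nat \<Rightarrow> complex) \<Rightarrow> nat \<Rightarrow> complex" where "r j e = ret (g j e)"
definition P :: "(nat \<Rightarrow> complex) set" where "P = (\<Union>j. c j ` A)"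

text \<open>The group law of the four-element group that indexes the charts.\<close>

definition xor2 :: "bool \<times> bool \<Rightarrow> bool \<times> bool \<Rightarrow> bool \<times> bool" where
  "xor2 j k = (fst j \<noteq> fst k, snd j \<noteq> snd k)"

lemma xor2_cancel: "xor2 (xor2 j k) k = j"
  by (cases j; cases k) (auto simp: xor2_def)

lemma c_in_P: "z \<in> A \<Longrightarrow> c j z \<in> P"
  unfolding P_def by blast

lemma P_cases:
  assumes "e \<in> P" obtains j z where "z \<in> A" "e = c j z"
  using assms unfolding P_def by blast

lemma g_E: "e \<in> E \<Longrightarrow> g j e \<in> E"
  using \<kappa>_E by (simp add: g_def)

lemma g_g: "e \<in> E \<Longrightarrow> g j (g k e) = g (xor2 j k) e"
  using \<kappa>_inv \<kappa>_E by (auto simp: g_def xor2_def)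

lemma g_g_same: "e \<in> E \<Longrightarrow> g j (g j e) = e"
  by (simp add: g_g xor2_def) (simp add: g_def)

lemma g_cont: "continuous_on UNIV (g j)"
  unfolding g_def[abs_def]
  by (auto intro!: continuous_on_compose2[OF \<kappa>_cont(1) \<kappa>_cont(2)] \<kappa>_cont)

lemma P_E: "P \<subseteq> E"
  using g_E emb_E by (auto simp: P_def c_def)

definition dom :: "bool \<times> bool \<Rightarrow> (nat \<Rightarrow> complex) set" where
  "dom j = {z \<in> A. (fst j \<longrightarrow> z 0 \<noteq> 0) \<and> (snd j \<longrightarrow> z 2 \<noteq> 0)}"

lemma one_plus_norm_neq0: "1 + z * cnj z \<noteq> (0::complex)"
proof
  assume "1 + z * cnj z = 0"
  then have "complex_of_real (1 + (norm z)\<^sup>2) = of_real 0"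
    by (simp only: complex_norm_square of_real_add of_real_1 of_real_0)
  then have "1 + (norm z)\<^sup>2 = 0" by (simp only: of_real_eq_iff)
  then show False using zero_le_power2[of "norm z"] by linarith
qed

lemma emb_in: "z \<in> A \<Longrightarrow> emb z 1 \<noteq> 0 \<and> emb z 3 \<noteq> 0"
  using emb_coords one_plus_norm_neq0 by simp

lemma c_coord_nz:
  assumes "z \<in> A"
  shows "c j z 1 \<noteq> 0 \<longleftrightarrow> (fst j \<longrightarrow> z 0 \<noteq> 0)" "c j z 3 \<noteq> 0 \<longleftrightarrow> (snd j \<longrightarrow> z 2 \<noteq> 0)"
proof -
  have "1 - 1 / (1 + w * cnj w) = w * cnj w / (1 + w * cnj w)" for w :: complex
    using one_plus_norm_neq0[of w] by (simp add: field_simps)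
  then have *: "1 - 1 / (1 + w * cnj w) = 0 \<longleftrightarrow> w = 0" for w :: complex
    using one_plus_norm_neq0[of w] by (simp only: divide_eq_0_iff mult_eq_0_iff complex_cnj_zero_iff) simp
  show "c j z 1 \<noteq> 0 \<longleftrightarrow> (fst j \<longrightarrow> z 0 \<noteq> 0)"
    unfolding c_def g_def using emb_coords[OF assms] \<kappa>_coords emb_in[OF assms] * by auto
  show "c j z 3 \<noteq> 0 \<longleftrightarrow> (snd j \<longrightarrow> z 2 \<noteq> 0)"
    unfolding c_def g_def using emb_coords[OF assms] \<kappa>_coords emb_in[OF assms] * by auto
qed

lemma g_emb:
  assumes "z \<in> dom j"
  shows "\<tau> j z \<in> A" "g j (emb z) = emb (\<tau> j z)"
  using assms \<tau>1 \<tau>2 \<tau>_coords by (auto simp: dom_def \<tau>_def g_def)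

text \<open>A point of another chart has a nonzero entry 1 or 3 precisely when the coordinate to be
  inverted is nonzero; then the flip \<open>\<tau> j\<close> brings it into the affine part.\<close>

lemma range_emb: "emb ` A = {e \<in> P. e 1 \<noteq> 0 \<and> e 3 \<noteq> 0}"
proof (intro subset_antisym subsetI)
  fix e assume "e \<in> emb ` A"
  then obtain z where "z \<in> A" "e = emb z" by blast
  moreover have "emb z = c (False, False) z" by (simp add: c_def g_def)
  ultimately show "e \<in> {e \<in> P. e 1 \<noteq> 0 \<and> e 3 \<noteq> 0}" using emb_in[of z] c_in_P[of z "(False, False)"] by simp
next
  fix e assume e: "e \<in> {e \<in> P. e 1 \<noteq> 0 \<and> e 3 \<noteq> 0}"
  then obtain j z where z: "z \<in> A" "e = c j z" using P_cases by blast
  then have "z \<in> dom j" using c_coord_nz[OF z(1), of j] e by (auto simp: dom_def)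
  then show "e \<in> emb ` A" using g_emb[of z j] z by (auto simp: c_def)
qed

lemma g_P:
  assumes "e \<in> P"
  shows "g j e \<in> P"
proof -
  obtain k z where z: "z \<in> A" "e = c k z" using assms by (rule P_cases)
  then have "g j e = c (xor2 j k) z" using g_g emb_E by (simp add: c_def)
  then show ?thesis using c_in_P z by simp
qed

text \<open>The involution \<open>g j\<close> carries the chart \<open>j\<close> to the affine part,
  to which \<open>range_emb\<close> applies.\<close>

lemma range_c: "c j ` A = {e \<in> P. g j e 1 \<noteq> 0 \<and> g j e 3 \<noteq> 0}"
proof (intro subset_antisym subsetI)
  fix e assume "e \<in> c j ` A"
  then obtain z where z: "z \<in> A" "e = g j (emb z)" by (auto simp: c_def)
  then have "g j e = emb z" using g_g_same emb_E by simp
  then show "e \<in> {e \<in> P. g j e 1 \<noteq> 0 \<and> g j e 3 \<noteq> 0}" using emb_in[OF z(1)] z c_in_P[OF z(1), of j] by (simp add: c_def)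
next
  fix e assume e: "e \<in> {e \<in> P. g j e 1 \<noteq> 0 \<and> g j e 3 \<noteq> 0}"
  then have "g j e \<in> emb ` A" using range_emb g_P by auto
  then obtain z where "z \<in> A" "g j e = emb z" by blast
  moreover have "e = g j (g j e)" using g_g_same[of e j] e P_E by auto
  ultimately show "e \<in> c j ` A" by (auto simp: c_def)
qed

text \<open>Applying \<open>g k\<close> reduces the overlap of two charts to the overlap with the
  affine part, where only the index difference \<open>xor2 k j\<close> matters.\<close>

lemma c_in_range_iff: "z \<in> A \<Longrightarrow> c j z \<in> c k ` A \<longleftrightarrow> z \<in> dom (xor2 k j)"
proof -
  assume z: "z \<in> A"
  have "g k (c j z) = c (xor2 k j) z" using g_g emb_E[OF z] by (simp add: c_def)
  moreover have "c j z \<in> P" by (rule c_in_P[OF z])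
  ultimately show ?thesis
    using c_coord_nz[OF z, of "xor2 k j"] z by (auto simp: range_c dom_def)
qed

lemma \<tau>_hol: "holomorphic_map (space_of_subset 4 (dom j)) (space_of_subset 4 A) (\<tau> j)"
proof -
  have AC: "A \<subseteq> Cn 4" using A_analytic by (auto simp: analytic_subset_def dest!: open_Cn_subset)
  have sub: "{z \<in> A. z i \<noteq> 0} \<subseteq> Cn 4" for i using AC by auto
  note sh = subsheaf_space_of_subset
  have restr: "holomorphic_map (space_of_subset 4 U) Y f"
    if "holomorphic_map (space_of_subset 4 V) Y f" "openin (top_of_set V) U" "V \<subseteq> Cn 4" for U V f and Y :: "(nat \<Rightarrow> complex) function_space"
    using holomorphic_map_restrict_domain[OF sh[OF that(3)] that(1), of U] that(2)
    by (simp add: restrict_space_of_subset openin_imp_subset)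
  have o: "openin (top_of_set {z \<in> A. z i \<noteq> 0}) {z \<in> A. z i \<noteq> 0 \<and> z k \<noteq> 0}" for i k
    using openin_coord_neq[of "{z \<in> A. z i \<noteq> 0}" k] by (simp add: conj_assoc)
  consider "j = (False, False)" | "j = (True, False)" | "j = (False, True)" | "j = (True, True)"
    by (metis (full_types) surj_pair)
  then show ?thesis
  proof cases
    case 1
    have "holomorphic_map (restrict_space_to (space_of_subset 4 A) A) (space_of_subset 4 A) id"
      by (rule holomorphic_map_id_restrict[OF sh[OF AC]]) simp
    then show ?thesis using 1 by (simp add: dom_def \<tau>_def[abs_def] restrict_space_of_subset id_def)
  next
    case 2
    then show ?thesis using \<tau>1_hol by (simp add: dom_def \<tau>_def[abs_def])
  next
    case 3
    then show ?thesis using \<tau>2_hol by (simp add: dom_def \<tau>_def[abs_def])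
  next
    case 4
    have o0: "openin (topo (space_of_subset 4 A)) {z \<in> A. z 0 \<noteq> 0}" using openin_coord_neq by simp
    have "holomorphic_map (space_of_subset 4 {z \<in> A. z 2 \<noteq> 0 \<and> z 0 \<noteq> 0}) (space_of_subset 4 A) \<tau>2"
      by (rule restr[OF \<tau>2_hol o sub])
    then have "holomorphic_map (space_of_subset 4 {z \<in> A. z 2 \<noteq> 0 \<and> z 0 \<noteq> 0})
        (restrict_space_to (space_of_subset 4 A) {z \<in> A. z 0 \<noteq> 0}) \<tau>2"
      by (rule holomorphic_map_into_restrict[OF _ o0]) (use \<tau>2 \<tau>_coords in auto)
    then have "holomorphic_map (space_of_subset 4 {z \<in> A. z 2 \<noteq> 0 \<and> z 0 \<noteq> 0}) (space_of_subset 4 {z \<in> A. z 0 \<noteq> 0}) \<tau>2"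
      by (simp add: restrict_space_of_subset)
    from holomorphic_map_compose[OF this \<tau>1_hol]
    have "holomorphic_map (space_of_subset 4 {z \<in> A. z 2 \<noteq> 0 \<and> z 0 \<noteq> 0}) (space_of_subset 4 A) (\<tau>1 \<circ> \<tau>2)" .
    moreover have "{z \<in> A. z 2 \<noteq> 0 \<and> z 0 \<noteq> 0} = dom j" using 4 by (auto simp: dom_def)
    ultimately show ?thesis using 4 by (simp add: \<tau>_def[abs_def] comp_def)
  qed
qed

sublocale atlas 4 A P UNIV c r
proof
  show "\<exists>\<Omega>. analytic_subset 4 \<Omega> A" by (rule A_analytic)
  show cc: "continuous_on A (c j)" for j
    unfolding c_def[abs_def] by (rule continuous_on_compose2[OF g_cont emb_cont]) auto
  show "c j a \<in> P" if "a \<in> A" for j a using that by (rule c_in_P)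
  have gi: "continuous_on UNIV (\<lambda>e. g j e i)" for j i
    using g_cont by (rule continuous_on_product_then_coordinatewise)
  have op: "open {e. g j e i \<noteq> 0}" for j i
    using open_Collect_neq[OF gi continuous_on_const] .
  show "openin (top_of_set P) (c j ` A)" for j
  proof -
    have "c j ` A = P \<inter> ({e. g j e 1 \<noteq> 0} \<inter> {e. g j e 3 \<noteq> 0})" unfolding range_c by auto
    then show ?thesis using openin_open_Int[OF open_Int[OF op[of j 1] op[of j 3]], of P] by simp
  qed
  show "continuous_on (c j ` A) (r j)" for j
    unfolding r_def[abs_def]
    by (rule continuous_on_compose2[OF ret_cont continuous_on_subset[OF g_cont]]) (auto simp: range_c)
  show "r j (c j a) = a" if "a \<in> A" for j a
    using that g_g_same emb_E ret_emb by (simp add: r_def c_def)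
  show "\<exists>j\<in>UNIV. p \<in> c j ` A" if "p \<in> P" for p using that P_cases by blast
  show "holomorphic_map (space_of_subset 4 {a \<in> A. c j a \<in> c k ` A}) (space_of_subset 4 A) (\<lambda>a. r k (c j a))" for j k
  proof -
    have D: "{a \<in> A. c j a \<in> c k ` A} = dom (xor2 k j)"
    proof -
      have "dom (xor2 k j) \<subseteq> A" by (auto simp: dom_def)
      then show ?thesis using c_in_range_iff[of _ j k] by blast
    qed
    have AC: "dom (xor2 k j) \<subseteq> Cn 4" using A_analytic by (auto simp: dom_def analytic_subset_def dest!: open_Cn_subset)
    show ?thesis
      unfolding D
    proof (rule holomorphic_map_cong[OF subsheaf_space_of_subset[OF AC] \<tau>_hol])
      fix x assume "x \<in> points (space_of_subset 4 (dom (xor2 k j)))"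
      then have x: "x \<in> dom (xor2 k j)" by simp
      then have "x \<in> A" by (simp add: dom_def)
      then show "\<tau> (xor2 k j) x = r k (c j x)"
        using g_emb[OF x] g_g emb_E ret_emb by (simp add: r_def c_def)
    qed
  qed
qed

text \<open>Inverting those of x and w that have modulus above 1 moves a point into the compact set
  |x| \<le> 1, |w| \<le> 1 of some chart, so four images of that set cover everything.\<close>

lemma compact_P: "compact P"
proof -
  define K where "K = {z \<in> A. norm (z 0) \<le> 1 \<and> norm (z 2) \<le> 1}"
  have *: "c j ` K \<subseteq> P" for j using c_in_P[of _ j] by (auto simp: K_def)
  have "P \<subseteq> (\<Union>j. c j ` K)"
  proof
    fix e assume "e \<in> P"
    then obtain j z where z: "z \<in> A" "e = c j z" by (rule P_cases)
    define k where "k = (norm (z 0) > 1, norm (z 2) > 1)"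
    have d: "z \<in> dom k" using z(1) by (auto simp: dom_def k_def)
    have "\<tau> k z \<in> K"
      using g_emb(1)[OF d] \<tau>_coords
      by (auto simp: K_def \<tau>_def k_def norm_divide divide_le_eq)
    moreover have "e = c (xor2 j k) (\<tau> k z)"
    proof -
      have "c (xor2 j k) (\<tau> k z) = g (xor2 j k) (g k (emb z))" using g_emb(2)[OF d] by (simp add: c_def)
      also have "\<dots> = g j (emb z)" using g_g emb_E[OF z(1)] by (simp add: xor2_cancel)
      also have "\<dots> = e" using z by (simp add: c_def)
      finally show ?thesis ..
    qed
    ultimately show "e \<in> (\<Union>j. c j ` K)" by blast
  qed
  then have "P = (\<Union>j. c j ` K)" using * by blast
  moreover have "compact (\<Union>j. c j ` K)"
  proof (intro compact_UN finite_class.finite_UNIV)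
    fix j
    have "continuous_on K (c j)" by (rule continuous_on_subset[OF c_cont]) (auto simp: K_def)
    then show "compact (c j ` K)" using cpt by (intro compact_continuous_image) (simp_all add: K_def)
  qed
  ultimately show ?thesis by simp
qed

end

section \<open>The compactifications\<close>

text \<open>Prefixing an entry to a sequence lets points of the ambient space be written as lists
  that simplification can index.\<close>

definition cseq :: "complex \<Rightarrow> (nat \<Rightarrow> complex) \<Rightarrow> nat \<Rightarrow> complex" (infixr "\<triangleright>" 65) where
  "a \<triangleright> e = (\<lambda>i. case i of 0 \<Rightarrow> a | Suc k \<Rightarrow> e k)"

definition zseq :: "nat \<Rightarrow> complex" where "zseq = (\<lambda>_. 0)"

lemma cseq_simps [simp]:
  "(a \<triangleright> e) 0 = a" "(a \<triangleright> e) (Suc k) = e k" "(a \<triangleright> e) 1 = e 0"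
  "(a \<triangleright> e) (numeral v) = e (pred_numeral v)" "zseq k = 0"
  by (simp_all add: cseq_def zseq_def numeral_eq_Suc)

lemma cseq_eqI: "a = b \<Longrightarrow> e = f \<Longrightarrow> a \<triangleright> e = b \<triangleright> f"
  by simp

lemma zseq_in_Cn [simp]: "zseq \<in> Cn n"
  by (simp add: Cn_def)

lemma cseq_in_Cn: "0 < n \<Longrightarrow> e \<in> Cn (n - 1) \<Longrightarrow> a \<triangleright> e \<in> Cn n"
  by (auto simp: Cn_def cseq_def split: nat.split)

lemma Cn8_expand:
  assumes "e \<in> Cn 8"
  shows "e 0 \<triangleright> e 1 \<triangleright> e 2 \<triangleright> e 3 \<triangleright> e 4 \<triangleright> e 5 \<triangleright> e 6 \<triangleright> e 7 \<triangleright> zseq = e"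
proof
  fix i
  show "(e 0 \<triangleright> e 1 \<triangleright> e 2 \<triangleright> e 3 \<triangleright> e 4 \<triangleright> e 5 \<triangleright> e 6 \<triangleright> e 7 \<triangleright> zseq) i = e i"
  proof (cases "i < 8")
    case True
    then have "i = 0 \<or> i = 1 \<or> i = 2 \<or> i = 3 \<or> i = 4 \<or> i = 5 \<or> i = 6 \<or> i = 7" by linarith
    then show ?thesis by (elim disjE) simp_all
  next
    case False
    then obtain k where "i = 8 + k" by (metis le_Suc_ex not_less)
    then have "i = Suc (Suc (Suc (Suc (Suc (Suc (Suc (Suc k)))))))" by simp
    then show ?thesis using assms False by (simp add: Cn_def)
  qed
qed

lemma continuous_on_cseq:
  assumes "continuous_on S a" "continuous_on S e"
  shows "continuous_on S (\<lambda>x. a x \<triangleright> e x)"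
proof (rule continuous_on_coordinatewise_then_product)
  fix i
  show "continuous_on S (\<lambda>x. (a x \<triangleright> e x) i)"
    by (cases i) (use assms continuous_on_product_then_coordinatewise[OF assms(2)] in auto)
qed

text \<open>z / wt z and 1 / wt z are, up to scaling and translation, the coordinates of
  stereographic projection onto the Riemann sphere.\<close>

definition wt :: "complex \<Rightarrow> complex" where "wt z = 1 + z * cnj z"

lemma wt_nonzero [simp]: "wt z \<noteq> 0"
proof
  assume "wt z = 0"
  then have "complex_of_real (1 + (norm z)\<^sup>2) = of_real 0"
    by (simp only: wt_def complex_norm_square of_real_add of_real_1 of_real_0)
  then have "1 + (norm z)\<^sup>2 = 0" by (simp only: of_real_eq_iff)
  then show False using zero_le_power2[of "norm z"] by linarith
qed

lemma cnj_wt [simp]: "cnj (wt z) = wt z"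
  by (simp add: wt_def mult.commute)

lemma one_minus_inverse_wt: "1 - 1 / wt z = z * cnj z / wt z"
  by (simp add: field_simps) (simp add: wt_def algebra_simps)

lemma wt_inverse: "z \<noteq> 0 \<Longrightarrow> wt (1 / z) = wt z / (z * cnj z)"
  by (simp add: wt_def field_simps)

text \<open>All four follow from wt (1/x) = wt x / |x|^2. They are the rules by which the flip of
  the curve acts on its embedding.\<close>

lemma wt_swap:
  assumes "x \<noteq> 0"
  shows "1 / x / wt (1 / x) = cnj (x / wt x)" "1 / wt (1 / x) = 1 - 1 / wt x"
    "- (y / x ^ 3) / wt (1 / x) ^ 3 = - (y * cnj x ^ 3 / wt x ^ 3)"
    "- (y / x ^ 3) * cnj (1 / x) ^ 3 / wt (1 / x) ^ 3 = - (y / wt x ^ 3)"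
  using assms unfolding one_minus_inverse_wt wt_inverse[OF assms]
  by (simp_all add: field_simps power3_eq_cube)

lemma continuous_on_wt: "continuous_on S f \<Longrightarrow> continuous_on S (\<lambda>x. wt (f x))"
  unfolding wt_def by (intro continuous_intros continuous_on_cnj)

lemmas emb_continuous_intros = continuous_on_cseq continuous_on_divide continuous_on_wt continuous_on_mult
  continuous_on_power continuous_on_cnj continuous_on_coord continuous_on_const continuous_on_minus
  continuous_on_diff continuous_on_vec4

text \<open>
  The coordinates are chosen so that the transition maps \<open>(x, y) \<mapsto> (1/x, -y/x\<^sup>3)\<close> of the
  compactified curve become involutions of the ambient space.
\<close>

definition embC :: "(nat \<Rightarrow> complex) \<Rightarrow> nat \<Rightarrow> complex" where
  "embC z = z 0 / wt (z 0) \<triangleright> 1 / wt (z 0) \<triangleright> z 2 / wt (z 2) \<triangleright> 1 / wt (z 2) \<triangleright>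
     z 3 / wt (z 2) ^ 3 \<triangleright> z 3 * cnj (z 2) ^ 3 / wt (z 2) ^ 3 \<triangleright>
     z 1 / wt (z 0) ^ 3 \<triangleright> z 1 * cnj (z 0) ^ 3 / wt (z 0) ^ 3 \<triangleright> zseq"

text \<open>Under the two flips v is multiplied by -1/x^3 and by 1/w^2, whence the exponents 3 and 2
  of the weights. Entries 6 to 9 are v over the weights times 1, cnj x^3, cnj w^2 and both factors,
  a family that the flips permute up to sign. Entries 0 to 5 agree with those of
  \<open>embC\<close>.\<close>

definition embP :: "(nat \<Rightarrow> complex) \<Rightarrow> nat \<Rightarrow> complex" where
  "embP z = z 0 / wt (z 0) \<triangleright> 1 / wt (z 0) \<triangleright> z 2 / wt (z 2) \<triangleright> 1 / wt (z 2) \<triangleright>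
     z 3 / wt (z 2) ^ 3 \<triangleright> z 3 * cnj (z 2) ^ 3 / wt (z 2) ^ 3 \<triangleright>
     z 1 / (wt (z 0) ^ 3 * wt (z 2) ^ 2) \<triangleright> z 1 * cnj (z 0) ^ 3 / (wt (z 0) ^ 3 * wt (z 2) ^ 2) \<triangleright>
     z 1 * cnj (z 2) ^ 2 / (wt (z 0) ^ 3 * wt (z 2) ^ 2) \<triangleright>
     z 1 * cnj (z 0) ^ 3 * cnj (z 2) ^ 2 / (wt (z 0) ^ 3 * wt (z 2) ^ 2) \<triangleright> zseq"

definition retC :: "(nat \<Rightarrow> complex) \<Rightarrow> nat \<Rightarrow> complex" where
  "retC e = vec4 (e 0 / e 1) (e 6 / e 1 ^ 3) (e 2 / e 3) (e 4 / e 3 ^ 3)"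

definition retP :: "(nat \<Rightarrow> complex) \<Rightarrow> nat \<Rightarrow> complex" where
  "retP e = vec4 (e 0 / e 1) (e 6 / (e 1 ^ 3 * e 3 ^ 2)) (e 2 / e 3) (e 4 / e 3 ^ 3)"

text \<open>The flip of the first factor as read off from \<open>wt_swap\<close>. No entry is
  divided by, so it is defined at infinity as well.\<close>

definition \<kappa>1C :: "(nat \<Rightarrow> complex) \<Rightarrow> nat \<Rightarrow> complex" where
  "\<kappa>1C e = cnj (e 0) \<triangleright> (1 - e 1) \<triangleright> e 2 \<triangleright> e 3 \<triangleright> e 4 \<triangleright> e 5 \<triangleright> - e 7 \<triangleright> - e 6 \<triangleright> zseq"

definition \<kappa>2C :: "(nat \<Rightarrow> complex) \<Rightarrow> nat \<Rightarrow> complex" where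
  "\<kappa>2C e = e 0 \<triangleright> e 1 \<triangleright> cnj (e 2) \<triangleright> (1 - e 3) \<triangleright> - e 5 \<triangleright> - e 4 \<triangleright> e 6 \<triangleright> e 7 \<triangleright> zseq"

definition \<kappa>1P :: "(nat \<Rightarrow> complex) \<Rightarrow> nat \<Rightarrow> complex" where
  "\<kappa>1P e = cnj (e 0) \<triangleright> (1 - e 1) \<triangleright> e 2 \<triangleright> e 3 \<triangleright> e 4 \<triangleright> e 5 \<triangleright> - e 7 \<triangleright> - e 6 \<triangleright> - e 9 \<triangleright> - e 8 \<triangleright> zseq"

definition \<kappa>2P :: "(nat \<Rightarrow> complex) \<Rightarrow> nat \<Rightarrow> complex" where
  "\<kappa>2P e = e 0 \<triangleright> e 1 \<triangleright> cnj (e 2) \<triangleright> (1 - e 3) \<triangleright> - e 5 \<triangleright> - e 4 \<triangleright> e 8 \<triangleright> e 9 \<triangleright> e 6 \<triangleright> e 7 \<triangleright> zseq"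

definition flip1 :: "(nat \<Rightarrow> complex) \<Rightarrow> nat \<Rightarrow> complex" where
  "flip1 z = vec4 (1 / z 0) (- (z 1 / z 0 ^ 3)) (z 2) (z 3)"

definition flip2C :: "(nat \<Rightarrow> complex) \<Rightarrow> nat \<Rightarrow> complex" where
  "flip2C z = vec4 (z 0) (z 1) (1 / z 2) (- (z 3 / z 2 ^ 3))"

text \<open>With y fixed and w replaced by 1/w, the product v = y w becomes y/w = v/w^2.\<close>

definition flip2P :: "(nat \<Rightarrow> complex) \<Rightarrow> nat \<Rightarrow> complex" where
  "flip2P z = vec4 (z 0) (z 1 / z 2 ^ 2) (1 / z 2) (- (z 3 / z 2 ^ 3))"

lemma Cn10_expand:
  assumes "e \<in> Cn 10"
  shows "e 0 \<triangleright> e 1 \<triangleright> e 2 \<triangleright> e 3 \<triangleright> e 4 \<triangleright> e 5 \<triangleright> e 6 \<triangleright> e 7 \<triangleright> e 8 \<triangleright> e 9 \<triangleright> zseq = e"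
proof -
  define f where "f = (\<lambda>i. e (Suc (Suc i)))"
  have "f \<in> Cn 8" using assms by (auto simp: f_def Cn_def)
  from Cn8_expand[OF this]
  have "e 2 \<triangleright> e 3 \<triangleright> e 4 \<triangleright> e 5 \<triangleright> e 6 \<triangleright> e 7 \<triangleright> e 8 \<triangleright> e 9 \<triangleright> zseq = f"
    by (simp add: f_def eval_nat_numeral)
  moreover have "e 0 \<triangleright> e 1 \<triangleright> f = e"
    by (auto simp: f_def cseq_def fun_eq_iff split: nat.split)
  ultimately show ?thesis by simp
qed

lemma curve_flip: "y ^ 2 = x ^ 6 + 1 \<Longrightarrow> x \<noteq> 0 \<Longrightarrow> (- (y / x ^ 3)) ^ 2 = (1 / x) ^ 6 + (1::complex)"
  by (simp add: power_divide power_mult[symmetric]) (simp add: field_simps)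

lemma secs_open_coord:
  assumes "A \<subseteq> Cn 4" "\<And>z. z \<in> Cn 4 \<Longrightarrow> z i \<noteq> 0 \<Longrightarrow> holo_at 4 f z"
  shows "f \<in> secs 4 {z \<in> A. z i \<noteq> 0}"
proof (rule secsI)
  show "open {z :: nat \<Rightarrow> complex. z i \<noteq> 0}"
    using open_coord[of "-{0}" i] by (simp add: open_Compl)
qed (use assms in auto)

lemma flip_holomorphic:
  assumes A: "A \<subseteq> Cn 4" and f: "\<And>z. z \<in> A \<Longrightarrow> z i \<noteq> 0 \<Longrightarrow> f z \<in> A"
    and h: "\<And>z j. j < 4 \<Longrightarrow> z i \<noteq> 0 \<Longrightarrow> holo_at 4 (\<lambda>z. f z j) z"
  shows "holomorphic_map (space_of_subset 4 {z \<in> A. z i \<noteq> 0}) (space_of_subset 4 A) f"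
  by (rule holomorphic_map_subsets[OF _ A]) (use A f h in \<open>auto intro!: secs_open_coord\<close>)

text \<open>Bounds on x and w bound the other two coordinates, so the set is a closed part of a
  compact box.\<close>

lemma compact_fundamental:
  assumes "closed A" "A \<subseteq> Cn 4"
    and "\<And>z. z \<in> A \<Longrightarrow> norm (z 0) \<le> 1 \<Longrightarrow> norm (z 2) \<le> 1 \<Longrightarrow> norm (z 1) \<le> 2 \<and> norm (z 3) \<le> 2"
  shows "compact {z \<in> A. norm (z 0) \<le> 1 \<and> norm (z 2) \<le> 1}"
proof -
  have "norm (z i) \<le> 2" if "z \<in> A" "norm (z 0) \<le> 1" "norm (z 2) \<le> 1" "i < 4" for z i
    using that(4) by (cases rule: less_4_cases) (use assms(3)[OF that(1-3)] that in auto)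
  then have "{z \<in> A. norm (z 0) \<le> 1 \<and> norm (z 2) \<le> 1} = {z \<in> Cn 4. \<forall>i<4. norm (z i) \<le> 2} \<inter>
      (A \<inter> {z. norm (z 0) \<le> 1} \<inter> {z. norm (z 2) \<le> 1})"
    using assms(2) by blast
  moreover have "closed (A \<inter> {z. norm (z 0) \<le> 1} \<inter> {z. norm (z 2) \<le> 1})"
    by (intro closed_Int assms closed_Collect_le continuous_on_norm continuous_on_coord continuous_on_const)
  ultimately show ?thesis using compact_Int_closed[OF compact_box4] by simp
qed

lemma norm_le_2_of_square: "norm (y ^ 2) \<le> 2 \<Longrightarrow> norm (y::complex) \<le> 2"
proof -
  assume "norm (y ^ 2) \<le> 2"
  then have "norm y ^ 2 \<le> 2 ^ 2" by (simp add: norm_power)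
  then show "norm y \<le> 2" by (rule power2_le_imp_le) simp
qed

lemma norm_curve_le: "norm x \<le> 1 \<Longrightarrow> norm (x ^ 6 + (1::complex)) \<le> 2"
  using norm_triangle_ineq[of "x ^ 6" 1] power_le_one[of "norm x" 6] by (simp add: norm_power)

section \<open>The compact smooth surface and the compact pinched surface\<close>

interpretation C: gluing curve_square "Cn 8" embC retC \<kappa>1C \<kappa>2C flip1 flip2C
proof
  show "\<exists>\<Omega>. analytic_subset 4 \<Omega> curve_square" using analytic_curve_square by blast
  show "continuous_on curve_square embC"
    unfolding embC_def[abs_def] by (intro emb_continuous_intros) auto
  show "retC (embC z) = z" if "z \<in> curve_square" for z
    by (rule Cn4_eqI) (use that curve_square_subset in \<open>auto simp: retC_def embC_def power_divide\<close>)
  show "continuous_on {e. e 1 \<noteq> 0 \<and> e 3 \<noteq> 0} retC"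
    unfolding retC_def[abs_def] by (intro emb_continuous_intros) auto
  show "embC z \<in> Cn 8" for z unfolding embC_def by (simp add: cseq_in_Cn)
  show "continuous_on UNIV \<kappa>1C" "continuous_on UNIV \<kappa>2C"
    unfolding \<kappa>1C_def[abs_def] \<kappa>2C_def[abs_def] by (intro emb_continuous_intros)+
  show "\<kappa>1C e \<in> Cn 8 \<and> \<kappa>2C e \<in> Cn 8" for e
    unfolding \<kappa>1C_def \<kappa>2C_def by (simp add: cseq_in_Cn)
  show "\<kappa>1C (\<kappa>1C e) = e \<and> \<kappa>2C (\<kappa>2C e) = e \<and> \<kappa>1C (\<kappa>2C e) = \<kappa>2C (\<kappa>1C e)" if "e \<in> Cn 8" for e
    using Cn8_expand[OF that] by (simp add: \<kappa>1C_def \<kappa>2C_def)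
  show "embC z 1 = 1 / (1 + z 0 * cnj (z 0)) \<and> embC z 3 = 1 / (1 + z 2 * cnj (z 2))" for z
    by (simp add: embC_def wt_def)
  show "\<kappa>1C e 1 = 1 - e 1 \<and> \<kappa>1C e 3 = e 3 \<and> \<kappa>2C e 1 = e 1 \<and> \<kappa>2C e 3 = 1 - e 3" for e
    by (simp add: \<kappa>1C_def \<kappa>2C_def)
  show f1: "flip1 z \<in> curve_square \<and> \<kappa>1C (embC z) = embC (flip1 z)" if "z \<in> curve_square" "z 0 \<noteq> 0" for z
    using that curve_flip[of "z 1" "z 0"] wt_swap(1,2)[OF that(2)] wt_swap(3,4)[OF that(2), of "z 1"]
    by (simp add: curve_square_def flip1_def embC_def \<kappa>1C_def del: complex_cnj_divide)
  show f2: "flip2C z \<in> curve_square \<and> \<kappa>2C (embC z) = embC (flip2C z)" if "z \<in> curve_square" "z 2 \<noteq> 0" for z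
    using that curve_flip[of "z 3" "z 2"] wt_swap(1,2)[OF that(2)] wt_swap(3,4)[OF that(2), of "z 3"]
    by (simp add: curve_square_def flip2C_def embC_def \<kappa>2C_def del: complex_cnj_divide)
  show "flip1 z 0 = 1 / z 0 \<and> flip1 z 2 = z 2 \<and> flip2C z 0 = z 0 \<and> flip2C z 2 = 1 / z 2" for z
    by (simp add: flip1_def flip2C_def)
  show "holomorphic_map (space_of_subset 4 {z \<in> curve_square. z 0 \<noteq> 0}) (space_of_subset 4 curve_square) flip1"
  proof (rule flip_holomorphic[OF curve_square_subset])
    show "holo_at 4 (\<lambda>z. flip1 z j) z" if "j < 4" "z 0 \<noteq> 0" for j z
      using that(1) by (cases rule: less_4_cases) (use that(2) in \<open>auto simp: flip1_def intro!: holo_intros\<close>)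
  qed (use f1 in blast)
  show "holomorphic_map (space_of_subset 4 {z \<in> curve_square. z 2 \<noteq> 0}) (space_of_subset 4 curve_square) flip2C"
  proof (rule flip_holomorphic[OF curve_square_subset])
    show "holo_at 4 (\<lambda>z. flip2C z j) z" if "j < 4" "z 2 \<noteq> 0" for j z
      using that(1) by (cases rule: less_4_cases) (use that(2) in \<open>auto simp: flip2C_def intro!: holo_intros\<close>)
  qed (use f2 in blast)
  show "compact {z \<in> curve_square. norm (z 0) \<le> 1 \<and> norm (z 2) \<le> 1}"
  proof (rule compact_fundamental[OF closed_curve_square curve_square_subset])
    fix z assume z: "z \<in> curve_square" "norm (z 0) \<le> 1" "norm (z 2) \<le> 1"
    then have "z 1 ^ 2 = z 0 ^ 6 + 1" "z 3 ^ 2 = z 2 ^ 6 + 1" by (simp_all add: curve_square_def)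
    then have "norm (z 1 ^ 2) \<le> 2" "norm (z 3 ^ 2) \<le> 2" using norm_curve_le z(2,3) by (simp_all only:)
    then show "norm (z 1) \<le> 2 \<and> norm (z 3) \<le> 2" by (simp only: norm_le_2_of_square)
  qed
qed

interpretation P: gluing pinched_square "Cn 10" embP retP \<kappa>1P \<kappa>2P flip1 flip2P
proof
  show "\<exists>\<Omega>. analytic_subset 4 \<Omega> pinched_square" using analytic_pinched_square by blast
  show "continuous_on pinched_square embP"
    unfolding embP_def[abs_def] by (intro emb_continuous_intros) auto
  show "retP (embP z) = z" if "z \<in> pinched_square" for z
    by (rule Cn4_eqI) (use that pinched_square_subset in \<open>auto simp: retP_def embP_def power_divide\<close>)
  show "continuous_on {e. e 1 \<noteq> 0 \<and> e 3 \<noteq> 0} retP"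
    unfolding retP_def[abs_def] by (intro emb_continuous_intros) auto
  show "embP z \<in> Cn 10" for z unfolding embP_def by (simp add: cseq_in_Cn)
  show "continuous_on UNIV \<kappa>1P" "continuous_on UNIV \<kappa>2P"
    unfolding \<kappa>1P_def[abs_def] \<kappa>2P_def[abs_def] by (intro emb_continuous_intros)+
  show "\<kappa>1P e \<in> Cn 10 \<and> \<kappa>2P e \<in> Cn 10" for e
    unfolding \<kappa>1P_def \<kappa>2P_def by (simp add: cseq_in_Cn)
  show "\<kappa>1P (\<kappa>1P e) = e \<and> \<kappa>2P (\<kappa>2P e) = e \<and> \<kappa>1P (\<kappa>2P e) = \<kappa>2P (\<kappa>1P e)" if "e \<in> Cn 10" for e
    using Cn10_expand[OF that] by (simp add: \<kappa>1P_def \<kappa>2P_def)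
  show "embP z 1 = 1 / (1 + z 0 * cnj (z 0)) \<and> embP z 3 = 1 / (1 + z 2 * cnj (z 2))" for z
    by (simp add: embP_def wt_def)
  show "\<kappa>1P e 1 = 1 - e 1 \<and> \<kappa>1P e 3 = e 3 \<and> \<kappa>2P e 1 = e 1 \<and> \<kappa>2P e 3 = 1 - e 3" for e
    by (simp add: \<kappa>1P_def \<kappa>2P_def)
  show f1: "flip1 z \<in> pinched_square \<and> \<kappa>1P (embP z) = embP (flip1 z)" if z: "z \<in> pinched_square" "z 0 \<noteq> 0" for z
  proof
    show "flip1 z \<in> pinched_square"
      using z by (simp add: pinched_square_def flip1_def power_divide power_mult[symmetric]) (simp add: field_simps)
    show "\<kappa>1P (embP z) = embP (flip1 z)"
      unfolding \<kappa>1P_def embP_def flip1_def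
      using wt_swap(1,2)[OF z(2)] z(2)
      by (intro cseq_eqI refl; simp add: wt_inverse del: complex_cnj_divide)
        (simp_all add: field_simps eval_nat_numeral)
  qed
  show f2: "flip2P z \<in> pinched_square \<and> \<kappa>2P (embP z) = embP (flip2P z)" if z: "z \<in> pinched_square" "z 2 \<noteq> 0" for z
  proof
    show "flip2P z \<in> pinched_square"
      using z curve_flip[of "z 3" "z 2"]
      by (simp add: pinched_square_def flip2P_def) (simp add: field_simps)
    show "\<kappa>2P (embP z) = embP (flip2P z)"
      unfolding \<kappa>2P_def embP_def flip2P_def
      using wt_swap(1,2)[OF z(2)] wt_swap(3,4)[OF z(2), of "z 3"] z(2)
      by (intro cseq_eqI refl; simp add: wt_inverse del: complex_cnj_divide)
        (simp_all add: field_simps eval_nat_numeral)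
  qed
  show "flip1 z 0 = 1 / z 0 \<and> flip1 z 2 = z 2 \<and> flip2P z 0 = z 0 \<and> flip2P z 2 = 1 / z 2" for z
    by (simp add: flip1_def flip2P_def)
  show "holomorphic_map (space_of_subset 4 {z \<in> pinched_square. z 0 \<noteq> 0}) (space_of_subset 4 pinched_square) flip1"
  proof (rule flip_holomorphic[OF pinched_square_subset])
    show "holo_at 4 (\<lambda>z. flip1 z j) z" if "j < 4" "z 0 \<noteq> 0" for j z
      using that(1) by (cases rule: less_4_cases) (use that(2) in \<open>auto simp: flip1_def intro!: holo_intros\<close>)
  qed (use f1 in blast)
  show "holomorphic_map (space_of_subset 4 {z \<in> pinched_square. z 2 \<noteq> 0}) (space_of_subset 4 pinched_square) flip2P"
  proof (rule flip_holomorphic[OF pinched_square_subset])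
    show "holo_at 4 (\<lambda>z. flip2P z j) z" if "j < 4" "z 2 \<noteq> 0" for j z
      using that(1) by (cases rule: less_4_cases) (use that(2) in \<open>auto simp: flip2P_def intro!: holo_intros\<close>)
  qed (use f2 in blast)
  show "compact {z \<in> pinched_square. norm (z 0) \<le> 1 \<and> norm (z 2) \<le> 1}"
  proof (rule compact_fundamental[OF closed_pinched_square pinched_square_subset])
    fix z assume z: "z \<in> pinched_square" "norm (z 0) \<le> 1" "norm (z 2) \<le> 1"
    have "norm ((z 0 ^ 6 + 1) * z 2 ^ 2) \<le> 2 * 1"
      unfolding norm_mult using norm_curve_le[OF z(2)] power_le_one[of "norm (z 2)" 2] z(3)
      by (intro mult_mono) (auto simp: norm_power)
    moreover have "z 1 ^ 2 = (z 0 ^ 6 + 1) * z 2 ^ 2" "z 3 ^ 2 = z 2 ^ 6 + 1"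
      using z(1) by (simp_all add: pinched_square_def)
    ultimately have "norm (z 1 ^ 2) \<le> 2" "norm (z 3 ^ 2) \<le> 2" using norm_curve_le[OF z(3)] by (simp_all only: mult_1_right)
    then show "norm (z 1) \<le> 2 \<and> norm (z 3) \<le> 2" by (simp only: norm_le_2_of_square)
  qed
qed

text \<open>\<open>pinch\<close> in embedding coordinates: v over its weights is (y/wt x^3)(w/wt
  w)(1/wt w), and the variant with cnj w^2 is (y/wt x^3)(|w|^2/wt w)(cnj w/wt w), where |w|^2/wt w =
  1 - 1/wt w. These are polynomials in the entries and their conjugates, hence continuous across
  infinity.\<close>

definition proj :: "(nat \<Rightarrow> complex) \<Rightarrow> nat \<Rightarrow> complex" where
  "proj e = e 0 \<triangleright> e 1 \<triangleright> e 2 \<triangleright> e 3 \<triangleright> e 4 \<triangleright> e 5 \<triangleright> e 6 * e 2 * e 3 \<triangleright> e 7 * e 2 * e 3 \<triangleright>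
     e 6 * (1 - e 3) * cnj (e 2) \<triangleright> e 7 * (1 - e 3) * cnj (e 2) \<triangleright> zseq"

lemma proj_embC: "proj (embC z) = embP (pinch z)"
  unfolding proj_def embC_def embP_def pinch_def
  by (simp add: one_minus_inverse_wt) (simp add: power2_eq_square mult_ac)

text \<open>Equivariance under both flips, so that the description of \<open>proj\<close> in the
  affine chart holds in all four.\<close>

lemma proj_g: "proj (C.g j e) = P.g j (proj e)"
proof -
  have "proj (\<kappa>1C e) = \<kappa>1P (proj e)" "proj (\<kappa>2C e) = \<kappa>2P (proj e)" for e
    by (simp_all add: proj_def \<kappa>1C_def \<kappa>1P_def \<kappa>2C_def \<kappa>2P_def mult_ac)
  then show ?thesis by (simp add: C.g_def P.g_def)
qed

lemma normalization_P: "is_normalization P.glue C.glue proj"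
proof (rule normalization_glue[OF P.atlas_axioms C.atlas_axioms C.compact_P])
  show "continuous_on C.P proj"
    unfolding proj_def[abs_def] by (intro emb_continuous_intros)
  show "proj (C.c j a) = P.c j (pinch a)" for j a
    by (simp add: C.c_def P.c_def proj_g proj_embC)
  show "x \<in> C.c j ` curve_square" if "x \<in> C.P" "proj x \<in> P.c j ` pinched_square" for j x
  proof -
    have "P.g j (proj x) 1 = C.g j x 1" "P.g j (proj x) 3 = C.g j x 3"
      unfolding proj_g[symmetric] by (simp_all add: proj_def)
    then show ?thesis using that unfolding C.range_c P.range_c by simp
  qed
qed

text \<open>Recovers the curve from four of the ambient coordinates: x and y are quotients by entry
  \<open>i1\<close> where that entry is nonzero, and the same quotients after \<kappa> give x' and
  y'. This supplies the hypotheses of \<open>curve_disc_lipschitz\<close>. The indices are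
  parameters in order to treat the two factors alike.\<close>

lemma factor_lipschitz:
  fixes X :: "(nat \<Rightarrow> complex) function_space"
  assumes H: "\<And>e. e \<in> points X \<Longrightarrow> e i1 \<noteq> 0 \<Longrightarrow> \<exists>x y. y ^ 2 = x ^ 6 + 1 \<and> e i0 = x / wt x \<and>
      e i1 = 1 / wt x \<and> e i2 = y / wt x ^ 3 \<and> e i3 = y * cnj x ^ 3 / wt x ^ 3"
    and \<kappa>: "\<And>e. e \<in> points X \<Longrightarrow> \<kappa> e \<in> points X \<and> \<kappa> e i0 = cnj (e i0) \<and> \<kappa> e i1 = 1 - e i1 \<and>
      \<kappa> e i2 = - e i3 \<and> \<kappa> e i3 = - e i2"
    and V1: "openin (topo X) {e \<in> points X. e i1 \<noteq> 0}"
    and V2: "openin (topo X) {e \<in> points X. \<kappa> e i1 \<noteq> 0}"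
    and s1: "(\<lambda>e. e i0 / e i1) \<in> sections X {e \<in> points X. e i1 \<noteq> 0}"
      "(\<lambda>e. e i2 / e i1 ^ 3) \<in> sections X {e \<in> points X. e i1 \<noteq> 0}"
    and s2: "(\<lambda>e. \<kappa> e i0 / \<kappa> e i1) \<in> sections X {e \<in> points X. \<kappa> e i1 \<noteq> 0}"
      "(\<lambda>e. \<kappa> e i2 / \<kappa> e i1 ^ 3) \<in> sections X {e \<in> points X. \<kappa> e i1 \<noteq> 0}"
    and f: "holomorphic_map unit_disc X f" and i: "i \<in> {i0, i1, i2, i3}" and z: "z \<in> ball 0 1"
  shows "norm (f z i - f 0 i) \<le> 1600 * (- ln (1 - norm z))"
proof -
  define S1 where "S1 = {z \<in> ball 0 1. f z i1 \<noteq> 0}"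
  define S2 where "S2 = {z \<in> ball 0 1. \<kappa> (f z) i1 \<noteq> 0}"
  have fX: "f z \<in> points X" if "z \<in> ball 0 1" for z using holomorphic_map_points[OF f, of z] that by simp
  have pre: "open {z \<in> points unit_disc. f z \<in> V}" if "openin (topo X) V" for V
    using openin_continuous_map_preimage[OF holomorphic_map_continuous[OF f] that] open_ball
    by (auto dest: openin_open_trans)
  have S1e: "{z \<in> points unit_disc. f z \<in> {e \<in> points X. e i1 \<noteq> 0}} = S1" using fX by (auto simp: S1_def)
  have S2e: "{z \<in> points unit_disc. f z \<in> {e \<in> points X. \<kappa> e i1 \<noteq> 0}} = S2" using fX by (auto simp: S2_def)
  have o: "open S1" "open S2" using pre[OF V1] pre[OF V2] unfolding S1e S2e by auto
  have hol: "(\<lambda>z. f z i0 / f z i1) holomorphic_on S1" "(\<lambda>z. f z i2 / f z i1 ^ 3) holomorphic_on S1"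
    "(\<lambda>z. \<kappa> (f z) i0 / \<kappa> (f z) i1) holomorphic_on S2" "(\<lambda>z. \<kappa> (f z) i2 / \<kappa> (f z) i1 ^ 3) holomorphic_on S2"
    using holomorphic_map_section[OF f V1 s1(1)] holomorphic_map_section[OF f V1 s1(2)]
      holomorphic_map_section[OF f V2 s2(1)] holomorphic_map_section[OF f V2 s2(2)]
    unfolding S1e S2e by (simp_all add: comp_def)
  have rep: "\<exists>x y. y ^ 2 = x ^ 6 + 1 \<and> e i0 = x / wt x \<and> e i1 = 1 / wt x \<and> e i2 = y / wt x ^ 3 \<and>
      e i3 = y * cnj x ^ 3 / wt x ^ 3 \<and> e i0 / e i1 = x \<and> e i2 / e i1 ^ 3 = y"
    if e: "e \<in> points X" "e i1 \<noteq> 0" for e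
  proof -
    obtain x y where xy: "y ^ 2 = x ^ 6 + 1" "e i0 = x / wt x" "e i1 = 1 / wt x" "e i2 = y / wt x ^ 3"
      "e i3 = y * cnj x ^ 3 / wt x ^ 3" using H[OF e] by blast
    then show ?thesis by (intro exI[of _ x] exI[of _ y]) (simp add: power_divide)
  qed
  have trans: "e i0 / e i1 \<noteq> 0 \<and> \<kappa> e i0 / \<kappa> e i1 = 1 / (e i0 / e i1) \<and>
      \<kappa> e i2 / \<kappa> e i1 ^ 3 = - ((e i2 / e i1 ^ 3) / (e i0 / e i1) ^ 3)"
    if e: "e \<in> points X" "e i1 \<noteq> 0" "\<kappa> e i1 \<noteq> 0" for e
  proof -
    obtain x y where xy: "e i0 = x / wt x" "e i1 = 1 / wt x"
      "e i3 = y * cnj x ^ 3 / wt x ^ 3" "e i0 / e i1 = x" "e i2 / e i1 ^ 3 = y" using rep[OF e(1,2)] by blast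
    have k: "\<kappa> e i0 = cnj x / wt x" "\<kappa> e i1 = x * cnj x / wt x" "\<kappa> e i2 = - (y * cnj x ^ 3 / wt x ^ 3)"
      using \<kappa>[OF e(1)] xy by (simp_all add: one_minus_inverse_wt)
    then have x: "x \<noteq> 0" using e(3) by auto
    then show ?thesis unfolding xy(4,5) k by (simp add: field_simps)
  qed
  have small: "z \<in> S1 \<and> norm (f z i0 / f z i1) \<le> 1 \<or> z \<in> S2 \<and> norm (\<kappa> (f z) i0 / \<kappa> (f z) i1) \<le> 1"
    if z: "z \<in> ball 0 1" for z
  proof (cases "f z i1 = 0")
    case True
    \<comment> \<open>A point with x at infinity: in the flipped chart 1 / wt x' = 1, so x' =
      0.\<close>
    then have k1: "\<kappa> (f z) i1 = 1" using \<kappa>[OF fX[OF z]] by simp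
    then obtain x where "1 = 1 / wt x" "\<kappa> (f z) i0 / \<kappa> (f z) i1 = x"
      using rep[of "\<kappa> (f z)"] \<kappa>[OF fX[OF z]] by (metis zero_neq_one)
    then have "x * cnj x = 0" "\<kappa> (f z) i0 / \<kappa> (f z) i1 = x" using wt_nonzero[of x] by (simp_all add: field_simps wt_def)
    then show ?thesis using k1 z by (auto simp: S2_def)
  next
    case False
    show ?thesis
    proof (cases "norm (f z i0 / f z i1) \<le> 1")
      case True
      then show ?thesis using False z by (simp add: S1_def)
    next
      case big: False
      obtain x where x: "f z i1 = 1 / wt x" "f z i0 / f z i1 = x" using rep[OF fX[OF z] False] by blast
      then have "x \<noteq> 0" using big by auto
      then have k: "\<kappa> (f z) i1 \<noteq> 0"
        using \<kappa>[OF fX[OF z]] x(1) by (simp add: one_minus_inverse_wt)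
      then have "\<kappa> (f z) i0 / \<kappa> (f z) i1 = 1 / x" using trans[OF fX[OF z] False k] x(2) by simp
      then show ?thesis using k z big x(2) by (simp add: S2_def norm_divide divide_le_eq)
    qed
  qed
  have "norm ((\<lambda>z. f z i) z - (\<lambda>z. f z i) 0) \<le> 1600 * (- ln (1 - norm z))"
  proof (rule curve_disc_lipschitz[OF o _ hol, of "\<lambda>z. f z i0" "\<lambda>z. f z i1" "\<lambda>z. f z i2" "\<lambda>z. f z i3"])
    show "S1 \<union> S2 = ball 0 1" using small unfolding S1_def S2_def by blast
    show "(f z i2 / f z i1 ^ 3) ^ 2 = (f z i0 / f z i1) ^ 6 + 1" if "z \<in> S1" for z
      using rep[of "f z"] that fX by (auto simp: S1_def)
    show "(\<kappa> (f z) i2 / \<kappa> (f z) i1 ^ 3) ^ 2 = (\<kappa> (f z) i0 / \<kappa> (f z) i1) ^ 6 + 1" if "z \<in> S2" for z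
      using rep[of "\<kappa> (f z)"] \<kappa> that fX by (auto simp: S2_def)
    show "f z i0 / f z i1 \<noteq> 0 \<and> \<kappa> (f z) i0 / \<kappa> (f z) i1 = 1 / (f z i0 / f z i1) \<and>
       \<kappa> (f z) i2 / \<kappa> (f z) i1 ^ 3 = - (f z i2 / f z i1 ^ 3 / (f z i0 / f z i1) ^ 3)" if "z \<in> S1 \<inter> S2" for z
      using trans[of "f z"] that fX by (auto simp: S1_def S2_def)
    show "z \<in> S1 \<and> norm (f z i0 / f z i1) \<le> 1 \<or> z \<in> S2 \<and> norm (\<kappa> (f z) i0 / \<kappa> (f z) i1) \<le> 1"
      if "z \<in> ball 0 1" for z by (rule small[OF that])
    show "f z i0 = (f z i0 / f z i1) / (1 + (f z i0 / f z i1) * cnj (f z i0 / f z i1)) \<and>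
        f z i1 = 1 / (1 + (f z i0 / f z i1) * cnj (f z i0 / f z i1)) \<and>
        f z i2 = (f z i2 / f z i1 ^ 3) / (1 + (f z i0 / f z i1) * cnj (f z i0 / f z i1)) ^ 3 \<and>
        f z i3 = (f z i2 / f z i1 ^ 3) * cnj (f z i0 / f z i1) ^ 3 / (1 + (f z i0 / f z i1) * cnj (f z i0 / f z i1)) ^ 3"
      if "z \<in> S1" for z
    proof -
      have "f z \<in> points X" "f z i1 \<noteq> 0" using that fX by (auto simp: S1_def)
      from rep[OF this] obtain x y where "f z i0 = x / wt x" "f z i1 = 1 / wt x" "f z i2 = y / wt x ^ 3"
        "f z i3 = y * cnj x ^ 3 / wt x ^ 3" "f z i0 / f z i1 = x" "f z i2 / f z i1 ^ 3 = y" by blast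
      then show ?thesis unfolding wt_def[symmetric] by (metis (no_types, lifting))
    qed
    show "f z i0 = cnj ((\<kappa> (f z) i0 / \<kappa> (f z) i1) / (1 + (\<kappa> (f z) i0 / \<kappa> (f z) i1) * cnj (\<kappa> (f z) i0 / \<kappa> (f z) i1))) \<and>
        f z i1 = 1 - 1 / (1 + (\<kappa> (f z) i0 / \<kappa> (f z) i1) * cnj (\<kappa> (f z) i0 / \<kappa> (f z) i1)) \<and>
        f z i2 = - ((\<kappa> (f z) i2 / \<kappa> (f z) i1 ^ 3) * cnj (\<kappa> (f z) i0 / \<kappa> (f z) i1) ^ 3 /
          (1 + (\<kappa> (f z) i0 / \<kappa> (f z) i1) * cnj (\<kappa> (f z) i0 / \<kappa> (f z) i1)) ^ 3) \<and>
        f z i3 = - ((\<kappa> (f z) i2 / \<kappa> (f z) i1 ^ 3) / (1 + (\<kappa> (f z) i0 / \<kappa> (f z) i1) * cnj (\<kappa> (f z) i0 / \<kappa> (f z) i1)) ^ 3)"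
      if "z \<in> S2" for z
    proof -
      have e: "f z \<in> points X" "\<kappa> (f z) i1 \<noteq> 0" using that fX by (auto simp: S2_def)
      have k: "\<kappa> (f z) \<in> points X" "f z i0 = cnj (\<kappa> (f z) i0)" "f z i1 = 1 - \<kappa> (f z) i1"
        "f z i2 = - \<kappa> (f z) i3" "f z i3 = - \<kappa> (f z) i2" using \<kappa>[OF e(1)] by auto
      from rep[OF k(1) e(2)] obtain x y where "\<kappa> (f z) i0 = x / wt x" "\<kappa> (f z) i1 = 1 / wt x" "\<kappa> (f z) i2 = y / wt x ^ 3"
        "\<kappa> (f z) i3 = y * cnj x ^ 3 / wt x ^ 3" "\<kappa> (f z) i0 / \<kappa> (f z) i1 = x" "\<kappa> (f z) i2 / \<kappa> (f z) i1 ^ 3 = y" by blast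
      then show ?thesis unfolding k(2-5) unfolding wt_def[symmetric] by (metis (no_types, lifting))
    qed
    show "(\<lambda>z. f z i) \<in> {\<lambda>z. f z i0, \<lambda>z. f z i1, \<lambda>z. f z i2, \<lambda>z. f z i3}" using i by auto
  qed (rule z)
  then show ?thesis by simp
qed

text \<open>\<open>g k\<close> carries the chart \<open>j\<close> to the chart
  \<open>xor2 k j\<close>, so it respects the sheaf, although its ambient formula contains
  conjugates.\<close>

lemma (in gluing) section_g:
  assumes "\<xi> \<in> sections glue {e \<in> P. Q e}"
  shows "(\<lambda>e. \<xi> (g k e)) \<in> sections glue {e \<in> P. Q (g k e)}"
  unfolding glue_simps
proof
  fix j
  have gc: "g k (c j a) = c (xor2 k j) a" if "a \<in> A" for a using g_g emb_E[OF that] by (simp add: c_def)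
  have "\<xi> \<circ> c (xor2 k j) \<in> secs 4 {a \<in> A. c (xor2 k j) a \<in> {e \<in> P. Q e}}"
    using assms unfolding glue_simps by blast
  moreover have "{a \<in> A. c (xor2 k j) a \<in> {e \<in> P. Q e}} = {a \<in> A. c j a \<in> {e \<in> P. Q (g k e)}}"
    using gc c_in_P[of _ j] c_in_P[of _ "xor2 k j"] by auto
  ultimately have "\<xi> \<circ> c (xor2 k j) \<in> secs 4 {a \<in> A. c j a \<in> {e \<in> P. Q (g k e)}}" by simp
  then show "(\<lambda>e. \<xi> (g k e)) \<circ> c j \<in> secs 4 {a \<in> A. c j a \<in> {e \<in> P. Q (g k e)}}"
    by (rule secs_cong) (use gc in auto)
qed

lemma C_c_coords:
  "C.c j a 0 = (if fst j then cnj (a 0 / wt (a 0)) else a 0 / wt (a 0))"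
  "C.c j a 1 = (if fst j then 1 - 1 / wt (a 0) else 1 / wt (a 0))"
  "C.c j a 6 = (if fst j then - (a 1 * cnj (a 0) ^ 3 / wt (a 0) ^ 3) else a 1 / wt (a 0) ^ 3)"
  "C.c j a 7 = (if fst j then - (a 1 / wt (a 0) ^ 3) else a 1 * cnj (a 0) ^ 3 / wt (a 0) ^ 3)"
  "C.c j a 2 = (if snd j then cnj (a 2 / wt (a 2)) else a 2 / wt (a 2))"
  "C.c j a 3 = (if snd j then 1 - 1 / wt (a 2) else 1 / wt (a 2))"
  "C.c j a 4 = (if snd j then - (a 3 * cnj (a 2) ^ 3 / wt (a 2) ^ 3) else a 3 / wt (a 2) ^ 3)"
  "C.c j a 5 = (if snd j then - (a 3 / wt (a 2) ^ 3) else a 3 * cnj (a 2) ^ 3 / wt (a 2) ^ 3)"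
  by (simp_all add: C.c_def C.g_def embC_def \<kappa>1C_def \<kappa>2C_def)

lemma swapped_quotients:
  assumes "1 - 1 / wt x \<noteq> 0"
  shows "x \<noteq> 0" "cnj (x / wt x) / (1 - 1 / wt x) = 1 / x"
    "- (y * cnj x ^ 3 / wt x ^ 3) / (1 - 1 / wt x) ^ 3 = - (y / x ^ 3)"
proof -
  show x: "x \<noteq> 0" using assms by (auto simp: one_minus_inverse_wt)
  show "cnj (x / wt x) / (1 - 1 / wt x) = 1 / x"
    "- (y * cnj x ^ 3 / wt x ^ 3) / (1 - 1 / wt x) ^ 3 = - (y / x ^ 3)"
    unfolding one_minus_inverse_wt using x by (simp_all add: field_simps)
qed

text \<open>The single entries are not holomorphic, but the weights cancel in these quotients: in an
  unflipped chart they are x and y, in a flipped one 1/x and -y/x^3.\<close>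

lemma C_section:
  fixes b :: "bool \<times> bool \<Rightarrow> bool" and k l i0 i1 i2 :: nat
  assumes i: "b = fst \<and> (k, l) = (0, 1) \<and> (i0, i1, i2) = (0, 1, 6) \<or> b = snd \<and> (k, l) = (2, 3) \<and> (i0, i1, i2) = (2, 3, 4)"
  shows "(\<lambda>e. e i0 / e i1) \<in> sections C.glue {e \<in> C.P. e i1 \<noteq> 0}"
    and "(\<lambda>e. e i2 / e i1 ^ 3) \<in> sections C.glue {e \<in> C.P. e i1 \<noteq> 0}"
proof -
  have co: "C.c j a i0 = (if b j then cnj (a k / wt (a k)) else a k / wt (a k))"
    "C.c j a i1 = (if b j then 1 - 1 / wt (a k) else 1 / wt (a k))"
    "C.c j a i2 = (if b j then - (a l * cnj (a k) ^ 3 / wt (a k) ^ 3) else a l / wt (a k) ^ 3)" for j a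
    using i by (auto simp: C_c_coords C_c_coords(2)[unfolded One_nat_def])
  have kl: "k < 4" "l < 4" using i by auto
  have S: "{a \<in> curve_square. C.c j a \<in> {e \<in> C.P. e i1 \<noteq> 0}} \<subseteq> Cn 4" for j using curve_square_subset by auto
  have quot: "C.c j a i0 / C.c j a i1 = (if b j then 1 / a k else a k) \<and>
      C.c j a i2 / C.c j a i1 ^ 3 = (if b j then - (a l / a k ^ 3) else a l) \<and> (b j \<longrightarrow> a k \<noteq> 0)"
    if "C.c j a i1 \<noteq> 0" for j a
    using that swapped_quotients(1,2)[of "a k"] swapped_quotients(3)[of "a k" "a l"] unfolding co
    by (cases "b j") (simp_all add: power_divide)
  have T: "open (if b j then {a :: nat \<Rightarrow> complex. a k \<in> -{0}} else UNIV)" for j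
    using open_coord[of "-{0}" k] by (simp add: open_Compl)
  have hol: "(\<lambda>a. if b j then 1 / a k else a k) \<in> secs 4 {a \<in> curve_square. C.c j a \<in> {e \<in> C.P. e i1 \<noteq> 0}}"
    "(\<lambda>a. if b j then - (a l / a k ^ 3) else a l) \<in> secs 4 {a \<in> curve_square. C.c j a \<in> {e \<in> C.P. e i1 \<noteq> 0}}" for j
    by (rule secsI[OF T[of j] _ S]; use kl quot[of j] in \<open>auto intro!: holo_intros split: if_splits\<close>)+
  show "(\<lambda>e. e i0 / e i1) \<in> sections C.glue {e \<in> C.P. e i1 \<noteq> 0}"
    unfolding C.glue_simps
  proof
    fix j show "(\<lambda>e. e i0 / e i1) \<circ> C.c j \<in> secs 4 {a \<in> curve_square. C.c j a \<in> {e \<in> C.P. e i1 \<noteq> 0}}"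
      by (rule secs_cong[OF hol(1)]) (use quot[of j] in auto)
  qed
  show "(\<lambda>e. e i2 / e i1 ^ 3) \<in> sections C.glue {e \<in> C.P. e i1 \<noteq> 0}"
    unfolding C.glue_simps
  proof
    fix j show "(\<lambda>e. e i2 / e i1 ^ 3) \<circ> C.c j \<in> secs 4 {a \<in> curve_square. C.c j a \<in> {e \<in> C.P. e i1 \<noteq> 0}}"
      by (rule secs_cong[OF hol(2)]) (use quot[of j] in auto)
  qed
qed

text \<open>Entries 0, 1, 6, 7 embed the first curve and 2, 3, 4, 5 the second; \<open>k\<close>
  selects the involution of the factor concerned.\<close>

lemma C_lipschitz:
  assumes i: "(i0, i1, i2, i3) = (0, 1, 6, 7) \<and> k = (True, False) \<or> (i0, i1, i2, i3) = (2, 3, 4, 5) \<and> k = (False, True)"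
    and f: "holomorphic_map unit_disc C.glue f" and ii: "i \<in> {i0, i1, i2, i3}" and z: "z \<in> ball 0 1"
  shows "norm (f z i - f 0 i) \<le> 1600 * (- ln (1 - norm z))"
proof -
  have pts: "points C.glue = C.P" by simp
  have sec: "(\<lambda>e. e i0 / e i1) \<in> sections C.glue {e \<in> C.P. e i1 \<noteq> 0}"
    "(\<lambda>e. e i2 / e i1 ^ 3) \<in> sections C.glue {e \<in> C.P. e i1 \<noteq> 0}"
    using C_section[of fst 0 1 0 1 6] C_section[of snd 2 3 2 3 4] i by auto
  have op: "openin (top_of_set C.P) {e \<in> C.P. C.g j e i1 \<noteq> 0}" for j
  proof -
    have "open {e. C.g j e i1 \<noteq> 0}"
      by (rule open_Collect_neq[OF continuous_on_product_then_coordinatewise[OF C.g_cont] continuous_on_const])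
    from openin_open_Int[OF this, of C.P] show ?thesis by (simp add: Int_def)
  qed
  show ?thesis
  proof (rule factor_lipschitz[where X=C.glue and \<kappa>="C.g k" and ?i0.0=i0 and ?i1.0=i1 and ?i2.0=i2 and ?i3.0=i3])
    show "openin (topo C.glue) {e \<in> points C.glue. e i1 \<noteq> 0}"
      using op[of "(False, False)"] by (simp add: C.g_def)
    show "openin (topo C.glue) {e \<in> points C.glue. C.g k e i1 \<noteq> 0}" using op[of k] by simp
    show "(\<lambda>e. e i0 / e i1) \<in> sections C.glue {e \<in> points C.glue. e i1 \<noteq> 0}"
      "(\<lambda>e. e i2 / e i1 ^ 3) \<in> sections C.glue {e \<in> points C.glue. e i1 \<noteq> 0}"
      unfolding pts by (rule sec)+
    show "(\<lambda>e. C.g k e i0 / C.g k e i1) \<in> sections C.glue {e \<in> points C.glue. C.g k e i1 \<noteq> 0}"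
      "(\<lambda>e. C.g k e i2 / C.g k e i1 ^ 3) \<in> sections C.glue {e \<in> points C.glue. C.g k e i1 \<noteq> 0}"
      unfolding pts
      using C.section_g[OF sec(1), of k] C.section_g[OF sec(2), of k] by blast+
    show "C.g k e \<in> points C.glue \<and> C.g k e i0 = cnj (e i0) \<and> C.g k e i1 = 1 - e i1 \<and>
        C.g k e i2 = - e i3 \<and> C.g k e i3 = - e i2" if "e \<in> points C.glue" for e
      using that C.g_P[of e k] i by (auto simp: C.g_def \<kappa>1C_def \<kappa>2C_def)
    show "\<exists>x y. y ^ 2 = x ^ 6 + 1 \<and> e i0 = x / wt x \<and> e i1 = 1 / wt x \<and> e i2 = y / wt x ^ 3 \<and>
        e i3 = y * cnj x ^ 3 / wt x ^ 3" if e: "e \<in> points C.glue" "e i1 \<noteq> 0" for e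
    proof -
      obtain j a where a: "a \<in> curve_square" "e = C.c j a" by (rule C.P_cases[of e]) (use e(1) in simp)
      define b l0 l1 where "b = (if k = (True, False) then fst j else snd j)"
        and "l0 = (if k = (True, False) then 0 else 2 :: nat)" and "l1 = (if k = (True, False) then 1 else 3 :: nat)"
      have cu: "a l1 ^ 2 = a l0 ^ 6 + 1" using a(1) by (auto simp: curve_square_def l0_def l1_def)
      have co: "e i0 = (if b then cnj (a l0 / wt (a l0)) else a l0 / wt (a l0))"
        "e i1 = (if b then 1 - 1 / wt (a l0) else 1 / wt (a l0))"
        "e i2 = (if b then - (a l1 * cnj (a l0) ^ 3 / wt (a l0) ^ 3) else a l1 / wt (a l0) ^ 3)"
        "e i3 = (if b then - (a l1 / wt (a l0) ^ 3) else a l1 * cnj (a l0) ^ 3 / wt (a l0) ^ 3)"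
        unfolding a(2) using i by (auto simp: C_c_coords C_c_coords(2)[unfolded One_nat_def] b_def l0_def l1_def)
      show ?thesis
      proof (cases b)
        case False
        then show ?thesis using cu co by (intro exI[of _ "a l0"] exI[of _ "a l1"]) simp
      next
        case True
        then have x0: "a l0 \<noteq> 0" using e(2) co(2) swapped_quotients(1)[of "a l0"] by simp
        show ?thesis
          using wt_swap(1,2)[OF x0] wt_swap(3,4)[OF x0, of "a l1"] curve_flip[OF cu x0] co True
          by (intro exI[of _ "1 / a l0"] exI[of _ "- (a l1 / a l0 ^ 3)"]) metis
      qed
    qed
  qed (use f ii z in auto)
qed

text \<open>The eight ambient coordinates separate points because the compact surface lies in
  \<open>Cn 8\<close>.\<close>

lemma hyperbolic_C: "hyperbolic_space C.glue"
proof (rule hyperbolic_if_separated[where K=1600 and \<U>="(\<lambda>i e. e i) ` {..<8}"])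
  fix f u z assume f: "holomorphic_map unit_disc C.glue f" and u: "u \<in> (\<lambda>i (e :: nat \<Rightarrow> complex). e i) ` {..<8::nat}"
    and z: "z \<in> ball (0::complex) 1"
  obtain i where i: "i < 8" "u = (\<lambda>e. e i)" using u by auto
  then have "i \<in> {0, 1, 6, 7} \<or> i \<in> {2, 3, 4, 5}" by auto
  then show "norm (u (f z) - u (f 0)) \<le> 1600 * (- ln (1 - norm z))"
    using C_lipschitz[OF _ f _ z, of 0 1 6 7 "(True, False)" i] C_lipschitz[OF _ f _ z, of 2 3 4 5 "(False, True)" i] i(2)
    by auto
next
  fix p q assume "p \<in> points C.glue" "q \<in> points C.glue" "p \<noteq> q"
  then have "p \<in> Cn 8" "q \<in> Cn 8" "p \<noteq> q" using C.P_E by auto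
  then obtain i where i: "p i \<noteq> q i" by (auto simp: fun_eq_iff)
  then have "i < 8" using \<open>p \<in> Cn 8\<close> \<open>q \<in> Cn 8\<close> by (cases "i < 8") (auto simp: Cn_def)
  then show "\<exists>u\<in>(\<lambda>i (e :: nat \<Rightarrow> complex). e i) ` {..<8}. u p \<noteq> u q" using i by auto
qed simp

text \<open>The affine surface is one chart of the compact one and inherits its hyperbolicity, so no
  separate estimate is made.\<close>

lemma hyperbolic_curve_square: "hyperbolic_space (space_of_subset 4 curve_square)"
proof (rule hyperbolic_space_injective[OF hyperbolic_C C.chart_holomorphic[of "(False, False)"]])
  show "inj_on (C.c (False, False)) (points (space_of_subset 4 curve_square))"
    using C.r_c[of "(False, False)"] by (intro inj_on_inverseI[of _ "C.r (False, False)"]) simp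
qed simp

section \<open>Large discs in the double line\<close>

lemma line_in_pinched_square:
  "holomorphic_map unit_disc (space_of_subset 4 pinched_square) (\<lambda>\<zeta>. vec4 (of_real R * \<zeta>) 0 0 1)"
proof (rule holomorphic_map_disc[OF pinched_square_subset])
  show "vec4 (of_real R * \<zeta>) 0 0 1 \<in> pinched_square" for \<zeta> by (simp add: pinched_square_def)
  show "(\<lambda>\<zeta>. vec4 (of_real R * \<zeta>) 0 0 1 j) holomorphic_on ball 0 1" if "j < 4" for j
    using that by (cases rule: less_4_cases) (auto intro!: holomorphic_intros)
qed

text \<open>The line is traversed with speed R, so x = 0 and x = 1 are reached at the parameters 0
  and 1/R, whose Poincare distance tends to 0.\<close>

lemma not_hyperbolic_pinched_square: "\<not> hyperbolic_space (space_of_subset 4 pinched_square)"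
proof (rule not_hyperbolic_if_large_discs)
  show "vec4 0 0 0 1 \<in> points (space_of_subset 4 pinched_square)"
    "vec4 1 0 0 1 \<in> points (space_of_subset 4 pinched_square)" by (simp_all add: pinched_square_def)
  show "vec4 0 0 0 1 \<noteq> vec4 1 0 0 1" using vec4_simps(1) by (metis zero_neq_one)
  show "holomorphic_map unit_disc (space_of_subset 4 pinched_square) (\<lambda>\<zeta>. vec4 (of_real R * \<zeta>) 0 0 1) \<and>
      vec4 (of_real R * 0) 0 0 1 = vec4 0 0 0 1 \<and> vec4 (of_real R * of_real (1 / R)) 0 0 1 = vec4 1 0 0 1"
    if "1 < R" for R :: real
    using line_in_pinched_square that by simp
qed

text \<open>Hyperbolicity would descend to the affine chart, which contains the line.\<close>

lemma not_hyperbolic_P: "\<not> hyperbolic_space P.glue"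
proof
  assume "hyperbolic_space P.glue"
  then have "hyperbolic_space (space_of_subset 4 pinched_square)"
  proof (rule hyperbolic_space_injective[OF _ P.chart_holomorphic[of "(False, False)"]])
    show "inj_on (P.c (False, False)) (points (space_of_subset 4 pinched_square))"
      using P.r_c[of "(False, False)"] by (intro inj_on_inverseI[of _ "P.r (False, False)"]) simp
  qed simp
  then show False using not_hyperbolic_pinched_square by simp
qed

theorem mainTheorem1:
  shows "(\<exists>A (E' :: (nat \<Rightarrow> complex) function_space) \<pi>.
            affine_algebraic_subvariety 4 A \<and>
            is_normalization (space_of_subset 4 A) E' \<pi> \<and>
            hyperbolic_space E' \<and> \<not> hyperbolic_space (space_of_subset 4 A)) \<and>
         (\<exists>(E1 :: (nat \<Rightarrow> complex) function_space) (E1' :: (nat \<Rightarrow> complex) function_space) \<pi>1.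
            complex_space E1 \<and> compact_space (topo E1) \<and>
            is_normalization E1 E1' \<pi>1 \<and>
            hyperbolic_space E1' \<and> \<not> hyperbolic_space E1)"
proof (intro conjI)
  show "\<exists>A (E' :: (nat \<Rightarrow> complex) function_space) \<pi>.
            affine_algebraic_subvariety 4 A \<and>
            is_normalization (space_of_subset 4 A) E' \<pi> \<and>
            hyperbolic_space E' \<and> \<not> hyperbolic_space (space_of_subset 4 A)"
    using affine_pinched_square normalization_pinched_square hyperbolic_curve_square not_hyperbolic_pinched_square
    by blast
  have "compact_space (topo P.glue)"
    using P.compact_P by (simp add: compact_space_subtopology)
  then show "\<exists>(E1 :: (nat \<Rightarrow> complex) function_space) (E1' :: (nat \<Rightarrow> complex) function_space) \<pi>1.
            complex_space E1 \<and> compact_space (topo E1) \<and>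
            is_normalization E1 E1' \<pi>1 \<and>
            hyperbolic_space E1' \<and> \<not> hyperbolic_space E1"
    using P.complex_space_glue normalization_P hyperbolic_C not_hyperbolic_P by blast
qed

end
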